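(* Let $N\ge 1$, $0<s<1$, $2<p<\infty$, and let $\Omega\subset\mathbb{R}^N$ be a bounded domain with smooth boundary. For every $u_0\in L^2(\Omega)$ there is a unique strong solution $u$ of the problem $$\partial_t u+\mathcal{L}_{p,s}u=0 \ \text{ in } \Omega\times(0,\infty),\qquad u(\cdot,0)=u_0 \ \text{ in } \Omega,\qquad u(x,t)=0 \ \text{ for } x\in\mathbb{R}^N\setminus\Omega,\ t>0,$$ such that (i) $u\in C([0,\infty);L^2(\Omega))$; (ii) for every $t>0$, $\mathcal{L}_{p,s}u(t)\in L^2(\Omega)$; and (iii) the equation $\partial_t u+\mathcal{L}_{p,s}u=0$ is satisfied for a.e. $x\in\Omega$ for every $t>0$. Moreover, for every two solutions $u_1,u_2$ with initial data $u_{01},u_{02}$ we have $$\|(u_1(t)-u_2(t))_+\|_1\le \|(u_{01}-u_{02})_+\|_1,\qquad \|u_1(t)-u_2(t)\|_q\le \|u_{01}-u_{02}\|_q$$ for every $1\le q\le\infty$ and every $t>0$.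
   Context: Norms $\|\cdot\|_q$ are those of $L^q(\Omega)$, and $f_+=\max\{f,0\}$. Functions on $\Omega$ are extended by zero to $\mathbb{R}^N\setminus\Omega$. Let $$J_{p,s}(u)=\frac1p\int_{\mathbb{R}^N}\int_{\mathbb{R}^N}\frac{|u(x)-u(y)|^p}{|x-y|^{N+sp}}\,dx\,dy ,$$ and let $W^{s,p}_0(\Omega)$ be the closure of $C_c^\infty(\Omega)$ in the norm given by $\|u\|^p=J_{p,s}(u)+\int_{\mathbb{R}^N}|u|^p\,dx$. The fractional $p$-Laplacian is $$\mathcal{L}_{p,s}u(x)=2\,\mathrm{p.v.}\int_{\mathbb{R}^N}\frac{|u(x)-u(y)|^{p-2}(u(x)-u(y))}{|x-y|^{N+sp}}\,dy,\qquad x\in\Omega,$$ understood on $\Omega$ as the sub-differential in $L^2(\Omega)$ of $J_{p,s}$ (defined on $W^{s,p}_0(\Omega)$, and $+\infty$ elsewhere in $L^2(\Omega)$). That is, $\mathcal{L}_{p,s}u=w\in L^2(\Omega)$ means $u\in W^{s,p}_0(\Omega)$ and $$\int_{\mathbb{R}^N}\int_{\mathbb{R}^N}\frac{|u(x)-u(y)|^{p-2}(u(x)-u(y))(\phi(x)-\phi(y))}{|x-y|^{N+sp}}\,dx\,dy=\int_\Omega w\,\phi\,dx\quad\text{for all }\phi\in W^{s,p}_0(\Omega).$$ A strong solution is one for which the orbit $t\mapsto u(t)\in L^2(\Omega)$ is differentiable for a.e. $t>0$ with $du/dt=-\mathcal{L}_{p,s}u\in L^2(\Omega)$. *)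

theory Defs
  imports "HOL-Analysis.Analysis" "HOL-Probability.Essential_Supremum"
begin

text \<open>The ambient space \<open>\<real>\<^sup>N\<close> is an arbitrary Euclidean space \<open>'a\<close> with \<open>N = DIM('a) \<ge> 1\<close>.
  Elements of function spaces are represented by concrete functions, identified up to
  equality almost everywhere.\<close>


subsection \<open>Smooth functions and smooth domains\<close>

primrec Ck :: "nat \<Rightarrow> ('a::euclidean_space \<Rightarrow> real) \<Rightarrow> bool" where
  "Ck 0 f \<longleftrightarrow> continuous_on UNIV f"
| "Ck (Suc k) f \<longleftrightarrow> (\<forall>x. f differentiable (at x)) \<and>
     (\<forall>b\<in>Basis. Ck k (\<lambda>x. frechet_derivative f (at x) b))"

definition Cinfinity :: "('a::euclidean_space \<Rightarrow> real) \<Rightarrow> bool" where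
  "Cinfinity f \<longleftrightarrow> (\<forall>k. Ck k f)"

definition Cc_infinity :: "'a::euclidean_space set \<Rightarrow> ('a \<Rightarrow> real) set" where
  "Cc_infinity \<Omega> = {\<phi>. Cinfinity \<phi> \<and> compact (closure {x. \<phi> x \<noteq> 0}) \<and>
     closure {x. \<phi> x \<noteq> 0} \<subseteq> \<Omega>}"

text \<open>Near each boundary point the domain is the part above the graph of a smooth function
  \<open>\<gamma>\<close> of the \<open>N - 1\<close> coordinates orthogonal to some unit vector \<open>e\<close>; the point
  \<open>x - (x \<bullet> e) *\<^sub>R e\<close> is the orthogonal projection of \<open>x\<close> to the hyperplane orthogonal to \<open>e\<close>,
  so only the values of \<open>\<gamma>\<close> on that hyperplane matter.\<close>

definition smooth_boundary :: "'a::euclidean_space set \<Rightarrow> bool" where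
  "smooth_boundary \<Omega> \<longleftrightarrow> (\<forall>x0\<in>frontier \<Omega>. \<exists>r>0. \<exists>e \<gamma>. norm e = 1 \<and> Cinfinity \<gamma> \<and>
     \<Omega> \<inter> ball x0 r = {x \<in> ball x0 r. x \<bullet> e > \<gamma> (x - (x \<bullet> e) *\<^sub>R e)})"

definition bounded_smooth_domain :: "'a::euclidean_space set \<Rightarrow> bool" where
  "bounded_smooth_domain \<Omega> \<longleftrightarrow>
     open \<Omega> \<and> connected \<Omega> \<and> \<Omega> \<noteq> {} \<and> bounded \<Omega> \<and> smooth_boundary \<Omega>"


subsection \<open>Lebesgue spaces\<close>

definition ennroot :: "real \<Rightarrow> ennreal \<Rightarrow> ennreal" where
  "ennroot q a = (if a = \<infinity> then \<infinity> else ennreal (enn2real a powr (1 / q)))"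

text \<open>The norm of \<open>L\<^sup>q(\<Omega>)\<close>, \<open>1 \<le> q \<le> \<infinity>\<close>; it takes the value \<open>\<infinity>\<close> outside the space.\<close>

definition Lq_norm :: "ennreal \<Rightarrow> 'a::euclidean_space set \<Rightarrow> ('a \<Rightarrow> real) \<Rightarrow> ennreal" where
  "Lq_norm q \<Omega> f =
     (if q = \<infinity> then esssup (lebesgue_on \<Omega>) (\<lambda>x. ennreal \<bar>f x\<bar>)
      else ennroot (enn2real q) (\<integral>\<^sup>+x. ennreal (\<bar>f x\<bar> powr enn2real q) \<partial>lebesgue_on \<Omega>))"

text \<open>Functions on \<open>\<Omega>\<close> are extended by zero to the whole space.\<close>

definition L2 :: "'a::euclidean_space set \<Rightarrow> ('a \<Rightarrow> real) set" where
  "L2 \<Omega> = {f \<in> borel_measurable lebesgue. (\<forall>x. x \<notin> \<Omega> \<longrightarrow> f x = 0) \<and> Lq_norm 2 \<Omega> f < \<infinity>}"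


subsection \<open>The fractional energy and the fractional p-Laplacian\<close>

text \<open>On the diagonal \<open>x = y\<close>, a null set, the quotients below are \<open>0 / 0 = 0\<close>.\<close>

definition J_energy :: "real \<Rightarrow> real \<Rightarrow> ('a::euclidean_space \<Rightarrow> real) \<Rightarrow> ennreal" where
  "J_energy p s u = ennreal (1 / p) *
     (\<integral>\<^sup>+(x, y). ennreal (\<bar>u x - u y\<bar> powr p / norm (x - y) powr (real DIM('a) + s * p))
        \<partial>(lebesgue \<Otimes>\<^sub>M lebesgue))"

definition W_norm :: "real \<Rightarrow> real \<Rightarrow> ('a::euclidean_space \<Rightarrow> real) \<Rightarrow> ennreal" where
  "W_norm p s u = ennroot p (J_energy p s u + (\<integral>\<^sup>+x. ennreal (\<bar>u x\<bar> powr p) \<partial>lebesgue))"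

definition W0 :: "real \<Rightarrow> real \<Rightarrow> 'a::euclidean_space set \<Rightarrow> ('a \<Rightarrow> real) set" where
  "W0 p s \<Omega> = {u \<in> borel_measurable lebesgue. (\<forall>x. x \<notin> \<Omega> \<longrightarrow> u x = 0) \<and>
     (\<exists>\<phi>. (\<forall>n::nat. \<phi> n \<in> Cc_infinity \<Omega>) \<and>
        (\<lambda>n. W_norm p s (\<lambda>x. u x - \<phi> n x)) \<longlonglongrightarrow> 0)}"

text \<open>\<open>frac_p_Laplacian p s \<Omega> u w\<close> says that \<open>\<L>\<^bsub>p,s\<^esub>u\<close> belongs to \<open>L\<^sup>2(\<Omega>)\<close> and equals \<open>w\<close>.\<close>

definition frac_p_Laplacian ::
    "real \<Rightarrow> real \<Rightarrow> 'a::euclidean_space set \<Rightarrow> ('a \<Rightarrow> real) \<Rightarrow> ('a \<Rightarrow> real) \<Rightarrow> bool" where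
  "frac_p_Laplacian p s \<Omega> u w \<longleftrightarrow> w \<in> L2 \<Omega> \<and> u \<in> L2 \<Omega> \<and> u \<in> W0 p s \<Omega> \<and>
     (\<forall>\<phi>\<in>W0 p s \<Omega>.
        (LINT (x, y)|(lebesgue \<Otimes>\<^sub>M lebesgue).
           \<bar>u x - u y\<bar> powr (p - 2) * (u x - u y) * (\<phi> x - \<phi> y)
             / norm (x - y) powr (real DIM('a) + s * p))
        = (LINT x|lebesgue_on \<Omega>. w x * \<phi> x))"


subsection \<open>The evolution problem\<close>

definition L2_continuous ::
    "'a::euclidean_space set \<Rightarrow> (real \<Rightarrow> 'a \<Rightarrow> real) \<Rightarrow> bool" where
  "L2_continuous \<Omega> u \<longleftrightarrow> (\<forall>t\<ge>0. u t \<in> L2 \<Omega> \<and>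
     ((\<lambda>\<tau>. Lq_norm 2 \<Omega> (\<lambda>x. u \<tau> x - u t x)) \<longlongrightarrow> 0) (at t within {0..}))"

text \<open>\<open>v = du/dt\<close> at time \<open>t\<close>, as a two-sided strong limit in \<open>L\<^sup>2(\<Omega>)\<close>.\<close>

definition has_L2_derivative ::
    "'a::euclidean_space set \<Rightarrow> (real \<Rightarrow> 'a \<Rightarrow> real) \<Rightarrow> ('a \<Rightarrow> real) \<Rightarrow> real \<Rightarrow> bool" where
  "has_L2_derivative \<Omega> u v t \<longleftrightarrow> v \<in> L2 \<Omega> \<and>
     ((\<lambda>h. Lq_norm 2 \<Omega> (\<lambda>x. (u (t + h) x - u t x) / h - v x)) \<longlongrightarrow> 0) (at 0)"

definition strong_solution ::
    "real \<Rightarrow> real \<Rightarrow> 'a::euclidean_space set \<Rightarrow> ('a \<Rightarrow> real) \<Rightarrow> (real \<Rightarrow> 'a \<Rightarrow> real) \<Rightarrow> bool" where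
  "strong_solution p s \<Omega> u0 u \<longleftrightarrow>
     (\<forall>t\<ge>0. u t \<in> L2 \<Omega>) \<and>
     (AE t in lebesgue. t > 0 \<longrightarrow>
        (\<exists>w. frac_p_Laplacian p s \<Omega> (u t) w \<and> has_L2_derivative \<Omega> u (\<lambda>x. - w x) t)) \<and>
     (AE x in lebesgue_on \<Omega>. u 0 x = u0 x) \<and>
     (\<forall>t>0. \<forall>x. x \<notin> \<Omega> \<longrightarrow> u t x = 0)"

text \<open>The equation itself is required at every \<open>t > 0\<close>, not only at almost every one; the
  exceptional null set of points \<open>x\<close> may depend on \<open>t\<close>.\<close>

definition regular_strong_solution ::
    "real \<Rightarrow> real \<Rightarrow> 'a::euclidean_space set \<Rightarrow> ('a \<Rightarrow> real) \<Rightarrow> (real \<Rightarrow> 'a \<Rightarrow> real) \<Rightarrow> bool" where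
  "regular_strong_solution p s \<Omega> u0 u \<longleftrightarrow>
     strong_solution p s \<Omega> u0 u \<and>
     L2_continuous \<Omega> u \<and>
     (\<forall>t>0. \<exists>w\<in>L2 \<Omega>. frac_p_Laplacian p s \<Omega> (u t) w) \<and>
     (\<forall>t>0. \<exists>v w. has_L2_derivative \<Omega> u v t \<and> frac_p_Laplacian p s \<Omega> (u t) w \<and>
        (AE x in lebesgue_on \<Omega>. v x + w x = 0))"

end

theory Submission
  imports Defs
begin

text \<open>The operator is the gradient, on the closed subspace \<open>L\<^sup>2(\<Omega>)\<close> of \<open>L\<^sup>2(\<real>\<^sup>N)\<close>, of a convex
  \<open>p\<close>-homogeneous energy. Its resolvents are obtained by minimization: Clarkson's inequality makes
  minimizing sequences Cauchy. The implicit Euler scheme on dyadic grids then converges to a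
  contraction semigroup \<open>u(t)\<close> with \<open>\<parallel>A u(t)\<parallel>\<close> nonincreasing for \<open>t > 0\<close>.

  For a general subdifferential only right derivatives exist at every \<open>t > 0\<close>. Here
  \<open>\<langle>A u - A v, u - v\<rangle>\<close> is comparable to the squared distance of \<open>\<bar>du\<bar>\<^bsup>p/2-1\<^esup>du\<close> and \<open>\<bar>dv\<bar>\<^bsup>p/2-1\<^esup>dv\<close>
  in a Hilbert space, where \<open>du(x,y) = u(x) - u(y)\<close>. Chaining this along Euler steps gives
  \<open>\<langle>A u(s) - A u(t), u(s) - u(t)\<rangle> \<le> C (t - s) (\<parallel>A u(s)\<parallel>\<^sup>2 - \<parallel>A u(t)\<parallel>\<^sup>2)\<close> for \<open>s < t\<close>, which rules out
  jumps of \<open>\<parallel>A u\<parallel>\<close>, so that the derivative is two-sided at every positive time.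

  For two solutions, testing the difference of the equations with smooth nondecreasing functions of
  \<open>u\<^sub>1 - u\<^sub>2\<close> shows that \<open>\<integral>(u\<^sub>1 - u\<^sub>2 - k)\<^sub>+\<close> is nonincreasing in time for each \<open>k \<ge> 0\<close>; integrating over
  \<open>k\<close> gives all \<open>L\<^sup>q\<close> contractions.\<close>

section \<open>The Hilbert space of square integrable functions\<close>

text \<open>Limits are made strong by one recurring device: along a family with monotone norms, |a -
  b|^2 is bounded by a difference of squared norms. It gives the convergence of Yosida
  approximations and of resolvent residuals; summed along Euler steps it gives an error of order
  sqrt h between the steps h and h/2, and on dyadic grids these errors form a convergent series.

  Initial data lie only in the closure of the domain. Nonexpansiveness extends the flow to them, and
  the energy inequality weighted by time bounds |A u(t)| by a multiple of |u0| / t, so the flow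
  enters the domain at once.

  The obstacle to a left derivative is a downward jump of |A u| at t: left quotients would keep the
  larger norm. Cauchy-Schwarz over n Euler steps loses a factor n, but each step contributes a
  factor h, and n h is the elapsed time; this is why the gap bound is linear in t - s.

  Test functions must lie in the closure of the smooth functions of compact support. The derivative
  of (r - k)_+ is therefore replaced by smooth steps, and they are made steep only after
  integration, where no Sobolev regularity is at stake.\<close>

definition sq_integrable :: "('a::euclidean_space \<Rightarrow> real) \<Rightarrow> bool" where
  "sq_integrable f \<longleftrightarrow> f \<in> borel_measurable lebesgue \<and> integrable lebesgue (\<lambda>x. (f x)\<^sup>2)"

lemma sq_integrable_measurable: "sq_integrable f \<Longrightarrow> f \<in> borel_measurable lebesgue"
  by (simp add: sq_integrable_def)

lemma sq_integrable_bound: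
  assumes "f \<in> borel_measurable lebesgue" "integrable lebesgue h" "\<And>x. (f x)\<^sup>2 \<le> h x"
  shows "sq_integrable f"
  unfolding sq_integrable_def using assms
  by (auto intro!: Bochner_Integration.integrable_bound[OF assms(2)] order_trans[OF assms(3) abs_ge_self] AE_I2)

lemma sq_integrable_zero [simp]: "sq_integrable (\<lambda>x. 0)"
  by (simp add: sq_integrable_def)

lemma sq_integrable_scale: "sq_integrable f \<Longrightarrow> sq_integrable (\<lambda>x. c * f x)"
  by (auto simp: sq_integrable_def power_mult_distrib)

lemma sq_integrable_uminus: "sq_integrable f \<Longrightarrow> sq_integrable (\<lambda>x. - f x)"
  by (auto simp: sq_integrable_def)

lemma square_add_le: "(a + b :: real)\<^sup>2 \<le> 2 * a\<^sup>2 + 2 * b\<^sup>2"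
  using zero_le_power2[of "a - b"] by (simp add: power2_eq_square algebra_simps)

lemma sq_integrable_add:
  assumes "sq_integrable f" "sq_integrable g" shows "sq_integrable (\<lambda>x. f x + g x)"
  by (rule sq_integrable_bound[where h = "\<lambda>x. 2 * (f x)\<^sup>2 + 2 * (g x)\<^sup>2"])
    (use assms square_add_le in \<open>auto simp: sq_integrable_def\<close>)

lemma sq_integrable_diff:
  "sq_integrable f \<Longrightarrow> sq_integrable g \<Longrightarrow> sq_integrable (\<lambda>x. f x - g x)"
  using sq_integrable_add[of f "\<lambda>x. - g x"] sq_integrable_uminus[of g] by simp

lemma sq_integrable_mult:
  assumes "sq_integrable f" "sq_integrable g" shows "integrable lebesgue (\<lambda>x. f x * g x)"
proof (rule Bochner_Integration.integrable_bound[where f = "\<lambda>x. (f x)\<^sup>2 + (g x)\<^sup>2"])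
  have "\<bar>a * b\<bar> \<le> a\<^sup>2 + b\<^sup>2" for a b :: real
  proof -
    have "0 \<le> (\<bar>a\<bar> - \<bar>b\<bar>)\<^sup>2" "0 \<le> \<bar>a\<bar> * \<bar>b\<bar>" by simp_all
    then show ?thesis unfolding abs_mult power2_diff power2_abs by linarith
  qed
  then show "AE x in lebesgue. norm (f x * g x) \<le> norm ((f x)\<^sup>2 + (g x)\<^sup>2)"
    by (intro AE_I2) simp
qed (use assms in \<open>auto simp: sq_integrable_def\<close>)

\<comment> \<open>A type cannot depend on the set \<Omega>, so classes over the whole space are
  formed and L2(\<Omega>) is recovered later as a closed subspace. The relation is partial:
  functions that are not square integrable are related to nothing.\<close>
quotient_type (overloaded) 'a l2 = "'a::euclidean_space \<Rightarrow> real" /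
  partial: "\<lambda>f g. sq_integrable f \<and> sq_integrable g \<and> (AE x in lebesgue. f x = g x)"
proof (rule part_equivpI)
  show "\<exists>f::'a \<Rightarrow> real. sq_integrable f \<and> sq_integrable f \<and> (AE x in lebesgue. f x = f x)"
    by (rule exI[of _ "\<lambda>x. 0"]) simp
  show "symp (\<lambda>f g::'a \<Rightarrow> real. sq_integrable f \<and> sq_integrable g \<and> (AE x in lebesgue. f x = g x))"
    by (auto simp: symp_def elim: eventually_mono)
  show "transp (\<lambda>f g::'a \<Rightarrow> real. sq_integrable f \<and> sq_integrable g \<and> (AE x in lebesgue. f x = g x))"
    unfolding transp_def by (auto elim: eventually_elim2)
qed

instantiation l2 :: (euclidean_space) real_vector
begin

lift_definition zero_l2 :: "'a l2" is "\<lambda>x. 0" by simp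

lift_definition plus_l2 :: "'a l2 \<Rightarrow> 'a l2 \<Rightarrow> 'a l2" is "\<lambda>f g x. f x + g x"
  by (auto simp: sq_integrable_add)

lift_definition minus_l2 :: "'a l2 \<Rightarrow> 'a l2 \<Rightarrow> 'a l2" is "\<lambda>f g x. f x - g x"
  by (auto simp: sq_integrable_diff)

lift_definition uminus_l2 :: "'a l2 \<Rightarrow> 'a l2" is "\<lambda>f x. - f x"
  by (auto simp: sq_integrable_uminus)

lift_definition scaleR_l2 :: "real \<Rightarrow> 'a l2 \<Rightarrow> 'a l2" is "\<lambda>c f x. c * f x"
  by (auto simp: sq_integrable_scale)

instance
proof
  fix x y z :: "'a l2" and a b :: real
  show "x + y + z = x + (y + z)" by transfer (auto simp: sq_integrable_add add.assoc)
  show "x + y = y + x" by transfer (auto simp: sq_integrable_add add.commute)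
  show "0 + x = x" by transfer auto
  show "- x + x = 0" by transfer auto
  show "x - y = x + - y" by transfer (auto simp: sq_integrable_diff)
  show "a *\<^sub>R (x + y) = a *\<^sub>R x + a *\<^sub>R y"
    by transfer (auto simp: sq_integrable_add sq_integrable_scale distrib_left)
  show "(a + b) *\<^sub>R x = a *\<^sub>R x + b *\<^sub>R x"
    by transfer (auto simp: sq_integrable_add sq_integrable_scale distrib_right)
  show "a *\<^sub>R b *\<^sub>R x = (a * b) *\<^sub>R x"
    by transfer (auto simp: sq_integrable_scale mult.assoc)
  show "1 *\<^sub>R x = x" by transfer auto
qed

end

instantiation l2 :: (euclidean_space) real_inner
begin

lift_definition inner_l2 :: "'a l2 \<Rightarrow> 'a l2 \<Rightarrow> real" is "\<lambda>f g. LINT x|lebesgue. f x * g x"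
  by (auto intro!: integral_cong_AE borel_measurable_times simp: sq_integrable_measurable)

definition norm_l2 :: "'a l2 \<Rightarrow> real" where "norm_l2 x = sqrt (x \<bullet> x)"

definition sgn_l2 :: "'a l2 \<Rightarrow> 'a l2" where "sgn_l2 x = x /\<^sub>R norm x"

definition dist_l2 :: "'a l2 \<Rightarrow> 'a l2 \<Rightarrow> real" where "dist_l2 x y = norm (x - y)"

definition uniformity_l2 :: "('a l2 \<times> 'a l2) filter" where
  "uniformity_l2 = (INF e\<in>{0<..}. principal {(x, y). dist x y < e})"

definition open_l2 :: "'a l2 set \<Rightarrow> bool" where
  "open_l2 U = (\<forall>x\<in>U. eventually (\<lambda>(x', y). x' = x \<longrightarrow> y \<in> U) uniformity)"

instance
proof
  fix x y z :: "'a l2" and a b :: real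
  show "dist x y = norm (x - y)" by (rule dist_l2_def)
  show "sgn x = x /\<^sub>R norm x" by (rule sgn_l2_def)
  show "uniformity = (INF e\<in>{0<..}. principal {(x::'a l2, y). dist x y < e})" by (rule uniformity_l2_def)
  show "open U = (\<forall>x\<in>U. eventually (\<lambda>(x', y). x' = x \<longrightarrow> y \<in> U) uniformity)" for U :: "'a l2 set"
    by (rule open_l2_def)
  show "x \<bullet> y = y \<bullet> x" by transfer (simp add: mult.commute)
  show "(x + y) \<bullet> z = x \<bullet> z + y \<bullet> z"
    by transfer (simp add: distrib_right sq_integrable_mult)
  show "a *\<^sub>R x \<bullet> y = a * (x \<bullet> y)" by transfer (simp add: mult.assoc)
  show "0 \<le> x \<bullet> x" by transfer simp
  show "(x \<bullet> x = 0) = (x = 0)"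
  proof (transfer, goal_cases)
    case (1 f)
    then have f: "sq_integrable f" by simp
    have "(LINT x|lebesgue. f x * f x) = 0 \<longleftrightarrow> (AE x in lebesgue. f x * f x = 0)"
      using integral_nonneg_eq_0_iff_AE[of lebesgue "\<lambda>x. f x * f x"] sq_integrable_mult[OF f f] by simp
    then show ?case using f by simp
  qed
  show "norm x = sqrt (x \<bullet> x)" by (rule norm_l2_def)
qed

end

lemma sq_integrable_rep: "sq_integrable (rep_l2 x)"
  using Quotient3_rep_reflp[OF Quotient3_l2] by blast

lemma abs_rep_l2 [simp]: "abs_l2 (rep_l2 x) = x"
  by (rule Quotient3_abs_rep[OF Quotient3_l2])

lemma abs_l2_eq_iff:
  "sq_integrable f \<Longrightarrow> sq_integrable g \<Longrightarrow> abs_l2 f = abs_l2 g \<longleftrightarrow> (AE x in lebesgue. f x = g x)"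
  using Quotient3_rel[OF Quotient3_l2, of f g] by blast

lemma abs_l2_add: "sq_integrable f \<Longrightarrow> sq_integrable g \<Longrightarrow> abs_l2 f + abs_l2 g = abs_l2 (\<lambda>x. f x + g x)"
  by (simp add: plus_l2.abs_eq eq_onp_def)

lemma abs_l2_diff: "sq_integrable f \<Longrightarrow> sq_integrable g \<Longrightarrow> abs_l2 f - abs_l2 g = abs_l2 (\<lambda>x. f x - g x)"
  by (simp add: minus_l2.abs_eq eq_onp_def)

lemma abs_l2_scaleR: "sq_integrable f \<Longrightarrow> c *\<^sub>R abs_l2 f = abs_l2 (\<lambda>x. c * f x)"
  by (simp add: scaleR_l2.abs_eq eq_onp_def)

lemma abs_l2_inner: "sq_integrable f \<Longrightarrow> sq_integrable g \<Longrightarrow> abs_l2 f \<bullet> abs_l2 g = (LINT x|lebesgue. f x * g x)"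
  by (simp add: inner_l2.abs_eq eq_onp_def)

lemma abs_l2_norm: "sq_integrable f \<Longrightarrow> (norm (abs_l2 f))\<^sup>2 = (LINT x|lebesgue. (f x)\<^sup>2)"
  by (simp only: power2_norm_eq_inner abs_l2_inner) (simp add: power2_eq_square)

lemma abs_l2_nn_integral:
  assumes "sq_integrable f"
  shows "(\<integral>\<^sup>+x. ennreal ((f x)\<^sup>2) \<partial>lebesgue) = ennreal ((norm (abs_l2 f))\<^sup>2)"
  using assms by (simp add: abs_l2_norm nn_integral_eq_integral sq_integrable_def)

lemma sq_integrableI:
  assumes "f \<in> borel_measurable lebesgue" "(\<integral>\<^sup>+x. ennreal ((f x)\<^sup>2) \<partial>lebesgue) < \<infinity>"
  shows "sq_integrable f"
  using assms by (auto simp: sq_integrable_def intro!: integrableI_nonneg)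

section \<open>Completeness (Riesz-Fischer)\<close>

lemma summable_partial_sums_bound:
  fixes a :: "nat \<Rightarrow> real"
  assumes "\<And>k. 0 \<le> a k" "(SUP K. ennreal ((\<Sum>k<K. a k)\<^sup>2)) < \<infinity>"
  shows "summable a"
proof -
  obtain c where c: "(SUP K. ennreal ((\<Sum>k<K. a k)\<^sup>2)) = ennreal c" "0 \<le> c"
    using assms(2) by (cases "SUP K. ennreal ((\<Sum>k<K. a k)\<^sup>2)") auto
  have "(\<Sum>k<K. a k) \<le> sqrt c" for K
  proof -
    have "ennreal ((\<Sum>k<K. a k)\<^sup>2) \<le> ennreal c"
      unfolding c(1)[symmetric] by (intro SUP_upper) simp
    then show ?thesis using c(2) by (intro real_le_rsqrt) simp
  qed
  then show ?thesis by (intro summableI_nonneg_bounded[of a "sqrt c"] assms(1))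
qed

lemma liminf_le_eventually:
  fixes u :: "nat \<Rightarrow> ennreal"
  assumes "eventually (\<lambda>n. u n \<le> c) sequentially" shows "liminf u \<le> c"
  using order_trans[OF Liminf_le_Limsup[OF trivial_limit_sequentially] Limsup_bounded[OF assms]] .

text \<open>The partial sums of |X(k+1) - X(k)| have L2 norm at most 2, so by monotone convergence
  the series is finite a.e. and the representatives converge pointwise. Fatou's lemma then turns the
  tail bound for X into the same bound for the distance to the pointwise limit.\<close>

lemma l2_fast_cauchy_convergent:
  fixes X :: "nat \<Rightarrow> 'a::euclidean_space l2"
  assumes fast: "\<And>k. dist (X k) (X (Suc k)) \<le> (1/2)^k"
  shows "convergent X"
proof -
  define f where "f k = rep_l2 (X k)" for k
  have f: "sq_integrable (f k)" "X k = abs_l2 (f k)" for k by (simp_all add: f_def sq_integrable_rep)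
  have [measurable]: "f k \<in> borel_measurable lebesgue" for k using f(1) by (rule sq_integrable_measurable)
  define d where "d k x = \<bar>f (Suc k) x - f k x\<bar>" for k x
  have d: "sq_integrable (d k)" "norm (abs_l2 (d k)) \<le> (1/2)^k" for k
  proof -
    have "sq_integrable (\<lambda>x. f (Suc k) x - f k x)" by (intro sq_integrable_diff f)
    then show *: "sq_integrable (d k)" by (simp add: sq_integrable_def d_def[abs_def])
    have "(norm (abs_l2 (d k)))\<^sup>2 = (norm (X (Suc k) - X k))\<^sup>2"
      unfolding abs_l2_norm[OF *] f(2) abs_l2_diff[OF f(1) f(1)]
      by (subst abs_l2_norm) (auto intro: sq_integrable_diff f simp: d_def)
    then have "norm (abs_l2 (d k)) = norm (X (Suc k) - X k)" by simp
    then show "norm (abs_l2 (d k)) \<le> (1/2)^k" using fast[of k] by (simp add: dist_norm norm_minus_commute)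
  qed
  have g: "sq_integrable (\<lambda>x. \<Sum>k<K. d k x) \<and> norm (abs_l2 (\<lambda>x. \<Sum>k<K. d k x)) \<le> (\<Sum>k<K. (1/2)^k)" for K
  proof (induction K)
    case 0
    have "(0::'a l2) = abs_l2 (\<lambda>x. 0)" by (simp add: zero_l2_def)
    then show ?case by (simp flip: \<open>0 = abs_l2 (\<lambda>x. 0)\<close>)
  next
    case (Suc K)
    then have "norm (abs_l2 (\<lambda>x. \<Sum>k<K. d k x) + abs_l2 (d K)) \<le> (\<Sum>k<K. (1/2)^k) + (1/2)^K"
      using d(2)[of K] norm_triangle_mono by blast
    then show ?case using Suc d(1)[of K] by (simp add: abs_l2_add sq_integrable_add)
  qed
  have "(\<Sum>k<K. (1/2)^k) \<le> (2::real)" for K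
    using sum_le_suminf[of "\<lambda>k. (1/2::real)^k" "{..<K}"] suminf_geometric[of "1/2::real"] by simp
  then have bd: "norm (abs_l2 (\<lambda>x. \<Sum>k<K. d k x)) \<le> 2" for K using g[of K] by (meson order_trans)
  have "(\<integral>\<^sup>+x. ennreal ((\<Sum>k<K. d k x)\<^sup>2) \<partial>lebesgue) \<le> ennreal (2\<^sup>2)" for K
    unfolding abs_l2_nn_integral[OF conjunct1[OF g]] by (intro ennreal_leI power_mono bd norm_ge_zero)
  then have "(SUP K. \<integral>\<^sup>+x. ennreal ((\<Sum>k<K. d k x)\<^sup>2) \<partial>lebesgue) \<le> ennreal (2\<^sup>2)"
    by (intro SUP_least)
  moreover have "(\<integral>\<^sup>+x. (SUP K. ennreal ((\<Sum>k<K. d k x)\<^sup>2)) \<partial>lebesgue)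
      = (SUP K. \<integral>\<^sup>+x. ennreal ((\<Sum>k<K. d k x)\<^sup>2) \<partial>lebesgue)"
  proof (rule nn_integral_monotone_convergence_SUP)
    show "incseq (\<lambda>K x. ennreal ((\<Sum>k<K. d k x)\<^sup>2))"
      by (auto simp: incseq_def le_fun_def d_def intro!: ennreal_leI power_mono sum_mono2 sum_nonneg)
    show "(\<lambda>x. ennreal ((\<Sum>k<K. d k x)\<^sup>2)) \<in> borel_measurable lebesgue" for K
      unfolding d_def by measurable
  qed
  ultimately have "(\<integral>\<^sup>+x. (SUP K. ennreal ((\<Sum>k<K. d k x)\<^sup>2)) \<partial>lebesgue) < \<infinity>"
    using le_less_trans[of _ "ennreal (2\<^sup>2)" \<infinity>] by simp
  then have "AE x in lebesgue. (SUP K. ennreal ((\<Sum>k<K. d k x)\<^sup>2)) \<noteq> \<infinity>"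
    by (intro nn_integral_noteq_infinite) (auto simp: d_def)
  then have conv: "AE x in lebesgue. convergent (\<lambda>k. f k x)"
  proof eventually_elim
    case (elim x)
    have "summable (\<lambda>k. d k x)"
    proof (rule summable_partial_sums_bound)
      show "(SUP K. ennreal ((\<Sum>k<K. d k x)\<^sup>2)) < \<infinity>"
        using elim by (simp only: infinity_ennreal_def top.not_eq_extremum)
    qed (simp add: d_def)
    then have "summable (\<lambda>k. f (Suc k) x - f k x)"
      using summable_norm_cancel[of "\<lambda>k. f (Suc k) x - f k x"] by (simp add: d_def)
    then have "convergent (\<lambda>K. \<Sum>k<K. f (Suc k) x - f k x)" by (simp add: summable_iff_convergent)
    then have "convergent (\<lambda>K. f K x - f 0 x)" unfolding sum_lessThan_telescope[of "\<lambda>k. f k x"] .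
    from convergent_add[OF this convergent_const[of "f 0 x"]] show ?case by simp
  qed
  define l where "l x = lim (\<lambda>k. f k x)" for x
  have [measurable]: "l \<in> borel_measurable lebesgue" unfolding l_def[abs_def] by measurable
  have tail: "dist (X k) (X m) \<le> 2 * (1/2)^k" if "k \<le> m" for k m
  proof -
    \<comment> \<open>The subtracted term is exactly what pays for the step from m to m + 1 in the
      induction.\<close>
    have "dist (X k) (X m) \<le> 2 * (1/2)^k - 2 * (1/2)^m" using that
    proof (induction m rule: dec_induct)
      case (step m)
      then show ?case using fast[of m] dist_triangle[of "X k" "X (Suc m)" "X m"] by simp
    qed simp
    moreover have "0 \<le> 2 * (1/2::real)^m" by simp
    ultimately show ?thesis by linarith
  qed
  have fatou: "(\<integral>\<^sup>+x. ennreal ((l x - f k x)\<^sup>2) \<partial>lebesgue) \<le> ennreal ((2 * (1/2)^k)\<^sup>2)" for k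
  proof -
    have "(\<integral>\<^sup>+x. ennreal ((l x - f k x)\<^sup>2) \<partial>lebesgue)
        = (\<integral>\<^sup>+x. liminf (\<lambda>m. ennreal ((f m x - f k x)\<^sup>2)) \<partial>lebesgue)"
    proof (rule nn_integral_cong_AE, use conv in eventually_elim)
      case (elim x)
      then have "(\<lambda>m. ennreal ((f m x - f k x)\<^sup>2)) \<longlonglongrightarrow> ennreal ((l x - f k x)\<^sup>2)"
        unfolding l_def by (intro tendsto_intros tendsto_ennrealI) (simp add: convergent_LIMSEQ_iff)
      from lim_imp_Liminf[OF trivial_limit_sequentially this] show ?case by (rule sym)
    qed
    also have "\<dots> \<le> liminf (\<lambda>m. \<integral>\<^sup>+x. ennreal ((f m x - f k x)\<^sup>2) \<partial>lebesgue)"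
      by (rule nn_integral_liminf) measurable
    also have "\<dots> \<le> ennreal ((2 * (1/2)^k)\<^sup>2)"
    proof (rule liminf_le_eventually, rule eventually_sequentiallyI[of k])
      fix m assume "k \<le> m"
      from tail[OF this] have "(norm (X m - X k))\<^sup>2 \<le> (2 * (1/2)^k)\<^sup>2"
        by (intro power_mono) (auto simp: dist_norm norm_minus_commute)
      then show "(\<integral>\<^sup>+x. ennreal ((f m x - f k x)\<^sup>2) \<partial>lebesgue) \<le> ennreal ((2 * (1/2)^k)\<^sup>2)"
        using f by (simp add: abs_l2_nn_integral sq_integrable_diff abs_l2_diff ennreal_leI)
    qed
    finally show ?thesis .
  qed
  have lk: "sq_integrable (\<lambda>x. l x - f k x)" for k
    by (rule sq_integrableI[OF _ le_less_trans[OF fatou[of k]]]) simp_all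
  have ls: "sq_integrable l" using sq_integrable_add[OF lk f(1), of 0 0] by simp
  have 1: "norm (X k - abs_l2 l) \<le> 2 * (1/2)^k" for k
  proof -
    have "(norm (abs_l2 l - X k))\<^sup>2 \<le> (2 * (1/2)^k)\<^sup>2"
      using fatou[of k] lk[of k] f[of k] ls by (simp add: abs_l2_nn_integral abs_l2_diff)
    then have "norm (abs_l2 l - X k) \<le> 2 * (1/2)^k" by (rule power2_le_imp_le) simp
    then show ?thesis by (simp add: norm_minus_commute)
  qed
  have 2: "(\<lambda>k. 2 * (1/2)^k :: real) \<longlonglongrightarrow> 0"
    by (intro tendsto_mult_right_zero LIMSEQ_power_zero) simp
  have "(\<lambda>k. X k - abs_l2 l) \<longlonglongrightarrow> 0"
    by (rule Lim_null_comparison[OF eventuallyI 2]) (rule 1)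
  then show ?thesis by (auto simp: LIM_zero_iff convergent_def)
qed

instance l2 :: (euclidean_space) complete_space
proof
  fix X :: "nat \<Rightarrow> 'a l2" assume X: "Cauchy X"
  have "\<exists>N. \<forall>m\<ge>N. \<forall>n\<ge>N. dist (X m) (X n) < (1/2)^k" for k
    by (rule metric_CauchyD[OF X]) simp
  then obtain N where N: "\<And>k m n. N k \<le> m \<Longrightarrow> N k \<le> n \<Longrightarrow> dist (X m) (X n) < (1/2)^k" by metis
  \<comment> \<open>The summand k makes \<open>r\<close> strictly increasing; the sum keeps
    \<open>r k\<close> above \<open>N k\<close>.\<close>
  define r where "r k = (\<Sum>j\<le>k. N j) + k" for k
  have "strict_mono r" by (auto simp: strict_mono_Suc_iff r_def)
  have rN: "N k \<le> r k" for k
    using member_le_sum[of k "{..k}" N] by (simp add: r_def)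
  have "r k \<le> r (Suc k)" for k using strict_monoD[OF \<open>strict_mono r\<close>, of k "Suc k"] by simp
  then have "dist ((X \<circ> r) k) ((X \<circ> r) (Suc k)) \<le> (1/2)^k" for k
    using N[OF rN[of k] order_trans[OF rN[of k]]] by (auto intro: less_imp_le)
  then have "convergent (X \<circ> r)" by (rule l2_fast_cauchy_convergent)
  then obtain l where "(X \<circ> r) \<longlonglongrightarrow> l" by (auto simp: convergent_def)
  then have "X \<longlonglongrightarrow> l" using Cauchy_converges_subseq[OF X \<open>strict_mono r\<close>] by simp
  then show "convergent X" by (auto simp: convergent_def)
qed

section \<open>Monotone operators and the implicit Euler scheme\<close>

text \<open>\<open>range\<close> is Minty's form of maximal monotonicity, posed for a single-valued
  operator inside a closed subspace. Limits are identified through the resolvents that it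
  provides.\<close>

locale monotone_operator =
  fixes V D :: "'h::{real_inner,complete_space} set" and A :: "'h \<Rightarrow> 'h"
  assumes subspace_V: "subspace V" and closed_V: "closed V"
    and D_V: "D \<subseteq> V" and A_V: "x \<in> D \<Longrightarrow> A x \<in> V"
    and mono: "x \<in> D \<Longrightarrow> y \<in> D \<Longrightarrow> 0 \<le> (A x - A y) \<bullet> (x - y)"
    and range: "f \<in> V \<Longrightarrow> 0 < l \<Longrightarrow> \<exists>x\<in>D. x + l *\<^sub>R A x = f"
begin

section \<open>Resolvents and Yosida approximations\<close>

definition resolvent :: "real \<Rightarrow> 'h \<Rightarrow> 'h"
  where "resolvent l f = (SOME x. x \<in> D \<and> x + l *\<^sub>R A x = f)"

lemma
  assumes "f \<in> V" "0 < l"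
  shows resolvent_D: "resolvent l f \<in> D"
    and resolvent_eq: "resolvent l f + l *\<^sub>R A (resolvent l f) = f"
proof -
  have "\<exists>x. x \<in> D \<and> x + l *\<^sub>R A x = f" using range assms by blast
  from someI_ex[OF this] show "resolvent l f \<in> D" "resolvent l f + l *\<^sub>R A (resolvent l f) = f"
    by (auto simp: resolvent_def)
qed

lemma resolvent_V: "f \<in> V \<Longrightarrow> 0 < l \<Longrightarrow> resolvent l f \<in> V"
  using resolvent_D D_V by blast

text \<open>Pair the difference of the two images with x - y: the contribution of \<open>A\<close>
  is nonnegative by monotonicity, and Cauchy-Schwarz leaves one factor |x - y| to cancel. The form
  for arbitrary points of \<open>D\<close> also compares an approximate solution with a
  resolvent.\<close>

lemma nonexpansive_aux:
  assumes "x \<in> D" "y \<in> D" "0 < l"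
  shows "norm (x - y) \<le> norm ((x + l *\<^sub>R A x) - (y + l *\<^sub>R A y))"
proof (cases "x = y")
  case False
  have "norm (x - y) ^ 2 \<le> (x - y) \<bullet> (x - y) + l * ((A x - A y) \<bullet> (x - y))"
    using mono[OF assms(1,2)] assms(3) by (simp add: power2_norm_eq_inner)
  also have "\<dots> = ((x + l *\<^sub>R A x) - (y + l *\<^sub>R A y)) \<bullet> (x - y)"
    by (simp add: inner_diff_left inner_diff_right inner_add_left algebra_simps)
  also have "\<dots> \<le> norm ((x + l *\<^sub>R A x) - (y + l *\<^sub>R A y)) * norm (x - y)"
    by (rule norm_cauchy_schwarz)
  finally show ?thesis using False by (simp add: power2_eq_square)
qed auto

lemma resolvent_nonexpansive:
  assumes "f \<in> V" "g \<in> V" "0 < l"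
  shows "norm (resolvent l f - resolvent l g) \<le> norm (f - g)"
  using nonexpansive_aux[OF resolvent_D[OF assms(1,3)] resolvent_D[OF assms(2,3)] assms(3)]
    resolvent_eq assms by simp

definition yosida :: "real \<Rightarrow> 'h \<Rightarrow> 'h" where "yosida l f = A (resolvent l f)"

lemma resolvent_yosida: "f \<in> V \<Longrightarrow> 0 < l \<Longrightarrow> f - resolvent l f = l *\<^sub>R yosida l f"
  using resolvent_eq[of f l] by (simp add: yosida_def algebra_simps)

text \<open>Monotonicity between x and \<open>resolvent l x\<close>, whose difference is l times the
  Yosida approximation. The first inequality is the sharper one: for consecutive Euler steps it
  bounds the squared increment of \<open>A\<close> by the drop of its squared norm.\<close>

lemma yosida_norm_le:
  assumes "x \<in> D" "0 < l"
  shows "norm (yosida l x) ^ 2 \<le> A x \<bullet> yosida l x" "norm (yosida l x) \<le> norm (A x)"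
proof -
  have xV: "x \<in> V" using assms D_V by auto
  have "0 \<le> (A x - yosida l x) \<bullet> (x - resolvent l x)"
    using mono[OF assms(1) resolvent_D[OF xV assms(2)]] by (simp add: yosida_def)
  then have "0 \<le> l * ((A x - yosida l x) \<bullet> yosida l x)"
    using resolvent_yosida[OF xV assms(2)] by simp
  then have "0 \<le> (A x - yosida l x) \<bullet> yosida l x"
    using assms(2) by (simp add: zero_le_mult_iff)
  then show 1: "norm (yosida l x) ^ 2 \<le> A x \<bullet> yosida l x"
    by (simp add: inner_diff_left power2_norm_eq_inner)
  also have "\<dots> \<le> norm (A x) * norm (yosida l x)" by (rule norm_cauchy_schwarz)
  finally have "norm (yosida l x) * norm (yosida l x) \<le> norm (A x) * norm (yosida l x)"
    by (simp add: power2_eq_square)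
  then show "norm (yosida l x) \<le> norm (A x)"
    using mult_right_le_imp_le[of "norm (yosida l x)" "norm (yosida l x)" "norm (A x)"]
    by (cases "yosida l x = 0") auto
qed

lemma yosida_lipschitz:
  assumes "f \<in> V" "g \<in> V" "0 < l"
  shows "norm (yosida l f - yosida l g) \<le> 2 / l * norm (f - g)"
proof -
  have "l *\<^sub>R (yosida l f - yosida l g) = (f - g) - (resolvent l f - resolvent l g)"
    using resolvent_yosida[of f l] resolvent_yosida[of g l] assms by (simp add: algebra_simps)
  then have "l * norm (yosida l f - yosida l g) = norm ((f - g) - (resolvent l f - resolvent l g))"
    using assms by (metis abs_of_pos norm_scaleR)
  also have "\<dots> \<le> norm (f - g) + norm (resolvent l f - resolvent l g)" by (rule norm_triangle_ineq4)
  also have "\<dots> \<le> 2 * norm (f - g)" using resolvent_nonexpansive[OF assms] by simp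
  finally show ?thesis using assms by (simp add: field_simps)
qed

text \<open>With a, b the approximations at l and m, monotonicity at the two resolvents gives (a -
  b) . a <= 0, that is |a|^2 <= a . b; expanding |a - b|^2 finishes. Norms thus increase as the
  parameter decreases, and a bound on them forces strong convergence.\<close>

lemma yosida_cauchy:
  assumes "f \<in> V" "0 < m" "m \<le> l"
  shows "norm (yosida l f - yosida m f) ^ 2 \<le> norm (yosida m f) ^ 2 - norm (yosida l f) ^ 2"
proof -
  define a b where "a = yosida l f" and "b = yosida m f"
  have l: "0 < l" using assms by simp
  have "0 \<le> (a - b) \<bullet> (resolvent l f - resolvent m f)"
    unfolding a_def b_def yosida_def using assms l by (intro mono resolvent_D)
  also have "resolvent l f - resolvent m f = m *\<^sub>R b - l *\<^sub>R a"
    using resolvent_yosida[of f l] resolvent_yosida[of f m] assms l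
    by (simp add: a_def b_def algebra_simps)
  also have "(a - b) \<bullet> (m *\<^sub>R b - l *\<^sub>R a) = - (m * ((a - b) \<bullet> (a - b))) - (l - m) * ((a - b) \<bullet> a)"
    by (simp add: inner_diff_left inner_diff_right algebra_simps)
  finally have 1: "m * ((a - b) \<bullet> (a - b)) + (l - m) * ((a - b) \<bullet> a) \<le> 0" by simp
  have "(a - b) \<bullet> a \<le> 0"
  proof (cases "l = m")
    case True
    then have "(a - b) \<bullet> (a - b) \<le> 0" using 1 assms by (simp add: mult_le_0_iff)
    then have "a = b" by (metis inner_eq_zero_iff inner_ge_zero order_antisym right_minus_eq)
    then show ?thesis by simp
  next
    case False
    then have "(l - m) * ((a - b) \<bullet> a) \<le> 0" using 1 assms
      by (smt (verit) inner_ge_zero mult_nonneg_nonneg)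
    then show ?thesis using False assms by (simp add: mult_le_0_iff)
  qed
  then have "a \<bullet> a \<le> a \<bullet> b" by (simp add: inner_diff_left inner_commute[of b a])
  then show ?thesis
    unfolding a_def[symmetric] b_def[symmetric]
    by (simp add: power2_norm_eq_inner inner_diff_left inner_diff_right inner_commute)
qed

section \<open>Closedness of the graph and weak continuity\<close>

lemma closed_graph:
  assumes "\<And>n. x n \<in> D" "x \<longlonglongrightarrow> u" "(\<lambda>n. A (x n)) \<longlonglongrightarrow> w"
  shows "u \<in> D" "A u = w"
proof -
  have "x n \<in> V" "A (x n) \<in> V" for n using assms(1) D_V A_V by auto
  then have V: "u \<in> V" "w \<in> V"
    by (auto intro: closed_sequentially[OF closed_V _ assms(2)] closed_sequentially[OF closed_V _ assms(3)])
  have uw: "u + w \<in> V" using V subspace_V by (auto intro: subspace_add)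
  \<comment> \<open>The candidate for the limit is the resolvent of u + w at l = 1; nonexpansiveness
    compares x n with it through x n + A (x n), which converges to u + w.\<close>
  have 1: "norm (x n - resolvent 1 (u + w)) \<le> norm ((x n + A (x n)) - (u + w))" for n
    using nonexpansive_aux[OF assms(1) resolvent_D[OF uw, of 1], of 1 n] resolvent_eq[OF uw, of 1]
    by simp
  have 2: "(\<lambda>n. norm ((x n + A (x n)) - (u + w))) \<longlonglongrightarrow> 0"
    using tendsto_add[OF assms(2,3)] by (simp add: LIM_zero tendsto_norm_zero)
  have "(\<lambda>n. x n - resolvent 1 (u + w)) \<longlonglongrightarrow> 0"
    by (rule Lim_null_comparison[OF eventuallyI 2]) (rule 1)
  then have "x \<longlonglongrightarrow> resolvent 1 (u + w)" by (simp add: LIM_zero_iff)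
  then have "u = resolvent 1 (u + w)" using assms(2) LIMSEQ_unique by blast
  then show "u \<in> D" "A u = w"
    using resolvent_D[OF uw, of 1] resolvent_eq[OF uw, of 1] by auto
qed

text \<open>A converse of \<open>yosida_norm_le\<close>: bounded approximations characterize the
  domain. Along l = 1 / (n + 1) the norms increase and stay bounded, so the approximations are
  Cauchy; the resolvents tend to u because they differ from it by l times a convergent sequence, and
  the closed graph identifies the limit.\<close>

lemma yosida_bounded:
  assumes u: "u \<in> V" and bd: "\<And>l. 0 < l \<Longrightarrow> norm (yosida l u) \<le> K"
  shows "u \<in> D" "(\<lambda>n. yosida (1 / Suc n) u) \<longlonglongrightarrow> A u" "norm (A u) \<le> K"
proof -
  define y where "y n = yosida (1 / Suc n) u" for n
  have le: "norm (y m - y n) ^ 2 \<le> norm (y n) ^ 2 - norm (y m) ^ 2" if "m \<le> n" for m n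
    unfolding y_def using that by (intro yosida_cauchy u) (auto simp: field_simps)
  have "incseq (\<lambda>n. norm (y n) ^ 2)"
    using le by (intro incseq_SucI) (smt (verit) le_SucI order_refl zero_le_power2)
  moreover have "Bseq (\<lambda>n. norm (y n) ^ 2)"
    using bd by (intro BseqI'[of _ "K^2"]) (auto simp: y_def intro!: power_mono)
  ultimately have "Cauchy (\<lambda>n. norm (y n) ^ 2)"
    by (meson Bseq_mono_convergent convergent_Cauchy incseq_def)
  have "Cauchy y"
  proof (rule metric_CauchyI)
    fix e :: real assume e: "0 < e"
    obtain M where M: "\<And>m n. m \<ge> M \<Longrightarrow> n \<ge> M \<Longrightarrow> dist (norm (y m) ^ 2) (norm (y n) ^ 2) < e^2"
      using metric_CauchyD[OF \<open>Cauchy (\<lambda>n. norm (y n) ^ 2)\<close>, of "e^2"] e by auto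
    have *: "dist (y m) (y n) < e" if "m \<ge> M" "m \<le> n" for m n
    proof -
      have "norm (y m - y n) ^ 2 < e ^ 2"
        using le[OF that(2)] M[of m n] that by (auto simp: dist_real_def)
      then show ?thesis using e by (simp add: dist_norm power_less_imp_less_base)
    qed
    show "\<exists>M. \<forall>m\<ge>M. \<forall>n\<ge>M. dist (y m) (y n) < e"
      by (metis * dist_commute nle_le)
  qed
  then obtain w where w: "y \<longlonglongrightarrow> w" using convergent_eq_Cauchy by blast
  have "(\<lambda>n. (1 / Suc n) *\<^sub>R y n) \<longlonglongrightarrow> 0 *\<^sub>R w"
    using w LIMSEQ_inverse_real_of_nat by (intro tendsto_scaleR) (auto simp: inverse_eq_divide)
  then have "(\<lambda>n. u - (1 / Suc n) *\<^sub>R y n) \<longlonglongrightarrow> u - 0 *\<^sub>R w" by (intro tendsto_diff) auto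
  moreover have "u - (1 / Suc n) *\<^sub>R y n = resolvent (1 / Suc n) u" for n
    using resolvent_yosida[OF u, of "1 / Suc n"] by (simp add: y_def algebra_simps)
  ultimately have R: "(\<lambda>n. resolvent (1 / Suc n) u) \<longlonglongrightarrow> u" by simp
  have D: "resolvent (1 / Suc n) u \<in> D" for n using resolvent_D[OF u] by simp
  have "(\<lambda>n. A (resolvent (1 / Suc n) u)) \<longlonglongrightarrow> w"
    using w unfolding y_def yosida_def .
  from closed_graph[OF D R this] show "u \<in> D" and "(\<lambda>n. yosida (1 / Suc n) u) \<longlonglongrightarrow> A u"
    using w by (auto simp: y_def[abs_def])
  then show "norm (A u) \<le> K"
    using bd by (intro LIMSEQ_le_const2[OF tendsto_norm]) auto
qed

text \<open>The values \<open>A (x n)\<close> are bounded but may fail to converge. For fixed l,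
  however, the Yosida approximation is Lipschitz with constant 2 / l, so the bound K passes to its
  value at u, and \<open>yosida_bounded\<close> applies.\<close>

lemma demiclosed:
  assumes D: "\<And>n. x n \<in> D" and lim: "x \<longlonglongrightarrow> u" and bd: "\<And>n. norm (A (x n)) \<le> K"
  shows "u \<in> D" "norm (A u) \<le> K"
proof -
  have u: "u \<in> V" using closed_sequentially[OF closed_V _ lim] D D_V by blast
  have "norm (yosida l u) \<le> K" if l: "0 < l" for l
  proof -
    have "norm (yosida l u) \<le> K + 2 / l * norm (x n - u)" for n
    proof -
      have "norm (yosida l u) \<le> norm (yosida l (x n)) + norm (yosida l (x n) - yosida l u)"
        by (metis norm_minus_commute norm_triangle_sub)
      then show ?thesis
        using yosida_lipschitz[of "x n" u l] yosida_norm_le(2)[OF D l, of n] bd[of n] D_V D u l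
        by (smt (verit) subsetD)
    qed
    moreover have "(\<lambda>n. K + 2 / l * norm (x n - u)) \<longlonglongrightarrow> K + 2 / l * 0"
      using lim by (intro tendsto_intros tendsto_norm_zero) (simp add: LIM_zero)
    ultimately show ?thesis by (intro LIMSEQ_le_const[of _ K]) auto
  qed
  from yosida_bounded[OF u this] show "u \<in> D" "norm (A u) \<le> K" by auto
qed

text \<open>Use monotonicity between x and \<open>resolvent l u\<close> for one small fixed l. With
  y the approximation at l, x - resolvent l u = (x - u) + l y, so A x . y >= |y|^2 up to an error of
  order |x - u| / l. As y is close to A u, it may be replaced by A u on both sides.\<close>

lemma weak_aux:
  assumes u: "u \<in> D" and e: "0 < e"
  shows "\<exists>d>0. \<forall>x\<in>D. norm (x - u) < d \<longrightarrow> norm (A x) \<le> K \<longrightarrow> norm (A u) ^ 2 - e \<le> A x \<bullet> A u"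
proof -
  have uV: "u \<in> V" using u D_V by auto
  \<comment> \<open>\<open>c\<close> dominates |A x - y|, |A x| and |A u| at once; the summand 1
    keeps it positive.\<close>
  define c where "c = \<bar>K\<bar> + norm (A u) + 1"
  have c: "0 < c" by (simp add: c_def add_nonneg_pos)
  have "(\<lambda>n. yosida (1 / Suc n) u) \<longlonglongrightarrow> A u"
    using yosida_bounded(2)[OF uV yosida_norm_le(2)[OF u]] by simp
  then have "eventually (\<lambda>n. dist (yosida (1 / Suc n) u) (A u) < e / (4 * c)) sequentially"
    by (rule tendstoD) (use e c in auto)
  then obtain n where n: "dist (yosida (1 / Suc n) u) (A u) < e / (4 * c)"
    by (auto simp: eventually_sequentially)
  define l :: real where "l = 1 / Suc n"
  define y where "y = yosida l u"
  have l: "0 < l" by (simp add: l_def)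
  have y: "norm (y - A u) < e / (4 * c)" using n by (simp add: y_def l_def dist_norm)
  have yA: "norm y \<le> norm (A u)" using yosida_norm_le(2)[OF u l] by (simp add: y_def)
  show ?thesis
  proof (intro exI conjI ballI impI)
    \<comment> \<open>The radius carries the factor l because the error caused by x - u is divided
      by l at the end.\<close>
    show "0 < l * e / (4 * c)" using l e c by simp
    fix x assume x: "x \<in> D" "norm (x - u) < l * e / (4 * c)" "norm (A x) \<le> K"
    have "0 \<le> (A x - y) \<bullet> (x - resolvent l u)"
      unfolding y_def yosida_def using x uV l by (intro mono resolvent_D)
    also have "x - resolvent l u = (x - u) + l *\<^sub>R y"
      using resolvent_yosida[OF uV l] by (simp add: y_def algebra_simps)
    also have "(A x - y) \<bullet> ((x - u) + l *\<^sub>R y) = (A x - y) \<bullet> (x - u) + l * ((A x - y) \<bullet> y)"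
      by (simp add: inner_add_right)
    also have "(A x - y) \<bullet> (x - u) \<le> norm (A x - y) * norm (x - u)" by (rule norm_cauchy_schwarz)
    also have "\<dots> \<le> c * (l * e / (4 * c))"
    proof (rule mult_mono)
      have "norm (A x - y) \<le> norm (A x) + norm y" by (rule norm_triangle_ineq4)
      then show "norm (A x - y) \<le> c" using yA x(3) by (auto simp: c_def)
    qed (use x c in auto)
    also have "\<dots> = l * (e / 4)" using c by simp
    finally have "0 \<le> l * (e / 4 + (A x - y) \<bullet> y)" by (simp add: algebra_simps)
    then have "0 \<le> e / 4 + (A x - y) \<bullet> y" using l by (simp add: zero_le_mult_iff)
    then have 1: "y \<bullet> y - e / 4 \<le> A x \<bullet> y" by (simp add: inner_diff_left)
    have K: "norm (A x) \<le> c" "norm (A u) \<le> c" using x(3) norm_ge_zero[of "A u"] unfolding c_def by linarith+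
    have ec: "c * (e / (4 * c)) = e / 4" using c by simp
    have 2: "A x \<bullet> (y - A u) \<le> e / 4"
    proof -
      have "A x \<bullet> (y - A u) \<le> norm (A x) * norm (y - A u)" by (rule norm_cauchy_schwarz)
      also have "\<dots> \<le> c * (e / (4 * c))" using K y c e by (intro mult_mono) auto
      finally show ?thesis using ec by simp
    qed
    have "(A u - y) \<bullet> A u \<le> e / 4"
    proof -
      have "(A u - y) \<bullet> A u \<le> norm (A u - y) * norm (A u)" by (rule norm_cauchy_schwarz)
      also have "\<dots> \<le> (e / (4 * c)) * c" using K y c e by (intro mult_mono) (auto simp: norm_minus_commute)
      finally show ?thesis using ec by (simp add: mult.commute)
    qed
    moreover have "A u \<bullet> A u - y \<bullet> y = 2 * ((A u - y) \<bullet> A u) - (A u - y) \<bullet> (A u - y)"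
      by (simp add: inner_diff_left inner_diff_right inner_commute)
    ultimately have "A u \<bullet> A u - y \<bullet> y \<le> e / 2"
      using inner_ge_zero[of "A u - y"] by linarith
    then show "norm (A u) ^ 2 - e \<le> A x \<bullet> A u"
      using 1 2 by (simp add: power2_norm_eq_inner inner_diff_right)
  qed
qed

text \<open>The one-sided bound for the translated operators \<open>A - z\<close>, all of which satisfy the range
  condition, gives weak continuity of \<open>A\<close> on norm-convergent sequences without any weak
  compactness.\<close>

lemma weak_continuity:
  assumes u: "u \<in> D" and e: "0 < e" and y: "y \<in> V"
  shows "\<exists>d>0. \<forall>x\<in>D. norm (x - u) < d \<longrightarrow> norm (A x) \<le> K \<longrightarrow> - e \<le> (A x - A u) \<bullet> y"
proof -
  \<comment> \<open>This shift makes the translated operator take the value y at u.\<close>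
  define z where "z = A u - y"
  have z: "z \<in> V" using y A_V[OF u] subspace_V by (simp add: z_def subspace_diff)
  interpret B: monotone_operator V D "\<lambda>x. A x - z"
  proof
    fix f :: 'h and l :: real assume "f \<in> V" "0 < l"
    then obtain x where "x \<in> D" "x + l *\<^sub>R A x = f + l *\<^sub>R z"
      using range[of "f + l *\<^sub>R z" l] z subspace_V by (auto intro: subspace_add subspace_scale)
    then show "\<exists>x\<in>D. x + l *\<^sub>R (A x - z) = f" by (intro bexI[of _ x]) (auto simp: algebra_simps)
  qed (use subspace_V closed_V D_V A_V z mono in \<open>auto simp: subspace_diff\<close>)
  obtain d where d: "d > 0" "\<And>x. x \<in> D \<Longrightarrow> norm (x - u) < d \<Longrightarrow> norm (A x - z) \<le> K + norm z \<Longrightarrow>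
      norm (A u - z) ^ 2 - e \<le> (A x - z) \<bullet> (A u - z)"
    using B.weak_aux[OF u e, of "K + norm z"] by blast
  show ?thesis
  proof (intro exI[of _ d] conjI ballI impI d(1))
    fix x assume x: "x \<in> D" "norm (x - u) < d" "norm (A x) \<le> K"
    have "norm (A x - z) \<le> K + norm z" using norm_triangle_ineq4[of "A x" z] x by simp
    from d(2)[OF x(1,2) this] show "- e \<le> (A x - A u) \<bullet> y"
      by (simp add: z_def power2_norm_eq_inner inner_diff_left inner_diff_right algebra_simps)
  qed
qed

lemma weak_limit:
  assumes D: "\<And>n. x n \<in> D" and lim: "(x \<longlongrightarrow> u) F" and u: "u \<in> D"
    and bd: "\<And>n. norm (A (x n)) \<le> K" and y: "y \<in> V"
  shows "((\<lambda>n. A (x n) \<bullet> y) \<longlongrightarrow> A u \<bullet> y) F"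
proof (rule tendstoI)
  fix e :: real assume e: "0 < e"
  obtain d1 where d1: "d1 > 0"
    "\<And>x. x \<in> D \<Longrightarrow> norm (x - u) < d1 \<Longrightarrow> norm (A x) \<le> K \<Longrightarrow> - (e/2) \<le> (A x - A u) \<bullet> y"
    using weak_continuity[OF u, of "e/2" y K] e y by auto
  obtain d2 where d2: "d2 > 0"
    "\<And>x. x \<in> D \<Longrightarrow> norm (x - u) < d2 \<Longrightarrow> norm (A x) \<le> K \<Longrightarrow> - (e/2) \<le> (A x - A u) \<bullet> (- y)"
    using weak_continuity[OF u, of "e/2" "-y" K] e y subspace_V by (auto simp: subspace_neg)
  have "eventually (\<lambda>n. dist (x n) u < min d1 d2) F"
    using lim d1 d2 by (intro tendstoD) auto
  then show "eventually (\<lambda>n. dist (A (x n) \<bullet> y) (A u \<bullet> y) < e) F"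
  proof eventually_elim
    case (elim n)
    then have "- (e/2) \<le> (A (x n) - A u) \<bullet> y" "- (e/2) \<le> (A (x n) - A u) \<bullet> (- y)"
      using d1(2)[OF D _ bd] d2(2)[OF D _ bd] by (auto simp: dist_norm)
    then show ?case using e by (auto simp: dist_real_def inner_diff_left)
  qed
qed

section \<open>The implicit Euler scheme\<close>

definition euler :: "real \<Rightarrow> nat \<Rightarrow> 'h \<Rightarrow> 'h" where "euler h k = (resolvent h ^^ k)"

lemma euler_0 [simp]: "euler h 0 x = x" by (simp add: euler_def)

lemma euler_Suc: "euler h (Suc k) x = resolvent h (euler h k x)" by (simp add: euler_def)

lemma euler_add: "euler h (j + k) x = euler h j (euler h k x)" by (simp add: euler_def funpow_add)

lemma euler_V: "x \<in> V \<Longrightarrow> 0 < h \<Longrightarrow> euler h k x \<in> V"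
  by (induction k) (auto simp: euler_Suc resolvent_V)

lemma euler_Suc_D: "x \<in> V \<Longrightarrow> 0 < h \<Longrightarrow> euler h (Suc k) x \<in> D"
  by (simp add: euler_Suc resolvent_D euler_V)

lemma euler_D: "x \<in> D \<Longrightarrow> 0 < h \<Longrightarrow> euler h k x \<in> D"
  using D_V euler_Suc_D[of x h] by (cases k) auto

lemma euler_step:
  "x \<in> V \<Longrightarrow> 0 < h \<Longrightarrow> euler h k x - euler h (Suc k) x = h *\<^sub>R A (euler h (Suc k) x)"
  using resolvent_eq[OF euler_V, of x h h k] by (simp add: euler_Suc algebra_simps)

lemma euler_nonexpansive:
  assumes "x \<in> V" "y \<in> V" "0 < h"
  shows "norm (euler h k x - euler h k y) \<le> norm (x - y)"
proof (induction k)
  case (Suc k)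
  then show ?case
    using resolvent_nonexpansive[OF euler_V euler_V, of x h y h h k k] assms
    by (fastforce simp: euler_Suc)
qed simp

lemma euler_inner:
  assumes "x \<in> V" "0 < h" "euler h k x \<in> D"
  shows "norm (A (euler h (Suc k) x)) ^ 2 \<le> A (euler h k x) \<bullet> A (euler h (Suc k) x)"
  using yosida_norm_le(1)[OF assms(3,2)] by (simp add: yosida_def euler_Suc)

lemma euler_decreasing:
  assumes "x \<in> V" "0 < h" "euler h k x \<in> D"
  shows "norm (A (euler h (Suc k) x)) \<le> norm (A (euler h k x))"
  using yosida_norm_le(2)[OF assms(3,2)] by (simp add: yosida_def euler_Suc)

lemma euler_decreasing_le:
  assumes "x \<in> V" "0 < h" "euler h j x \<in> D" "j \<le> k"
  shows "norm (A (euler h k x)) \<le> norm (A (euler h j x))"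
  using assms(4)
proof (induction k rule: dec_induct)
  case (step k)
  have "euler h k x \<in> D"
    using assms step.hyps euler_Suc_D[of x h "k - 1"] by (cases "k = j") auto
  then show ?case using euler_decreasing[OF assms(1,2)] step.IH by fastforce
qed auto

lemma euler_norm_le: "x \<in> D \<Longrightarrow> 0 < h \<Longrightarrow> norm (A (euler h k x)) \<le> norm (A x)"
  using euler_decreasing_le[of x h 0 k] D_V by auto

text \<open>Each squared increment of \<open>A\<close> is at most the drop of |A|^2 over the step,
  and the drops telescope. The bound is uniform in n and h; this square summability is what
  \<open>euler_halving\<close> exploits.\<close>

lemma euler_increment_sum:
  assumes "x \<in> D" "0 < h"
  shows "(\<Sum>k<n. norm (A (euler h k x) - A (euler h (Suc k) x)) ^ 2) \<le> norm (A x) ^ 2"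
proof -
  have xV: "x \<in> V" using assms D_V by auto
  have "norm (A (euler h k x) - A (euler h (Suc k) x)) ^ 2
      \<le> norm (A (euler h k x)) ^ 2 - norm (A (euler h (Suc k) x)) ^ 2" for k
    using euler_inner[OF xV assms(2) euler_D[OF assms], of k]
    by (simp add: power2_norm_eq_inner inner_diff_left inner_diff_right inner_commute)
  then have "(\<Sum>k<n. norm (A (euler h k x) - A (euler h (Suc k) x)) ^ 2)
      \<le> (\<Sum>k<n. norm (A (euler h k x)) ^ 2 - norm (A (euler h (Suc k) x)) ^ 2)"
    by (intro sum_mono)
  also have "\<dots> = norm (A x) ^ 2 - norm (A (euler h n x)) ^ 2"
    using sum_lessThan_telescope'[of "\<lambda>k. norm (A (euler h k x)) ^ 2" n] by simp
  finally show ?thesis by (smt (verit) zero_le_power2)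
qed

lemma euler_telescope:
  assumes "x \<in> V" "0 < h"
  shows "x - euler h n x = h *\<^sub>R (\<Sum>k<n. A (euler h (Suc k) x))"
proof -
  have "(\<Sum>k<n. euler h k x - euler h (Suc k) x) = x - euler h n x"
    using sum_lessThan_telescope'[of "\<lambda>k. euler h k x" n] by simp
  then show ?thesis using euler_step[OF assms] by (simp add: scaleR_sum_right)
qed

lemma euler_distance:
  assumes "x \<in> D" "0 < h"
  shows "norm (x - euler h n x) \<le> n * h * norm (A x)"
proof -
  have xV: "x \<in> V" using assms D_V by auto
  have "norm (\<Sum>k<n. A (euler h (Suc k) x)) \<le> (\<Sum>k<n. norm (A x))"
    using euler_norm_le[OF assms] by (intro sum_norm_le) auto
  then have "h * norm (\<Sum>k<n. A (euler h (Suc k) x)) \<le> h * (n * norm (A x))"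
    using assms by (intro mult_left_mono) auto
  then show ?thesis using assms by (simp add: euler_telescope[OF xV assms(2)] mult_ac)
qed

text \<open>Two half steps satisfy the equation of one full step up to the residual h/2 (A y(k+1) -
  A y(k+2)), and nonexpansiveness lets the residuals simply add up. Since their squares are
  summable, Cauchy-Schwarz yields sqrt n instead of n; with n h bounded the error is of order sqrt
  h.\<close>

lemma euler_halving:
  assumes "x \<in> D" "0 < h"
  shows "norm (euler h n x - euler (h / 2) (2 * n) x) \<le> h / 2 * sqrt n * norm (A x)"
proof -
  have xV: "x \<in> V" using assms D_V by auto
  have h2: "0 < h / 2" using assms by simp
  define y where "y k = euler (h / 2) k x" for k
  have yD: "y k \<in> D" for k using euler_D[OF assms(1) h2] by (simp add: y_def)
  then have yV: "y k \<in> V" for k using D_V by auto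
  have one: "norm (resolvent h (y k) - y (Suc (Suc k))) \<le> h / 2 * norm (A (y (Suc k)) - A (y (Suc (Suc k))))" for k
  proof -
    define z where "z = resolvent h (y k)"
    have z: "z \<in> D" "z + h *\<^sub>R A z = y k"
      using resolvent_D[OF yV assms(2)] resolvent_eq[OF yV assms(2)] by (auto simp: z_def)
    have "y k = y (Suc (Suc k)) + (h / 2) *\<^sub>R A (y (Suc k)) + (h / 2) *\<^sub>R A (y (Suc (Suc k)))"
      using euler_step[OF xV h2, of k] euler_step[OF xV h2, of "Suc k"]
      by (simp add: y_def algebra_simps)
    moreover have "h *\<^sub>R A (y (Suc (Suc k))) = (h / 2) *\<^sub>R A (y (Suc (Suc k))) + (h / 2) *\<^sub>R A (y (Suc (Suc k)))"
      by (simp add: scaleR_add_left[symmetric])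
    ultimately have "(z + h *\<^sub>R A z) - (y (Suc (Suc k)) + h *\<^sub>R A (y (Suc (Suc k))))
        = (h / 2) *\<^sub>R (A (y (Suc k)) - A (y (Suc (Suc k))))"
      using z(2) by (simp add: scaleR_diff_right)
    then show ?thesis
      using nonexpansive_aux[OF z(1) yD assms(2), of "Suc (Suc k)"] assms(2) by (simp add: z_def)
  qed
  have 1: "norm (euler h n x - y (2 * n)) \<le> h / 2 * (\<Sum>k<n. norm (A (y (2*k+1)) - A (y (2*k+2))))"
  proof (induction n)
    case (Suc n)
    have "norm (euler h (Suc n) x - y (2 * Suc n)) \<le>
        norm (resolvent h (euler h n x) - resolvent h (y (2 * n))) + norm (resolvent h (y (2 * n)) - y (2 * Suc n))"
      using norm_diff_triangle_le[OF order_refl order_refl] by (simp add: euler_Suc)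
    also have "\<dots> \<le> norm (euler h n x - y (2 * n)) + h / 2 * norm (A (y (2*n+1)) - A (y (2*n+2)))"
      using resolvent_nonexpansive[OF euler_V[OF xV] yV assms(2), of h n "2 * n"] one[of "2 * n"] assms(2)
      by (intro add_mono) auto
    finally show ?case using Suc by (simp add: algebra_simps)
  qed (simp add: y_def)
  have "(\<Sum>k<n. norm (A (y (2*k+1)) - A (y (2*k+2)))) \<le> sqrt n * norm (A x)"
  proof -
    let ?f = "\<lambda>k. norm (A (y k) - A (y (Suc k)))"
    have "(\<Sum>k<n. ?f (2*k+1) * 1)^2 \<le> (\<Sum>k<n. ?f (2*k+1) ^ 2) * (\<Sum>k<n. 1 ^ 2)"
      by (rule Cauchy_Schwarz_ineq_sum)
    then have "(\<Sum>k<n. ?f (2*k+1))^2 \<le> real n * (\<Sum>k<n. ?f (2*k+1) ^ 2)"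
      by (simp add: mult.commute)
    \<comment> \<open>Only increments between the first and the second half of a step occur; they
      are the odd members of the half-step chain and are dominated by all 2 n of them.\<close>
    also have "(\<Sum>k<n. ?f (2*k+1) ^ 2) = (\<Sum>k\<in>(\<lambda>k. 2*k+1) ` {..<n}. ?f k ^ 2)"
      by (subst sum.reindex) (auto simp: inj_on_def)
    also have "real n * \<dots> \<le> real n * (\<Sum>k<2*n. ?f k ^ 2)"
      by (intro mult_left_mono sum_mono2) auto
    also have "\<dots> \<le> real n * norm (A x) ^ 2"
      using euler_increment_sum[OF assms(1) h2] by (intro mult_left_mono) (auto simp: y_def)
    finally have "(\<Sum>k<n. ?f (2*k+1))^2 \<le> (sqrt n * norm (A x)) ^ 2"
      by (simp add: power_mult_distrib)
    then have "(\<Sum>k<n. ?f (2*k+1)) \<le> sqrt n * norm (A x)" by (rule power2_le_imp_le) simp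
    then show ?thesis by simp
  qed
  then have "h / 2 * (\<Sum>k<n. norm (A (y (2*k+1)) - A (y (2*k+2)))) \<le> h / 2 * (sqrt n * norm (A x))"
    using assms(2) by (intro mult_left_mono) auto
  then show ?thesis using 1 unfolding y_def mult.assoc by (rule order_trans[rotated])
qed

end

text \<open>\<open>chain\<close> is phrased for arbitrary sequences with a factor n, the form in
  which Cauchy-Schwarz bounds the square of a sum of n increments. For Euler iterates of step h each
  increment of x brings a factor h, and n h is the elapsed time.\<close>

locale gradient_operator = monotone_operator V D A
  for V D :: "'h::{real_inner,complete_space} set" and A :: "'h \<Rightarrow> 'h" +
  fixes J :: "'h \<Rightarrow> real" and C :: real
  assumes subgradient: "x \<in> D \<Longrightarrow> y \<in> D \<Longrightarrow> J x + A x \<bullet> (y - x) \<le> J y"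
    and J_nonneg: "x \<in> D \<Longrightarrow> 0 \<le> J x" and zero_D: "0 \<in> D" and J_zero: "J 0 = 0"
    and dense: "V \<subseteq> closure D"
    and C_nonneg: "0 \<le> C"
    and chain: "\<And>(x :: nat \<Rightarrow> 'h) n. (\<And>k. x k \<in> D) \<Longrightarrow> (A (x 0) - A (x n)) \<bullet> (x 0 - x n)
        \<le> C * n * (\<Sum>k<n. (A (x k) - A (x (Suc k))) \<bullet> (x k - x (Suc k)))"
begin

section \<open>Dyadic grids and the limit semigroup\<close>

definition grid :: "nat \<Rightarrow> real \<Rightarrow> nat" where "grid m t = nat \<lfloor>t * 2 ^ m\<rfloor>"

lemma grid_bounds:
  assumes "0 \<le> t" shows "grid m t * (1/2)^m \<le> t" "t - (1/2)^m < grid m t * (1/2)^m"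
proof -
  have "real (grid m t) = of_int \<lfloor>t * 2 ^ m\<rfloor>" using assms by (simp add: grid_def)
  then have "real (grid m t) \<le> t * 2 ^ m" "t * 2 ^ m - 1 < real (grid m t)" by linarith+
  then have "real (grid m t) / 2^m \<le> t * 2^m / 2^m" "(t * 2^m - 1) / 2^m < real (grid m t) / 2^m"
    by (intro divide_right_mono divide_strict_right_mono; simp)+
  then show "grid m t * (1/2)^m \<le> t" "t - (1/2)^m < grid m t * (1/2)^m"
    by (simp_all add: power_one_over diff_divide_distrib)
qed

lemma grid_tendsto: "0 \<le> t \<Longrightarrow> (\<lambda>m. grid m t * (1/2)^m) \<longlonglongrightarrow> t"
proof -
  assume t: "0 \<le> t"
  have "(\<lambda>m. t - (1/2)^m) \<longlonglongrightarrow> t - 0" by (intro tendsto_intros LIMSEQ_power_zero) auto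
  then have lim: "(\<lambda>m. t - (1/2)^m) \<longlonglongrightarrow> t" by simp
  show ?thesis
  proof (rule tendsto_sandwich[OF _ _ lim tendsto_const])
    show "\<forall>\<^sub>F m in sequentially. t - (1/2)^m \<le> grid m t * (1/2)^m"
      using grid_bounds(2)[OF t] by (intro eventuallyI less_imp_le)
    show "\<forall>\<^sub>F m in sequentially. grid m t * (1/2)^m \<le> t"
      using grid_bounds(1)[OF t] by (intro eventuallyI)
  qed
qed

definition approx :: "nat \<Rightarrow> real \<Rightarrow> 'h \<Rightarrow> 'h" where "approx m t x = euler ((1/2)^m) (grid m t) x"

lemma approx_V: "x \<in> V \<Longrightarrow> approx m t x \<in> V" by (simp add: approx_def euler_V)

lemma approx_D: "x \<in> D \<Longrightarrow> approx m t x \<in> D" by (simp add: approx_def euler_D)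

lemma approx_nonexpansive:
  "x \<in> V \<Longrightarrow> y \<in> V \<Longrightarrow> norm (approx m t x - approx m t y) \<le> norm (x - y)"
  by (simp add: approx_def euler_nonexpansive)

lemma euler_shift:
  assumes "x \<in> D" "0 < h" "j \<le> k"
  shows "norm (euler h j x - euler h k x) \<le> (real k - real j) * h * norm (A x)"
proof -
  have e: "euler h k x = euler h (k - j) (euler h j x)"
    using euler_add[of h "k - j" j] assms(3) by simp
  have "norm (euler h j x - euler h k x) \<le> (k - j) * h * norm (A (euler h j x))"
    unfolding e by (intro euler_distance euler_D assms)
  also have "\<dots> \<le> (k - j) * h * norm (A x)"
    using euler_norm_le[OF assms(1,2)] assms(2) by (intro mult_left_mono) auto
  finally show ?thesis using assms(3) by (simp add: of_nat_diff)
qed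

text \<open>Refining the grid costs the halving error plus at most one extra half step. Both are of
  order sqrt h with h = (1/2)^m, so the differences are summable over m.\<close>

lemma approx_step:
  assumes x: "x \<in> D" and t: "0 \<le> t"
  shows "norm (approx m t x - approx (Suc m) t x) \<le> (sqrt t + 1) * norm (A x) * sqrt (1/2) ^ m"
proof -
  define h :: real where "h = (1/2)^m"
  have h: "0 < h" "h / 2 = (1/2)^Suc m" "h \<le> 1" by (auto simp: h_def power_le_one)
  define n where "n = grid m t"
  define k where "k = grid (Suc m) t"
  have nt: "n * h \<le> t" using grid_bounds(1)[OF t] by (simp add: n_def h_def)
  \<comment> \<open>Doubling a number doubles its floor or exceeds that by one.\<close>
  have "2 * n \<le> k" "k \<le> 2 * n + 1"
    using t unfolding n_def k_def grid_def by (simp_all add: mult.commute mult.left_commute) linarith+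
  then have "norm (euler (h/2) (2 * n) x - euler (h/2) k x) \<le> 1 * (h/2) * norm (A x)"
    by (intro order_trans[OF euler_shift[OF x]] mult_right_mono) (use h in auto)
  moreover have "norm (euler h n x - euler (h / 2) (2 * n) x) \<le> h / 2 * sqrt n * norm (A x)"
    by (rule euler_halving[OF x h(1)])
  ultimately have "norm (euler h n x - euler (h/2) k x) \<le> (h / 2 * sqrt n + h / 2) * norm (A x)"
    using norm_diff_triangle_le[of "euler h n x" "euler (h/2) (2 * n) x" _ "euler (h/2) k x"]
    by (simp add: distrib_right)
  also have "\<dots> \<le> ((sqrt t + 1) * sqrt h) * norm (A x)"
  proof (rule mult_right_mono)
    have "h = sqrt h * sqrt h" using h by simp
    then have "h * sqrt n = sqrt h * sqrt (n * h)" by (simp add: real_sqrt_mult)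
    also have "\<dots> \<le> sqrt h * sqrt t" using nt h by (intro mult_left_mono) auto
    finally have 1: "h * sqrt n \<le> sqrt t * sqrt h" by (simp add: mult.commute)
    have hs: "h \<le> sqrt h" using h by (intro real_le_rsqrt) (simp add: power2_eq_square mult_left_le)
    then show "h / 2 * sqrt n + h / 2 \<le> (sqrt t + 1) * sqrt h"
    proof -
      have "0 \<le> h * sqrt n" using h(1) by simp
      then have "h / 2 * sqrt n + h / 2 \<le> h * sqrt n + h" using h(1) by linarith
      also have "\<dots> \<le> (sqrt t + 1) * sqrt h" using 1 hs by (simp add: distrib_right)
      finally show ?thesis .
    qed
  qed simp
  also have "sqrt h = sqrt (1/2) ^ m" by (simp add: h_def real_sqrt_power)
  finally show ?thesis by (simp add: approx_def n_def k_def h(2)[symmetric] h_def[symmetric] mult_ac)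
qed

text \<open>For points of \<open>D\<close> the differences of successive grids are dominated by a
  geometric series. Nonexpansiveness, uniform in m, carries the Cauchy property to the closure of
  \<open>D\<close>, which contains \<open>V\<close>.\<close>

lemma approx_convergent:
  assumes x: "x \<in> V" and t: "0 \<le> t"
  shows "convergent (\<lambda>m. approx m t x)"
proof -
  have conv: "Cauchy (\<lambda>m. approx m t z)" if z: "z \<in> D" for z
  proof -
    have "summable (\<lambda>m. (sqrt t + 1) * norm (A z) * sqrt (1/2) ^ m)"
      by (intro summable_mult summable_geometric) (simp add: real_sqrt_lt_1_iff)
    then have "summable (\<lambda>m. norm (approx m t z - approx (Suc m) t z))"
      by (rule summable_comparison_test'[where N=0]) (use approx_step[OF z t] in auto)
    then have s: "summable (\<lambda>m. dist (approx m t z) (approx (Suc m) t z))" by (simp add: dist_norm)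
    show ?thesis
    proof (rule metric_CauchyI)
      fix e :: real assume e: "0 < e"
      obtain N where N: "\<And>m n. m \<ge> N \<Longrightarrow> norm (sum (\<lambda>m. dist (approx m t z) (approx (Suc m) t z)) {m..<n}) < e"
        using s[unfolded summable_Cauchy] e by blast
      have "dist (approx m t z) (approx n t z) \<le> sum (\<lambda>m. dist (approx m t z) (approx (Suc m) t z)) {m..<n}"
        if "m \<le> n" for m n using that
      proof (induction n rule: dec_induct)
        case (step n)
        have "dist (approx m t z) (approx (Suc n) t z) \<le> dist (approx m t z) (approx n t z) + dist (approx n t z) (approx (Suc n) t z)"
          by (rule dist_triangle)
        then show ?case using step by simp
      qed simp
      then have "dist (approx m t z) (approx n t z) < e" if "m \<ge> N" "m \<le> n" for m n
        using N[of m n] that by force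
      then show "\<exists>M. \<forall>m\<ge>M. \<forall>n\<ge>M. dist (approx m t z) (approx n t z) < e"
        by (metis dist_commute nle_le)
    qed
  qed
  have "Cauchy (\<lambda>m. approx m t x)"
  proof (rule metric_CauchyI)
    fix e :: real assume e: "0 < e"
    obtain z where z: "z \<in> D" "dist z x < e / 3"
      using dense x e closure_approachable[of x D] by (metis divide_pos_pos subsetD zero_less_numeral)
    obtain M where M: "\<And>m n. m \<ge> M \<Longrightarrow> n \<ge> M \<Longrightarrow> dist (approx m t z) (approx n t z) < e / 3"
      using metric_CauchyD[OF conv[OF z(1)], of "e/3"] e by auto
    have zx: "dist (approx m t z) (approx m t x) < e / 3" for m
      using approx_nonexpansive[of z x m t] z x D_V by (auto simp: dist_norm)
    have "dist (approx m t x) (approx n t x) < e" if "m \<ge> M" "n \<ge> M" for m n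
    proof -
      have "dist (approx m t x) (approx n t x) \<le> dist (approx m t z) (approx m t x)
          + dist (approx m t z) (approx n t z) + dist (approx n t z) (approx n t x)"
        using dist_triangle[of "approx m t x" "approx n t x" "approx m t z"]
          dist_triangle[of "approx m t z" "approx n t x" "approx n t z"]
        by (simp add: dist_commute)
      then show ?thesis using zx[of m] zx[of n] M[OF that] by simp
    qed
    then show "\<exists>M. \<forall>m\<ge>M. \<forall>n\<ge>M. dist (approx m t x) (approx n t x) < e" by blast
  qed
  then show ?thesis by (rule Cauchy_convergent)
qed

definition flow :: "real \<Rightarrow> 'h \<Rightarrow> 'h" where "flow t x = lim (\<lambda>m. approx m t x)"

lemma flow_tendsto: "x \<in> V \<Longrightarrow> 0 \<le> t \<Longrightarrow> (\<lambda>m. approx m t x) \<longlonglongrightarrow> flow t x"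
  using approx_convergent by (simp add: flow_def convergent_LIMSEQ_iff)

lemma flow_V: "x \<in> V \<Longrightarrow> 0 \<le> t \<Longrightarrow> flow t x \<in> V"
  using closed_sequentially[OF closed_V _ flow_tendsto] approx_V by blast

lemma flow_0: "x \<in> V \<Longrightarrow> flow 0 x = x"
  by (simp add: flow_def approx_def grid_def)

lemma flow_nonexpansive:
  assumes "x \<in> V" "y \<in> V" "0 \<le> t" shows "norm (flow t x - flow t y) \<le> norm (x - y)"
  using approx_nonexpansive[OF assms(1,2)]
  by (intro LIMSEQ_le_const2[OF tendsto_norm[OF tendsto_diff[OF flow_tendsto flow_tendsto]]]) (use assms in auto)

lemma flow_lipschitz:
  assumes "x \<in> D" "0 \<le> s" "s \<le> t" shows "norm (flow s x - flow t x) \<le> (t - s) * norm (A x)"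
proof -
  have xV: "x \<in> V" using assms D_V by auto
  have "norm (approx m s x - approx m t x) \<le> (grid m t * (1/2)^m - grid m s * (1/2)^m) * norm (A x)" for m
  proof -
    have "grid m s \<le> grid m t" using assms unfolding grid_def
      by (intro nat_mono floor_mono) (auto intro: mult_right_mono)
    then show ?thesis
      using euler_shift[OF assms(1), of "(1/2)^m" "grid m s" "grid m t"] by (simp add: approx_def left_diff_distrib)
  qed
  moreover have "(\<lambda>m. (grid m t * (1/2)^m - grid m s * (1/2)^m) * norm (A x)) \<longlonglongrightarrow> (t - s) * norm (A x)"
    using assms by (intro tendsto_intros grid_tendsto) auto
  moreover have "(\<lambda>m. norm (approx m s x - approx m t x)) \<longlonglongrightarrow> norm (flow s x - flow t x)"
    using assms xV by (intro tendsto_intros flow_tendsto) auto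
  ultimately show ?thesis by (intro LIMSEQ_le) auto
qed

text \<open>Along a sequence of \<open>D\<close> tending to x the common images converge to both
  values. The semigroup law is extended from \<open>D\<close> to \<open>V\<close> in this
  way.\<close>

lemma continuous_extension:
  assumes x: "x \<in> V" and f: "\<And>z. z \<in> V \<Longrightarrow> norm (f z - f x) \<le> L * norm (z - x)"
    and g: "\<And>z. z \<in> V \<Longrightarrow> norm (g z - g x) \<le> L * norm (z - x)"
    and fg: "\<And>z. z \<in> D \<Longrightarrow> f z = g z"
  shows "f x = (g x :: 'h)"
proof -
  obtain z where z: "\<And>n. z n \<in> D" "z \<longlonglongrightarrow> x" using dense x closure_sequential[of x D] by blast
  have zV: "z n \<in> V" for n using z D_V by auto
  have n0: "(\<lambda>n. L * norm (z n - x)) \<longlonglongrightarrow> 0"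
    using z(2) by (intro tendsto_mult_right_zero tendsto_norm_zero LIM_zero)
  have "(\<lambda>n. f (z n) - f x) \<longlonglongrightarrow> 0" by (rule Lim_null_comparison[OF eventuallyI n0]) (use f zV in auto)
  moreover have "(\<lambda>n. g (z n) - g x) \<longlonglongrightarrow> 0" by (rule Lim_null_comparison[OF eventuallyI n0]) (use g zV in auto)
  ultimately show ?thesis using fg z by (simp add: LIM_zero_iff) (metis LIMSEQ_unique)
qed

text \<open>Step counts add up exactly, but grid m t + grid m s may miss grid m (t + s) by one step
  of length (1/2)^m. On \<open>D\<close> that step costs at most (1/2)^m |A z|, which vanishes in
  the limit.\<close>

lemma flow_add:
  assumes x: "x \<in> V" and s: "0 \<le> s" and t: "0 \<le> t"
  shows "flow (t + s) x = flow t (flow s x)"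
proof (rule continuous_extension[OF x, where L = 1 and f = "flow (t + s)" and g = "\<lambda>x. flow t (flow s x)"])
  fix z assume z: "z \<in> D"
  then have zV: "z \<in> V" using D_V by auto
  have 1: "norm (approx m t (approx m s z) - approx m (t + s) z) \<le> (1/2)^m * norm (A z)" for m
  proof -
    have "grid m t + grid m s \<le> grid m (t + s)" "grid m (t + s) \<le> grid m t + grid m s + 1"
      using s t unfolding grid_def by (simp_all add: distrib_right nat_add_distrib[symmetric]) linarith+
    then have "norm (euler ((1/2)^m) (grid m t + grid m s) z - euler ((1/2)^m) (grid m (t + s)) z)
        \<le> 1 * (1/2)^m * norm (A z)"
      by (intro order_trans[OF euler_shift[OF z]] mult_right_mono) auto
    then show ?thesis by (simp add: approx_def euler_add)
  qed
  have 2: "norm (approx m t (flow s z) - approx m (t + s) z)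
      \<le> (1/2)^m * norm (A z) + norm (flow s z - approx m s z)" for m
  proof -
    have "norm (approx m t (flow s z) - approx m t (approx m s z)) \<le> norm (flow s z - approx m s z)"
      using zV s by (intro approx_nonexpansive flow_V approx_V)
    then show ?thesis using 1[of m] by (smt (verit) norm_diff_triangle_le)
  qed
  have "(\<lambda>m. (1/2)^m * norm (A z) + norm (flow s z - approx m s z)) \<longlonglongrightarrow> 0 * norm (A z) + norm (flow s z - flow s z)"
    using zV s by (intro tendsto_intros flow_tendsto LIMSEQ_power_zero) auto
  then have 3: "(\<lambda>m. (1/2)^m * norm (A z) + norm (flow s z - approx m s z)) \<longlonglongrightarrow> 0" by simp
  have "(\<lambda>m. approx m t (flow s z) - approx m (t + s) z) \<longlonglongrightarrow> 0"
    by (rule Lim_null_comparison[OF eventuallyI 3]) (rule 2)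
  moreover have "(\<lambda>m. approx m t (flow s z) - approx m (t + s) z) \<longlonglongrightarrow> flow t (flow s z) - flow (t + s) z"
    using zV s t by (intro tendsto_intros flow_tendsto flow_V) auto
  ultimately show "flow (t + s) z = flow t (flow s z)" using LIMSEQ_unique by fastforce
next
  fix z assume z: "z \<in> V"
  show "norm (flow (t + s) z - flow (t + s) x) \<le> 1 * norm (z - x)"
    using flow_nonexpansive z x s t by simp
  show "norm (flow t (flow s z) - flow t (flow s x)) \<le> 1 * norm (z - x)"
    using order_trans[OF flow_nonexpansive[OF flow_V flow_V] flow_nonexpansive] z x s t by auto
qed

lemma flow_continuous:
  assumes x: "x \<in> V" shows "continuous_on {0..} (\<lambda>t. flow t x)"
proof (rule continuous_on_iff[THEN iffD2], intro ballI allI impI)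
  fix t e :: real assume t: "t \<in> {0..}" and e: "0 < e"
  obtain z where z: "z \<in> D" "dist z x < e / 3"
    using dense x e closure_approachable[of x D] by (metis divide_pos_pos subsetD zero_less_numeral)
  then have zV: "z \<in> V" using D_V by auto
  define d where "d = e / (3 * (norm (A z) + 1))"
  have d: "0 < d" using e by (auto simp: d_def intro!: divide_pos_pos add_nonneg_pos)
  have lip: "norm (flow s z - flow t z) \<le> \<bar>s - t\<bar> * norm (A z)" if "0 \<le> s" for s
    using flow_lipschitz[OF z(1), of s t] flow_lipschitz[OF z(1), of t s] t that
    by (cases "s \<le> t") (auto simp: norm_minus_commute)
  have close: "norm (flow s z - flow s x) < e / 3" if "0 \<le> s" for s
    using flow_nonexpansive[OF zV x that] z(2) by (simp add: dist_norm)
  have "dist (flow s x) (flow t x) < e" if s: "s \<in> {0..}" "dist s t < d" for s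
  proof -
    have "\<bar>s - t\<bar> * norm (A z) \<le> d * (norm (A z) + 1)"
      using s d by (intro mult_mono) (auto simp: dist_real_def)
    also have "\<dots> = e / 3" using add_nonneg_pos[of "norm (A z)" 1] by (simp add: d_def field_simps)
    finally have "norm (flow s z - flow t z) \<le> e / 3" using lip[of s] s by auto
    moreover have "norm (flow s z - flow s x) < e / 3" "norm (flow t z - flow t x) < e / 3"
      using close s t by auto
    moreover have "flow s x - flow t x = (flow s z - flow t z) - (flow s z - flow s x) + (flow t z - flow t x)"
      by simp
    moreover have "norm (flow s x - flow t x)
        \<le> norm (flow s z - flow t z) + norm (flow s z - flow s x) + norm (flow t z - flow t x)"
      using norm_triangle_ineq[of "(flow s z - flow t z) - (flow s z - flow s x)" "flow t z - flow t x"]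
        norm_triangle_ineq4[of "flow s z - flow t z" "flow s z - flow s x"]
      unfolding calculation(4) by linarith
    ultimately show ?thesis unfolding dist_norm by linarith
  qed
  then show "\<exists>d>0. \<forall>s\<in>{0..}. dist s t < d \<longrightarrow> dist (flow s x) (flow t x) < e" using d by blast
qed

end

section \<open>Regularity of the gradient flow\<close>

context gradient_operator
begin

section \<open>Smoothing: the flow enters the domain at once\<close>

lemma euler_subgradient:
  assumes "x \<in> V" "0 < h" "euler h k x \<in> D"
  shows "h * norm (A (euler h (Suc k) x)) ^ 2 \<le> J (euler h k x) - J (euler h (Suc k) x)"
  using subgradient[OF euler_Suc_D[OF assms(1,2)] assms(3), of k]
  by (simp add: euler_step[OF assms(1,2)] power2_norm_eq_inner)

text \<open>Convexity tested against 0, where \<open>J\<close> vanishes, gives J y <= A y . y;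
  expanding |y + h A y|^2 turns this into a drop of the squared norm.\<close>

lemma euler_J_le:
  assumes "x \<in> V" "0 < h"
  shows "2 * h * J (euler h (Suc k) x) \<le> norm (euler h k x) ^ 2 - norm (euler h (Suc k) x) ^ 2"
proof -
  define y g where "y = euler h (Suc k) x" and "g = A y"
  have e: "euler h k x = y + h *\<^sub>R g"
    using euler_step[OF assms, of k] by (simp add: y_def g_def algebra_simps)
  have "J y \<le> g \<bullet> y"
    using subgradient[OF euler_Suc_D[OF assms] zero_D, of k] by (simp add: y_def g_def J_zero)
  then have "2 * h * J y \<le> 2 * h * (g \<bullet> y)" using assms(2) by (intro mult_left_mono) auto
  also have "\<dots> \<le> 2 * h * (g \<bullet> y) + (h * norm g) ^ 2" by simp
  also have "\<dots> = norm (y + h *\<^sub>R g) ^ 2 - norm y ^ 2"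
    by (simp add: power2_norm_eq_inner power_mult_distrib inner_add_left inner_add_right inner_commute)
      (simp add: power2_eq_square algebra_simps)
  finally show ?thesis unfolding e y_def[symmetric] .
qed

text \<open>Discrete form of multiplying the energy dissipation by t. The quantity in
  \<open>key\<close> is a Lyapunov functional: a sum of |A|^2 with weights 2 h (k h), plus 2 (n h)
  J, plus the squared norm. As |A| decreases along the scheme, every summand may be evaluated at the
  last step, and 2 k summed over k < n is n (n - 1).\<close>

lemma euler_regularization:
  assumes x: "x \<in> V" and h: "0 < h"
  shows "(h * norm (A (euler h n x))) ^ 2 * (n * (real n - 1)) \<le> norm x ^ 2"
proof -
  define e where "e k = euler h k x" for k
  have key: "(\<Sum>k<n. 2 * h ^ 2 * k * norm (A (e (Suc k))) ^ 2) + 2 * h * n * J (e n) + norm (e n) ^ 2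
      \<le> norm x ^ 2" for n
  proof (induction n)
    case (Suc n)
    have "2 * h * n * (h * norm (A (e (Suc n))) ^ 2) \<le> 2 * h * n * (J (e n) - J (e (Suc n)))"
    \<comment> \<open>The starting point x may lie outside \<open>D\<close>, where \<open>J\<close>
      carries no information; the weight n vanishes at exactly that step.\<close>
    proof (cases "n = 0")
      case False
      then have "e n \<in> D" using euler_Suc_D[OF x h, of "n - 1"] by (simp add: e_def)
      then have "h * norm (A (e (Suc n))) ^ 2 \<le> J (e n) - J (e (Suc n))"
        using euler_subgradient[OF x h] by (simp add: e_def)
      then show ?thesis using h by (intro mult_left_mono) auto
    qed simp
    moreover have "2 * h * J (e (Suc n)) \<le> norm (e n) ^ 2 - norm (e (Suc n)) ^ 2"
      using euler_J_le[OF x h, of n] by (simp add: e_def)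
    ultimately show ?case using Suc
      by (simp add: algebra_simps power2_eq_square)
  qed (simp add: e_def)
  show ?thesis
  proof (cases "n = 0")
    case False
    then have eD: "e n \<in> D" using euler_Suc_D[OF x h, of "n - 1"] by (simp add: e_def)
    have "(h * norm (A (e n))) ^ 2 * (n * (real n - 1)) = (\<Sum>k<n. 2 * h ^ 2 * k * norm (A (e n)) ^ 2)"
    proof -
      have "(\<Sum>k<n. 2 * real k) = n * (real n - 1)"
        by (induction n) (auto simp: algebra_simps)
      then have "(h * norm (A (e n))) ^ 2 * (n * (real n - 1)) = (h * norm (A (e n))) ^ 2 * (\<Sum>k<n. 2 * real k)" by simp
      also have "\<dots> = (\<Sum>k<n. 2 * h ^ 2 * k * norm (A (e n)) ^ 2)"
        by (simp add: sum_distrib_left power_mult_distrib mult_ac)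
      finally show ?thesis .
    qed
    also have "\<dots> \<le> (\<Sum>k<n. 2 * h ^ 2 * k * norm (A (e (Suc k))) ^ 2)"
      using euler_decreasing_le[OF x h euler_Suc_D[OF x h]]
      by (intro sum_mono mult_left_mono power_mono) (auto simp: e_def)
    also have "\<dots> \<le> norm x ^ 2"
    proof -
      have "0 \<le> 2 * h * n * J (e n)" using J_nonneg[OF eD] h by simp
      then show ?thesis using key[of n] zero_le_power2[of "norm (e n)"] by linarith
    qed
    finally show ?thesis by (simp add: e_def)
  qed simp
qed

text \<open>For fine grids the regularization bound reads |A (approx m t x)| <= 2 |x| / t, uniformly
  in m, and \<open>demiclosed\<close> then puts the limit into \<open>D\<close>.\<close>

lemma flow_regular:
  assumes x: "x \<in> V" and t: "0 < t"
  shows "flow t x \<in> D"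
proof -
  define K where "K = 2 * norm x / t"
  have "(\<lambda>m. (1/2)^m :: real) \<longlonglongrightarrow> 0" by (intro LIMSEQ_power_zero) auto
  \<comment> \<open>Steps below t / 4 make both n h and (n - 1) h at least t / 2.\<close>
  then have "eventually (\<lambda>m. (1/2)^m < t / 4) sequentially" using t by (intro order_tendstoD) auto
  then obtain M where M: "\<And>m. m \<ge> M \<Longrightarrow> (1/2)^m < t / 4" by (auto simp: eventually_sequentially)
  have *: "approx m t x \<in> D \<and> norm (A (approx m t x)) \<le> K" if m: "m \<ge> M" for m
  proof -
    define h :: real where "h = (1/2)^m"
    define n where "n = grid m t"
    define g where "g = norm (A (approx m t x))"
    have h: "0 < h" "h < t / 4" using M[OF m] by (auto simp: h_def)
    have nh: "t - h < n * h" using grid_bounds(2)[of t m] t by (simp add: n_def h_def)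
    then have "0 < n * h" using h t by linarith
    then have n: "0 < n" using h by (simp add: zero_less_mult_iff)
    have "(n * h) * ((real n - 1) * h) * g ^ 2 \<le> norm x ^ 2"
      using euler_regularization[OF x h(1), of n]
      by (simp add: g_def approx_def n_def h_def power_mult_distrib power2_eq_square mult_ac)
    moreover have "(t / 2) * (t / 2) \<le> (n * h) * ((real n - 1) * h)"
      using nh h t by (intro mult_mono) (auto simp: left_diff_distrib)
    ultimately have "(t / 2) * (t / 2) * g ^ 2 \<le> norm x ^ 2"
      using mult_right_mono[of "(t / 2) * (t / 2)" _ "g ^ 2"] by (meson order_trans zero_le_power2)
    then have "(t / 2 * g) ^ 2 \<le> norm x ^ 2" by (simp add: power2_eq_square mult_ac)
    then have "t / 2 * g \<le> norm x" by (rule power2_le_imp_le) simp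
    then have "g \<le> K" using t by (simp add: K_def field_simps)
    moreover have "approx m t x \<in> D"
      using euler_Suc_D[OF x, of "(1/2)^m" "n - 1"] n by (simp add: approx_def n_def)
    ultimately show ?thesis by (simp add: g_def)
  qed
  show ?thesis
    by (rule demiclosed(1)[where x = "\<lambda>m. approx (m + M) t x" and K = K])
      (use * LIMSEQ_ignore_initial_segment[OF flow_tendsto] x t in auto)
qed

section \<open>Energy inequalities in the limit\<close>

lemma approx_norm_le: "x \<in> D \<Longrightarrow> norm (A (approx m t x)) \<le> norm (A x)"
  by (simp add: approx_def euler_norm_le)

lemma
  assumes "x \<in> D" "0 \<le> t"
  shows flow_D: "flow t x \<in> D" and flow_norm_le: "norm (A (flow t x)) \<le> norm (A x)"
  using demiclosed[of "\<lambda>m. approx m t x", OF approx_D flow_tendsto approx_norm_le] assms D_V by auto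

lemma approx_weak_limit:
  assumes "x \<in> D" "0 \<le> t" "y \<in> V"
  shows "(\<lambda>m. A (approx m t x) \<bullet> y) \<longlonglongrightarrow> A (flow t x) \<bullet> y"
  using assms D_V by (intro weak_limit[OF approx_D flow_tendsto flow_D approx_norm_le]) auto

lemma approx_weak_strong:
  assumes x: "x \<in> D" and t: "0 \<le> t" and y: "y \<longlonglongrightarrow> z" "z \<in> V"
  shows "(\<lambda>m. A (approx m t x) \<bullet> y m) \<longlonglongrightarrow> A (flow t x) \<bullet> z"
proof -
  have 1: "norm (A (approx m t x) \<bullet> (y m - z)) \<le> norm (A x) * norm (y m - z)" for m
    using Cauchy_Schwarz_ineq2[of "A (approx m t x)" "y m - z"] approx_norm_le[OF x, of m t]
    by (smt (verit) mult_right_mono norm_ge_zero real_norm_def)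
  have 2: "(\<lambda>m. norm (A x) * norm (y m - z)) \<longlonglongrightarrow> 0"
    using y(1) by (intro tendsto_mult_right_zero tendsto_norm_zero LIM_zero)
  have "(\<lambda>m. A (approx m t x) \<bullet> (y m - z)) \<longlonglongrightarrow> 0"
    by (rule Lim_null_comparison[OF eventuallyI 2]) (rule 1)
  from tendsto_add[OF this approx_weak_limit[OF x t y(2)]] show ?thesis
    by (simp add: inner_diff_right)
qed

text \<open>Two quantities of the discrete inequality have no evident limit along the scheme. With y
  the limit point and a the value of \<open>A\<close> on the grid, |a|^2 is bounded below by 2 a . A
  y - |A y|^2, which is affine in a and has a weak limit, and \<open>J\<close> is bounded below by
  its supporting hyperplane at y.\<close>

lemma flow_energy:
  assumes x: "x \<in> D" and t: "0 \<le> t"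
  shows "t * norm (A (flow t x)) ^ 2 \<le> J x - J (flow t x)"
proof -
  have xV: "x \<in> V" using x D_V by auto
  define y where "y = flow t x"
  have yD: "y \<in> D" using flow_D[OF x t] by (simp add: y_def)
  then have yV: "y \<in> V" "A y \<in> V" using D_V A_V by auto
  define f where "f m = grid m t * (1/2)^m * (2 * (A (approx m t x) \<bullet> A y) - norm (A y) ^ 2)
    + A y \<bullet> (approx m t x - y)" for m
  have "f m \<le> J x - J y" for m
  proof -
    define h :: real where "h = (1/2)^m"
    define n where "n = grid m t"
    have h: "0 < h" by (simp add: h_def)
    define a where "a = A (approx m t x)"
    have "n * h * norm a ^ 2 = (\<Sum>k<n. h * norm a ^ 2)" by simp
    also have "\<dots> \<le> (\<Sum>k<n. J (euler h k x) - J (euler h (Suc k) x))"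
    proof (rule sum_mono)
      fix k assume k: "k \<in> {..<n}"
      have "norm a \<le> norm (A (euler h (Suc k) x))"
        unfolding a_def approx_def h_def[symmetric] n_def[symmetric]
        using k by (intro euler_decreasing_le xV h euler_D x) auto
      then have "h * norm a ^ 2 \<le> h * norm (A (euler h (Suc k) x)) ^ 2"
        using h by (intro mult_left_mono power_mono) auto
      also have "\<dots> \<le> J (euler h k x) - J (euler h (Suc k) x)"
        by (intro euler_subgradient xV h euler_D x)
      finally show "h * norm a ^ 2 \<le> J (euler h k x) - J (euler h (Suc k) x)" .
    qed
    also have "\<dots> = J x - J (approx m t x)"
      using sum_lessThan_telescope'[of "\<lambda>k. J (euler h k x)" n] by (simp add: approx_def h_def n_def)
    also have "\<dots> \<le> J x - (J y + A y \<bullet> (approx m t x - y))"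
      using subgradient[OF yD approx_D[OF x], of m t] by simp
    finally have 1: "n * h * norm a ^ 2 + A y \<bullet> (approx m t x - y) \<le> J x - J y" by simp
    have "0 \<le> (a - A y) \<bullet> (a - A y)" by simp
    then have "2 * (a \<bullet> A y) - norm (A y) ^ 2 \<le> norm a ^ 2"
      by (simp add: power2_norm_eq_inner inner_diff_left inner_diff_right inner_commute)
    then have "n * h * (2 * (a \<bullet> A y) - norm (A y) ^ 2) \<le> n * h * norm a ^ 2"
      using h by (intro mult_left_mono) auto
    then show ?thesis using 1 by (simp add: f_def a_def n_def h_def)
  qed
  moreover have "f \<longlonglongrightarrow> t * (2 * (A y \<bullet> A y) - norm (A y) ^ 2) + A y \<bullet> (y - y)"
    unfolding f_def y_def
    using x t xV yV by (intro tendsto_intros grid_tendsto approx_weak_limit flow_tendsto) (auto simp: y_def)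
  ultimately have "t * (2 * (A y \<bullet> A y) - norm (A y) ^ 2) + A y \<bullet> (y - y) \<le> J x - J y"
    by (intro LIMSEQ_le_const2) auto
  then show ?thesis by (simp add: y_def power2_norm_eq_inner)
qed

text \<open>The only place where the chain condition enters; it excludes jumps of \<open>\<parallel>A u\<parallel>\<close> and thereby
  makes the derivative two-sided.\<close>

lemma flow_gap:
  assumes x: "x \<in> D" and t: "0 \<le> t"
  shows "(A x - A (flow t x)) \<bullet> (x - flow t x) \<le> C * t * (norm (A x) ^ 2 - norm (A (flow t x)) ^ 2)"
proof -
  have xV: "x \<in> V" using x D_V by auto
  define y where "y = flow t x"
  have yD: "y \<in> D" using flow_D[OF x t] by (simp add: y_def)
  then have yV: "y \<in> V" "A y \<in> V" using D_V A_V by auto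
  have ineq: "(A x - A (approx m t x)) \<bullet> (x - approx m t x)
      \<le> C * (grid m t * (1/2)^m) * (norm (A x) ^ 2 - (2 * (A (approx m t x) \<bullet> A y) - norm (A y) ^ 2))" for m
  proof -
    define h :: real where "h = (1/2)^m"
    define n where "n = grid m t"
    have h: "0 < h" by (simp add: h_def)
    define e where "e k = euler h k x" for k
    have eD: "e k \<in> D" for k using euler_D[OF x h] by (simp add: e_def)
    define a where "a = A (e n)"
    have "(A (e 0) - A (e n)) \<bullet> (e 0 - e n) \<le> C * n * (\<Sum>k<n. (A (e k) - A (e (Suc k))) \<bullet> (e k - e (Suc k)))"
      by (rule chain[OF eD])
    also have "\<dots> \<le> C * n * (h * (norm (A x) ^ 2 - (2 * (a \<bullet> A y) - norm (A y) ^ 2)))"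
    proof (rule mult_left_mono)
    have "(\<Sum>k<n. (A (e k) - A (e (Suc k))) \<bullet> (e k - e (Suc k)))
        \<le> (\<Sum>k<n. h * (norm (A (e k)) ^ 2 - norm (A (e (Suc k))) ^ 2))"
    proof (rule sum_mono)
      fix k
      \<comment> \<open>With a, b the values of \<open>A\<close> before and after the step, |b|^2 <=
        a . b and |a - b|^2 >= 0 give (a - b) . b <= |a|^2 - |b|^2; the step itself equals h
        b.\<close>
      have "0 \<le> (A (e k) - A (e (Suc k))) \<bullet> (A (e k) - A (e (Suc k)))" by simp
      moreover have "norm (A (e (Suc k))) ^ 2 \<le> A (e k) \<bullet> A (e (Suc k))"
        using euler_inner[OF xV h] eD by (simp add: e_def)
      ultimately have "(A (e k) - A (e (Suc k))) \<bullet> A (e (Suc k)) \<le> norm (A (e k)) ^ 2 - norm (A (e (Suc k))) ^ 2"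
        by (simp add: power2_norm_eq_inner inner_diff_left inner_diff_right inner_commute)
      then have "h * ((A (e k) - A (e (Suc k))) \<bullet> A (e (Suc k))) \<le> h * (norm (A (e k)) ^ 2 - norm (A (e (Suc k))) ^ 2)"
        using h by (intro mult_left_mono) auto
      then show "(A (e k) - A (e (Suc k))) \<bullet> (e k - e (Suc k)) \<le> h * (norm (A (e k)) ^ 2 - norm (A (e (Suc k))) ^ 2)"
        using euler_step[OF xV h, of k] by (simp add: e_def)
    qed
    also have "\<dots> = h * (norm (A x) ^ 2 - norm a ^ 2)"
      using sum_lessThan_telescope'[of "\<lambda>k. norm (A (e k)) ^ 2" n]
      by (simp add: sum_distrib_left[symmetric] a_def e_def)
    also have "\<dots> \<le> h * (norm (A x) ^ 2 - (2 * (a \<bullet> A y) - norm (A y) ^ 2))"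
    proof -
      have "0 \<le> (a - A y) \<bullet> (a - A y)" by simp
      then have "2 * (a \<bullet> A y) - norm (A y) ^ 2 \<le> norm a ^ 2"
        by (simp add: power2_norm_eq_inner inner_diff_left inner_diff_right inner_commute)
      then show ?thesis using h by (intro mult_left_mono) auto
    qed
    finally show "(\<Sum>k<n. (A (e k) - A (e (Suc k))) \<bullet> (e k - e (Suc k)))
        \<le> h * (norm (A x) ^ 2 - (2 * (a \<bullet> A y) - norm (A y) ^ 2))" .
    qed (use C_nonneg in simp)
    finally show ?thesis by (simp add: a_def e_def approx_def n_def h_def mult_ac)
  qed
  have l1: "(\<lambda>m. A x \<bullet> (x - approx m t x) - A (approx m t x) \<bullet> (x - approx m t x))
      \<longlonglongrightarrow> A x \<bullet> (x - y) - A y \<bullet> (x - y)"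
    unfolding y_def using x t xV yV subspace_V
    by (intro tendsto_intros approx_weak_strong flow_tendsto) (auto simp: y_def subspace_diff)
  have l2: "(\<lambda>m. C * (grid m t * (1/2)^m) * (norm (A x) ^ 2 - (2 * (A (approx m t x) \<bullet> A y) - norm (A y) ^ 2)))
      \<longlonglongrightarrow> C * t * (norm (A x) ^ 2 - (2 * (A y \<bullet> A y) - norm (A y) ^ 2))"
    unfolding y_def using x t xV yV
    by (intro tendsto_intros grid_tendsto approx_weak_limit) (auto simp: y_def)
  have "A x \<bullet> (x - y) - A y \<bullet> (x - y) \<le> C * t * (norm (A x) ^ 2 - (2 * (A y \<bullet> A y) - norm (A y) ^ 2))"
    using ineq by (intro LIMSEQ_le[OF l1 l2]) (auto simp: inner_diff_left)
  then show ?thesis by (simp add: y_def power2_norm_eq_inner inner_diff_left)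
qed

text \<open>Up to the limit in m, x - flow h x is h times an average of values of \<open>A\<close>
  met by the scheme. These points stay within h |A x| of x and have |A| at most |A x|, so a lower
  bound valid there survives averaging.\<close>

lemma flow_average:
  assumes x: "x \<in> D" and h: "0 < h"
    and low: "\<And>z. z \<in> D \<Longrightarrow> norm (z - x) \<le> h * norm (A x) \<Longrightarrow> norm (A z) \<le> norm (A x) \<Longrightarrow> c \<le> A z \<bullet> y"
  shows "h * c \<le> (x - flow h x) \<bullet> y"
proof -
  have xV: "x \<in> V" using x D_V by auto
  have "(grid m h * (1/2)^m) * c \<le> (x - approx m h x) \<bullet> y" for m
  proof -
    define r :: real where "r = (1/2)^m"
    define n where "n = grid m h"
    have r: "0 < r" by (simp add: r_def)
    have nr: "n * r \<le> h" using grid_bounds(1)[of h m] h by (simp add: n_def r_def)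
    have "n * r * c = (\<Sum>k<n. r * c)" by simp
    also have "\<dots> \<le> (\<Sum>k<n. r * (A (euler r (Suc k) x) \<bullet> y))"
    proof (intro sum_mono mult_left_mono low)
      fix k assume k: "k \<in> {..<n}"
      show "euler r (Suc k) x \<in> D" by (intro euler_D x r)
      show "norm (A (euler r (Suc k) x)) \<le> norm (A x)" by (intro euler_norm_le x r)
      have "norm (x - euler r (Suc k) x) \<le> Suc k * r * norm (A x)" by (rule euler_distance[OF x r])
      also have "\<dots> \<le> n * r * norm (A x)" using k r by (intro mult_right_mono) auto
      also have "\<dots> \<le> h * norm (A x)" using nr by (intro mult_right_mono) auto
      finally show "norm (euler r (Suc k) x - x) \<le> h * norm (A x)" by (simp add: norm_minus_commute)
    qed (use r in auto)
    also have "\<dots> = (x - euler r n x) \<bullet> y"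
      unfolding euler_telescope[OF xV r] by (simp add: inner_sum_left sum_distrib_left)
    finally show ?thesis by (simp add: approx_def r_def n_def)
  qed
  moreover have "(\<lambda>m. (grid m h * (1/2)^m) * c) \<longlonglongrightarrow> h * c"
    using h by (intro tendsto_intros grid_tendsto) auto
  moreover have "(\<lambda>m. (x - approx m h x) \<bullet> y) \<longlonglongrightarrow> (x - flow h x) \<bullet> y"
    using h xV by (intro tendsto_intros flow_tendsto) auto
  ultimately show ?thesis by (intro LIMSEQ_le) auto
qed

text \<open>Expand |d - h A u|^2 with d = x - flow h x: |d| <= h |A x| costs e h^2, and the averaged
  lower bound for A z . A u costs 2 e h^2 in the cross term. Keeping x and u separate lets one
  estimate serve the right quotient, where x = u, and the left one, where flow h x = u.\<close>

lemma flow_difference_quotient: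
  assumes x: "x \<in> D" and u: "u \<in> D" and h: "0 < h" and e: "0 < e"
    and close: "norm (x - u) \<le> h * norm (A x)" and Ax: "norm (A x) ^ 2 \<le> norm (A u) ^ 2 + e"
    and low: "\<And>z. z \<in> D \<Longrightarrow> norm (z - u) \<le> 2 * h * norm (A x) \<Longrightarrow> norm (A z) \<le> norm (A x) \<Longrightarrow>
      norm (A u) ^ 2 - e \<le> A z \<bullet> A u"
  shows "norm ((x - flow h x) - h *\<^sub>R A u) ^ 2 \<le> 3 * e * h ^ 2"
proof -
  define d where "d = x - flow h x"
  have 1: "h * (norm (A u) ^ 2 - e) \<le> d \<bullet> A u"
    unfolding d_def
  proof (rule flow_average[OF x h low])
    fix z assume "norm (z - x) \<le> h * norm (A x)"
    from norm_diff_triangle_le[OF this close] show "norm (z - u) \<le> 2 * h * norm (A x)" by simp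
  qed auto
  have "norm d \<le> h * norm (A x)"
    using flow_lipschitz[OF x, of 0 h] h x D_V by (auto simp: d_def flow_0)
  then have "norm d ^ 2 \<le> h ^ 2 * norm (A x) ^ 2"
    using power_mono[of "norm d" "h * norm (A x)" 2] by (simp add: power_mult_distrib)
  also have "\<dots> \<le> h ^ 2 * (norm (A u) ^ 2 + e)" using Ax by (intro mult_left_mono) auto
  finally have 2: "norm d ^ 2 \<le> h ^ 2 * (norm (A u) ^ 2 + e)" .
  have "norm (d - h *\<^sub>R A u) ^ 2 = norm d ^ 2 - 2 * h * (d \<bullet> A u) + h ^ 2 * norm (A u) ^ 2"
    by (simp add: power2_norm_eq_inner inner_diff_left inner_diff_right inner_commute)
      (simp add: power2_eq_square)
  moreover have "2 * h * (h * (norm (A u) ^ 2 - e)) \<le> 2 * h * (d \<bullet> A u)"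
    using 1 h by (intro mult_left_mono) auto
  ultimately show ?thesis using 2 by (simp add: d_def algebra_simps power2_eq_square)
qed

text \<open>Let l be the infimum of |A u|^2 before t0. For s near t0 the drop of |A u|^2 between s
  and any t < t0 is below d, so the gap inequality lets A u(t) replace A u(s) in A u(s) . (u(s) -
  u(t)) >= (t - s) l at the cost C (t - s) d. Letting t tend to t0, where A u converges weakly, and
  then d to 0 yields l <= |A u(t0)| sqrt l.\<close>

lemma flow_left_continuous:
  assumes x: "x \<in> V" and t0: "0 < t0" and e: "0 < e"
  shows "\<exists>s. 0 < s \<and> s < t0 \<and> norm (A (flow s x)) ^ 2 \<le> norm (A (flow t0 x)) ^ 2 + e"
proof -
  define u where "u t = flow t x" for t
  define F where "F t = norm (A (u t)) ^ 2" for t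
  define l where "l = Inf (F ` {0<..<t0})"
  have uD: "u t \<in> D" if "0 < t" for t using flow_regular[OF x that] by (simp add: u_def)
  have uu: "u t = flow (t - s) (u s)" if "0 < s" "s \<le> t" for s t
    using flow_add[OF x, of s "t - s"] that by (simp add: u_def)
  have F_mono: "F t \<le> F s" if "0 < s" "s \<le> t" for s t
    using flow_norm_le[OF uD, of s "t - s"] uu[OF that] that by (auto simp: F_def intro: power_mono)
  have bdd: "bdd_below (F ` {0<..<t0})" by (intro bdd_belowI[of _ 0]) (auto simp: F_def)
  have ne: "F ` {0<..<t0} \<noteq> {}" using t0 by auto
  have l_le: "l \<le> F t" if "0 < t" "t < t0" for t
    unfolding l_def using that by (intro cInf_lower bdd) auto
  have l_nonneg: "0 \<le> l" unfolding l_def using ne by (intro cInf_greatest) (auto simp: F_def)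
  have Ft0: "F t0 \<le> l" unfolding l_def using ne F_mono by (intro cInf_greatest) auto
  have main: "l - C * d \<le> sqrt (F t0) * sqrt (l + d)" if d: "0 < d" for d
  proof -
    obtain s where s: "0 < s" "s < t0" "F s < l + d"
      using cInf_lessD[OF ne, of "l + d"] d by (auto simp: l_def)
    have step: "(t - s) * (l - C * d) \<le> A (u t) \<bullet> (u s - u t)" if t: "s < t" "t < t0" for t
    proof -
      have ut: "u t = flow (t - s) (u s)" using uu[of s t] s t by simp
      have "(A (u s) - A (u t)) \<bullet> (u s - u t) \<le> C * (t - s) * (F s - F t)"
        unfolding F_def ut using flow_gap[OF uD[OF s(1)], of "t - s"] t by simp
      also have "\<dots> \<le> C * (t - s) * d"
        using l_le[of t] s t C_nonneg by (intro mult_left_mono) auto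
      finally have 1: "(A (u s) - A (u t)) \<bullet> (u s - u t) \<le> C * (t - s) * d" .
      have "(t - s) * l \<le> (t - s) * F t" using l_le[of t] s t by (intro mult_left_mono) auto
      also have "\<dots> \<le> J (u s) - J (u t)"
        unfolding F_def ut using flow_energy[OF uD[OF s(1)], of "t - s"] t by simp
      also have "\<dots> \<le> A (u s) \<bullet> (u s - u t)"
        using subgradient[OF uD[OF s(1)] uD, of t] s t by (simp add: inner_diff_right)
      finally show ?thesis using 1 by (simp add: algebra_simps inner_diff_left)
    qed
    \<comment> \<open>The denominators start at 2, so that already the first point lies strictly
      between s and t0.\<close>
    define r where "r n = t0 - (t0 - s) / real (Suc (Suc n))" for n
    have r: "s < r n" "r n < t0" for n
    proof -
      define q where "q = (t0 - s) / real (Suc (Suc n))"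
      have "q \<le> (t0 - s) / 2" unfolding q_def using s by (intro divide_left_mono) auto
      then show "s < r n" unfolding r_def q_def[symmetric] using s(2) by (simp add: field_simps)
      show "r n < t0" using s by (simp add: r_def add_nonneg_pos)
    qed
    have "(\<lambda>n. t0 - (t0 - s) * inverse (real (Suc (Suc n)))) \<longlonglongrightarrow> t0 - (t0 - s) * 0"
      by (intro tendsto_diff tendsto_mult tendsto_const LIMSEQ_Suc[OF LIMSEQ_inverse_real_of_nat])
    then have rl: "r \<longlonglongrightarrow> t0" unfolding r_def[abs_def] divide_inverse mult_zero_right diff_zero .
    have "continuous_on {0..} u" using flow_continuous[OF x] by (simp add: u_def[abs_def])
    then have ul: "(\<lambda>n. u (r n)) \<longlonglongrightarrow> u t0"
      by (rule continuous_on_tendsto_compose[OF _ rl]) (use r s t0 in \<open>auto intro!: always_eventually less_imp_le simp: less_trans\<close>)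
    have bd: "norm (A (u (r n))) \<le> norm (A (u s))" for n
      using flow_norm_le[OF uD[OF s(1)], of "r n - s"] uu[of s "r n"] r[of n] s by simp
    have rD: "u (r n) \<in> D" for n using uD r s less_trans by blast
    have V: "u s - u t0 \<in> V" using uD s t0 D_V subspace_V by (meson subsetD subspace_diff)
    have w: "(\<lambda>n. A (u (r n)) \<bullet> (u s - u t0)) \<longlonglongrightarrow> A (u t0) \<bullet> (u s - u t0)"
      by (rule weak_limit[OF rD ul uD[OF t0] bd V])
    have n1: "norm (A (u (r n)) \<bullet> (u t0 - u (r n))) \<le> norm (A (u s)) * norm (u (r n) - u t0)" for n
      using Cauchy_Schwarz_ineq2[of "A (u (r n))" "u t0 - u (r n)"] bd[of n]
      by (smt (verit) mult_right_mono norm_ge_zero real_norm_def norm_minus_commute)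
    have n2: "(\<lambda>n. norm (A (u s)) * norm (u (r n) - u t0)) \<longlonglongrightarrow> 0"
      using ul by (intro tendsto_mult_right_zero tendsto_norm_zero LIM_zero)
    have "(\<lambda>n. A (u (r n)) \<bullet> (u t0 - u (r n))) \<longlonglongrightarrow> 0"
      by (rule Lim_null_comparison[OF eventuallyI n2]) (rule n1)
    from tendsto_add[OF w this]
    have lim: "(\<lambda>n. A (u (r n)) \<bullet> (u s - u (r n))) \<longlonglongrightarrow> A (u t0) \<bullet> (u s - u t0)"
      by (simp add: inner_diff_right)
    have lim2: "(\<lambda>n. (r n - s) * (l - C * d)) \<longlonglongrightarrow> (t0 - s) * (l - C * d)"
      using rl by (intro tendsto_intros)
    have "(t0 - s) * (l - C * d) \<le> A (u t0) \<bullet> (u s - u t0)"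
      using step r by (intro LIMSEQ_le[OF lim2 lim]) auto
    also have "\<dots> \<le> norm (A (u t0)) * norm (u s - u t0)" by (rule norm_cauchy_schwarz)
    also have "\<dots> \<le> sqrt (F t0) * ((t0 - s) * sqrt (l + d))"
    proof (rule mult_mono)
      have "norm (u s - u t0) \<le> (t0 - s) * norm (A (u s))"
        using flow_lipschitz[OF uD[OF s(1)], of 0 "t0 - s"] uu[of s t0] s uD[OF s(1)] D_V
        by (auto simp: flow_0)
      also have "norm (A (u s)) \<le> sqrt (l + d)" using s(3) by (auto simp: F_def intro: real_le_rsqrt)
      finally show "norm (u s - u t0) \<le> (t0 - s) * sqrt (l + d)" using s by (simp add: mult_left_mono)
    qed (auto simp: F_def)
    finally have "(t0 - s) * (l - C * d) \<le> (t0 - s) * (sqrt (F t0) * sqrt (l + d))" by (simp add: mult_ac)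
    then show ?thesis using s by simp
  qed
  have d0: "(\<lambda>n. 1 / real (Suc n)) \<longlonglongrightarrow> 0"
    using LIMSEQ_inverse_real_of_nat by (simp add: inverse_eq_divide)
  have "(\<lambda>n. l - C * (1 / real (Suc n))) \<longlonglongrightarrow> l - C * 0"
    "(\<lambda>n. sqrt (F t0) * sqrt (l + 1 / real (Suc n))) \<longlonglongrightarrow> sqrt (F t0) * sqrt (l + 0)"
    by (intro tendsto_intros d0)+
  then have "l - C * 0 \<le> sqrt (F t0) * sqrt (l + 0)"
    by (rule LIMSEQ_le) (use main[of "1 / real (Suc _)"] in auto)
  then have 1: "sqrt l * sqrt l \<le> sqrt (F t0) * sqrt l" using l_nonneg by simp
  have "l \<le> F t0"
  proof (cases "l = 0")
    case True
    then show ?thesis by (simp add: F_def)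
  next
    case False
    then have "0 < sqrt l" using l_nonneg by simp
    then have "sqrt l \<le> sqrt (F t0)" by (rule mult_right_le_imp_le[OF 1])
    then show ?thesis by (simp only: real_sqrt_le_iff)
  qed
  then have "Inf (F ` {0<..<t0}) < F t0 + e" using e by (simp add: l_def)
  from cInf_lessD[OF ne this] obtain s where "0 < s" "s < t0" "F s < F t0 + e" by auto
  then show ?thesis by (auto simp: F_def u_def intro!: exI[of _ s])
qed

text \<open>For r > t the quotient is based at u(t), for r < t at u(r), whose |A| exceeds |A u(t)|
  only slightly by left continuity. In both cases \<open>weak_aux\<close> supplies the lower bound
  for A z . A u(t) near u(t).\<close>

theorem flow_derivative:
  assumes x: "x \<in> V" and t: "0 < t"
  shows "((\<lambda>t. flow t x) has_vector_derivative - A (flow t x)) (at t)"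
proof -
  define u where "u t = flow t x" for t
  define g where "g = A (u t)"
  have uD: "u t \<in> D" if "0 < t" for t using flow_regular[OF x that] by (simp add: u_def)
  have uu: "u t = flow (t - s) (u s)" if "0 < s" "s \<le> t" for s t
    using flow_add[OF x, of s "t - s"] that by (simp add: u_def)
  have mono: "norm (A (u b)) \<le> norm (A (u a))" if "0 < a" "a \<le> b" for a b
    using flow_norm_le[OF uD, of a "b - a"] uu[OF that] that by auto
  have est: "\<exists>d>0. \<forall>r. \<bar>r - t\<bar> < d \<longrightarrow> norm (u r - u t + (r - t) *\<^sub>R g) \<le> e * \<bar>r - t\<bar>" if e: "0 < e" for e
  proof -
    \<comment> \<open>The bound 3 e' h^2 for the squared error then equals (e h)^2.\<close>
    define e' where "e' = e ^ 2 / 3"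
    have e': "0 < e'" using e by (simp add: e'_def)
    obtain s where s: "0 < s" "s < t" "norm (A (u s)) ^ 2 \<le> norm g ^ 2 + e'"
      using flow_left_continuous[OF x t e'] by (auto simp: u_def g_def)
    define K where "K = norm (A (u s))"
    obtain d where d: "d > 0"
      "\<And>z. z \<in> D \<Longrightarrow> norm (z - u t) < d \<Longrightarrow> norm (A z) \<le> K \<Longrightarrow> norm g ^ 2 - e' \<le> A z \<bullet> g"
      using weak_aux[OF uD[OF t] e', of K] by (auto simp: g_def)
    \<comment> \<open>The first entry keeps the base point at or after s, where |A| <= K; the second
      keeps 2 h |A| below the radius d of the weak lower bound.\<close>
    define d' where "d' = min (t - s) (d / (2 * (K + 1)))"
    have K1: "0 < K + 1" by (simp add: K_def add_nonneg_pos)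
    have d': "0 < d'" using s d K1 by (simp add: d'_def)
    have fin: "norm (v - w + (a - b) *\<^sub>R g) \<le> e * \<bar>a - b\<bar>"
      if "norm (w - v - (a - b) *\<^sub>R g) ^ 2 \<le> 3 * e' * (a - b) ^ 2" for v w and a b :: real
    proof -
      have "norm (w - v - (a - b) *\<^sub>R g) ^ 2 \<le> (e * \<bar>a - b\<bar>) ^ 2"
        using that by (simp add: e'_def power_mult_distrib)
      then have "norm (w - v - (a - b) *\<^sub>R g) \<le> e * \<bar>a - b\<bar>"
        by (rule power2_le_imp_le) (use e in simp)
      moreover have "norm (v - w + (a - b) *\<^sub>R g) = norm (w - v - (a - b) *\<^sub>R g)"
        by (subst norm_minus_cancel[symmetric]) (simp add: algebra_simps)
      ultimately show ?thesis by simp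
    qed
    have dq: "norm ((u a - u (a + h)) - h *\<^sub>R g) ^ 2 \<le> 3 * e' * h ^ 2"
      if a: "s \<le> a" "a \<le> t" "t \<le> a + h" "0 < h" "h < d'" and ta: "t = a \<or> t = a + h" for a h
    proof -
      have a0: "0 < a" using a s by simp
      have AK: "norm (A (u a)) \<le> K" using mono[OF s(1) a(1)] by (simp add: K_def)
      have "flow h (u a) = u (a + h)" using uu[OF a0, of "a + h"] a by simp
      moreover have "norm ((u a - flow h (u a)) - h *\<^sub>R A (u t)) ^ 2 \<le> 3 * e' * h ^ 2"
      proof (rule flow_difference_quotient[OF uD[OF a0] uD[OF t] a(4) e'])
        have "norm (u a - u t) \<le> (t - a) * norm (A (u a))"
          using flow_lipschitz[OF uD[OF a0], of 0 "t - a"] uu[OF a0 a(2)] a uD[OF a0] D_V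
          by (auto simp: flow_0)
        also have "\<dots> \<le> h * norm (A (u a))" using a by (intro mult_right_mono) auto
        finally show "norm (u a - u t) \<le> h * norm (A (u a))" .
        have "norm (A (u a)) ^ 2 \<le> norm (A (u s)) ^ 2" using mono[OF s(1) a(1)] by (intro power_mono) auto
        then show "norm (A (u a)) ^ 2 \<le> norm (A (u t)) ^ 2 + e'" using s(3) unfolding g_def by linarith
        fix z assume z: "z \<in> D" "norm (z - u t) \<le> 2 * h * norm (A (u a))" "norm (A z) \<le> norm (A (u a))"
        have "2 * h * norm (A (u a)) \<le> 2 * h * (K + 1)" using AK a by (intro mult_left_mono) auto
        also have "\<dots> < d" using a(5) K1 by (simp add: d'_def field_simps)
        finally have "norm (z - u t) < d" using z by simp
        then show "norm (A (u t)) ^ 2 - e' \<le> A z \<bullet> A (u t)"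
          using d(2)[OF z(1)] z AK by (simp add: g_def)
      qed
      ultimately show ?thesis by (simp add: g_def)
    qed
    show ?thesis
    proof (intro exI[of _ d'] conjI allI impI)
      show "0 < d'" by (rule d')
    next
      fix r assume r: "\<bar>r - t\<bar> < d'"
      consider "r = t" | "t < r" | "r < t" by linarith
      then show "norm (u r - u t + (r - t) *\<^sub>R g) \<le> e * \<bar>r - t\<bar>"
      proof cases
        case 2
        then show ?thesis using dq[of t "r - t"] r s by (intro fin) auto
      next
        case 3
        have "norm ((u r - u (r + (t - r))) - (t - r) *\<^sub>R g) ^ 2 \<le> 3 * e' * (t - r) ^ 2"
          using 3 r s by (intro dq) (auto simp: d'_def)
        then have "norm (u t - u r + (t - r) *\<^sub>R g) \<le> e * \<bar>t - r\<bar>" by (intro fin) simp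
        moreover have "norm (u r - u t + (r - t) *\<^sub>R g) = norm (u t - u r + (t - r) *\<^sub>R g)"
          by (subst norm_minus_cancel[symmetric]) (simp add: algebra_simps)
        ultimately show ?thesis by (simp add: abs_minus_commute)
      qed simp
    qed
  qed
  have "(u has_derivative (\<lambda>h. h *\<^sub>R (- g))) (at t)"
    unfolding has_derivative_within_alt
  proof (intro conjI allI impI bounded_linear_scaleR_left)
    fix e :: real assume "0 < e"
    from est[OF this] show "\<exists>d>0. \<forall>y\<in>UNIV. norm (y - t) < d \<longrightarrow>
        norm (u y - u t - (y - t) *\<^sub>R - g) \<le> e * norm (y - t)" by auto
  qed
  then show ?thesis by (simp add: has_vector_derivative_def u_def[abs_def] g_def)
qed

end

section \<open>Smooth functions of compact support\<close>

lemma Ck_Suc_imp_Ck: "Ck (Suc k) f \<Longrightarrow> Ck k f"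
proof (induction k arbitrary: f)
  case 0
  then show ?case
    by (auto simp: continuous_on_eq_continuous_at differentiable_imp_continuous_within)
qed simp

lemma Ck_const: "Ck k (\<lambda>x. c)"
  by (induction k arbitrary: c) simp_all

lemma Ck_add: "Ck k f \<Longrightarrow> Ck k g \<Longrightarrow> Ck k (\<lambda>x. f x + g x)"
proof (induction k arbitrary: f g)
  case (Suc k)
  have "frechet_derivative (\<lambda>x. f x + g x) (at x) b = frechet_derivative f (at x) b + frechet_derivative g (at x) b"
    for x b
    using Suc.prems
    by (subst frechet_derivative_at[symmetric, OF has_derivative_add[OF frechet_derivative_works[THEN iffD1] frechet_derivative_works[THEN iffD1]]]) auto
  then show ?case using Suc by (auto intro: differentiable_add)
qed (auto intro: continuous_on_add)

lemma Ck_mult: "Ck k f \<Longrightarrow> Ck k g \<Longrightarrow> Ck k (\<lambda>x. f x * g x)"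
proof (induction k arbitrary: f g)
  case (Suc k)
  have "frechet_derivative (\<lambda>x. f x * g x) (at x) b
      = f x * frechet_derivative g (at x) b + frechet_derivative f (at x) b * g x" for x b
    using Suc.prems
    by (subst frechet_derivative_at[symmetric, OF has_derivative_mult[OF frechet_derivative_works[THEN iffD1] frechet_derivative_works[THEN iffD1]]]) auto
  then show ?case
    using Suc Ck_Suc_imp_Ck[OF Suc.prems(1)] Ck_Suc_imp_Ck[OF Suc.prems(2)]
    by (auto intro!: Ck_add simp del: Ck.simps(1))
qed (auto intro: continuous_on_mult)

lemma Ck_compose: "Ck k h \<Longrightarrow> Ck k f \<Longrightarrow> Ck k (\<lambda>x. h (f x :: real))"
proof (induction k arbitrary: h f)
  case 0
  then show ?case using continuous_on_compose2[of UNIV h UNIV f] by auto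
next
  case (Suc k)
  have d: "frechet_derivative (\<lambda>x. h (f x)) (at x) b
      = frechet_derivative h (at (f x)) 1 * frechet_derivative f (at x) b" for x b
  proof -
    have lin: "linear (frechet_derivative h (at (f x)))"
      using Suc.prems by (auto intro: linear_frechet_derivative)
    have "frechet_derivative (h \<circ> f) (at x) b = frechet_derivative h (at (f x)) (frechet_derivative f (at x) b *\<^sub>R 1)"
      using Suc.prems by (subst frechet_derivative_compose) auto
    also have "\<dots> = frechet_derivative f (at x) b *\<^sub>R frechet_derivative h (at (f x)) 1"
      by (rule linear_scale[OF lin])
    finally show ?thesis by (simp add: o_def mult.commute)
  qed
  have "(\<lambda>x. h (f x)) differentiable (at x)" for x
    using Suc.prems differentiable_chain_at[of f x h] by (auto simp: o_def)
  moreover have "Ck k (\<lambda>x. frechet_derivative h (at (f x)) 1 * frechet_derivative f (at x) b)" if "b \<in> Basis" for b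
    using Suc Ck_Suc_imp_Ck[OF Suc.prems(2)] that by (auto intro!: Ck_mult)
  ultimately show ?case by (auto simp: d)
qed

lemma Ck_inner: "Ck k (\<lambda>x. x \<bullet> v)"
proof (cases k)
  case (Suc k)
  have "frechet_derivative (\<lambda>x. x \<bullet> v) (at x) = (\<lambda>b. b \<bullet> v)" for x :: 'a
    by (rule frechet_derivative_at[symmetric]) (auto intro!: derivative_eq_intros)
  then show ?thesis using Suc by (auto simp: Ck_const)
qed (auto intro: continuous_intros)

lemma Cinfinity_const: "Cinfinity (\<lambda>x. c)" by (simp add: Cinfinity_def Ck_const)

lemma Cinfinity_add: "Cinfinity f \<Longrightarrow> Cinfinity g \<Longrightarrow> Cinfinity (\<lambda>x. f x + g x)"
  by (simp add: Cinfinity_def Ck_add)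

lemma Cinfinity_mult: "Cinfinity f \<Longrightarrow> Cinfinity g \<Longrightarrow> Cinfinity (\<lambda>x. f x * g x)"
  by (simp add: Cinfinity_def Ck_mult)

lemma Cinfinity_compose: "Cinfinity h \<Longrightarrow> Cinfinity f \<Longrightarrow> Cinfinity (\<lambda>x. h (f x :: real))"
  by (simp add: Cinfinity_def Ck_compose)

lemma Cinfinity_inner: "Cinfinity (\<lambda>x. x \<bullet> v)" by (simp add: Cinfinity_def Ck_inner)

lemma Cinfinity_prod: "(\<And>i. i \<in> I \<Longrightarrow> Cinfinity (f i)) \<Longrightarrow> Cinfinity (\<lambda>x. \<Prod>i\<in>I. f i x)"
  by (induction I rule: infinite_finite_induct) (simp_all add: Cinfinity_const Cinfinity_mult)

text \<open>Derivatives of members of this family are linear combinations of members, so smoothness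
  of all of them follows by one induction on the order. The case n = 0 is the classical smooth
  function that is flat at 0.\<close>

definition flat_exp :: "nat \<Rightarrow> real \<Rightarrow> real" where
  "flat_exp n t = (if 0 < t then exp (- (1 / t)) / t ^ n else 0)"

lemma flat_exp_tendsto_right: "((flat_exp n) \<longlongrightarrow> 0) (at_right 0)"
proof -
  have "((\<lambda>t. inverse t ^ n / exp (inverse t)) \<longlongrightarrow> (0::real)) (at_right 0)"
    by (rule filterlim_compose[OF tendsto_power_div_exp_0 filterlim_inverse_at_top_right])
  moreover have "eventually (\<lambda>t. inverse t ^ n / exp (inverse t) = flat_exp n t) (at_right (0::real))"
    by (auto simp: eventually_at_filter flat_exp_def exp_minus divide_simps)
  ultimately show ?thesis by (rule Lim_transform_eventually)
qed

lemma flat_exp_deriv: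
  "(flat_exp n has_real_derivative (- real n * flat_exp (Suc n) t + flat_exp (Suc (Suc n)) t)) (at t)"
proof -
  consider "t < 0" | "t = 0" | "0 < t" by linarith
  then show ?thesis
  proof cases
    case 1
    have "((\<lambda>t. 0) has_real_derivative 0) (at t)" by simp
    then have "(flat_exp n has_real_derivative 0) (at t)"
      by (rule has_field_derivative_transform_within_open[where S = "{..<0}"]) (use 1 in \<open>auto simp: flat_exp_def\<close>)
    then show ?thesis using 1 by (simp add: flat_exp_def)
  next
    case 2
    \<comment> \<open>From the right, the difference quotient at 0 is
      \<open>flat_exp (Suc n)\<close> itself.\<close>
    have "((\<lambda>h. flat_exp n h / h) \<longlongrightarrow> 0) (at_right 0)"
      using flat_exp_tendsto_right[of "Suc n"]
      by (rule Lim_transform_eventually) (auto simp: eventually_at_filter flat_exp_def)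
    moreover have "((\<lambda>h. flat_exp n h / h) \<longlongrightarrow> 0) (at_left 0)"
      by (rule Lim_transform_eventually[OF tendsto_const])
        (auto simp: eventually_at_filter flat_exp_def)
    ultimately have "((\<lambda>h. flat_exp n h / h) \<longlongrightarrow> 0) (at 0)" by (simp add: filterlim_at_split)
    then show ?thesis using 2 by (simp add: DERIV_def flat_exp_def)
  next
    case 3
    have "((\<lambda>t. exp (- (1 / t)) / t ^ n) has_real_derivative
        (exp (- (1 / t)) * (1 / t\<^sup>2) * t ^ n - exp (- (1 / t)) * (real n * t ^ (n - 1))) / (t ^ n * t ^ n)) (at t)"
      using 3 by (auto intro!: derivative_eq_intros simp: power2_eq_square)
    moreover have "(exp (- (1 / t)) * (1 / t\<^sup>2) * t ^ n - exp (- (1 / t)) * (real n * t ^ (n - 1))) / (t ^ n * t ^ n)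
        = - real n * flat_exp (Suc n) t + flat_exp (Suc (Suc n)) t"
    proof (cases n)
      case 0
      then show ?thesis using 3 by (simp add: flat_exp_def power2_eq_square)
    next
      case (Suc m)
      then show ?thesis using 3 by (simp add: flat_exp_def power2_eq_square field_simps)
    qed
    ultimately have "((\<lambda>t. exp (- (1 / t)) / t ^ n) has_real_derivative
        (- real n * flat_exp (Suc n) t + flat_exp (Suc (Suc n)) t)) (at t)" by simp
    then show ?thesis
      by (rule has_field_derivative_transform_within_open[where S = "{0<..}"]) (use 3 in \<open>auto simp: flat_exp_def\<close>)
  qed
qed

lemma Ck_flat_exp: "Ck k (flat_exp n)"
proof (induction k arbitrary: n)
  case 0
  show ?case using flat_exp_deriv by (auto simp: continuous_on_eq_continuous_at intro: DERIV_isCont)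
next
  case (Suc k)
  have "frechet_derivative (flat_exp n) (at t) 1 = - real n * flat_exp (Suc n) t + flat_exp (Suc (Suc n)) t" for t
    using frechet_derivative_at[OF flat_exp_deriv[of n t, unfolded has_field_derivative_def]] by (metis mult.right_neutral)
  moreover have "flat_exp n differentiable (at t)" for t
    using flat_exp_deriv real_differentiable_def by blast
  moreover have "Ck k (\<lambda>t. - real n * flat_exp (Suc n) t + flat_exp (Suc (Suc n)) t)"
    by (intro Ck_add Ck_mult Ck_const Suc.IH)
  ultimately show ?case by simp
qed

text \<open>The values stay below 1 and approach it only at infinity; a sharp step arises from
  smooth_step (c t) as c grows.\<close>

definition smooth_step :: "real \<Rightarrow> real" where "smooth_step = flat_exp 0"

lemma smooth_step_eq: "smooth_step t = (if 0 < t then exp (- (1 / t)) else 0)"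
  by (simp add: smooth_step_def flat_exp_def)

lemma Cinfinity_smooth_step: "Cinfinity smooth_step"
  by (simp add: Cinfinity_def smooth_step_def Ck_flat_exp)

lemma Cinfinity_smooth_step_compose: "Cinfinity f \<Longrightarrow> Cinfinity (\<lambda>x. smooth_step (f x))"
  by (rule Cinfinity_compose[OF Cinfinity_smooth_step])

lemma smooth_step_bounds: "0 \<le> smooth_step t" "smooth_step t \<le> 1"
  by (auto simp: smooth_step_eq)

lemma smooth_step_mono: "s \<le> t \<Longrightarrow> smooth_step s \<le> smooth_step t"
  by (auto simp: smooth_step_eq frac_le)

lemma smooth_step_scale_tendsto:
  "(\<lambda>n. smooth_step (real (Suc n) * t)) \<longlonglongrightarrow> (if 0 < t then 1 else 0)"
proof (cases "0 < t")
  case True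
  have "(\<lambda>n. exp (- (inverse (real (Suc n)) * (1 / t)))) \<longlonglongrightarrow> exp (- (0 * (1 / t)))"
    by (intro tendsto_intros LIMSEQ_inverse_real_of_nat)
  moreover have "exp (- (inverse (real (Suc n)) * (1 / t))) = smooth_step (real (Suc n) * t)" for n
    using True by (simp add: smooth_step_eq divide_simps del: of_nat_Suc)
  ultimately show ?thesis using True by simp
next
  case False
  then have "smooth_step (real (Suc n) * t) = 0" for n
    by (auto simp: smooth_step_eq zero_less_mult_iff simp del: of_nat_Suc)
  then show ?thesis using False by simp
qed

text \<open>A smooth substitute for the indicator of the open box: nonzero only inside it, with
  values between 0 and 1, and converging to the indicator pointwise as n grows.\<close>

definition bump :: "'a::euclidean_space \<Rightarrow> 'a \<Rightarrow> nat \<Rightarrow> 'a \<Rightarrow> real" where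
  "bump a b n x = (\<Prod>i\<in>Basis. smooth_step (real (Suc n) * (x \<bullet> i - a \<bullet> i)) * smooth_step (real (Suc n) * (b \<bullet> i - x \<bullet> i)))"

lemma Cinfinity_bump: "Cinfinity (bump a b n)"
proof -
  have "Cinfinity (\<lambda>x. smooth_step (real (Suc n) * (x \<bullet> i + - (a \<bullet> i))) * smooth_step (real (Suc n) * (b \<bullet> i + (- 1) * (x \<bullet> i))))" for i
    by (intro Cinfinity_mult Cinfinity_smooth_step_compose Cinfinity_add Cinfinity_const Cinfinity_inner)
  then show ?thesis unfolding bump_def[abs_def] by (intro Cinfinity_prod) simp
qed

lemma bump_nonzero: "bump a b n x \<noteq> 0 \<Longrightarrow> x \<in> box a b"
  by (auto simp: bump_def smooth_step_eq mem_box zero_less_mult_iff split: if_splits)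

lemma bump_bounds: "0 \<le> bump a b n x" "bump a b n x \<le> 1"
  unfolding bump_def
  by (auto intro!: prod_nonneg prod_le_1 mult_le_one simp: smooth_step_bounds simp del: of_nat_Suc)

lemma bump_tendsto: "(\<lambda>n. bump a b n x) \<longlonglongrightarrow> indicator (box a b) x"
proof -
  have "(\<lambda>n. bump a b n x) \<longlonglongrightarrow> (\<Prod>i\<in>Basis. (if 0 < x \<bullet> i - a \<bullet> i then 1 else 0) * (if 0 < b \<bullet> i - x \<bullet> i then 1 else 0))"
    unfolding bump_def by (intro tendsto_prod tendsto_mult smooth_step_scale_tendsto)
  also have "(\<Prod>i\<in>Basis. (if 0 < x \<bullet> i - a \<bullet> i then 1 else 0) * (if 0 < b \<bullet> i - x \<bullet> i then 1 else 0))
      = (indicator (box a b) x :: real)"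
    by (auto simp: indicator_def mem_box intro!: prod.neutral)
  finally show ?thesis .
qed

section \<open>Test functions\<close>

lemma Cc_infinityI:
  assumes "Cinfinity \<phi>" "compact K" "K \<subseteq> \<Omega>" "\<And>x. \<phi> x \<noteq> 0 \<Longrightarrow> x \<in> K"
  shows "\<phi> \<in> Cc_infinity \<Omega>"
proof -
  have "closure {x. \<phi> x \<noteq> 0} \<subseteq> K"
    using assms by (intro closure_minimal) (auto intro: compact_imp_closed)
  then show ?thesis
    using assms by (auto simp: Cc_infinity_def compact_eq_bounded_closed intro: bounded_subset closure_subset[THEN subset_trans])
qed

lemma Cc_infinityD:
  assumes "\<phi> \<in> Cc_infinity \<Omega>"
  shows "Cinfinity \<phi>" "compact (closure {x. \<phi> x \<noteq> 0})" "closure {x. \<phi> x \<noteq> 0} \<subseteq> \<Omega>"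
    "\<phi> x \<noteq> 0 \<Longrightarrow> x \<in> closure {x. \<phi> x \<noteq> 0}"
  using assms closure_subset[of "{x. \<phi> x \<noteq> 0}"] unfolding Cc_infinity_def by blast+

lemma bump_Cc: "cbox a b \<subseteq> \<Omega> \<Longrightarrow> bump a b n \<in> Cc_infinity \<Omega>"
  using bump_nonzero[of a b n] box_subset_cbox[of a b]
  by (intro Cc_infinityI[of _ "cbox a b"] Cinfinity_bump) auto

lemma Cc_infinity_add:
  assumes "\<phi> \<in> Cc_infinity \<Omega>" "\<psi> \<in> Cc_infinity \<Omega>" shows "(\<lambda>x. \<phi> x + \<psi> x) \<in> Cc_infinity \<Omega>"
proof (rule Cc_infinityI)
  show "Cinfinity (\<lambda>x. \<phi> x + \<psi> x)" by (intro Cinfinity_add Cc_infinityD(1)[OF assms(1)] Cc_infinityD(1)[OF assms(2)])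
  show "compact (closure {x. \<phi> x \<noteq> 0} \<union> closure {x. \<psi> x \<noteq> 0})"
    by (intro compact_Un Cc_infinityD(2)[OF assms(1)] Cc_infinityD(2)[OF assms(2)])
  show "closure {x. \<phi> x \<noteq> 0} \<union> closure {x. \<psi> x \<noteq> 0} \<subseteq> \<Omega>"
    by (intro Un_least Cc_infinityD(3)[OF assms(1)] Cc_infinityD(3)[OF assms(2)])
  fix x assume "\<phi> x + \<psi> x \<noteq> 0"
  then have "\<phi> x \<noteq> 0 \<or> \<psi> x \<noteq> 0" by linarith
  then show "x \<in> closure {x. \<phi> x \<noteq> 0} \<union> closure {x. \<psi> x \<noteq> 0}"
    using Cc_infinityD(4)[OF assms(1)] Cc_infinityD(4)[OF assms(2)] by blast
qed

lemma Cc_infinity_compose: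
  assumes "\<phi> \<in> Cc_infinity \<Omega>" "Cinfinity H" "H 0 = 0" shows "(\<lambda>x. H (\<phi> x)) \<in> Cc_infinity \<Omega>"
proof (rule Cc_infinityI[OF _ Cc_infinityD(2,3)[OF assms(1)]])
  show "Cinfinity (\<lambda>x. H (\<phi> x))" by (rule Cinfinity_compose[OF assms(2) Cc_infinityD(1)[OF assms(1)]])
  fix x assume "H (\<phi> x) \<noteq> 0"
  then have "\<phi> x \<noteq> 0" using assms(3) by metis
  then show "x \<in> closure {x. \<phi> x \<noteq> 0}" by (rule Cc_infinityD(4)[OF assms(1)])
qed

lemma Cinfinity_scale: "Cinfinity (\<lambda>x::real. c * x)"
  using Cinfinity_mult[OF Cinfinity_const Cinfinity_inner[of "1::real"]] by simp

lemma Cc_infinity_scale: "\<phi> \<in> Cc_infinity \<Omega> \<Longrightarrow> (\<lambda>x. c * \<phi> x) \<in> Cc_infinity \<Omega>"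
  by (rule Cc_infinity_compose[where H = "\<lambda>t. c * t", OF _ Cinfinity_scale mult_zero_right])

lemma Cc_infinity_continuous: "\<phi> \<in> Cc_infinity \<Omega> \<Longrightarrow> continuous_on UNIV \<phi>"
  using Cc_infinityD(1) Ck.simps(1) unfolding Cinfinity_def by blast

lemma compact_support_bounded:
  fixes f :: "'a::euclidean_space \<Rightarrow> real"
  assumes "continuous_on UNIV f" "compact K" "\<And>x. x \<notin> K \<Longrightarrow> f x = 0"
  obtains B where "0 < B" "\<And>x. \<bar>f x\<bar> \<le> B"
proof -
  have "bounded (f ` K)"
    using assms by (intro compact_imp_bounded compact_continuous_image) (auto intro: continuous_on_subset)
  then obtain B where "\<And>x. x \<in> K \<Longrightarrow> \<bar>f x\<bar> \<le> B" by (auto simp: bounded_iff)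
  then have "\<bar>f x\<bar> \<le> \<bar>B\<bar> + 1" for x using assms(3)[of x] by (cases "x \<in> K") force+
  then show ?thesis by (intro that[of "\<bar>B\<bar> + 1"]) auto
qed

lemma Cc_infinity_bounded:
  assumes "\<phi> \<in> Cc_infinity \<Omega>" obtains B where "0 < B" "\<And>x. \<bar>\<phi> x\<bar> \<le> B"
  by (rule compact_support_bounded[OF Cc_infinity_continuous[OF assms] Cc_infinityD(2)[OF assms]])
    (use Cc_infinityD(4)[OF assms] that in auto)

text \<open>The partial derivatives are continuous and vanish off the support, hence are bounded;
  the mean value inequality does the rest.\<close>

lemma Cc_infinity_lipschitz:
  assumes \<phi>: "\<phi> \<in> Cc_infinity \<Omega>"
  obtains L where "0 < L" "\<And>x y. \<bar>\<phi> x - \<phi> y\<bar> \<le> L * norm (x - y)"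
proof -
  define K where "K = closure {x. \<phi> x \<noteq> 0}"
  have diff: "\<phi> differentiable (at x)" and cont: "b \<in> Basis \<Longrightarrow> continuous_on UNIV (\<lambda>x. frechet_derivative \<phi> (at x) b)" for x b
    using Cc_infinityD(1)[OF \<phi>] unfolding Cinfinity_def by (metis Ck.simps)+
  have zero: "frechet_derivative \<phi> (at x) = (\<lambda>h. 0)" if "x \<notin> K" for x
  proof -
    have "((\<lambda>x. 0) has_derivative (\<lambda>h. 0)) (at x)" by simp
    then have "(\<phi> has_derivative (\<lambda>h. 0)) (at x)"
      by (rule has_derivative_transform_within_open[where s = "- K"])
        (use that Cc_infinityD(4)[OF \<phi>] in \<open>auto simp: K_def\<close>)
    then show ?thesis using frechet_derivative_at by metis
  qed
  have "\<exists>B. \<forall>x. \<bar>frechet_derivative \<phi> (at x) b\<bar> \<le> B" if b: "b \<in> Basis" for b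
    by (rule compact_support_bounded[OF cont[OF b], of K]) (use zero Cc_infinityD(2)[OF \<phi>] in \<open>auto simp: K_def\<close>)
  then obtain B where B: "\<And>b x. b \<in> Basis \<Longrightarrow> \<bar>frechet_derivative \<phi> (at x) b\<bar> \<le> B b" by metis
  define L where "L = (\<Sum>b\<in>Basis. \<bar>B b\<bar>) + 1"
  have on: "onorm (frechet_derivative \<phi> (at x)) \<le> L" for x
  proof (rule onorm_le)
    fix h :: 'a
    have lin: "linear (frechet_derivative \<phi> (at x))" by (rule linear_frechet_derivative[OF diff])
    have "frechet_derivative \<phi> (at x) h = frechet_derivative \<phi> (at x) (\<Sum>b\<in>Basis. (h \<bullet> b) *\<^sub>R b)"
      by (simp add: euclidean_representation)
    also have "\<dots> = (\<Sum>b\<in>Basis. (h \<bullet> b) * frechet_derivative \<phi> (at x) b)"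
      by (simp add: linear_sum[OF lin] linear_scale[OF lin])
    finally have "norm (frechet_derivative \<phi> (at x) h) \<le> (\<Sum>b\<in>Basis. \<bar>(h \<bullet> b) * frechet_derivative \<phi> (at x) b\<bar>)"
      by (simp add: sum_abs)
    also have "\<dots> \<le> (\<Sum>b\<in>Basis. norm h * \<bar>B b\<bar>)"
      using B by (intro sum_mono) (auto simp: abs_mult Basis_le_norm intro!: mult_mono order_trans[OF B abs_ge_self])
    also have "\<dots> \<le> L * norm h" by (simp add: L_def sum_distrib_left[symmetric] algebra_simps)
    finally show "norm (frechet_derivative \<phi> (at x) h) \<le> L * norm h" .
  qed
  have "norm (\<phi> x - \<phi> y) \<le> L * norm (x - y)" for x y
    by (rule differentiable_bound[where S = UNIV and f' = "\<lambda>x. frechet_derivative \<phi> (at x)"])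
      (use diff frechet_derivative_works on in auto)
  moreover have "0 < L" by (simp add: L_def add_nonneg_pos sum_nonneg)
  ultimately show ?thesis by (intro that[of L]) auto
qed

text \<open>Bumps approximate the indicator of a box, so g integrates to zero over every closed box
  inside \<Omega>. Almost everywhere g is the limit of its averages over shrinking cubes, which
  eventually lie in \<Omega>.\<close>

lemma AE_zero_if_orthogonal_Cc_infinity:
  fixes g :: "'a::euclidean_space \<Rightarrow> real"
  assumes \<Omega>: "open \<Omega>" and g: "integrable lebesgue g"
    and orth: "\<And>\<phi>. \<phi> \<in> Cc_infinity \<Omega> \<Longrightarrow> (LINT x|lebesgue. g x * \<phi> x) = 0"
  shows "AE x in lebesgue. x \<in> \<Omega> \<longrightarrow> g x = 0"
proof -
  have [measurable]: "g \<in> borel_measurable lebesgue" using g by simp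
  have box: "integral (cbox a b) g = 0" if ab: "cbox a b \<subseteq> \<Omega>" for a b
  proof -
    have "(\<lambda>n. LINT x|lebesgue. g x * bump a b n x) \<longlonglongrightarrow> (LINT x|lebesgue. g x * indicator (box a b) x)"
    proof (rule integral_dominated_convergence[where w = "\<lambda>x. \<bar>g x\<bar>"])
      show "AE x in lebesgue. (\<lambda>n. g x * bump a b n x) \<longlonglongrightarrow> g x * indicator (box a b) x"
        by (intro AE_I2 tendsto_intros bump_tendsto)
      show "AE x in lebesgue. norm (g x * bump a b n x) \<le> \<bar>g x\<bar>" for n
        using bump_bounds[of a b n] by (intro AE_I2) (auto simp: abs_mult mult_left_le)
      show "(\<lambda>x. g x * bump a b n x) \<in> borel_measurable lebesgue" for n
      proof -
        have "bump a b n \<in> borel_measurable borel"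
          using Cc_infinity_continuous[OF bump_Cc[OF ab]] by (rule borel_measurable_continuous_onI)
        then have "bump a b n \<in> borel_measurable lebesgue" by (simp add: measurable_completion)
        then show ?thesis by measurable
      qed
      show "(\<lambda>x. g x * indicator (box a b) x) \<in> borel_measurable lebesgue"
        by (intro borel_measurable_times borel_measurable_indicator) auto
    qed (use g in auto)
    then have "(LINT x|lebesgue. g x * indicator (box a b) x) = 0"
      unfolding orth[OF bump_Cc[OF ab]] using LIMSEQ_unique[OF _ tendsto_const] by blast
    moreover have "(LINT x|lebesgue. g x * indicator (box a b) x) = integral (box a b) g"
    proof -
      have "set_integrable lebesgue (box a b) g"
        unfolding set_integrable_def by (intro integrable_mult_indicator g) auto
      from set_lebesgue_integral_eq_integral(2)[OF this] show ?thesis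
        by (simp add: set_lebesgue_integral_def mult.commute)
    qed
    ultimately show ?thesis by (metis integral_open_interval)
  qed
  have "g integrable_on cbox a b" for a b
  proof -
    have "set_integrable lebesgue (cbox a b) g"
      unfolding set_integrable_def by (intro integrable_mult_indicator g) auto
    then show ?thesis by (rule set_lebesgue_integral_eq_integral(1))
  qed
  from integrable_ccontinuous_explicit[OF this] obtain N where N: "negligible N"
    "\<And>x e. x \<notin> N \<Longrightarrow> 0 < e \<Longrightarrow> \<exists>d>0. \<forall>h. 0 < h \<and> h < d \<longrightarrow> norm (integral (cbox x (x + h *\<^sub>R One)) g /\<^sub>R h ^ DIM('a) - g x) < e"
    by metis
  have "g x = 0" if x: "x \<in> \<Omega>" "x \<notin> N" for x
  proof (rule ccontr)
    assume "g x \<noteq> 0"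
    then obtain d where d: "0 < d" "\<And>h. 0 < h \<Longrightarrow> h < d \<Longrightarrow> norm (integral (cbox x (x + h *\<^sub>R One)) g /\<^sub>R h ^ DIM('a) - g x) < \<bar>g x\<bar>"
      using N(2)[OF x(2), of "\<bar>g x\<bar>"] by auto
    obtain r where r: "0 < r" "ball x r \<subseteq> \<Omega>" using \<Omega> x(1) openE by blast
    \<comment> \<open>Points of the cube of side h are at distance at most DIM h <= r / 2 from its
      corner x, so the cube stays in the ball.\<close>
    define h where "h = min (d / 2) (r / (2 * DIM('a)))"
    have h: "0 < h" "h < d" using d r by (auto simp: h_def)
    have "cbox x (x + h *\<^sub>R One) \<subseteq> ball x r"
    proof
      fix y assume y: "y \<in> cbox x (x + h *\<^sub>R One)"
      have "norm (y - x) \<le> (\<Sum>b\<in>Basis. \<bar>(y - x) \<bullet> b\<bar>)" by (rule norm_le_l1)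
      also have "\<dots> \<le> (\<Sum>b\<in>(Basis::'a set). h)"
        using y by (intro sum_mono) (auto simp: mem_box inner_diff_left inner_add_left)
      also have "\<dots> = DIM('a) * h" by simp
      also have "\<dots> \<le> DIM('a) * (r / (2 * DIM('a)))" unfolding h_def by (intro mult_left_mono) auto
      also have "\<dots> < r" using r by simp
      finally show "y \<in> ball x r" by (simp add: dist_norm norm_minus_commute)
    qed
    then have "integral (cbox x (x + h *\<^sub>R One)) g = 0" using r by (intro box) auto
    then show False using d(2)[OF h] by simp
  qed
  then have "{x \<in> space lebesgue. \<not> (x \<in> \<Omega> \<longrightarrow> g x = 0)} \<subseteq> N" by auto
  with N(1) show ?thesis unfolding negligible_iff_null_sets by (rule AE_I')
qed

section \<open>Inequalities for signed powers\<close>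

text \<open>The signed power. With r = p - 1 it is the nonlinearity of the operator; with r = p / 2
  it is the map whose squared increments measure the monotonicity gap.\<close>

definition spow :: "real \<Rightarrow> real \<Rightarrow> real" where "spow r a = \<bar>a\<bar> powr (r - 1) * a"

lemma spow_0 [simp]: "spow r 0 = 0" by (simp add: spow_def)

lemma spow_minus: "spow r (- a) = - spow r a" by (simp add: spow_def)

lemma spow_nonneg_eq: "0 \<le> a \<Longrightarrow> 0 < r \<Longrightarrow> spow r a = a powr r"
  by (cases "a = 0") (simp_all add: spow_def powr_mult_base mult.commute)

lemma abs_spow: "0 < r \<Longrightarrow> \<bar>spow r a\<bar> = \<bar>a\<bar> powr r"
  by (cases "a = 0") (simp_all add: spow_def abs_mult powr_mult_base mult.commute)

lemma spow_measurable [measurable]: "spow r \<in> borel_measurable borel"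
  unfolding spow_def[abs_def] by measurable

lemma continuous_on_spow: "1 < r \<Longrightarrow> continuous_on UNIV (spow r)"
  unfolding spow_def[abs_def] by (intro continuous_on_mult continuous_on_powr' continuous_intros) auto

text \<open>Convexity in tangent form; it is Young's inequality for a and m^(r-1) with the exponents
  r and r / (r - 1).\<close>

lemma powr_tangent:
  assumes "0 \<le> a" "0 \<le> m" "1 \<le> (r::real)"
  shows "m powr r + r * m powr (r - 1) * (a - m) \<le> a powr r"
proof (cases "r = 1 \<or> m = 0")
  case True
  then show ?thesis using assms by auto
next
  case False
  then have r: "1 < r" and m: "0 < m" using assms by auto
  define q where "q = r / (r - 1)"
  have q: "1 < q" "1 / r + 1 / q = 1" using r by (auto simp: q_def field_simps)
  have "a * m powr (r - 1) \<le> a powr r / r + (m powr (r - 1)) powr q / q"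
    by (rule Youngs_inequality) (use q r assms in auto)
  also have "(m powr (r - 1)) powr q = m powr r" using r by (simp add: powr_powr q_def)
  finally have "r * (a * m powr (r - 1)) \<le> r * (a powr r / r + m powr r / q)"
    using r by (intro mult_left_mono) auto
  also have "\<dots> = a powr r + (r - 1) * m powr r" using r by (simp add: q_def field_simps)
  finally have "r * (a * m powr (r - 1)) \<le> a powr r + (r - 1) * m powr r" .
  moreover have "m powr (r - 1) * m = m powr r" using m by (simp add: powr_mult_base mult.commute)
  ultimately show ?thesis by (simp add: algebra_simps)
qed

text \<open>Bounding the signed product by |a|^(p-1) |b| reduces the claim to the tangent line on
  the half line.\<close>

lemma spow_subgradient:
  assumes p: "2 < p"
  shows "\<bar>a\<bar> powr p + p * spow (p - 1) a * (b - a) \<le> \<bar>b\<bar> powr p"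
proof -
  have e: "spow (p - 1) a * a = \<bar>a\<bar> powr p"
  proof (cases "a = 0")
    case False
    have "spow (p - 1) a * a = \<bar>a\<bar> powr (p - 2) * a\<^sup>2"
      by (simp add: spow_def power2_eq_square)
    also have "a\<^sup>2 = \<bar>a\<bar> powr 2" using False by simp
    also have "\<bar>a\<bar> powr (p - 2) * \<bar>a\<bar> powr 2 = \<bar>a\<bar> powr p" unfolding powr_add[symmetric] by simp
    finally show ?thesis .
  qed (use p in simp)
  have "spow (p - 1) a * b \<le> \<bar>spow (p - 1) a\<bar> * \<bar>b\<bar>" by (metis abs_ge_self abs_mult)
  also have "\<dots> = \<bar>a\<bar> powr (p - 1) * \<bar>b\<bar>" using p by (simp add: abs_spow)
  finally have 1: "spow (p - 1) a * b \<le> \<bar>a\<bar> powr (p - 1) * \<bar>b\<bar>" .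
  have 2: "\<bar>a\<bar> powr (p - 1) * \<bar>a\<bar> = \<bar>a\<bar> powr p"
    using p by (cases "a = 0") (simp_all add: powr_mult_base mult.commute)
  have "\<bar>a\<bar> powr p + p * spow (p - 1) a * (b - a) = \<bar>a\<bar> powr p + p * (spow (p - 1) a * b - \<bar>a\<bar> powr p)"
    by (simp add: e[symmetric] algebra_simps)
  also have "\<dots> \<le> \<bar>a\<bar> powr p + p * (\<bar>a\<bar> powr (p - 1) * \<bar>b\<bar> - \<bar>a\<bar> powr p)"
    using 1 p by (intro add_mono mult_left_mono) auto
  also have "\<dots> = \<bar>a\<bar> powr p + p * \<bar>a\<bar> powr (p - 1) * (\<bar>b\<bar> - \<bar>a\<bar>)"
    by (simp add: 2[symmetric] algebra_simps)
  also have "\<dots> \<le> \<bar>b\<bar> powr p" using p by (intro powr_tangent) auto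
  finally show ?thesis .
qed

lemma spow_mono_ineq:
  assumes p: "2 < p" shows "0 \<le> (spow (p - 1) a - spow (p - 1) b) * (a - b)"
proof -
  have "p * (spow (p - 1) a * (b - a)) + p * (spow (p - 1) b * (a - b)) \<le> 0"
    using spow_subgradient[OF p, of a b] spow_subgradient[OF p, of b a] by (simp add: mult.assoc)
  then have "0 \<le> p * ((spow (p - 1) a - spow (p - 1) b) * (a - b))" by (simp add: algebra_simps)
  then show ?thesis using p by (simp add: zero_le_mult_iff)
qed

lemma powr_superadditive:
  assumes "0 \<le> s" "0 \<le> t" "1 \<le> (r::real)" shows "s powr r + t powr r \<le> (s + t) powr r"
proof -
  have "x powr r \<le> x * (s + t) powr (r - 1)" if "0 \<le> x" "x \<le> s + t" for x
  proof (cases "x = 0")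
    case False
    then have "x powr r = x * x powr (r - 1)" using that by (simp add: powr_mult_base)
    also have "\<dots> \<le> x * (s + t) powr (r - 1)"
      using that assms by (intro mult_left_mono powr_mono2) auto
    finally show ?thesis .
  qed simp
  from this[of s] this[of t] have "s powr r + t powr r \<le> (s + t) * (s + t) powr (r - 1)"
    using assms by (simp add: distrib_right)
  also have "\<dots> = (s + t) powr r"
    using assms by (cases "s + t = 0") (simp_all add: powr_mult_base)
  finally show ?thesis .
qed

text \<open>Take squares as variables and r = p / 2: superadditivity of t^r, then the parallelogram
  identity, then convexity of t^r at the mean of a^2 and b^2.\<close>

lemma clarkson_real:
  fixes a b p :: real
  assumes p: "2 < p"
  shows "\<bar>(a + b) / 2\<bar> powr p + \<bar>(a - b) / 2\<bar> powr p \<le> (\<bar>a\<bar> powr p + \<bar>b\<bar> powr p) / 2"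
proof -
  define r where "r = p / 2"
  have r: "1 \<le> r" using p by (simp add: r_def)
  have sq: "(x\<^sup>2) powr r = \<bar>x\<bar> powr p" for x :: real
  proof -
    have "x\<^sup>2 = \<bar>x\<bar> powr 2" by (cases "x = 0") simp_all
    then have "(x\<^sup>2) powr r = \<bar>x\<bar> powr (2 * r)" by (simp only: powr_powr)
    then show ?thesis by (simp add: r_def)
  qed
  define m where "m = (a\<^sup>2 + b\<^sup>2) / 2"
  have "\<bar>(a + b) / 2\<bar> powr p + \<bar>(a - b) / 2\<bar> powr p
      = (((a + b) / 2)\<^sup>2) powr r + (((a - b) / 2)\<^sup>2) powr r" by (simp add: sq)
  also have "\<dots> \<le> (((a + b) / 2)\<^sup>2 + ((a - b) / 2)\<^sup>2) powr r"
    using r by (intro powr_superadditive) auto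
  also have "((a + b) / 2)\<^sup>2 + ((a - b) / 2)\<^sup>2 = m"
    by (simp add: m_def power2_eq_square field_simps)
  also have "m powr r \<le> ((a\<^sup>2) powr r + (b\<^sup>2) powr r) / 2"
  proof -
    have m: "0 \<le> m" by (simp add: m_def)
    have "m powr r + r * m powr (r - 1) * (a\<^sup>2 - m) \<le> (a\<^sup>2) powr r"
      "m powr r + r * m powr (r - 1) * (b\<^sup>2 - m) \<le> (b\<^sup>2) powr r"
      using r m by (intro powr_tangent; simp)+
    moreover have "r * m powr (r - 1) * (a\<^sup>2 - m) + r * m powr (r - 1) * (b\<^sup>2 - m) = 0"
      by (simp add: m_def field_simps)
    ultimately show ?thesis by simp
  qed
  finally show ?thesis by (simp add: sq)
qed

lemma abs_add_powr_le:
  assumes p: "0 < (p::real)"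
  shows "\<bar>a + b\<bar> powr p \<le> 2 powr p * (\<bar>a\<bar> powr p + \<bar>b\<bar> powr p)"
proof -
  have "\<bar>a + b\<bar> powr p \<le> (2 * max \<bar>a\<bar> \<bar>b\<bar>) powr p" using p by (intro powr_mono2) auto
  also have "\<dots> = 2 powr p * (max \<bar>a\<bar> \<bar>b\<bar>) powr p" by (simp add: powr_mult)
  also have "\<dots> \<le> 2 powr p * (\<bar>a\<bar> powr p + \<bar>b\<bar> powr p)"
    by (intro mult_left_mono) (auto simp: max_def)
  finally show ?thesis .
qed

lemma spow_mult_le:
  assumes p: "2 < p"
  shows "\<bar>spow (p - 1) a * b\<bar> \<le> \<bar>a\<bar> powr p + \<bar>b\<bar> powr p"
proof -
  define m where "m = max \<bar>a\<bar> \<bar>b\<bar>"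
  have m: "0 \<le> m" by (simp add: m_def)
  have "\<bar>spow (p - 1) a * b\<bar> = \<bar>a\<bar> powr (p - 1) * \<bar>b\<bar>" using p by (simp add: abs_mult abs_spow)
  also have "\<dots> \<le> m powr (p - 1) * m" using p by (intro mult_mono powr_mono2) (auto simp: m_def)
  also have "\<dots> = m powr p" using m p by (cases "m = 0") (simp_all add: powr_mult_base mult.commute)
  also have "\<dots> \<le> \<bar>a\<bar> powr p + \<bar>b\<bar> powr p" by (auto simp: m_def max_def)
  finally show ?thesis .
qed

text \<open>Both \<open>\<bar>a\<bar>\<^bsup>p-2\<^esup>a\<close> and \<open>\<bar>a\<bar>\<^bsup>p/2-1\<^esup>a\<close> have increments comparable to \<open>\<bar>a - b\<bar>\<close> times the
  power of the larger argument. Hence the monotonicity gap of the first is comparable to the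
  squared increment of the second, and squared increments chain by Cauchy-Schwarz.\<close>

lemma spow_increment:
  assumes r: "1 \<le> r" and ab: "\<bar>b\<bar> \<le> \<bar>a\<bar>"
  shows "\<bar>a\<bar> powr (r - 1) * \<bar>a - b\<bar> / 2 \<le> \<bar>spow r a - spow r b\<bar>"
    and "\<bar>spow r a - spow r b\<bar> \<le> (r + 2) * (\<bar>a\<bar> powr (r - 1) * \<bar>a - b\<bar>)"
proof -
  have *: "a powr (r - 1) * \<bar>a - b\<bar> / 2 \<le> \<bar>spow r a - spow r b\<bar> \<and>
      \<bar>spow r a - spow r b\<bar> \<le> (r + 2) * (a powr (r - 1) * \<bar>a - b\<bar>)"
    if a: "0 < a" "\<bar>b\<bar> \<le> a" for a b
  proof -
    have ar: "a powr (r - 1) * a = a powr r" using a by (simp add: powr_mult_base mult.commute)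
    have sa: "spow r a = a powr r" using a r by (simp add: spow_nonneg_eq)
    show ?thesis
    proof (cases "0 \<le> b")
      case True
      then have b: "0 \<le> b" "b \<le> a" using a by auto
      have sb: "spow r b = b powr r" using b r by (simp add: spow_nonneg_eq)
      have "b powr r \<le> a powr (r - 1) * b"
      proof (cases "b = 0")
        case False
        then have "b powr r = b powr (r - 1) * b" using b by (simp add: powr_mult_base mult.commute)
        then show ?thesis using b r by (auto intro!: mult_right_mono powr_mono2)
      qed simp
      then have lo: "a powr (r - 1) * (a - b) \<le> a powr r - b powr r" using ar by (simp add: right_diff_distrib)
      have "a powr r + r * a powr (r - 1) * (b - a) \<le> b powr r"
        using b r a by (intro powr_tangent) auto
      then have hi: "a powr r - b powr r \<le> r * (a powr (r - 1) * (a - b))" by (simp add: algebra_simps)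
      have nn: "0 \<le> a powr (r - 1) * (a - b)" using b by simp
      have e1: "spow r a - spow r b = a powr r - b powr r" by (simp add: sa sb)
      have e2: "\<bar>a - b\<bar> = a - b" using b by simp
      have e3: "(r + 2) * (a powr (r - 1) * (a - b)) = r * (a powr (r - 1) * (a - b)) + 2 * (a powr (r - 1) * (a - b))"
        by (rule distrib_right)
      show ?thesis unfolding e1 e2 e3 using lo hi nn by linarith
    next
      case False
      then have b: "b < 0" "- b \<le> a" using a by auto
      have sb: "spow r b = - ((- b) powr r)"
        using spow_minus[of r "- b"] spow_nonneg_eq[of "- b" r] b r by simp
      have bb: "0 \<le> (- b) powr r" "(- b) powr r \<le> a powr r" using b r by (auto intro: powr_mono2)
      have 1: "a powr (r - 1) * a \<le> a powr (r - 1) * (a - b)" "a powr (r - 1) * (a - b) \<le> a powr (r - 1) * (2 * a)"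
        using b by (intro mult_left_mono; simp)+
      have "0 \<le> r * (a powr (r - 1) * (a - b))" using b a r by simp
      moreover have e3: "(r + 2) * (a powr (r - 1) * (a - b)) = r * (a powr (r - 1) * (a - b)) + 2 * (a powr (r - 1) * (a - b))"
        by (rule distrib_right)
      have e2: "\<bar>a - b\<bar> = a - b" using b a by simp
      have e1: "spow r a - spow r b = a powr r + (- b) powr r" by (simp add: sa sb)
      have "a powr (r - 1) * (2 * a) = 2 * a powr r" using ar by simp
      ultimately show ?thesis unfolding e1 e2 e3 using 1 bb ar by linarith
    qed
  qed
  consider "a = 0" | "0 < a" | "a < 0" by linarith
  then have "\<bar>a\<bar> powr (r - 1) * \<bar>a - b\<bar> / 2 \<le> \<bar>spow r a - spow r b\<bar> \<and>
      \<bar>spow r a - spow r b\<bar> \<le> (r + 2) * (\<bar>a\<bar> powr (r - 1) * \<bar>a - b\<bar>)"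
  proof cases
    case 1
    then show ?thesis using ab by simp
  next
    case 2
    then show ?thesis using *[of a b] ab by simp
  next
    case 3
    have "\<bar>- spow r a + spow r b\<bar> = \<bar>spow r a - spow r b\<bar>" "\<bar>- a + b\<bar> = \<bar>a - b\<bar>" by linarith+
    then show ?thesis using *[of "- a" "- b"] ab 3 by (simp add: spow_minus)
  qed
  then show "\<bar>a\<bar> powr (r - 1) * \<bar>a - b\<bar> / 2 \<le> \<bar>spow r a - spow r b\<bar>"
    "\<bar>spow r a - spow r b\<bar> \<le> (r + 2) * (\<bar>a\<bar> powr (r - 1) * \<bar>a - b\<bar>)" by auto
qed

lemma spow_gap_equiv:
  assumes p: "2 < p"
  shows "(spow (p - 1) a - spow (p - 1) b) * (a - b) \<le> 4 * (p + 1) * (spow (p / 2) a - spow (p / 2) b)\<^sup>2"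
    and "(spow (p / 2) a - spow (p / 2) b)\<^sup>2 \<le> 2 * (p / 2 + 2)\<^sup>2 * ((spow (p - 1) a - spow (p - 1) b) * (a - b))"
proof -
  have main: "(spow (p - 1) a - spow (p - 1) b) * (a - b) \<le> 4 * (p + 1) * (spow (p / 2) a - spow (p / 2) b)\<^sup>2 \<and>
     (spow (p / 2) a - spow (p / 2) b)\<^sup>2 \<le> 2 * (p / 2 + 2)\<^sup>2 * ((spow (p - 1) a - spow (p - 1) b) * (a - b))"
    if ab: "\<bar>b\<bar> \<le> \<bar>a\<bar>" for a b
  proof -
    \<comment> \<open>Everything is compared with X: X / 2 <= e <= (p + 1) X for the gap e, and X /
      4 <= d^2 <= (p / 2 + 2)^2 X for the increment d. Combining these pairs produces the constants
      of the lemma.\<close>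
    define X where "X = \<bar>a\<bar> powr (p - 2) * \<bar>a - b\<bar> ^ 2"
    have p1: "p - 1 - 1 = p - 2" "p - 1 + 2 = p + 1" by simp_all
    define e where "e = (spow (p - 1) a - spow (p - 1) b) * (a - b)"
    define d where "d = \<bar>spow (p / 2) a - spow (p / 2) b\<bar>"
    have ee: "e = \<bar>spow (p - 1) a - spow (p - 1) b\<bar> * \<bar>a - b\<bar>"
      using spow_mono_ineq[OF p, of a b] unfolding e_def abs_mult[symmetric] by (simp only: abs_of_nonneg)
    have inc1: "\<bar>a\<bar> powr (p - 2) * \<bar>a - b\<bar> / 2 \<le> \<bar>spow (p - 1) a - spow (p - 1) b\<bar>"
      "\<bar>spow (p - 1) a - spow (p - 1) b\<bar> \<le> (p + 1) * (\<bar>a\<bar> powr (p - 2) * \<bar>a - b\<bar>)"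
      using spow_increment[of "p - 1" b a] p ab by (simp_all only: p1)
    have X: "X = (\<bar>a\<bar> powr (p - 2) * \<bar>a - b\<bar>) * \<bar>a - b\<bar>"
      by (simp only: X_def power2_eq_square mult.assoc)
    have e1: "X / 2 \<le> e"
      using mult_right_mono[OF inc1(1), of "\<bar>a - b\<bar>"] unfolding ee X by simp
    have e2: "e \<le> (p + 1) * X"
      using mult_right_mono[OF inc1(2), of "\<bar>a - b\<bar>"] unfolding ee X by (simp only: mult.assoc abs_ge_zero)
    define Y where "Y = \<bar>a\<bar> powr (p / 2 - 1) * \<bar>a - b\<bar>"
    have Y2: "Y ^ 2 = X"
    proof -
      have "(\<bar>a\<bar> powr (p / 2 - 1))\<^sup>2 = \<bar>a\<bar> powr (p - 2)"
        by (simp add: power2_eq_square powr_add[symmetric])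
      then show ?thesis by (simp add: Y_def X_def power_mult_distrib)
    qed
    have Y0: "0 \<le> Y" by (simp add: Y_def)
    have inc2: "Y / 2 \<le> d" "d \<le> (p / 2 + 2) * Y"
      using spow_increment[of "p / 2" b a] p ab by (simp_all add: d_def Y_def)
    have d1: "X / 4 \<le> d ^ 2" using power_mono[OF inc2(1), of 2] Y0 by (simp add: power_divide Y2)
    have d2: "d ^ 2 \<le> (p / 2 + 2)\<^sup>2 * X" using power_mono[OF inc2(2), of 2] by (simp add: power_mult_distrib Y2 d_def)
    have "e \<le> 4 * (p + 1) * d ^ 2"
    proof -
      have "(p + 1) * X \<le> (p + 1) * (4 * d ^ 2)" using d1 p by (intro mult_left_mono) auto
      then show ?thesis using e2 by (simp add: algebra_simps)
    qed
    moreover have "d ^ 2 \<le> 2 * (p / 2 + 2)\<^sup>2 * e"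
    proof -
      have "(p / 2 + 2)\<^sup>2 * X \<le> (p / 2 + 2)\<^sup>2 * (2 * e)" using e1 by (intro mult_left_mono) auto
      then show ?thesis using d2 by simp
    qed
    ultimately show ?thesis by (simp add: e_def d_def)
  qed
  have sym: "(spow (p - 1) b - spow (p - 1) a) * (b - a) = (spow (p - 1) a - spow (p - 1) b) * (a - b)"
    "(spow (p / 2) b - spow (p / 2) a)\<^sup>2 = (spow (p / 2) a - spow (p / 2) b)\<^sup>2"
    by (simp_all add: algebra_simps power2_commute)
  show "(spow (p - 1) a - spow (p - 1) b) * (a - b) \<le> 4 * (p + 1) * (spow (p / 2) a - spow (p / 2) b)\<^sup>2"
    "(spow (p / 2) a - spow (p / 2) b)\<^sup>2 \<le> 2 * (p / 2 + 2)\<^sup>2 * ((spow (p - 1) a - spow (p - 1) b) * (a - b))"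
    using main[of b a] main[of a b] sym by (cases "\<bar>b\<bar> \<le> \<bar>a\<bar>"; simp)+
qed

text \<open>Pass to squared increments of the power p / 2, bound the square of a telescoping sum by
  n times the sum of squares, and pass back. The constant is the product of the comparison constants
  4 (p + 1) and 2 (p / 2 + 2)^2.\<close>

lemma spow_chain:
  fixes a :: "nat \<Rightarrow> real"
  assumes p: "2 < p"
  shows "(spow (p - 1) (a 0) - spow (p - 1) (a n)) * (a 0 - a n)
    \<le> 8 * (p + 1) * (p / 2 + 2)\<^sup>2 * n * (\<Sum>k<n. (spow (p - 1) (a k) - spow (p - 1) (a (Suc k))) * (a k - a (Suc k)))"
proof -
  let ?g = "\<lambda>k. spow (p / 2) (a k)"
  have "?g 0 - ?g n = (\<Sum>k<n. (?g k - ?g (Suc k)) * 1)"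
    using sum_lessThan_telescope'[of ?g n] by simp
  then have "(?g 0 - ?g n)\<^sup>2 \<le> (\<Sum>k<n. (?g k - ?g (Suc k))\<^sup>2) * (\<Sum>k<n. 1\<^sup>2)"
    using Cauchy_Schwarz_ineq_sum[of "\<lambda>k. ?g k - ?g (Suc k)" "\<lambda>k. 1" "{..<n}"] by simp
  also have "\<dots> = n * (\<Sum>k<n. (?g k - ?g (Suc k))\<^sup>2)" by simp
  also have "\<dots> \<le> n * (\<Sum>k<n. 2 * (p / 2 + 2)\<^sup>2 * ((spow (p - 1) (a k) - spow (p - 1) (a (Suc k))) * (a k - a (Suc k))))"
    by (intro mult_left_mono sum_mono spow_gap_equiv[OF p]) auto
  also have "\<dots> = n * (2 * (p / 2 + 2)\<^sup>2 * (\<Sum>k<n. (spow (p - 1) (a k) - spow (p - 1) (a (Suc k))) * (a k - a (Suc k))))"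
    by (simp only: sum_distrib_left)
  finally have "4 * (p + 1) * (?g 0 - ?g n)\<^sup>2 \<le> 4 * (p + 1) *
      (n * (2 * (p / 2 + 2)\<^sup>2 * (\<Sum>k<n. (spow (p - 1) (a k) - spow (p - 1) (a (Suc k))) * (a k - a (Suc k)))))"
    using p by (intro mult_left_mono) auto
  also have "\<dots> = 8 * (p + 1) * (p / 2 + 2)\<^sup>2 * n * (\<Sum>k<n. (spow (p - 1) (a k) - spow (p - 1) (a (Suc k))) * (a k - a (Suc k)))"
    by (simp add: algebra_simps del: sum_distrib_left)
  finally show ?thesis using spow_gap_equiv(1)[OF p, of "a 0" "a n"] by (rule order_trans[rotated])
qed

section \<open>The nonlocal energy\<close>

lemma sigma_finite_lebesgue: "sigma_finite_measure (lebesgue :: 'a::euclidean_space measure)"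
proof
  have "\<Union>(range (\<lambda>n::nat. ball (0::'a) (real n))) = UNIV"
  proof (intro set_eqI iffI UNIV_I)
    fix x :: 'a
    obtain n :: nat where "norm x < n" using reals_Archimedean2 by blast
    then show "x \<in> \<Union>(range (\<lambda>n::nat. ball (0::'a) (real n)))" by auto
  qed
  then show "\<exists>A::'a set set. countable A \<and> A \<subseteq> sets lebesgue \<and> \<Union>A = space lebesgue \<and> (\<forall>a\<in>A. emeasure lebesgue a \<noteq> \<infinity>)"
    by (intro exI[of _ "range (\<lambda>n::nat. ball (0::'a) (real n))"])
      (auto simp: top.not_eq_extremum emeasure_lborel_ball_finite[unfolded infinity_ennreal_def])
qed

interpretation lebesgue: sigma_finite_measure "lebesgue :: 'a::euclidean_space measure"
  by (rule sigma_finite_lebesgue)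

interpretation lebesgue_pair: pair_sigma_finite "lebesgue :: 'a::euclidean_space measure" "lebesgue :: 'a measure" ..

lemma ident_lebesgue_measurable [measurable]: "(\<lambda>x::'a::euclidean_space. x) \<in> borel_measurable lebesgue"
  by (simp add: measurable_completion)

lemma norm_diff_lebesgue_pair [measurable]:
  "(\<lambda>z. norm (fst z - snd z)) \<in> borel_measurable (lebesgue \<Otimes>\<^sub>M (lebesgue :: 'a::euclidean_space measure))"
proof -
  have [measurable]: "fst \<in> borel_measurable (lebesgue \<Otimes>\<^sub>M (lebesgue :: 'a measure))"
    "snd \<in> borel_measurable (lebesgue \<Otimes>\<^sub>M (lebesgue :: 'a measure))"
    using measurable_compose[OF measurable_fst ident_lebesgue_measurable]
      measurable_compose[OF measurable_snd ident_lebesgue_measurable] by auto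
  show ?thesis by measurable
qed

text \<open>The singular weight is absorbed into a measure on pairs, so that the energy is the p-th
  power of a plain L^p norm of \<open>jump u\<close>. On the diagonal the density is 1 / 0 =
  0.\<close>

definition kernel_measure :: "real \<Rightarrow> ('a::euclidean_space \<times> 'a) measure" where
  "kernel_measure \<alpha> = density (lebesgue \<Otimes>\<^sub>M lebesgue) (\<lambda>z. ennreal (1 / norm (fst z - snd z) powr \<alpha>))"

definition jump :: "('a \<Rightarrow> real) \<Rightarrow> 'a \<times> 'a \<Rightarrow> real" where "jump u z = u (fst z) - u (snd z)"

lemma sets_kernel_measure [measurable_cong]: "sets (kernel_measure \<alpha>) = sets (lebesgue \<Otimes>\<^sub>M lebesgue)"
  by (simp add: kernel_measure_def)

lemma jump_measurable_pair [measurable]: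
  "u \<in> borel_measurable lebesgue \<Longrightarrow> jump u \<in> borel_measurable (lebesgue \<Otimes>\<^sub>M lebesgue)"
  unfolding jump_def[abs_def]
  by (intro borel_measurable_diff measurable_compose[OF measurable_fst] measurable_compose[OF measurable_snd])

lemma jump_measurable [measurable]:
  "u \<in> borel_measurable lebesgue \<Longrightarrow> jump u \<in> borel_measurable (kernel_measure \<alpha>)"
  using jump_measurable_pair[of u] by (simp add: measurable_cong_sets[OF sets_kernel_measure refl])

text \<open>Pairs with one component in a null set form a null set of the product, and the kernel
  measure has a density with respect to it. Functions may thus be changed on null sets inside
  \<open>jump\<close>.\<close>

lemma AE_kernel_measure:
  assumes "AE x in lebesgue. Q x"
  shows "AE z in kernel_measure \<alpha>. Q (fst z) \<and> Q (snd z)"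
proof -
  obtain N where N: "N \<in> null_sets lebesgue" "{x \<in> space lebesgue. \<not> Q x} \<subseteq> N"
    using assms by (auto simp: eventually_ae_filter)
  have N1: "N \<times> UNIV \<in> null_sets (lebesgue \<Otimes>\<^sub>M lebesgue)"
    using N(1) lebesgue.emeasure_pair_measure_Times[of N lebesgue UNIV]
    by (auto simp: null_sets_def)
  have N2: "UNIV \<times> N \<in> null_sets (lebesgue \<Otimes>\<^sub>M lebesgue)"
    using N(1) lebesgue.emeasure_pair_measure_Times[of UNIV lebesgue N]
    by (auto simp: null_sets_def)
  have "AE z in lebesgue \<Otimes>\<^sub>M lebesgue. Q (fst z) \<and> Q (snd z)"
    by (rule AE_I'[OF null_sets.Un[OF N1 N2]]) (use N(2) in \<open>auto simp: space_pair_measure\<close>)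
  then show ?thesis unfolding kernel_measure_def
    by (subst AE_density) (auto elim: eventually_mono)
qed

lemma jump_AE_cong:
  "AE x in lebesgue. u x = v x \<Longrightarrow> AE z in kernel_measure \<alpha>. jump u z = jump v z"
  by (drule AE_kernel_measure[of _ \<alpha>]) (auto simp: jump_def elim: eventually_mono)

lemma jump_AE_tendsto:
  assumes "AE x in lebesgue. (\<lambda>n. u n x) \<longlonglongrightarrow> v x"
  shows "AE z in kernel_measure \<alpha>. (\<lambda>n. jump (u n) z) \<longlonglongrightarrow> jump v z"
  using AE_kernel_measure[OF assms, of \<alpha>] by eventually_elim (simp add: jump_def tendsto_diff)

lemma jump_add: "jump (\<lambda>x. u x + v x) z = jump u z + jump v z" by (simp add: jump_def)
lemma jump_diff: "jump (\<lambda>x. u x - v x) z = jump u z - jump v z" by (simp add: jump_def)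
lemma jump_scale: "jump (\<lambda>x. c * u x) z = c * jump u z" by (simp add: jump_def algebra_simps)
lemma jump_zero [simp]: "jump (\<lambda>x. 0) z = 0" by (simp add: jump_def)

definition energy :: "real \<Rightarrow> real \<Rightarrow> ('a::euclidean_space \<Rightarrow> real) \<Rightarrow> ennreal" where
  "energy p \<alpha> u = (\<integral>\<^sup>+z. ennreal (\<bar>jump u z\<bar> powr p) \<partial>kernel_measure \<alpha>)"

lemma energy_pair:
  assumes [measurable]: "u \<in> borel_measurable lebesgue"
  shows "energy p \<alpha> u = (\<integral>\<^sup>+z. ennreal (\<bar>jump u z\<bar> powr p / norm (fst z - snd z) powr \<alpha>) \<partial>(lebesgue \<Otimes>\<^sub>M lebesgue))"
  unfolding energy_def kernel_measure_def
  by (subst nn_integral_density) (auto intro!: nn_integral_cong simp: ennreal_mult''[symmetric])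

lemma J_energy_eq:
  fixes u :: "'a::euclidean_space \<Rightarrow> real"
  assumes "u \<in> borel_measurable lebesgue"
  shows "J_energy p s u = ennreal (1 / p) * energy p (real DIM('a) + s * p) u"
  unfolding J_energy_def energy_pair[OF assms] by (simp add: jump_def case_prod_unfold)

lemma energy_form_eq:
  fixes u \<phi> :: "'a::euclidean_space \<Rightarrow> real"
  assumes [measurable]: "u \<in> borel_measurable lebesgue" "\<phi> \<in> borel_measurable lebesgue"
  shows "(LINT (x, y)|(lebesgue \<Otimes>\<^sub>M lebesgue).
      \<bar>u x - u y\<bar> powr (p - 2) * (u x - u y) * (\<phi> x - \<phi> y) / norm (x - y) powr \<alpha>)
    = (LINT z|kernel_measure \<alpha>. spow (p - 1) (jump u z) * jump \<phi> z)"
  unfolding kernel_measure_def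
  by (subst integral_density)
    (auto intro!: Bochner_Integration.integral_cong simp: jump_def spow_def case_prod_beta)

section \<open>Integrability of the kernel and finiteness of the energy\<close>

lemma dyadic_small:
  assumes "0 < r" "r \<le> (1::real)"
  obtains k :: nat where "(1/2) ^ Suc k < r" "r \<le> (1/2) ^ k"
proof -
  define n where "n = (LEAST n. (1/2::real) ^ n < r)"
  obtain m where "(1/2::real) ^ m < r" using real_arch_pow_inv[of r "1/2"] assms by auto
  then have n: "(1/2::real) ^ n < r" unfolding n_def by (rule LeastI)
  then have "n \<noteq> 0" using assms by (intro notI) simp
  then obtain k where k: "n = Suc k" using not0_implies_Suc by blast
  then have "\<not> (1/2::real) ^ k < r" using not_less_Least[of k "\<lambda>n. (1/2::real) ^ n < r"] by (auto simp: n_def)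
  then show ?thesis using that[of k] n k by simp
qed

lemma dyadic_large:
  assumes "1 \<le> (r::real)"
  obtains k :: nat where "2 ^ k \<le> r" "r < 2 ^ Suc k"
proof -
  define n where "n = (LEAST n. r < (2::real) ^ n)"
  obtain m where "r < (2::real) ^ m" using real_arch_pow[of 2 r] by auto
  then have n: "r < (2::real) ^ n" unfolding n_def by (rule LeastI)
  then have "n \<noteq> 0" using assms by (intro notI) simp
  then obtain k where k: "n = Suc k" using not0_implies_Suc by blast
  then have "\<not> r < (2::real) ^ k" using not_less_Least[of k "\<lambda>n. r < (2::real) ^ n"] by (auto simp: n_def)
  then show ?thesis using that[of k] n k by simp
qed

text \<open>A radial profile on N-dimensional space that is integrable at the origin when \<beta> >
  0 and at infinity when \<gamma> > 0. It is applied with \<beta> = p - s p and \<gamma> = s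
  p.\<close>

definition kernel_majorant :: "nat \<Rightarrow> real \<Rightarrow> real \<Rightarrow> real \<Rightarrow> real" where
  "kernel_majorant N \<beta> \<gamma> r = (if r < 1 then r powr (\<beta> - real N) else r powr - (real N + \<gamma>))"

lemma nn_integral_balls:
  fixes x :: "'a::euclidean_space"
  assumes "\<And>k. 0 \<le> c k" "\<And>k. 0 \<le> R k" "summable (\<lambda>k. c k * R k ^ DIM('a))"
  shows "(\<integral>\<^sup>+y. (\<Sum>k. ennreal (c k) * indicator (cball x (R k)) y) \<partial>lebesgue)
    = ennreal (unit_ball_vol (real DIM('a)) * (\<Sum>k. c k * R k ^ DIM('a)))"
proof -
  have [measurable]: "cball x (R k) \<in> sets borel" for k by simp
  have "(\<integral>\<^sup>+y. (\<Sum>k. ennreal (c k) * indicator (cball x (R k)) y) \<partial>lebesgue)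
      = (\<integral>\<^sup>+y. (\<Sum>k. ennreal (c k) * indicator (cball x (R k)) y) \<partial>lborel)"
    by (rule nn_integral_completion)
  also have "\<dots> = (\<Sum>k. \<integral>\<^sup>+y. ennreal (c k) * indicator (cball x (R k)) y \<partial>lborel)"
    by (rule nn_integral_suminf) measurable
  also have "\<dots> = (\<Sum>k. ennreal (unit_ball_vol (real DIM('a)) * (c k * R k ^ DIM('a))))"
    using assms by (intro suminf_cong)
      (simp add: nn_integral_cmult_indicator emeasure_cball ennreal_mult'[symmetric] mult_ac)
  also have "\<dots> = ennreal (\<Sum>k. unit_ball_vol (real DIM('a)) * (c k * R k ^ DIM('a)))"
    using assms by (intro suminf_ennreal2 summable_mult) auto
  finally show ?thesis using assms(3) by (simp add: suminf_mult)
qed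

text \<open>On the shells of radius about 2^-k and 2^k the profile is at most a k and b k, and each
  shell lies in a ball of comparable radius. Constant times volume gives geometric series with
  ratios 2^-\<beta> and 2^-\<gamma>, uniformly in x.\<close>

lemma kernel_majorant_integral:
  assumes \<beta>: "0 < \<beta>" and \<gamma>: "0 < \<gamma>"
  shows "\<exists>C. \<forall>x::'a::euclidean_space. (\<integral>\<^sup>+y. ennreal (kernel_majorant DIM('a) \<beta> \<gamma> (norm (x - y))) \<partial>lebesgue) \<le> ennreal C"
proof -
  define N where "N = DIM('a)"
  \<comment> \<open>Within one shell r varies by a factor of at most 2, hence its power \<beta> - N
    by at most this constant, whatever the sign of the exponent.\<close>
  define c where "c = 2 powr \<bar>\<beta> - real N\<bar>"
  define a where "a k = c * ((1/2) ^ k) powr (\<beta> - real N)" for k :: nat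
  define b where "b k = (2 ^ k) powr - (real N + \<gamma>)" for k :: nat
  have c: "0 < c" by (simp add: c_def)
  have pw: "((1/2::real) ^ k) ^ N = ((1/2) ^ k) powr real N" "((2::real) ^ k) ^ N = (2 ^ k) powr real N" for k
    by (simp_all add: powr_realpow)
  have sa: "summable (\<lambda>k. a k * ((1/2) ^ k) ^ N)"
  proof -
    have "a k * ((1/2) ^ k) ^ N = c * ((1/2) powr \<beta>) ^ k" for k
    proof -
      have "a k * ((1/2) ^ k) ^ N = c * ((1/2) ^ k) powr \<beta>"
        by (simp only: a_def pw mult.assoc powr_add[symmetric]) simp
      also have "((1/2::real) ^ k) powr \<beta> = ((1/2) powr \<beta>) ^ k"
        by (simp add: powr_realpow[symmetric] powr_powr mult.commute)
      finally show ?thesis .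
    qed
    moreover have "(1/2::real) powr \<beta> < 1" using powr_less_mono2[OF \<beta>, of "1/2" 1] by simp
    ultimately show ?thesis by (auto intro!: summable_mult summable_geometric)
  qed
  have sb: "summable (\<lambda>k. b k * (2 ^ Suc k) ^ N)"
  proof -
    have "b k * (2 ^ Suc k) ^ N = 2 ^ N * ((1/2) powr \<gamma>) ^ k" for k
    proof -
      have "b k * (2 ^ Suc k) ^ N = 2 ^ N * (b k * (2 ^ k) ^ N)" by (simp add: power_mult_distrib)
      also have "b k * (2 ^ k) ^ N = (2 ^ k) powr - \<gamma>"
        by (simp only: b_def pw powr_add[symmetric]) simp
      also have "((2::real) ^ k) powr - \<gamma> = ((1/2) powr \<gamma>) ^ k"
        by (simp add: powr_realpow[symmetric] powr_powr mult.commute powr_minus_divide powr_divide)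
      finally show ?thesis .
    qed
    then have eq: "(\<lambda>k. b k * (2 ^ Suc k) ^ N) = (\<lambda>k. 2 ^ N * ((1/2) powr \<gamma>) ^ k)" by (rule ext)
    have "(1/2::real) powr \<gamma> < 1" using powr_less_mono2[OF \<gamma>, of "1/2" 1] by simp
    then show ?thesis unfolding eq by (intro summable_mult summable_geometric) simp
  qed
  have point: "ennreal (kernel_majorant N \<beta> \<gamma> (norm (x - y)))
      \<le> (\<Sum>k. ennreal (a k) * indicator (cball x ((1/2)^k)) y) + (\<Sum>k. ennreal (b k) * indicator (cball x (2 ^ Suc k)) y)"
    for x y :: 'a
  proof -
    define r where "r = norm (x - y)"
    have ge: "f k \<le> (\<Sum>k. f k)" for k and f :: "nat \<Rightarrow> ennreal"
      using sum_le_suminf[of f "{k}"] by simp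
    consider "r = 0" | "0 < r" "r < 1" | "1 \<le> r" by (auto simp: r_def) (metis linorder_not_less norm_eq_zero right_minus_eq zero_less_norm_iff)
    then show ?thesis
    proof cases
      case 1
      then show ?thesis by (simp add: kernel_majorant_def r_def[symmetric])
    next
      case 2
      obtain k where k: "(1/2) ^ Suc k < r" "r \<le> (1/2) ^ k" using dyadic_small[of r] 2 by auto
      define t where "t = r / (1/2) ^ k"
      have t: "1/2 < t" "t \<le> 1" "r = t * (1/2) ^ k" using k by (auto simp: t_def field_simps)
      have "t powr (\<beta> - real N) \<le> c"
      proof (cases "0 \<le> \<beta> - real N")
        case True
        have "t powr (\<beta> - real N) \<le> 1 powr (\<beta> - real N)" using t True by (intro powr_mono2) auto
        also have "\<dots> \<le> c" by (simp add: c_def ge_one_powr_ge_zero)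
        finally show ?thesis .
      next
        case False
        have "t powr (\<beta> - real N) \<le> (1/2) powr (\<beta> - real N)" using t False by (intro powr_mono2') auto
        also have "\<dots> = c" using False by (simp add: c_def powr_divide powr_minus_divide[symmetric])
        finally show ?thesis .
      qed
      then have "r powr (\<beta> - real N) \<le> a k"
        unfolding a_def using t by (simp add: powr_mult mult_right_mono)
      then have "ennreal (kernel_majorant N \<beta> \<gamma> r) \<le> ennreal (a k) * indicator (cball x ((1/2)^k)) y"
        using 2 k by (simp add: kernel_majorant_def r_def dist_norm ennreal_leI)
      also have "\<dots> \<le> (\<Sum>k. ennreal (a k) * indicator (cball x ((1/2)^k)) y)" by (rule ge)
      finally show ?thesis unfolding r_def by (rule order_trans) simp
    next
      case 3
      obtain k where k: "2 ^ k \<le> r" "r < 2 ^ Suc k" using dyadic_large[of r] 3 by auto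
      have "r powr - (real N + \<gamma>) \<le> b k" unfolding b_def using k \<gamma> 3 by (intro powr_mono2') auto
      then have "ennreal (kernel_majorant N \<beta> \<gamma> r) \<le> ennreal (b k) * indicator (cball x (2 ^ Suc k)) y"
        using 3 k by (simp add: kernel_majorant_def r_def dist_norm ennreal_leI)
      also have "\<dots> \<le> (\<Sum>k. ennreal (b k) * indicator (cball x (2 ^ Suc k)) y)" by (rule ge)
      finally show ?thesis unfolding r_def by (rule order_trans) simp
    qed
  qed
  define C where "C = unit_ball_vol N * (\<Sum>k. a k * ((1/2) ^ k) ^ N) + unit_ball_vol N * (\<Sum>k. b k * (2 ^ Suc k) ^ N)"
  have "(\<integral>\<^sup>+y. ennreal (kernel_majorant N \<beta> \<gamma> (norm (x - y))) \<partial>lebesgue) \<le> ennreal C" for x :: 'a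
  proof -
    have [measurable]: "cball x t \<in> sets lebesgue" for t by simp
    have ab: "0 \<le> a k" "0 \<le> b k" for k using c by (auto simp: a_def b_def)
    have "(\<integral>\<^sup>+y. ennreal (kernel_majorant N \<beta> \<gamma> (norm (x - y))) \<partial>lebesgue)
        \<le> (\<integral>\<^sup>+y. (\<Sum>k. ennreal (a k) * indicator (cball x ((1/2)^k)) y) + (\<Sum>k. ennreal (b k) * indicator (cball x (2 ^ Suc k)) y) \<partial>lebesgue)"
      by (intro nn_integral_mono point)
    also have "\<dots> = (\<integral>\<^sup>+y. (\<Sum>k. ennreal (a k) * indicator (cball x ((1/2)^k)) y) \<partial>lebesgue)
        + (\<integral>\<^sup>+y. (\<Sum>k. ennreal (b k) * indicator (cball x (2 ^ Suc k)) y) \<partial>lebesgue)"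
      by (intro nn_integral_add) measurable
    also have "\<dots> = ennreal (unit_ball_vol N * (\<Sum>k. a k * ((1/2) ^ k) ^ N)) + ennreal (unit_ball_vol N * (\<Sum>k. b k * (2 ^ Suc k) ^ N))"
      using nn_integral_balls[of a "\<lambda>k. (1/2)^k" x] nn_integral_balls[of b "\<lambda>k. 2 ^ Suc k" x] ab sa sb
      by (simp add: N_def)
    also have "\<dots> = ennreal C"
      using ab sa sb unfolding C_def by (intro ennreal_plus[symmetric] mult_nonneg_nonneg suminf_nonneg) auto
    finally show ?thesis .
  qed
  then show ?thesis by (auto simp: N_def)
qed

text \<open>Near the diagonal the Lipschitz bound gives |x - y|^(p - s p - N), integrable since s <
  1; far from it boundedness gives |x - y|^(- N - s p), integrable since s > 0. The jump vanishes
  unless x or y lies in the support, which has finite measure.\<close>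

lemma energy_Cc_infinity_finite:
  fixes \<phi> :: "'a::euclidean_space \<Rightarrow> real"
  assumes s: "0 < s" "s < 1" and p: "0 < p" and \<phi>: "\<phi> \<in> Cc_infinity \<Omega>"
  shows "energy p (real DIM('a) + s * p) \<phi> < \<infinity>"
proof -
  define \<alpha> where "\<alpha> = real DIM('a) + s * p"
  define K where "K = closure {x. \<phi> x \<noteq> 0}"
  have K: "compact K" "\<And>x. \<phi> x \<noteq> 0 \<Longrightarrow> x \<in> K" using Cc_infinityD[OF \<phi>] by (auto simp: K_def)
  have [measurable]: "K \<in> sets lebesgue" using K(1) by (simp add: compact_imp_closed)
  have Kfin: "emeasure lebesgue K < \<infinity>" using lmeasurable_compact[OF K(1)] by (simp add: fmeasurable_def)
  have "\<phi> \<in> borel_measurable borel" using Cc_infinity_continuous[OF \<phi>] by (rule borel_measurable_continuous_onI)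
  then have [measurable]: "\<phi> \<in> borel_measurable lebesgue" by (simp add: measurable_completion)
  obtain B where B: "0 < B" "\<And>x. \<bar>\<phi> x\<bar> \<le> B" using Cc_infinity_bounded[OF \<phi>] by blast
  obtain L where L: "0 < L" "\<And>x y. \<bar>\<phi> x - \<phi> y\<bar> \<le> L * norm (x - y)" using Cc_infinity_lipschitz[OF \<phi>] by blast
  define h where "h r = kernel_majorant DIM('a) (p - s * p) (s * p) r" for r
  define A where "A = L powr p + (2 * B) powr p"
  have "0 < p - s * p" using s p by (simp add: algebra_simps)
  then obtain C where C: "\<And>x::'a. (\<integral>\<^sup>+y. ennreal (h (norm (x - y))) \<partial>lebesgue) \<le> ennreal C"
    using kernel_majorant_integral[of "p - s * p" "s * p"] s p unfolding h_def by auto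
  have [measurable]: "h \<in> borel_measurable borel" unfolding h_def[abs_def] kernel_majorant_def by measurable
  have bound: "\<bar>jump \<phi> z\<bar> powr p / norm (fst z - snd z) powr \<alpha> \<le> A * h (norm (fst z - snd z))" for z
  proof -
    define r where "r = norm (fst z - snd z)"
    have r: "0 \<le> r" by (simp add: r_def)
    have j1: "\<bar>jump \<phi> z\<bar> \<le> L * r" using L(2) by (simp add: jump_def r_def)
    have j2: "\<bar>jump \<phi> z\<bar> \<le> 2 * B"
      using B(2)[of "fst z"] B(2)[of "snd z"] unfolding jump_def by linarith
    show ?thesis
    proof (cases "r < 1")
      case True
      have "\<bar>jump \<phi> z\<bar> powr p \<le> (L * r) powr p" using j1 p by (intro powr_mono2) auto
      then have "\<bar>jump \<phi> z\<bar> powr p / r powr \<alpha> \<le> (L * r) powr p / r powr \<alpha>" by (intro divide_right_mono) auto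
      also have "\<dots> = L powr p * r powr (p - \<alpha>)" using r L by (simp add: powr_mult powr_diff)
      also have "r powr (p - \<alpha>) = h r" using True by (simp add: h_def kernel_majorant_def \<alpha>_def algebra_simps)
      also have "L powr p * h r \<le> A * h r"
        unfolding A_def by (intro mult_right_mono) (auto simp: h_def kernel_majorant_def)
      finally show ?thesis by (simp add: r_def)
    next
      case False
      have "\<bar>jump \<phi> z\<bar> powr p \<le> (2 * B) powr p" using j2 p by (intro powr_mono2) auto
      then have "\<bar>jump \<phi> z\<bar> powr p / r powr \<alpha> \<le> (2 * B) powr p / r powr \<alpha>" by (intro divide_right_mono) auto
      also have "h r = r powr - \<alpha>" using False by (simp add: h_def kernel_majorant_def \<alpha>_def)
      then have "(2 * B) powr p / r powr \<alpha> = (2 * B) powr p * h r" by (simp add: powr_minus_divide)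
      also have "\<dots> \<le> A * h r"
        unfolding A_def by (intro mult_right_mono) (auto simp: h_def kernel_majorant_def)
      finally show ?thesis by (simp add: r_def)
    qed
  qed
  have A0: "0 \<le> A" by (simp add: A_def)
  have "energy p \<alpha> \<phi> = (\<integral>\<^sup>+z. ennreal (\<bar>jump \<phi> z\<bar> powr p / norm (fst z - snd z) powr \<alpha>) \<partial>(lebesgue \<Otimes>\<^sub>M lebesgue))"
    by (rule energy_pair) measurable
  also have "\<dots> \<le> (\<integral>\<^sup>+z. ennreal A * (indicator K (fst z) * ennreal (h (norm (fst z - snd z))))
      + ennreal A * (indicator K (snd z) * ennreal (h (norm (fst z - snd z)))) \<partial>(lebesgue \<Otimes>\<^sub>M lebesgue))"
  proof (rule nn_integral_mono)
    fix z :: "'a \<times> 'a"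
    have hh: "0 \<le> h (norm (fst z - snd z))" by (simp add: h_def kernel_majorant_def)
    have "fst z \<in> K \<or> snd z \<in> K \<or> jump \<phi> z = 0"
      using K(2)[of "fst z"] K(2)[of "snd z"] unfolding jump_def by (cases "\<phi> (snd z) = 0") auto
    then consider "fst z \<in> K" | "snd z \<in> K" | "jump \<phi> z = 0" by blast
    then show "ennreal (\<bar>jump \<phi> z\<bar> powr p / norm (fst z - snd z) powr \<alpha>)
        \<le> ennreal A * (indicator K (fst z) * ennreal (h (norm (fst z - snd z))))
        + ennreal A * (indicator K (snd z) * ennreal (h (norm (fst z - snd z))))"
    proof cases
      case 1
      then show ?thesis using bound[of z] A0 hh
        by (intro order_trans[OF ennreal_leI[OF bound[of z]] add_increasing2]) (auto simp: ennreal_mult)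
    next
      case 2
      then show ?thesis using bound[of z] A0 hh
        by (intro order_trans[OF ennreal_leI[OF bound[of z]] add_increasing]) (auto simp: ennreal_mult)
    next
      case 3
      then show ?thesis using p by simp
    qed
  qed
  also have "\<dots> = ennreal A * (\<integral>\<^sup>+z. indicator K (fst z) * ennreal (h (norm (fst z - snd z))) \<partial>(lebesgue \<Otimes>\<^sub>M lebesgue))
      + ennreal A * (\<integral>\<^sup>+z. indicator K (snd z) * ennreal (h (norm (fst z - snd z))) \<partial>(lebesgue \<Otimes>\<^sub>M lebesgue))"
    by (subst nn_integral_add) (auto simp: nn_integral_cmult)
  also have "(\<integral>\<^sup>+z. indicator K (fst z) * ennreal (h (norm (fst z - snd z))) \<partial>(lebesgue \<Otimes>\<^sub>M lebesgue))
      = (\<integral>\<^sup>+x. \<integral>\<^sup>+y. indicator K x * ennreal (h (norm (x - y))) \<partial>lebesgue \<partial>lebesgue)"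
    by (subst lebesgue.nn_integral_fst[symmetric]) auto
  also have "(\<integral>\<^sup>+z. indicator K (snd z) * ennreal (h (norm (fst z - snd z))) \<partial>(lebesgue \<Otimes>\<^sub>M lebesgue))
      = (\<integral>\<^sup>+x. \<integral>\<^sup>+y. indicator K x * ennreal (h (norm (x - y))) \<partial>lebesgue \<partial>lebesgue)"
    by (subst lebesgue_pair.nn_integral_snd[symmetric]) (auto simp: norm_minus_commute)
  also have "(\<integral>\<^sup>+x. \<integral>\<^sup>+y. indicator K x * ennreal (h (norm (x - y))) \<partial>lebesgue \<partial>lebesgue) \<le> (\<integral>\<^sup>+x. ennreal C * indicator K x \<partial>lebesgue)"
  proof (rule nn_integral_mono)
    fix x :: 'a
    have "(\<lambda>y. ennreal (h (norm (x - y)))) \<in> borel_measurable lebesgue" by measurable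
    then have "(\<integral>\<^sup>+y. indicator K x * ennreal (h (norm (x - y))) \<partial>lebesgue) = indicator K x * (\<integral>\<^sup>+y. ennreal (h (norm (x - y))) \<partial>lebesgue)"
      by (rule nn_integral_cmult)
    also have "\<dots> \<le> indicator K x * ennreal C" using C by (rule mult_left_mono) simp
    finally show "(\<integral>\<^sup>+y. indicator K x * ennreal (h (norm (x - y))) \<partial>lebesgue) \<le> ennreal C * indicator K x" by (simp add: mult.commute)
  qed
  also have "(\<integral>\<^sup>+x. ennreal C * indicator K x \<partial>lebesgue) = ennreal C * emeasure lebesgue K"
    by (rule nn_integral_cmult_indicator) measurable
  finally have "energy p \<alpha> \<phi> \<le> ennreal A * (ennreal C * emeasure lebesgue K) + ennreal A * (ennreal C * emeasure lebesgue K)"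
    by (simp add: mult_left_mono add_mono)
  also have "\<dots> < \<infinity>" using Kfin by (auto simp: ennreal_mult_less_top)
  finally show ?thesis by (simp add: \<alpha>_def)
qed

text \<open>A ball B outside \<Omega> makes the energy see u itself: for x in \<Omega> and y in B
  the jump is u x and |x - y| <= d, so the integral over y is at least |u x|^p times the volume of B
  divided by d^\<alpha>.\<close>

lemma energy_poincare:
  fixes \<Omega> :: "'a::euclidean_space set"
  assumes "bounded \<Omega>" and \<alpha>: "0 \<le> \<alpha>" and p: "0 < p"
  shows "\<exists>c>0. \<forall>u. u \<in> borel_measurable lebesgue \<longrightarrow> (\<forall>x. x \<notin> \<Omega> \<longrightarrow> u x = 0) \<longrightarrow>
    (\<integral>\<^sup>+x. ennreal (\<bar>u x\<bar> powr p) \<partial>lebesgue) \<le> ennreal c * energy p \<alpha> u"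
proof -
  obtain R where R: "0 < R" "\<And>x. x \<in> \<Omega> \<Longrightarrow> norm x \<le> R" using assms(1) by (meson bounded_pos)
  obtain b :: 'a where b: "b \<in> Basis" using nonempty_Basis by blast
  \<comment> \<open>The open unit ball around a point of norm R + 1 avoids the closed ball of radius
    R, which contains \<Omega>.\<close>
  define B where "B = ball ((R + 1) *\<^sub>R b) 1"
  define d where "d = 2 * R + 2"
  have [measurable]: "B \<in> sets lebesgue" by (simp add: B_def)
  have B: "y \<notin> \<Omega>" "norm y \<le> R + 2" if "y \<in> B" for y
  proof -
    have "norm ((R + 1) *\<^sub>R b) = R + 1" using b R by simp
    moreover have "norm ((R + 1) *\<^sub>R b - y) < 1" using that by (simp add: B_def dist_norm)
    ultimately have "R < norm y" "norm y < R + 2"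
      using norm_triangle_ineq2[of "(R + 1) *\<^sub>R b" y] norm_triangle_ineq2[of y "(R + 1) *\<^sub>R b"]
      by (auto simp: norm_minus_commute)
    then show "y \<notin> \<Omega>" "norm y \<le> R + 2" using R(2) by fastforce+
  qed
  define v where "v = measure lebesgue B"
  have v: "0 < v" unfolding v_def B_def using content_ball_pos[of 1] by (simp add: measure_completion)
  have vB: "emeasure lebesgue B = ennreal v"
    unfolding v_def B_def by (intro emeasure_eq_measure2 lmeasurable_ball)
  define c where "c = d powr \<alpha> / v"
  have d: "0 < d" using R by (simp add: d_def)
  have main: "(\<integral>\<^sup>+x. ennreal (\<bar>u x\<bar> powr p) \<partial>lebesgue) \<le> ennreal c * energy p \<alpha> u"
    if [measurable]: "u \<in> borel_measurable lebesgue" and u: "\<And>x. x \<notin> \<Omega> \<Longrightarrow> u x = 0" for u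
  proof -
    have "(\<integral>\<^sup>+x. ennreal (\<bar>u x\<bar> powr p) \<partial>lebesgue) * ennreal (v / d powr \<alpha>)
        = (\<integral>\<^sup>+x. ennreal (\<bar>u x\<bar> powr p) * ennreal (v / d powr \<alpha>) \<partial>lebesgue)"
      by (rule nn_integral_multc[symmetric]) measurable
    also have "\<dots> \<le> (\<integral>\<^sup>+x. \<integral>\<^sup>+y. ennreal (\<bar>jump u (x, y)\<bar> powr p / norm (x - y) powr \<alpha>) \<partial>lebesgue \<partial>lebesgue)"
    proof (rule nn_integral_mono)
      fix x
      have "ennreal (\<bar>u x\<bar> powr p) * ennreal (v / d powr \<alpha>) = ennreal (\<bar>u x\<bar> powr p / d powr \<alpha>) * emeasure lebesgue B"
        using v d by (simp add: vB ennreal_mult''[symmetric] mult_ac)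
      also have "\<dots> = (\<integral>\<^sup>+y. ennreal (\<bar>u x\<bar> powr p / d powr \<alpha>) * indicator B y \<partial>lebesgue)"
        by (rule nn_integral_cmult_indicator[symmetric]) measurable
      also have "\<dots> \<le> (\<integral>\<^sup>+y. ennreal (\<bar>jump u (x, y)\<bar> powr p / norm (x - y) powr \<alpha>) \<partial>lebesgue)"
      proof (rule nn_integral_mono)
        fix y
        show "ennreal (\<bar>u x\<bar> powr p / d powr \<alpha>) * indicator B y \<le> ennreal (\<bar>jump u (x, y)\<bar> powr p / norm (x - y) powr \<alpha>)"
        proof (cases "y \<in> B \<and> x \<in> \<Omega>")
          case True
          then have "norm (x - y) \<le> d" "x \<noteq> y"
            using norm_triangle_ineq4[of x y] R(2)[of x] B[of y] by (auto simp: d_def)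
          then have "norm (x - y) powr \<alpha> \<le> d powr \<alpha>" "0 < norm (x - y) powr \<alpha>"
            using \<alpha> by (auto intro: powr_mono2)
          moreover have "0 < d powr \<alpha>" using d by simp
          moreover have "jump u (x, y) = u x" using B(1)[of y] True u by (simp add: jump_def)
          ultimately show ?thesis using True by (auto intro!: ennreal_leI divide_left_mono)
        next
          case False
          then show ?thesis using u[of x] p by (auto simp: indicator_def)
        qed
      qed
      finally show "ennreal (\<bar>u x\<bar> powr p) * ennreal (v / d powr \<alpha>)
          \<le> (\<integral>\<^sup>+y. ennreal (\<bar>jump u (x, y)\<bar> powr p / norm (x - y) powr \<alpha>) \<partial>lebesgue)" .
    qed
    also have "\<dots> = energy p \<alpha> u"
      unfolding energy_pair[OF that(1)] by (subst lebesgue.nn_integral_fst[symmetric]) auto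
    finally have "(\<integral>\<^sup>+x. ennreal (\<bar>u x\<bar> powr p) \<partial>lebesgue) * ennreal (v / d powr \<alpha>) \<le> energy p \<alpha> u" .
    then have "ennreal c * ((\<integral>\<^sup>+x. ennreal (\<bar>u x\<bar> powr p) \<partial>lebesgue) * ennreal (v / d powr \<alpha>)) \<le> ennreal c * energy p \<alpha> u"
      by (rule mult_left_mono) simp
    moreover have "ennreal c * ennreal (v / d powr \<alpha>) = 1"
      using v d by (simp add: c_def ennreal_mult''[symmetric])
    ultimately show ?thesis by (metis mult.commute mult.left_commute mult_1)
  qed
  have c: "0 < c" using v d by (simp add: c_def)
  show ?thesis
  proof (intro exI conjI allI impI)
    show "0 < c" by (rule c)
    fix u :: "'a \<Rightarrow> real" assume "u \<in> borel_measurable lebesgue" "\<forall>x. x \<notin> \<Omega> \<longrightarrow> u x = 0"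
    then show "(\<integral>\<^sup>+x. ennreal (\<bar>u x\<bar> powr p) \<partial>lebesgue) \<le> ennreal c * energy p \<alpha> u"
      by (intro main) blast+
  qed
qed

section \<open>The fractional Sobolev space\<close>

lemma ennreal_tendsto_0_iff:
  "(f \<longlongrightarrow> (0::ennreal)) F \<longleftrightarrow> (\<forall>e>0. eventually (\<lambda>x. f x < ennreal e) F)"
proof
  assume "\<forall>e>0. eventually (\<lambda>x. f x < ennreal e) F"
  then show "(f \<longlongrightarrow> 0) F"
  proof (intro order_tendstoI)
    fix a :: ennreal assume *: "\<forall>e>0. eventually (\<lambda>x. f x < ennreal e) F" "0 < a"
    obtain e where e: "0 < e" "ennreal e \<le> a"
    proof (cases a)
      case (real r)
      then show ?thesis using *(2) that[of r] by auto
    qed (use that[of 1] in auto)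
    show "eventually (\<lambda>x. f x < a) F"
      using *(1)[rule_format, OF e(1)] by eventually_elim (use e(2) less_le_trans in auto)
  qed simp
qed (auto intro: order_tendstoD)

lemma ennroot_less_iff:
  assumes "0 < q" "0 < e" shows "ennroot q x < ennreal e \<longleftrightarrow> x < ennreal (e powr q)"
proof (cases x)
  case (real r)
  have "r powr (1 / q) < e \<longleftrightarrow> r < e powr q"
  proof
    assume "r powr (1 / q) < e"
    then have "(r powr (1 / q)) powr q < e powr q" using assms by (intro powr_less_mono2) auto
    then show "r < e powr q" using real assms by (simp add: powr_powr)
  next
    assume "r < e powr q"
    then have "r powr (1 / q) < (e powr q) powr (1 / q)" using real assms by (intro powr_less_mono2) auto
    then show "r powr (1 / q) < e" using assms by (simp add: powr_powr)
  qed
  then show ?thesis using real by (simp add: ennroot_def ennreal_less_iff)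
qed (simp add: ennroot_def)

lemma ennroot_tendsto_0_iff:
  assumes "0 < q" shows "((\<lambda>x. ennroot q (f x)) \<longlongrightarrow> 0) F \<longleftrightarrow> (f \<longlongrightarrow> 0) F"
proof
  assume *: "((\<lambda>x. ennroot q (f x)) \<longlongrightarrow> 0) F"
  show "(f \<longlongrightarrow> 0) F" unfolding ennreal_tendsto_0_iff
  proof (intro allI impI)
    fix e :: real assume "0 < e"
    then have "eventually (\<lambda>x. ennroot q (f x) < ennreal (e powr (1 / q))) F"
      using * unfolding ennreal_tendsto_0_iff by simp
    then show "eventually (\<lambda>x. f x < ennreal e) F"
      using assms \<open>0 < e\<close> by (simp add: ennroot_less_iff powr_powr)
  qed
next
  assume *: "(f \<longlongrightarrow> 0) F"
  show "((\<lambda>x. ennroot q (f x)) \<longlongrightarrow> 0) F" unfolding ennreal_tendsto_0_iff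
    using * assms unfolding ennreal_tendsto_0_iff by (simp add: ennroot_less_iff)
qed

lemma ennreal_tendsto_0_cmult:
  assumes "(f \<longlongrightarrow> (0::ennreal)) F" shows "((\<lambda>x. ennreal c * f x) \<longlongrightarrow> 0) F"
  using ennreal_tendsto_cmult[of "ennreal c" f 0 F] assms by simp

lemma ennreal_tendsto_0_le:
  assumes "(f \<longlongrightarrow> (0::ennreal)) F" "\<And>x. g x \<le> f x" shows "(g \<longlongrightarrow> 0) F"
  using tendsto_sandwich[OF _ _ tendsto_const assms(1), of g] assms(2) by simp

lemma energy_add_le:
  assumes [measurable]: "u \<in> borel_measurable lebesgue" "v \<in> borel_measurable lebesgue" and p: "0 < p"
  shows "energy p \<alpha> (\<lambda>x. u x + v x) \<le> ennreal (2 powr p) * (energy p \<alpha> u + energy p \<alpha> v)"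
proof -
  have "energy p \<alpha> (\<lambda>x. u x + v x) \<le> (\<integral>\<^sup>+z. ennreal (2 powr p) * (ennreal (\<bar>jump u z\<bar> powr p) + ennreal (\<bar>jump v z\<bar> powr p)) \<partial>kernel_measure \<alpha>)"
    unfolding energy_def jump_add using abs_add_powr_le[OF p]
    by (intro nn_integral_mono) (simp add: ennreal_plus[symmetric] ennreal_mult'[symmetric] ennreal_leI del: ennreal_plus)
  also have "\<dots> = ennreal (2 powr p) * (energy p \<alpha> u + energy p \<alpha> v)"
    unfolding energy_def by (subst nn_integral_cmult, measurable, subst nn_integral_add) auto
  finally show ?thesis .
qed

lemma energy_scale:
  assumes [measurable]: "u \<in> borel_measurable lebesgue"
  shows "energy p \<alpha> (\<lambda>x. c * u x) = ennreal (\<bar>c\<bar> powr p) * energy p \<alpha> u"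
  unfolding energy_def jump_scale
  by (subst nn_integral_cmult[symmetric]) (auto simp: abs_mult powr_mult ennreal_mult)

lemma energy_AE_cong:
  assumes "AE x in lebesgue. u x = v x" shows "energy p \<alpha> u = energy p \<alpha> v"
  unfolding energy_def using jump_AE_cong[OF assms, of \<alpha>] by (intro nn_integral_cong_AE) (auto elim: eventually_mono)

lemma Cc_infinity_measurable:
  assumes "\<phi> \<in> Cc_infinity \<Omega>" shows "\<phi> \<in> borel_measurable lebesgue"
  using borel_measurable_continuous_onI[OF Cc_infinity_continuous[OF assms]] by (simp add: measurable_completion)

lemma Cc_infinity_zero: "\<phi> \<in> Cc_infinity \<Omega> \<Longrightarrow> x \<notin> \<Omega> \<Longrightarrow> \<phi> x = 0"
  using Cc_infinityD(3,4) by blast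

lemma lebesgue_on_nn_integral:
  assumes "\<Omega> \<in> sets lebesgue" "\<And>x. x \<notin> \<Omega> \<Longrightarrow> g x = 0"
  shows "(\<integral>\<^sup>+x. g x \<partial>lebesgue_on \<Omega>) = (\<integral>\<^sup>+x. g x \<partial>lebesgue)"
  using assms by (subst nn_integral_restrict_space) (auto intro!: nn_integral_cong simp: indicator_def)

lemma lebesgue_on_integral:
  fixes g :: "'a::euclidean_space \<Rightarrow> real"
  assumes "\<Omega> \<in> sets lebesgue" "\<And>x. x \<notin> \<Omega> \<Longrightarrow> g x = 0"
  shows "(LINT x|lebesgue_on \<Omega>. g x) = (LINT x|lebesgue. g x)"
  using assms by (subst integral_restrict_space) (auto intro!: Bochner_Integration.integral_cong simp: indicator_def)

lemma Lq_norm_2_eq: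
  assumes "\<Omega> \<in> sets lebesgue" "\<And>x. x \<notin> \<Omega> \<Longrightarrow> f x = 0"
  shows "Lq_norm 2 \<Omega> f = ennroot 2 (\<integral>\<^sup>+x. ennreal ((f x)\<^sup>2) \<partial>lebesgue)"
proof -
  have "Lq_norm 2 \<Omega> f = ennroot 2 (\<integral>\<^sup>+x. ennreal ((f x)\<^sup>2) \<partial>lebesgue_on \<Omega>)"
    by (simp add: Lq_norm_def)
  also have "(\<integral>\<^sup>+x. ennreal ((f x)\<^sup>2) \<partial>lebesgue_on \<Omega>) = (\<integral>\<^sup>+x. ennreal ((f x)\<^sup>2) \<partial>lebesgue)"
    using assms by (intro lebesgue_on_nn_integral) auto
  finally show ?thesis .
qed

lemma L2_iff:
  assumes "\<Omega> \<in> sets lebesgue"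
  shows "f \<in> L2 \<Omega> \<longleftrightarrow> sq_integrable f \<and> (\<forall>x. x \<notin> \<Omega> \<longrightarrow> f x = 0)"
proof -
  have "Lq_norm 2 \<Omega> f < \<infinity> \<longleftrightarrow> (\<integral>\<^sup>+x. ennreal ((f x)\<^sup>2) \<partial>lebesgue) < \<infinity>" if "\<And>x. x \<notin> \<Omega> \<Longrightarrow> f x = 0"
    using that by (subst Lq_norm_2_eq[OF assms]) (auto simp: ennroot_def less_top)
  then show ?thesis
    by (auto simp: L2_def intro: sq_integrableI simp: abs_l2_nn_integral sq_integrable_measurable)
qed

lemma Lq_norm_2_abs_l2:
  assumes "\<Omega> \<in> sets lebesgue" "f \<in> L2 \<Omega>"
  shows "Lq_norm 2 \<Omega> f = ennreal (norm (abs_l2 f))"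
proof -
  have f: "sq_integrable f" "\<And>x. x \<notin> \<Omega> \<Longrightarrow> f x = 0" using assms L2_iff by auto
  show ?thesis
    using f(2) abs_l2_nn_integral[OF f(1)]
    by (subst Lq_norm_2_eq[OF assms(1)]) (auto simp: ennroot_def powr_half_sqrt)
qed

locale frac_space =
  fixes p s :: real and \<Omega> :: "'a::euclidean_space set"
  assumes s: "0 < s" "s < 1" and p: "2 < p" and open_\<Omega>: "open \<Omega>" and bounded_\<Omega>: "bounded \<Omega>"
begin

definition \<alpha> :: real where "\<alpha> = real DIM('a) + s * p"

abbreviation M :: "('a \<times> 'a) measure" where "M \<equiv> kernel_measure \<alpha>"

abbreviation E :: "('a \<Rightarrow> real) \<Rightarrow> ennreal" where "E \<equiv> energy p \<alpha>"

definition supported :: "('a \<Rightarrow> real) set" where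
  "supported = {u \<in> borel_measurable lebesgue. \<forall>x. x \<notin> \<Omega> \<longrightarrow> u x = 0}"

lemma sets_\<Omega> [measurable, simp]: "\<Omega> \<in> sets lebesgue" using open_\<Omega> by simp

lemma p_pos: "0 < p" using p by simp

lemma supported_measurable: "u \<in> supported \<Longrightarrow> u \<in> borel_measurable lebesgue"
  by (simp add: supported_def)

lemma supported_add: "u \<in> supported \<Longrightarrow> v \<in> supported \<Longrightarrow> (\<lambda>x. u x + v x) \<in> supported"
  by (auto simp: supported_def)

lemma supported_diff: "u \<in> supported \<Longrightarrow> v \<in> supported \<Longrightarrow> (\<lambda>x. u x - v x) \<in> supported"
  by (auto simp: supported_def)

lemma supported_scale: "u \<in> supported \<Longrightarrow> (\<lambda>x. c * u x) \<in> supported"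
  by (auto simp: supported_def)

lemma Cc_supported: "\<phi> \<in> Cc_infinity \<Omega> \<Longrightarrow> \<phi> \<in> supported"
  by (simp add: supported_def Cc_infinity_measurable Cc_infinity_zero)

lemma Cc_energy: "\<phi> \<in> Cc_infinity \<Omega> \<Longrightarrow> E \<phi> < \<infinity>"
  unfolding \<alpha>_def using s p by (intro energy_Cc_infinity_finite) auto

lemma poincare: obtains c where "0 < c" "\<And>u. u \<in> supported \<Longrightarrow> (\<integral>\<^sup>+x. ennreal (\<bar>u x\<bar> powr p) \<partial>lebesgue) \<le> ennreal c * E u"
proof -
  have "0 \<le> \<alpha>" using s p by (simp add: \<alpha>_def)
  from energy_poincare[OF bounded_\<Omega> this p_pos] show ?thesis using that by (auto simp: supported_def)
qed

text \<open>For functions vanishing off \<Omega> the Poincare inequality controls the L^p part of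
  the norm by the energy, so all later approximations are measured by \<open>E\<close>
  alone.\<close>

lemma W_norm_tendsto:
  assumes "\<And>n. f n \<in> supported"
  shows "(\<lambda>n. W_norm p s (f n)) \<longlonglongrightarrow> 0 \<longleftrightarrow> (\<lambda>n. E (f n)) \<longlonglongrightarrow> 0"
proof -
  obtain c where c: "0 < c" "\<And>u. u \<in> supported \<Longrightarrow> (\<integral>\<^sup>+x. ennreal (\<bar>u x\<bar> powr p) \<partial>lebesgue) \<le> ennreal c * E u"
    using poincare by blast
  let ?W = "\<lambda>n. ennreal (1 / p) * E (f n) + (\<integral>\<^sup>+x. ennreal (\<bar>f n x\<bar> powr p) \<partial>lebesgue)"
  have W: "W_norm p s (f n) = ennroot p (?W n)" for n
    using J_energy_eq[OF supported_measurable[OF assms], of p s n] by (simp add: W_norm_def \<alpha>_def)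
  have "?W \<longlonglongrightarrow> 0 \<longleftrightarrow> (\<lambda>n. E (f n)) \<longlonglongrightarrow> 0"
  proof
    assume "?W \<longlonglongrightarrow> 0"
    from ennreal_tendsto_0_cmult[OF this, of p] show "(\<lambda>n. E (f n)) \<longlonglongrightarrow> 0"
    proof (rule ennreal_tendsto_0_le)
      fix n
      have "E (f n) = ennreal p * (ennreal (1 / p) * E (f n))"
        using p_pos by (simp add: mult.assoc[symmetric] ennreal_mult''[symmetric])
      also have "\<dots> \<le> ennreal p * ?W n" by (intro mult_left_mono) auto
      finally show "E (f n) \<le> ennreal p * ?W n" .
    qed
  next
    assume "(\<lambda>n. E (f n)) \<longlonglongrightarrow> 0"
    from tendsto_add[OF ennreal_tendsto_0_cmult[OF this, of "1 / p"] ennreal_tendsto_0_cmult[OF this, of c]]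
    have "(\<lambda>n. ennreal (1 / p) * E (f n) + ennreal c * E (f n)) \<longlonglongrightarrow> 0" by simp
    then show "?W \<longlonglongrightarrow> 0" by (rule ennreal_tendsto_0_le) (intro add_left_mono c assms)
  qed
  then show ?thesis unfolding W ennroot_tendsto_0_iff[OF p_pos] .
qed

lemma W0_iff:
  "u \<in> W0 p s \<Omega> \<longleftrightarrow> u \<in> supported \<and> (\<exists>\<phi>. (\<forall>n::nat. \<phi> n \<in> Cc_infinity \<Omega>) \<and> (\<lambda>n. E (\<lambda>x. u x - \<phi> n x)) \<longlonglongrightarrow> 0)"
proof -
  have "(\<lambda>n. W_norm p s (\<lambda>x. u x - \<phi> n x)) \<longlonglongrightarrow> 0 \<longleftrightarrow> (\<lambda>n. E (\<lambda>x. u x - \<phi> n x)) \<longlonglongrightarrow> 0"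
    if "u \<in> supported" "\<And>n. \<phi> n \<in> Cc_infinity \<Omega>" for \<phi>
    using that by (intro W_norm_tendsto supported_diff) (auto intro: Cc_supported)
  then show ?thesis unfolding W0_def supported_def by (auto simp: supported_def) 
qed

lemma W0_supported: "u \<in> W0 p s \<Omega> \<Longrightarrow> u \<in> supported" by (simp add: W0_iff)

lemma W0_measurable: "u \<in> W0 p s \<Omega> \<Longrightarrow> u \<in> borel_measurable lebesgue"
  by (simp add: W0_supported supported_measurable)

lemma W0_approx:
  assumes "u \<in> W0 p s \<Omega>" "0 < e"
  obtains \<phi> where "\<phi> \<in> Cc_infinity \<Omega>" "E (\<lambda>x. u x - \<phi> x) < ennreal e"
proof -
  obtain \<phi> where \<phi>: "\<And>n::nat. \<phi> n \<in> Cc_infinity \<Omega>" "(\<lambda>n. E (\<lambda>x. u x - \<phi> n x)) \<longlonglongrightarrow> 0"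
    using assms(1) W0_iff by auto
  have "eventually (\<lambda>n. E (\<lambda>x. u x - \<phi> n x) < ennreal e) sequentially"
    using \<phi>(2) assms(2) unfolding ennreal_tendsto_0_iff by blast
  then show ?thesis using that \<phi>(1) by (auto simp: eventually_sequentially)
qed

text \<open>Diagonal choice: approximate w n by a test function up to 1 / (n + 1). Membership in W0
  is thereby closed under convergence in energy.\<close>

lemma W0I_limit:
  assumes u: "u \<in> supported" and w: "\<And>n. w n \<in> W0 p s \<Omega>" and lim: "(\<lambda>n. E (\<lambda>x. u x - w n x)) \<longlonglongrightarrow> 0"
  shows "u \<in> W0 p s \<Omega>"
proof -
  have "\<exists>\<phi>. \<phi> \<in> Cc_infinity \<Omega> \<and> E (\<lambda>x. w n x - \<phi> x) < ennreal (1 / Suc n)" for n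
    using W0_approx[OF w[of n], of "1 / Suc n"] by auto
  then obtain \<phi> where \<phi>: "\<And>n. \<phi> n \<in> Cc_infinity \<Omega>" "\<And>n. E (\<lambda>x. w n x - \<phi> n x) < ennreal (1 / Suc n)" by metis
  have "(\<lambda>n. ennreal (1 / Suc n)) \<longlonglongrightarrow> ennreal 0"
    using LIMSEQ_inverse_real_of_nat by (intro tendsto_ennrealI) (simp add: inverse_eq_divide)
  then have "(\<lambda>n. ennreal (2 powr p) * (E (\<lambda>x. u x - w n x) + ennreal (1 / Suc n))) \<longlonglongrightarrow> 0"
    using tendsto_add[OF lim] by (intro ennreal_tendsto_0_cmult) fastforce
  then have "(\<lambda>n. E (\<lambda>x. u x - \<phi> n x)) \<longlonglongrightarrow> 0"
  proof (rule ennreal_tendsto_0_le)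
    fix n
    have "E (\<lambda>x. (u x - w n x) + (w n x - \<phi> n x)) \<le> ennreal (2 powr p) * (E (\<lambda>x. u x - w n x) + E (\<lambda>x. w n x - \<phi> n x))"
      by (intro energy_add_le p_pos supported_measurable supported_diff u W0_supported[OF w] Cc_supported \<phi>)
    also have "\<dots> \<le> ennreal (2 powr p) * (E (\<lambda>x. u x - w n x) + ennreal (1 / Suc n))"
      using \<phi>(2) by (intro mult_left_mono add_left_mono less_imp_le) auto
    finally show "E (\<lambda>x. u x - \<phi> n x) \<le> ennreal (2 powr p) * (E (\<lambda>x. u x - w n x) + ennreal (1 / Suc n))" by simp
  qed
  then show ?thesis using u \<phi>(1) W0_iff by auto
qed

lemma Cc_W0: "\<phi> \<in> Cc_infinity \<Omega> \<Longrightarrow> \<phi> \<in> W0 p s \<Omega>"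
  unfolding W0_iff using p_pos by (auto intro!: Cc_supported exI[of _ "\<lambda>n. \<phi>"] simp: energy_def jump_def)

lemma W0_add:
  assumes "u \<in> W0 p s \<Omega>" "v \<in> W0 p s \<Omega>" shows "(\<lambda>x. u x + v x) \<in> W0 p s \<Omega>"
proof -
  obtain \<phi> where \<phi>: "\<And>n::nat. \<phi> n \<in> Cc_infinity \<Omega>" "(\<lambda>n. E (\<lambda>x. u x - \<phi> n x)) \<longlonglongrightarrow> 0" using assms(1) W0_iff by auto
  obtain \<psi> where \<psi>: "\<And>n::nat. \<psi> n \<in> Cc_infinity \<Omega>" "(\<lambda>n. E (\<lambda>x. v x - \<psi> n x)) \<longlonglongrightarrow> 0" using assms(2) W0_iff by auto
  have "(\<lambda>n. ennreal (2 powr p) * (E (\<lambda>x. u x - \<phi> n x) + E (\<lambda>x. v x - \<psi> n x))) \<longlonglongrightarrow> 0"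
    using tendsto_add[OF \<phi>(2) \<psi>(2)] by (intro ennreal_tendsto_0_cmult) simp
  then have "(\<lambda>n. E (\<lambda>x. (u x + v x) - (\<phi> n x + \<psi> n x))) \<longlonglongrightarrow> 0"
  proof (rule ennreal_tendsto_0_le)
    fix n
    have "E (\<lambda>x. (u x - \<phi> n x) + (v x - \<psi> n x)) \<le> ennreal (2 powr p) * (E (\<lambda>x. u x - \<phi> n x) + E (\<lambda>x. v x - \<psi> n x))"
      by (intro energy_add_le p_pos supported_measurable supported_diff W0_supported assms Cc_supported \<phi> \<psi>)
    then show "E (\<lambda>x. (u x + v x) - (\<phi> n x + \<psi> n x)) \<le> ennreal (2 powr p) * (E (\<lambda>x. u x - \<phi> n x) + E (\<lambda>x. v x - \<psi> n x))"
      by (simp add: algebra_simps)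
  qed
  then show ?thesis unfolding W0_iff
    by (intro conjI exI[of _ "\<lambda>n x. \<phi> n x + \<psi> n x"] allI Cc_infinity_add \<phi> \<psi> supported_add W0_supported assms)
qed

lemma W0_scale:
  assumes "u \<in> W0 p s \<Omega>" shows "(\<lambda>x. c * u x) \<in> W0 p s \<Omega>"
proof -
  obtain \<phi> where \<phi>: "\<And>n::nat. \<phi> n \<in> Cc_infinity \<Omega>" "(\<lambda>n. E (\<lambda>x. u x - \<phi> n x)) \<longlonglongrightarrow> 0" using assms(1) W0_iff by auto
  have "E (\<lambda>x. c * u x - c * \<phi> n x) = ennreal (\<bar>c\<bar> powr p) * E (\<lambda>x. u x - \<phi> n x)" for n
    unfolding right_diff_distrib[symmetric]
    by (intro energy_scale supported_measurable supported_diff W0_supported assms Cc_supported \<phi>)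
  then have "(\<lambda>n. E (\<lambda>x. c * u x - c * \<phi> n x)) \<longlonglongrightarrow> 0" using ennreal_tendsto_0_cmult[OF \<phi>(2)] by simp
  then show ?thesis unfolding W0_iff
    by (intro conjI exI[of _ "\<lambda>n x. c * \<phi> n x"] allI Cc_infinity_scale \<phi> supported_scale W0_supported assms)
qed

lemma W0_diff: "u \<in> W0 p s \<Omega> \<Longrightarrow> v \<in> W0 p s \<Omega> \<Longrightarrow> (\<lambda>x. u x - v x) \<in> W0 p s \<Omega>"
  using W0_add[of u "\<lambda>x. - 1 * v x"] W0_scale[of v "- 1"] by simp

lemma W0_energy: assumes "u \<in> W0 p s \<Omega>" shows "E u < \<infinity>"
proof -
  obtain \<phi> where \<phi>: "\<phi> \<in> Cc_infinity \<Omega>" "E (\<lambda>x. u x - \<phi> x) < ennreal 1" using W0_approx[OF assms, of 1] by auto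
  have "E (\<lambda>x. (u x - \<phi> x) + \<phi> x) \<le> ennreal (2 powr p) * (E (\<lambda>x. u x - \<phi> x) + E \<phi>)"
    by (intro energy_add_le p_pos supported_measurable supported_diff W0_supported assms Cc_supported \<phi>)
  also have "\<dots> < \<infinity>" using \<phi>(2) Cc_energy[OF \<phi>(1)] by (auto simp: ennreal_mult_less_top intro: less_trans)
  finally show ?thesis by simp
qed

lemma W0_AE_cong:
  assumes "u \<in> W0 p s \<Omega>" "v \<in> supported" "AE x in lebesgue. u x = v x" shows "v \<in> W0 p s \<Omega>"
proof (rule W0I_limit[OF assms(2) assms(1)])
  have "AE x in lebesgue. v x - u x = 0" using assms(3) by eventually_elim simp
  then have "E (\<lambda>x. v x - u x) = E (\<lambda>x. 0)" by (rule energy_AE_cong)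
  then show "(\<lambda>n. E (\<lambda>x. v x - u x)) \<longlonglongrightarrow> 0" using p_pos by (simp add: energy_def)
qed

text \<open>On \<Omega>, of finite measure, u^2 <= 1 + |u|^p because p > 2; the L^p norm is finite
  by the Poincare inequality.\<close>

lemma supported_Lp_sq_integrable:
  assumes u: "u \<in> supported" and E: "E u < \<infinity>" shows "sq_integrable u"
proof (rule sq_integrableI[OF supported_measurable[OF u]])
  obtain c where c: "0 < c" "\<And>u. u \<in> supported \<Longrightarrow> (\<integral>\<^sup>+x. ennreal (\<bar>u x\<bar> powr p) \<partial>lebesgue) \<le> ennreal c * E u"
    using poincare by blast
  have [measurable]: "u \<in> borel_measurable lebesgue" by (rule supported_measurable[OF u])
  have le: "(u x)\<^sup>2 \<le> indicator \<Omega> x + \<bar>u x\<bar> powr p" for x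
  proof (cases "x \<in> \<Omega>")
    case True
    show ?thesis
    proof (cases "\<bar>u x\<bar> \<le> 1")
      case True
      then have "(u x)\<^sup>2 \<le> 1" by (simp add: abs_square_le_1)
      then show ?thesis using \<open>x \<in> \<Omega>\<close> by (simp add: add_increasing2)
    next
      case False
      then have "(u x)\<^sup>2 = \<bar>u x\<bar> powr 2" by (cases "u x = 0") simp_all
      also have "\<dots> \<le> \<bar>u x\<bar> powr p" using False p by (intro powr_mono) auto
      finally show ?thesis by (simp add: add_increasing)
    qed
  qed (use u in \<open>simp add: supported_def\<close>)
  have "(\<integral>\<^sup>+x. ennreal ((u x)\<^sup>2) \<partial>lebesgue) \<le> (\<integral>\<^sup>+x. indicator \<Omega> x + ennreal (\<bar>u x\<bar> powr p) \<partial>lebesgue)"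
  proof (rule nn_integral_mono)
    fix x
    have "ennreal ((u x)\<^sup>2) \<le> ennreal (indicator \<Omega> x + \<bar>u x\<bar> powr p)" by (rule ennreal_leI[OF le])
    then show "ennreal ((u x)\<^sup>2) \<le> indicator \<Omega> x + ennreal (\<bar>u x\<bar> powr p)" by (simp add: ennreal_indicator)
  qed
  also have "\<dots> = emeasure lebesgue \<Omega> + (\<integral>\<^sup>+x. ennreal (\<bar>u x\<bar> powr p) \<partial>lebesgue)"
    by (subst nn_integral_add) auto
  also have "\<dots> < \<infinity>"
  proof -
    have "emeasure lebesgue \<Omega> < \<infinity>"
      using lmeasurable_open[OF bounded_\<Omega> open_\<Omega>] by (simp add: fmeasurable_def)
    moreover have "(\<integral>\<^sup>+x. ennreal (\<bar>u x\<bar> powr p) \<partial>lebesgue) < \<infinity>"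
      using le_less_trans[OF c(2)[OF u]] E by (simp add: ennreal_mult_less_top)
    ultimately show ?thesis by simp
  qed
  finally show "(\<integral>\<^sup>+x. ennreal ((u x)\<^sup>2) \<partial>lebesgue) < \<infinity>" .
qed

lemma L2_eq: "f \<in> L2 \<Omega> \<longleftrightarrow> sq_integrable f \<and> f \<in> supported"
  using L2_iff[OF sets_\<Omega>, of f] by (auto simp: supported_def sq_integrable_measurable)

lemma W0_L2: "u \<in> W0 p s \<Omega> \<Longrightarrow> u \<in> L2 \<Omega>"
  using W0_supported W0_energy supported_Lp_sq_integrable by (simp add: L2_eq)

section \<open>The energy and its first variation\<close>

definition form :: "('a \<Rightarrow> real) \<Rightarrow> ('a \<Rightarrow> real) \<Rightarrow> real" where
  "form u \<phi> = (LINT z|M. spow (p - 1) (jump u z) * jump \<phi> z)"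

text \<open>This is p times the energy J as a real number; the division by p takes place in
  \<open>penalized\<close> and \<open>potential\<close>.\<close>

definition en :: "('a \<Rightarrow> real) \<Rightarrow> real" where "en u = (LINT z|M. \<bar>jump u z\<bar> powr p)"

lemma en_integrable:
  assumes "u \<in> borel_measurable lebesgue" "E u < \<infinity>" shows "integrable M (\<lambda>z. \<bar>jump u z\<bar> powr p)"
  using assms by (intro integrableI_nonneg) (auto simp: energy_def)

lemma E_eq_en: "u \<in> borel_measurable lebesgue \<Longrightarrow> E u < \<infinity> \<Longrightarrow> E u = ennreal (en u)"
  unfolding energy_def en_def by (rule nn_integral_eq_integral[OF en_integrable]) (auto simp: energy_def)

lemma form_integrable:
  assumes "u \<in> borel_measurable lebesgue" "E u < \<infinity>" "v \<in> borel_measurable lebesgue" "E v < \<infinity>"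
  shows "integrable M (\<lambda>z. spow (p - 1) (jump u z) * jump v z)"
proof (rule Bochner_Integration.integrable_bound)
  show "integrable M (\<lambda>z. \<bar>jump u z\<bar> powr p + \<bar>jump v z\<bar> powr p)"
    using assms by (intro Bochner_Integration.integrable_add en_integrable)
  show "AE z in M. norm (spow (p - 1) (jump u z) * jump v z) \<le> norm (\<bar>jump u z\<bar> powr p + \<bar>jump v z\<bar> powr p)"
    using spow_mult_le[OF p] by (intro AE_I2) simp
  have [measurable]: "jump u \<in> borel_measurable M" "jump v \<in> borel_measurable M" using assms by auto
  show "(\<lambda>z. spow (p - 1) (jump u z) * jump v z) \<in> borel_measurable M" by measurable
qed

lemma W0_form_integrable:
  "u \<in> W0 p s \<Omega> \<Longrightarrow> v \<in> W0 p s \<Omega> \<Longrightarrow> integrable M (\<lambda>z. spow (p - 1) (jump u z) * jump v z)"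
  by (intro form_integrable W0_measurable W0_energy)

lemma W0_en_integrable: "u \<in> W0 p s \<Omega> \<Longrightarrow> integrable M (\<lambda>z. \<bar>jump u z\<bar> powr p)"
  by (intro en_integrable W0_measurable W0_energy)

lemma en_nonneg: "0 \<le> en u" by (simp add: en_def)

lemma en_subgradient:
  assumes "u \<in> W0 p s \<Omega>" "v \<in> W0 p s \<Omega>" shows "en u + p * form u (\<lambda>x. v x - u x) \<le> en v"
proof -
  have i: "integrable M (\<lambda>z. p * (spow (p - 1) (jump u z) * jump (\<lambda>x. v x - u x) z))"
    by (intro Bochner_Integration.integrable_mult_right W0_form_integrable W0_diff assms)
  have "en u + p * form u (\<lambda>x. v x - u x) = (LINT z|M. \<bar>jump u z\<bar> powr p + p * (spow (p - 1) (jump u z) * jump (\<lambda>x. v x - u x) z))"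
    unfolding en_def form_def by (subst Bochner_Integration.integral_add[OF W0_en_integrable[OF assms(1)] i]) simp
  also have "\<dots> \<le> en v"
    unfolding en_def
  proof (rule integral_mono[OF Bochner_Integration.integrable_add[OF W0_en_integrable[OF assms(1)] i] W0_en_integrable[OF assms(2)]])
    fix z
    show "\<bar>jump u z\<bar> powr p + p * (spow (p - 1) (jump u z) * jump (\<lambda>x. v x - u x) z) \<le> \<bar>jump v z\<bar> powr p"
      using spow_subgradient[OF p, of "jump u z" "jump v z"] by (simp add: jump_diff mult.assoc)
  qed
  finally show ?thesis .
qed

lemma form_gap:
  assumes "u \<in> W0 p s \<Omega>" "v \<in> W0 p s \<Omega>"
  shows "form u (\<lambda>x. u x - v x) - form v (\<lambda>x. u x - v x)
      = (LINT z|M. (spow (p - 1) (jump u z) - spow (p - 1) (jump v z)) * (jump u z - jump v z))"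
    and "integrable M (\<lambda>z. (spow (p - 1) (jump u z) - spow (p - 1) (jump v z)) * (jump u z - jump v z))"
proof -
  have i: "integrable M (\<lambda>z. spow (p - 1) (jump u z) * (jump u z - jump v z))"
    "integrable M (\<lambda>z. spow (p - 1) (jump v z) * (jump u z - jump v z))"
    using W0_form_integrable[OF assms(1) W0_diff[OF assms]] W0_form_integrable[OF assms(2) W0_diff[OF assms]]
    by (simp_all add: jump_diff)
  show "form u (\<lambda>x. u x - v x) - form v (\<lambda>x. u x - v x)
      = (LINT z|M. (spow (p - 1) (jump u z) - spow (p - 1) (jump v z)) * (jump u z - jump v z))"
    unfolding form_def jump_diff left_diff_distrib by (rule Bochner_Integration.integral_diff[symmetric, OF i])
  show "integrable M (\<lambda>z. (spow (p - 1) (jump u z) - spow (p - 1) (jump v z)) * (jump u z - jump v z))"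
    unfolding left_diff_distrib by (rule Bochner_Integration.integrable_diff[OF i])
qed

definition chain_const :: real where "chain_const = 8 * (p + 1) * (p / 2 + 2)\<^sup>2"

lemma form_chain:
  fixes u :: "nat \<Rightarrow> 'a \<Rightarrow> real"
  assumes "\<And>k. u k \<in> W0 p s \<Omega>"
  shows "form (u 0) (\<lambda>x. u 0 x - u n x) - form (u n) (\<lambda>x. u 0 x - u n x)
    \<le> chain_const * n * (\<Sum>k<n. form (u k) (\<lambda>x. u k x - u (Suc k) x) - form (u (Suc k)) (\<lambda>x. u k x - u (Suc k) x))"
proof -
  let ?g = "\<lambda>i j z. (spow (p - 1) (jump (u i) z) - spow (p - 1) (jump (u j) z)) * (jump (u i) z - jump (u j) z)"
  have i: "integrable M (?g i j)" for i j by (intro form_gap(2) assms)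
  have "(LINT z|M. ?g 0 n z) \<le> (LINT z|M. chain_const * n * (\<Sum>k<n. ?g k (Suc k) z))"
    using spow_chain[OF p, of "\<lambda>k. jump (u k) _" n]
    by (intro integral_mono i Bochner_Integration.integrable_mult_right Bochner_Integration.integrable_sum)
      (simp_all add: chain_const_def)
  also have "\<dots> = chain_const * n * (\<Sum>k<n. LINT z|M. ?g k (Suc k) z)"
    by (subst integral_mult_right_zero, subst Bochner_Integration.integral_sum) (auto intro: i)
  finally show ?thesis using assms by (simp add: form_gap(1))
qed

text \<open>Clarkson's inequality for the jumps, integrated. Applied at midpoints of a minimizing
  sequence it bounds the energy of the half differences.\<close>

lemma en_clarkson:
  assumes "u \<in> W0 p s \<Omega>" "v \<in> W0 p s \<Omega>"
  shows "en (\<lambda>x. 1/2 * (u x + v x)) + en (\<lambda>x. 1/2 * (u x - v x)) \<le> (en u + en v) / 2"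
proof -
  have i1: "integrable M (\<lambda>z. \<bar>jump (\<lambda>x. 1/2 * (u x + v x)) z\<bar> powr p)"
    "integrable M (\<lambda>z. \<bar>jump (\<lambda>x. 1/2 * (u x - v x)) z\<bar> powr p)"
    by (intro W0_en_integrable W0_scale W0_add W0_diff assms)+
  have i2: "integrable M (\<lambda>z. (\<bar>jump u z\<bar> powr p + \<bar>jump v z\<bar> powr p) / 2)"
    by (intro Bochner_Integration.integrable_divide Bochner_Integration.integrable_add W0_en_integrable assms)
  have "en (\<lambda>x. 1/2 * (u x + v x)) + en (\<lambda>x. 1/2 * (u x - v x))
      = (LINT z|M. \<bar>jump (\<lambda>x. 1/2 * (u x + v x)) z\<bar> powr p + \<bar>jump (\<lambda>x. 1/2 * (u x - v x)) z\<bar> powr p)"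
    unfolding en_def by (rule Bochner_Integration.integral_add[symmetric, OF i1])
  also have "\<dots> \<le> (LINT z|M. (\<bar>jump u z\<bar> powr p + \<bar>jump v z\<bar> powr p) / 2)"
  proof (rule integral_mono[OF Bochner_Integration.integrable_add[OF i1] i2])
    fix z
    show "\<bar>jump (\<lambda>x. 1/2 * (u x + v x)) z\<bar> powr p + \<bar>jump (\<lambda>x. 1/2 * (u x - v x)) z\<bar> powr p
        \<le> (\<bar>jump u z\<bar> powr p + \<bar>jump v z\<bar> powr p) / 2"
      using clarkson_real[OF p, of "jump u z" "jump v z"] unfolding jump_scale jump_add jump_diff by simp
  qed
  also have "\<dots> = (en u + en v) / 2"
    unfolding en_def using assms by (simp add: W0_en_integrable)
  finally show ?thesis .
qed

end

section \<open>Resolvents by minimization\<close>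

context monotone_operator
begin

text \<open>Counterpart of \<open>yosida_cauchy\<close> for the residuals r at l and q at m:
  monotonicity leads to q . (r - q) >= 0, that is |q|^2 <= q . r. Residuals shrink with the
  parameter and therefore converge strongly, which is the starting point of the density of the
  domain.\<close>

lemma residual_cauchy:
  assumes f: "f \<in> V" and m: "0 < m" "m \<le> l"
  defines "r \<equiv> f - resolvent l f" and "q \<equiv> f - resolvent m f"
  shows "norm (r - q) ^ 2 \<le> norm r ^ 2 - norm q ^ 2"
proof -
  have l: "0 < l" using m by simp
  define a b where "a = yosida l f" and "b = yosida m f"
  have r: "r = l *\<^sub>R a" and q: "q = m *\<^sub>R b"
    unfolding r_def q_def a_def b_def using f m l by (auto intro: resolvent_yosida)
  have "0 \<le> (a - b) \<bullet> (resolvent l f - resolvent m f)"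
    unfolding a_def b_def yosida_def using f m l by (intro mono resolvent_D)
  also have "resolvent l f - resolvent m f = q - r" by (simp add: r_def q_def)
  finally have "0 \<le> m * (a \<bullet> (q - r)) - q \<bullet> (q - r)"
    using m unfolding q by (simp add: inner_diff_left mult_le_cancel_left_pos right_diff_distrib[symmetric] zero_le_mult_iff)
  then have 1: "m * (a \<bullet> (r - q)) \<le> q \<bullet> (r - q)" by (simp add: inner_diff_right algebra_simps)
  have sq: "r \<bullet> (r - q) = l * (a \<bullet> (r - q))" by (simp add: r)
  have "0 \<le> a \<bullet> (r - q)"
  proof (rule ccontr)
    assume neg: "\<not> 0 \<le> a \<bullet> (r - q)"
    have "(r - q) \<bullet> (r - q) = l * (a \<bullet> (r - q)) - q \<bullet> (r - q)" by (simp add: inner_diff_left sq[symmetric])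
    also have "\<dots> \<le> (l - m) * (a \<bullet> (r - q))" using 1 by (simp add: algebra_simps)
    also have "\<dots> \<le> 0" using neg m by (simp add: mult_nonneg_nonpos)
    finally have "(r - q) \<bullet> (r - q) = 0" using inner_ge_zero[of "r - q"] by linarith
    then have "r = q" by simp
    then show False using neg by simp
  qed
  then have "0 \<le> q \<bullet> (r - q)" using 1 m by (smt (verit) mult_nonneg_nonneg)
  then show ?thesis by (simp add: power2_norm_eq_inner inner_diff_left inner_diff_right inner_commute)
qed

lemma residual_convergent:
  assumes f: "f \<in> V"
  shows "\<exists>r\<in>V. (\<lambda>n. f - resolvent (1 / Suc n) f) \<longlonglongrightarrow> r"
proof -
  define y where "y n = f - resolvent (1 / Suc n) f" for n
  have le: "norm (y m - y n) ^ 2 \<le> norm (y m) ^ 2 - norm (y n) ^ 2" if "m \<le> n" for m n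
    unfolding y_def using that by (intro residual_cauchy f) (auto simp: field_simps)
  have "decseq (\<lambda>n. norm (y n) ^ 2)"
    using le by (intro decseq_SucI) (smt (verit) le_SucI order_refl zero_le_power2)
  then have "convergent (\<lambda>n. norm (y n) ^ 2)"
    by (intro Bseq_monoseq_convergent) (auto simp: decseq_imp_monoseq intro!: decseq_bounded[where B = 0])
  then have C: "Cauchy (\<lambda>n. norm (y n) ^ 2)" by (rule convergent_Cauchy)
  have "Cauchy y"
  proof (rule metric_CauchyI)
    fix e :: real assume e: "0 < e"
    obtain M where M: "\<And>m n. m \<ge> M \<Longrightarrow> n \<ge> M \<Longrightarrow> dist (norm (y m) ^ 2) (norm (y n) ^ 2) < e^2"
      using metric_CauchyD[OF C, of "e^2"] e by auto
    have *: "dist (y m) (y n) < e" if "m \<ge> M" "m \<le> n" for m n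
    proof -
      have "norm (y m - y n) ^ 2 < e ^ 2"
        using le[OF that(2)] M[of m n] that by (auto simp: dist_real_def)
      then show ?thesis using e by (simp add: dist_norm power_less_imp_less_base)
    qed
    show "\<exists>M. \<forall>m\<ge>M. \<forall>n\<ge>M. dist (y m) (y n) < e"
      by (metis * dist_commute nle_le)
  qed
  then obtain r where r: "y \<longlonglongrightarrow> r" using convergent_eq_Cauchy by blast
  have "y n \<in> V" for n unfolding y_def by (intro subspace_diff subspace_V f resolvent_V) simp
  then have "r \<in> V" using closed_sequentially[OF closed_V _ r] by blast
  then show ?thesis using r by (auto simp: y_def[abs_def])
qed

end

lemma l2_AE_subseq:
  fixes f :: "nat \<Rightarrow> 'a::euclidean_space \<Rightarrow> real"
  assumes f: "\<And>n. sq_integrable (f n)" and u: "sq_integrable u" and lim: "(\<lambda>n. abs_l2 (f n)) \<longlonglongrightarrow> abs_l2 u"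
  shows "\<exists>r::nat\<Rightarrow>nat. strict_mono r \<and> (AE x in lebesgue. (\<lambda>n. f (r n) x) \<longlonglongrightarrow> u x)"
proof -
  have d: "sq_integrable (\<lambda>x. f n x - u x)" for n by (intro sq_integrable_diff f u)
  have "(\<lambda>n. (norm (abs_l2 (f n) - abs_l2 u))\<^sup>2) \<longlonglongrightarrow> 0\<^sup>2"
    using lim by (intro tendsto_power tendsto_norm_zero LIM_zero)
  then have "(\<lambda>n. LINT x|lebesgue. norm ((f n x - u x)\<^sup>2)) \<longlonglongrightarrow> 0"
    using f u d by (simp add: abs_l2_diff abs_l2_norm)
  moreover have "integrable lebesgue (\<lambda>x. (f n x - u x)\<^sup>2)" for n using d by (simp add: sq_integrable_def)
  ultimately obtain r :: "nat \<Rightarrow> nat" where r: "strict_mono r" "AE x in lebesgue. (\<lambda>n. (f (r n) x - u x)\<^sup>2) \<longlonglongrightarrow> 0"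
    using tendsto_L1_AE_subseq[of lebesgue "\<lambda>n x. (f n x - u x)\<^sup>2"] by blast
  have "AE x in lebesgue. (\<lambda>n. f (r n) x) \<longlonglongrightarrow> u x"
    using r(2)
  proof eventually_elim
    case (elim x)
    then have "(\<lambda>n. sqrt ((f (r n) x - u x)\<^sup>2)) \<longlonglongrightarrow> sqrt 0" by (rule tendsto_real_sqrt)
    then have "(\<lambda>n. f (r n) x - u x) \<longlonglongrightarrow> 0" by (simp add: tendsto_rabs_zero_iff)
    then show ?case by (simp add: LIM_zero_iff)
  qed
  then show ?thesis using r(1) by blast
qed

lemma energy_fatou:
  assumes [measurable]: "\<And>n. v n \<in> borel_measurable lebesgue"
    and lim: "AE x in lebesgue. (\<lambda>n. v n x) \<longlonglongrightarrow> u x" and p: "0 < p"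
  shows "energy p \<alpha> u \<le> liminf (\<lambda>n. energy p \<alpha> (v n))"
proof -
  have "energy p \<alpha> u = (\<integral>\<^sup>+z. liminf (\<lambda>n. ennreal (\<bar>jump (v n) z\<bar> powr p)) \<partial>kernel_measure \<alpha>)"
    unfolding energy_def
  proof (rule nn_integral_cong_AE, use jump_AE_tendsto[OF lim, of \<alpha>] in eventually_elim)
    case (elim z)
    then have "(\<lambda>n. ennreal (\<bar>jump (v n) z\<bar> powr p)) \<longlonglongrightarrow> ennreal (\<bar>jump u z\<bar> powr p)"
      using p by (intro tendsto_ennrealI tendsto_powr' tendsto_rabs tendsto_const) auto
    from lim_imp_Liminf[OF trivial_limit_sequentially this] show ?case by (rule sym)
  qed
  also have "\<dots> \<le> liminf (\<lambda>n. energy p \<alpha> (v n))"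
    unfolding energy_def by (rule nn_integral_liminf) measurable
  finally show ?thesis .
qed

context frac_space
begin

section \<open>L2(\<Omega>) as a closed subspace\<close>

lemma L2_sq: "f \<in> L2 \<Omega> \<Longrightarrow> sq_integrable f" by (simp add: L2_eq)

lemma L2_zero: "f \<in> L2 \<Omega> \<Longrightarrow> x \<notin> \<Omega> \<Longrightarrow> f x = 0" by (simp add: L2_eq supported_def)

lemma W0_sq: "u \<in> W0 p s \<Omega> \<Longrightarrow> sq_integrable u" by (simp add: W0_L2 L2_sq)

lemma L2_add: "f \<in> L2 \<Omega> \<Longrightarrow> g \<in> L2 \<Omega> \<Longrightarrow> (\<lambda>x. f x + g x) \<in> L2 \<Omega>"
  by (simp add: L2_eq sq_integrable_add supported_add)

lemma L2_diff: "f \<in> L2 \<Omega> \<Longrightarrow> g \<in> L2 \<Omega> \<Longrightarrow> (\<lambda>x. f x - g x) \<in> L2 \<Omega>"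
  by (simp add: L2_eq sq_integrable_diff supported_diff)

lemma L2_scale: "f \<in> L2 \<Omega> \<Longrightarrow> (\<lambda>x. c * f x) \<in> L2 \<Omega>"
  by (simp add: L2_eq sq_integrable_scale supported_scale)

definition L2_classes :: "'a l2 set" where "L2_classes = abs_l2 ` L2 \<Omega>"

text \<open>\<open>L2 \<Omega>\<close> asks for zeros at every point off \<Omega>, whereas a class
  knows its values only almost everywhere; a cutoff reconciles the two.\<close>

lemma L2_AE_modification:
  assumes u: "sq_integrable u" and zero: "AE x in lebesgue. x \<notin> \<Omega> \<longrightarrow> u x = 0"
  obtains v where "v \<in> L2 \<Omega>" "AE x in lebesgue. u x = v x" "abs_l2 v = abs_l2 u"
proof -
  define v where "v x = (if x \<in> \<Omega> then u x else 0)" for x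
  have [measurable]: "u \<in> borel_measurable lebesgue" using u by (rule sq_integrable_measurable)
  have "v = (\<lambda>x. indicator \<Omega> x * u x)" by (auto simp: v_def indicator_def)
  then have vm: "v \<in> borel_measurable lebesgue" by simp
  have "sq_integrable v"
    by (rule sq_integrable_bound[OF vm, of "\<lambda>x. (u x)\<^sup>2"]) (use u in \<open>auto simp: v_def sq_integrable_def\<close>)
  moreover have "AE x in lebesgue. u x = v x" using zero by eventually_elim (simp add: v_def)
  moreover have "v \<in> supported" using vm by (simp add: supported_def v_def)
  ultimately show ?thesis using that[of v] abs_l2_eq_iff[OF u, of v] by (simp add: L2_eq)
qed

text \<open>Almost everywhere convergence of a subsequence transfers the zeros off \<Omega> to the
  limit. The subsequence is returned as well, for use with Fatou's lemma.\<close>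

lemma L2_classes_limit:
  assumes v: "\<And>n. v n \<in> L2 \<Omega>" and lim: "(\<lambda>n. abs_l2 (v n)) \<longlonglongrightarrow> x"
  obtains u r where "u \<in> L2 \<Omega>" "abs_l2 u = x" "strict_mono (r :: nat \<Rightarrow> nat)"
    "AE z in lebesgue. (\<lambda>n. v (r n) z) \<longlonglongrightarrow> u z"
proof -
  obtain r :: "nat \<Rightarrow> nat" where r: "strict_mono r" "AE z in lebesgue. (\<lambda>n. v (r n) z) \<longlonglongrightarrow> rep_l2 x z"
    using l2_AE_subseq[of v "rep_l2 x"] v lim by (auto simp: L2_sq sq_integrable_rep)
  have "AE z in lebesgue. z \<notin> \<Omega> \<longrightarrow> rep_l2 x z = 0"
    using r(2)
  proof eventually_elim
    case (elim z)
    show ?case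
    proof
      assume "z \<notin> \<Omega>"
      then have "(\<lambda>n. v (r n) z) = (\<lambda>n. 0)" using v L2_zero by auto
      then show "rep_l2 x z = 0" using elim LIMSEQ_unique[OF _ tendsto_const] by metis
    qed
  qed
  then obtain u where u: "u \<in> L2 \<Omega>" "AE z in lebesgue. rep_l2 x z = u z" "abs_l2 u = abs_l2 (rep_l2 x)"
    using L2_AE_modification[OF sq_integrable_rep] by metis
  have "AE z in lebesgue. (\<lambda>n. v (r n) z) \<longlonglongrightarrow> u z" using r(2) u(2) by eventually_elim simp
  then show ?thesis using that[OF u(1) _ r(1)] u(3) by simp
qed

lemma L2_classes_subspace: "subspace L2_classes"
proof (rule subspaceI)
  have "(0 :: 'a l2) = abs_l2 (\<lambda>x. 0)" by (simp add: zero_l2_def)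
  moreover have "(\<lambda>x. 0) \<in> L2 \<Omega>" by (simp add: L2_eq supported_def)
  ultimately show "0 \<in> L2_classes" by (auto simp: L2_classes_def)
next
  fix x y assume "x \<in> L2_classes" "y \<in> L2_classes"
  then show "x + y \<in> L2_classes" by (auto simp: L2_classes_def abs_l2_add L2_sq intro: L2_add)
next
  fix c x assume "x \<in> L2_classes"
  then show "c *\<^sub>R x \<in> L2_classes" by (auto simp: L2_classes_def abs_l2_scaleR L2_sq intro: L2_scale)
qed

lemma L2_classes_closed: "closed L2_classes"
proof (rule closed_sequential_limits[THEN iffD2], intro allI impI, elim conjE)
  fix X x assume "\<forall>n. X n \<in> L2_classes" "X \<longlonglongrightarrow> x"
  then have "\<forall>n. \<exists>f. f \<in> L2 \<Omega> \<and> X n = abs_l2 f" by (auto simp: L2_classes_def)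
  then obtain f where f: "\<And>n. f n \<in> L2 \<Omega>" "\<And>n. X n = abs_l2 (f n)" by metis
  have "(\<lambda>n. abs_l2 (f n)) \<longlonglongrightarrow> x" using \<open>X \<longlonglongrightarrow> x\<close> by (simp only: f(2)[symmetric])
  from L2_classes_limit[OF f(1) this] show "x \<in> L2_classes" by (metis L2_classes_def image_eqI)
qed

text \<open>Since \<Omega> is bounded, its indicator is square integrable, so f is integrable and
  the fundamental lemma of the calculus of variations applies. Uniqueness of the value of the
  operator and density of its domain both rest on this.\<close>

lemma L2_classes_orthogonal:
  assumes f: "f \<in> L2 \<Omega>" and orth: "\<And>\<phi>. \<phi> \<in> Cc_infinity \<Omega> \<Longrightarrow> abs_l2 f \<bullet> abs_l2 \<phi> = 0"
  shows "abs_l2 f = 0"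
proof -
  have "sq_integrable (\<lambda>x. indicator \<Omega> x :: real)"
    using lmeasurable_open[OF bounded_\<Omega> open_\<Omega>]
    by (auto simp: sq_integrable_def fmeasurable_def power2_eq_square indicator_inter_arith[symmetric])
  from sq_integrable_mult[OF L2_sq[OF f] this] have "integrable lebesgue (\<lambda>x. f x * indicator \<Omega> x)" .
  moreover have "(\<lambda>x. f x * indicator \<Omega> x) = f" using L2_zero[OF f] by (auto simp: indicator_def fun_eq_iff)
  ultimately have "integrable lebesgue f" by simp
  moreover have "(LINT x|lebesgue. f x * \<phi> x) = 0" if "\<phi> \<in> Cc_infinity \<Omega>" for \<phi>
    using orth[OF that] L2_sq[OF f] W0_sq[OF Cc_W0[OF that]] by (simp add: abs_l2_inner)
  ultimately have "AE x in lebesgue. x \<in> \<Omega> \<longrightarrow> f x = 0" by (intro AE_zero_if_orthogonal_Cc_infinity open_\<Omega>)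
  then have "AE x in lebesgue. f x = 0" by eventually_elim (use L2_zero[OF f] in blast)
  then have "abs_l2 f = abs_l2 (\<lambda>x. 0)" using L2_sq[OF f] by (simp add: abs_l2_eq_iff)
  then show ?thesis by (simp add: zero_l2_def)
qed

section \<open>The operator and its resolvents\<close>

definition lap :: "('a \<Rightarrow> real) \<Rightarrow> ('a \<Rightarrow> real) \<Rightarrow> bool" where "lap u w \<longleftrightarrow> frac_p_Laplacian p s \<Omega> u w"

lemma lap_iff:
  "lap u w \<longleftrightarrow> w \<in> L2 \<Omega> \<and> u \<in> W0 p s \<Omega> \<and> (\<forall>\<phi>\<in>W0 p s \<Omega>. form u \<phi> = abs_l2 w \<bullet> abs_l2 \<phi>)"
proof -
  have "(LINT (x, y)|(lebesgue \<Otimes>\<^sub>M lebesgue). \<bar>u x - u y\<bar> powr (p - 2) * (u x - u y) * (\<phi> x - \<phi> y)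
      / norm (x - y) powr (real DIM('a) + s * p)) = form u \<phi>"
    if "u \<in> W0 p s \<Omega>" "\<phi> \<in> W0 p s \<Omega>" for \<phi>
    unfolding form_def \<alpha>_def using that by (intro energy_form_eq W0_measurable)
  moreover have "(LINT x|lebesgue_on \<Omega>. w x * \<phi> x) = abs_l2 w \<bullet> abs_l2 \<phi>"
    if "w \<in> L2 \<Omega>" "\<phi> \<in> W0 p s \<Omega>" for \<phi>
    using that L2_zero[OF that(1)] by (subst lebesgue_on_integral) (auto simp: abs_l2_inner L2_sq W0_sq)
  ultimately show ?thesis unfolding lap_def frac_p_Laplacian_def using W0_L2 by auto
qed

lemma form_AE_cong:
  assumes [measurable]: "u \<in> borel_measurable lebesgue" "v \<in> borel_measurable lebesgue" "\<phi> \<in> borel_measurable lebesgue"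
    and eq: "AE x in lebesgue. u x = v x"
  shows "form u \<phi> = form v \<phi>"
  unfolding form_def
proof (rule integral_cong_AE)
  show "AE z in M. spow (p - 1) (jump u z) * jump \<phi> z = spow (p - 1) (jump v z) * jump \<phi> z"
    using jump_AE_cong[OF eq, of \<alpha>] by eventually_elim simp
qed measurable

lemma lap_AE_cong:
  assumes "lap u w" "v \<in> supported" "AE x in lebesgue. u x = v x" shows "lap v w"
  unfolding lap_iff
proof (intro conjI ballI)
  have u: "u \<in> W0 p s \<Omega>" and w: "w \<in> L2 \<Omega>" using assms(1) by (auto simp: lap_iff)
  show v: "v \<in> W0 p s \<Omega>" by (rule W0_AE_cong[OF u assms(2,3)])
  show "w \<in> L2 \<Omega>" by (rule w)
  fix \<phi> assume \<phi>: "\<phi> \<in> W0 p s \<Omega>"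
  then show "form v \<phi> = abs_l2 w \<bullet> abs_l2 \<phi>"
    using assms(1) form_AE_cong[OF W0_measurable[OF u] W0_measurable[OF v] W0_measurable[OF \<phi>] assms(3)]
    by (auto simp: lap_iff)
qed

lemma lap_unique: "lap u w \<Longrightarrow> lap u w' \<Longrightarrow> abs_l2 w = abs_l2 w'"
proof -
  assume *: "lap u w" "lap u w'"
  then have w: "w \<in> L2 \<Omega>" "w' \<in> L2 \<Omega>" by (auto simp: lap_iff)
  have "abs_l2 (\<lambda>x. w x - w' x) = 0"
  proof (rule L2_classes_orthogonal[OF L2_diff[OF w]])
    fix \<phi> assume "\<phi> \<in> Cc_infinity \<Omega>"
    then have "abs_l2 w \<bullet> abs_l2 \<phi> = abs_l2 w' \<bullet> abs_l2 \<phi>" using * Cc_W0 by (auto simp: lap_iff)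
    then show "abs_l2 (\<lambda>x. w x - w' x) \<bullet> abs_l2 \<phi> = 0"
      using w by (simp add: abs_l2_diff[symmetric] L2_sq inner_diff_left)
  qed
  then show ?thesis using w by (simp add: abs_l2_diff[symmetric] L2_sq)
qed

lemma form_scale_right: "form u (\<lambda>x. c * \<phi> x) = c * form u \<phi>"
  by (simp add: form_def jump_scale mult.left_commute)

text \<open>Dominated convergence; the restriction |t n| <= 1 makes the majorant independent of
  n.\<close>

lemma form_continuous:
  assumes u: "u \<in> W0 p s \<Omega>" and \<phi>: "\<phi> \<in> W0 p s \<Omega>" and t: "t \<longlonglongrightarrow> (0::real)" "\<And>n. \<bar>t n\<bar> \<le> 1"
  shows "(\<lambda>n. form (\<lambda>x. u x + t n * \<phi> x) \<phi>) \<longlonglongrightarrow> form u \<phi>"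
  unfolding form_def jump_add jump_scale
proof (rule integral_dominated_convergence)
  have [measurable]: "jump u \<in> borel_measurable M" "jump \<phi> \<in> borel_measurable M"
    using u \<phi> W0_measurable by auto
  show "(\<lambda>z. spow (p - 1) (jump u z) * jump \<phi> z) \<in> borel_measurable M"
    "(\<lambda>z. spow (p - 1) (jump u z + t n * jump \<phi> z) * jump \<phi> z) \<in> borel_measurable M" for n
    by measurable
  show "integrable M (\<lambda>z. 2 powr p * (\<bar>jump u z\<bar> powr p + \<bar>jump \<phi> z\<bar> powr p) + \<bar>jump \<phi> z\<bar> powr p)"
    by (intro Bochner_Integration.integrable_add Bochner_Integration.integrable_mult_right W0_en_integrable u \<phi>)
  have cont: "isCont (spow (p - 1)) a" for a
    using continuous_on_spow[of "p - 1"] p by (simp add: continuous_on_eq_continuous_at)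
  show "AE z in M. (\<lambda>n. spow (p - 1) (jump u z + t n * jump \<phi> z) * jump \<phi> z) \<longlonglongrightarrow> spow (p - 1) (jump u z) * jump \<phi> z"
  proof (intro AE_I2 tendsto_mult tendsto_const isCont_tendsto_compose[OF cont])
    fix z
    show "(\<lambda>n. jump u z + t n * jump \<phi> z) \<longlonglongrightarrow> jump u z"
      using tendsto_add[OF tendsto_const tendsto_mult_left_zero[OF t(1)], of "jump u z" "jump \<phi> z"] by simp
  qed
  show "AE z in M. norm (spow (p - 1) (jump u z + t n * jump \<phi> z) * jump \<phi> z)
      \<le> 2 powr p * (\<bar>jump u z\<bar> powr p + \<bar>jump \<phi> z\<bar> powr p) + \<bar>jump \<phi> z\<bar> powr p" for n
  proof (rule AE_I2)
    fix z
    have "\<bar>t n * jump \<phi> z\<bar> powr p \<le> \<bar>jump \<phi> z\<bar> powr p"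
      using t(2)[of n] p by (intro powr_mono2) (auto simp: abs_mult mult_left_le_one_le)
    then have "2 powr p * (\<bar>jump u z\<bar> powr p + \<bar>t n * jump \<phi> z\<bar> powr p) \<le> 2 powr p * (\<bar>jump u z\<bar> powr p + \<bar>jump \<phi> z\<bar> powr p)"
      by (intro mult_left_mono add_left_mono) auto
    then show "norm (spow (p - 1) (jump u z + t n * jump \<phi> z) * jump \<phi> z)
        \<le> 2 powr p * (\<bar>jump u z\<bar> powr p + \<bar>jump \<phi> z\<bar> powr p) + \<bar>jump \<phi> z\<bar> powr p"
      using spow_mult_le[OF p, of "jump u z + t n * jump \<phi> z" "jump \<phi> z"]
        abs_add_powr_le[OF p_pos, of "jump u z" "t n * jump \<phi> z"] unfolding real_norm_def by linarith
  qed
qed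

text \<open>The energy J plus the squared distance to f over 2 l; a critical point u satisfies u + l
  A u = f.\<close>

definition penalized :: "real \<Rightarrow> ('a \<Rightarrow> real) \<Rightarrow> ('a \<Rightarrow> real) \<Rightarrow> real" where
  "penalized l f v = en v / p + norm (abs_l2 v - abs_l2 f) ^ 2 / (2 * l)"

text \<open>Clarkson's inequality for the energy and the parallelogram identity for the penalty make
  a minimizing sequence Cauchy in both. The L2 limit has an a.e. convergent subsequence, and Fatou's
  lemma is used twice: for u - v n, to place u in W0, and for u itself, to compare its energy with
  the infimum.\<close>

lemma minimizer_exists:
  assumes f: "f \<in> L2 \<Omega>" and l: "0 < l"
  obtains u where "u \<in> W0 p s \<Omega>" "\<And>v. v \<in> W0 p s \<Omega> \<Longrightarrow> penalized l f u \<le> penalized l f v"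
proof -
  let ?F = "penalized l f"
  define m where "m = Inf (?F ` W0 p s \<Omega>)"
  have F0: "0 \<le> ?F v" for v using p l by (simp add: penalized_def en_nonneg)
  have bdd: "bdd_below (?F ` W0 p s \<Omega>)" by (intro bdd_belowI[of _ 0]) (auto simp: F0)
  have ne: "?F ` W0 p s \<Omega> \<noteq> {}" using Cc_W0[OF bump_Cc, of 0 0] by (metis Cc_W0 Cc_infinityI Cinfinity_const compact_empty empty_iff empty_subsetI image_is_empty)
  have m_le: "m \<le> ?F v" if "v \<in> W0 p s \<Omega>" for v unfolding m_def using that by (intro cInf_lower bdd) auto
  have "\<exists>v\<in>W0 p s \<Omega>. ?F v < m + 1 / Suc n" for n
    using cInf_lessD[OF ne, of "m + 1 / Suc n"] by (auto simp: m_def)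
  then obtain v where v: "\<And>n. v n \<in> W0 p s \<Omega>" "\<And>n. ?F (v n) < m + 1 / Suc n" by metis
  have vL: "v n \<in> L2 \<Omega>" for n using v W0_L2 by blast
  \<comment> \<open>The midpoint is a competitor, so its value is at least m; what Clarkson and the
    parallelogram identity leave over is at most the mean excess of the two values over m. The 8 l
    is 2 l times the square of 2, from halving.\<close>
  have key: "en (\<lambda>x. 1/2 * (v n x - v k x)) / p + norm (abs_l2 (v n) - abs_l2 (v k)) ^ 2 / (8 * l) \<le> 1 / Suc N"
    if "N \<le> n" "N \<le> k" for n k N
  proof -
    define a b where "a = abs_l2 (v n) - abs_l2 f" and "b = abs_l2 (v k) - abs_l2 f"
    have half: "abs_l2 (\<lambda>x. 1/2 * (v n x + v k x)) = (1/2) *\<^sub>R (abs_l2 (v n) + abs_l2 (v k))"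
      unfolding abs_l2_add[OF W0_sq[OF v(1)] W0_sq[OF v(1)]]
      by (rule abs_l2_scaleR[symmetric]) (intro sq_integrable_add W0_sq v)
    then have "abs_l2 (\<lambda>x. 1/2 * (v n x + v k x)) - abs_l2 f = (1/2) *\<^sub>R (a + b)"
      by (simp add: a_def b_def algebra_simps scaleR_add_left[symmetric])
    then have mid: "?F (\<lambda>x. 1/2 * (v n x + v k x)) = en (\<lambda>x. 1/2 * (v n x + v k x)) / p + norm (a + b) ^ 2 / (8 * l)"
      by (simp add: penalized_def power_divide)
    have par: "norm (a + b) ^ 2 + norm (a - b) ^ 2 = 2 * norm a ^ 2 + 2 * norm b ^ 2"
      by (simp add: power2_norm_eq_inner inner_add_left inner_add_right inner_diff_left inner_diff_right)
    have "m \<le> en (\<lambda>x. 1/2 * (v n x + v k x)) / p + norm (a + b) ^ 2 / (8 * l)"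
      using m_le[OF W0_scale[OF W0_add[OF v(1) v(1)]], of "1/2" n k] unfolding mid .
    moreover have "(en (\<lambda>x. 1/2 * (v n x + v k x)) + en (\<lambda>x. 1/2 * (v n x - v k x))) / p \<le> ((en (v n) + en (v k)) / 2) / p"
      using en_clarkson[OF v(1) v(1)] p by (intro divide_right_mono) auto
    moreover have "norm (a - b) ^ 2 / (8 * l) = (2 * norm a ^ 2 + 2 * norm b ^ 2) / (8 * l) - norm (a + b) ^ 2 / (8 * l)"
      unfolding par[symmetric] by (simp add: add_divide_distrib)
    ultimately have "en (\<lambda>x. 1/2 * (v n x - v k x)) / p + norm (a - b) ^ 2 / (8 * l) \<le> (?F (v n) + ?F (v k)) / 2 - m"
      by (simp add: penalized_def a_def[symmetric] b_def[symmetric] add_divide_distrib)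
    also have "\<dots> \<le> 1 / Suc N"
    proof -
      have "1 / real (Suc n) \<le> 1 / Suc N" "1 / real (Suc k) \<le> 1 / Suc N" using that by (auto intro!: divide_left_mono)
      then have "?F (v n) \<le> m + 1 / Suc N" "?F (v k) \<le> m + 1 / Suc N" using v(2)[of n] v(2)[of k] by linarith+
      then show ?thesis by (simp add: field_simps)
    qed
    finally show ?thesis by (simp add: a_def b_def)
  qed
  have small: "(\<lambda>n. 1 / real (Suc n)) \<longlonglongrightarrow> 0" using LIMSEQ_inverse_real_of_nat by (simp add: inverse_eq_divide)
  have "Cauchy (\<lambda>n. abs_l2 (v n))"
  proof (rule metric_CauchyI)
    fix e :: real assume e: "0 < e"
    then have "eventually (\<lambda>n. 1 / real (Suc n) < e ^ 2 / (8 * l)) sequentially"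
      using l by (intro order_tendstoD(2)[OF small]) auto
    then obtain N where N: "1 / real (Suc N) < e ^ 2 / (8 * l)" by (auto simp: eventually_sequentially)
    have "dist (abs_l2 (v n)) (abs_l2 (v k)) < e" if "N \<le> n" "N \<le> k" for n k
    proof -
      have "0 \<le> en (\<lambda>x. 1/2 * (v n x - v k x)) / p" using p by (simp add: en_nonneg)
      then have "norm (abs_l2 (v n) - abs_l2 (v k)) ^ 2 / (8 * l) < e ^ 2 / (8 * l)" using key[OF that] N by linarith
      then have "norm (abs_l2 (v n) - abs_l2 (v k)) ^ 2 < e ^ 2" using l by (simp add: divide_less_cancel)
      then show ?thesis using e by (simp add: dist_norm power_less_imp_less_base)
    qed
    then show "\<exists>M. \<forall>m\<ge>M. \<forall>n\<ge>M. dist (abs_l2 (v m)) (abs_l2 (v n)) < e" by blast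
  qed
  then obtain x where x: "(\<lambda>n. abs_l2 (v n)) \<longlonglongrightarrow> x" using convergent_eq_Cauchy by blast
  obtain u r where u: "u \<in> L2 \<Omega>" "abs_l2 u = x" "strict_mono (r :: nat \<Rightarrow> nat)"
    "AE z in lebesgue. (\<lambda>n. v (r n) z) \<longlonglongrightarrow> u z"
    using L2_classes_limit[OF vL x] by blast
  have us: "u \<in> supported" using u(1) by (simp add: L2_eq)
  have Ed: "E (\<lambda>x. u x - v n x) \<le> ennreal (2 powr p * p * (1 / Suc n))" for n
  proof -
    have "E (\<lambda>x. u x - v n x) \<le> liminf (\<lambda>k. E (\<lambda>x. v (r k) x - v n x))"
    proof (rule energy_fatou[OF _ _ p_pos])
      show "AE x in lebesgue. (\<lambda>k. v (r k) x - v n x) \<longlonglongrightarrow> u x - v n x"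
        using u(4) by eventually_elim (intro tendsto_intros)
    qed (intro borel_measurable_diff W0_measurable v)
    also have "\<dots> \<le> ennreal (2 powr p * p * (1 / Suc n))"
    proof (rule liminf_le_eventually, rule eventually_sequentiallyI[of n])
      fix k assume k: "n \<le> k"
      then have nk: "n \<le> r k" using seq_suble[OF u(3), of k] by simp
      let ?d = "\<lambda>x. v (r k) x - v n x"
      have d: "?d \<in> W0 p s \<Omega>" by (intro W0_diff v)
      have "en (\<lambda>x. 1/2 * ?d x) / p \<le> 1 / Suc n"
        using key[OF nk order_refl] l by (smt (verit) divide_nonneg_pos zero_le_power2)
      then have "en (\<lambda>x. 1/2 * ?d x) \<le> p * (1 / Suc n)" using p by (simp add: field_simps)
      have "E (\<lambda>x. 2 * (1/2 * ?d x)) = ennreal (\<bar>2\<bar> powr p) * E (\<lambda>x. 1/2 * ?d x)"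
        by (intro energy_scale W0_measurable W0_scale d)
      moreover have "(\<lambda>x. 2 * (1/2 * ?d x)) = ?d" by (rule ext) simp
      moreover have "E (\<lambda>x. 1/2 * ?d x) = ennreal (en (\<lambda>x. 1/2 * ?d x))"
        by (intro E_eq_en W0_measurable W0_energy W0_scale d)
      ultimately have "E ?d = ennreal (2 powr p) * ennreal (en (\<lambda>x. 1/2 * ?d x))"
        by (simp only: abs_numeral)
      also have "\<dots> = ennreal (2 powr p * en (\<lambda>x. 1/2 * ?d x))" by (simp add: ennreal_mult' en_nonneg)
      also have "\<dots> \<le> ennreal (2 powr p * p * (1 / Suc n))"
        using \<open>en (\<lambda>x. 1/2 * ?d x) \<le> p * (1 / Suc n)\<close> by (intro ennreal_leI) (simp only: mult.assoc, intro mult_left_mono, auto)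
      finally show "E ?d \<le> ennreal (2 powr p * p * (1 / Suc n))" .
    qed
    finally show ?thesis .
  qed
  have "(\<lambda>n. ennreal (2 powr p * p * (1 / Suc n))) \<longlonglongrightarrow> ennreal (2 powr p * p * 0)"
    by (intro tendsto_ennrealI tendsto_intros small)
  then have "(\<lambda>n. E (\<lambda>x. u x - v n x)) \<longlonglongrightarrow> 0"
    using ennreal_tendsto_0_le[OF _ Ed] by simp
  then have uW: "u \<in> W0 p s \<Omega>" by (rule W0I_limit[OF us v(1)])
  have "?F u \<le> m"
  proof -
    have Fl: "(\<lambda>n. ?F (v n)) \<longlonglongrightarrow> m"
    proof (rule tendsto_sandwich[OF _ _ tendsto_const])
      show "(\<lambda>n. m + 1 / Suc n) \<longlonglongrightarrow> m" using tendsto_add[OF tendsto_const small, of m] by simp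
    qed (use v m_le in \<open>auto intro!: always_eventually less_imp_le\<close>)
    \<comment> \<open>Both the penalized values and the penalties converge, so the energies do too;
      their limit bounds \<open>en u\<close>.\<close>
    have "(\<lambda>n. p * (?F (v n) - norm (abs_l2 (v n) - abs_l2 f) ^ 2 / (2 * l))) \<longlonglongrightarrow> p * (m - norm (x - abs_l2 f) ^ 2 / (2 * l))"
      using l by (intro tendsto_intros Fl x) simp
    moreover have "p * (?F (v n) - norm (abs_l2 (v n) - abs_l2 f) ^ 2 / (2 * l)) = en (v n)" for n
      using p by (simp add: penalized_def)
    ultimately have el: "(\<lambda>n. en (v n)) \<longlonglongrightarrow> p * (m - norm (x - abs_l2 f) ^ 2 / (2 * l))" by simp
    then have elr: "(\<lambda>n. en (v (r n))) \<longlonglongrightarrow> p * (m - norm (x - abs_l2 f) ^ 2 / (2 * l))"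
      using LIMSEQ_subseq_LIMSEQ[OF _ u(3)] by (auto simp: o_def)
    have "ennreal (en u) = E u" by (rule E_eq_en[symmetric]) (use uW W0_measurable W0_energy in auto)
    also have "\<dots> \<le> liminf (\<lambda>n. E (v (r n)))" by (rule energy_fatou[OF W0_measurable[OF v(1)] u(4) p_pos])
    also have "(\<lambda>n. E (v (r n))) = (\<lambda>n. ennreal (en (v (r n))))"
      by (intro ext E_eq_en W0_measurable W0_energy v)
    also have "liminf (\<lambda>n. ennreal (en (v (r n)))) = ennreal (p * (m - norm (x - abs_l2 f) ^ 2 / (2 * l)))"
      by (intro lim_imp_Liminf tendsto_ennrealI elr) simp
    finally have "en u \<le> p * (m - norm (x - abs_l2 f) ^ 2 / (2 * l))"
      using LIMSEQ_le_const[OF elr, of 0] en_nonneg by (subst (asm) ennreal_le_iff) auto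
    then have "en u / p \<le> m - norm (x - abs_l2 f) ^ 2 / (2 * l)" using p by (simp add: field_simps)
    then show ?thesis by (simp add: penalized_def u(2))
  qed
  then show ?thesis using that[OF uW] m_le order_trans by blast
qed

text \<open>First variation along u + t \<phi> with t decreasing to 0. The energy difference is
  estimated by the subgradient at the varied point, and \<open>form_continuous\<close> removes the
  variation in the limit; this yields one inequality, and - \<phi> the other.\<close>

lemma resolvent_exists:
  assumes f: "f \<in> L2 \<Omega>" and l: "0 < l"
  shows "\<exists>u w. lap u w \<and> abs_l2 u + l *\<^sub>R abs_l2 w = abs_l2 f"
proof -
  obtain u where u: "u \<in> W0 p s \<Omega>" and min: "\<And>v. v \<in> W0 p s \<Omega> \<Longrightarrow> penalized l f u \<le> penalized l f v"
    using minimizer_exists[OF f l] by blast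
  define w where "w x = 1 / l * (f x - u x)" for x
  have w: "w \<in> L2 \<Omega>" unfolding w_def[abs_def] by (intro L2_scale L2_diff f W0_L2 u)
  have aw: "abs_l2 w = (1 / l) *\<^sub>R (abs_l2 f - abs_l2 u)"
    unfolding w_def[abs_def] using L2_sq[OF f] W0_sq[OF u]
    by (subst abs_l2_scaleR[symmetric]) (auto simp: abs_l2_diff sq_integrable_diff)
  have ge: "abs_l2 w \<bullet> abs_l2 \<phi> \<le> form u \<phi>" if \<phi>: "\<phi> \<in> W0 p s \<Omega>" for \<phi>
  proof -
    define t where "t n = 1 / real (Suc n)" for n
    have t: "0 < t n" "\<bar>t n\<bar> \<le> 1" for n by (simp_all add: t_def)
    have tl: "t \<longlonglongrightarrow> 0" using LIMSEQ_inverse_real_of_nat by (simp add: t_def[abs_def] inverse_eq_divide)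
    have ineq: "abs_l2 w \<bullet> abs_l2 \<phi> \<le> form (\<lambda>x. u x + t n * \<phi> x) \<phi> + t n * (norm (abs_l2 \<phi>) ^ 2 / (2 * l))" for n
    proof -
      define v where "v x = u x + t n * \<phi> x" for x
      have v: "v \<in> W0 p s \<Omega>" unfolding v_def[abs_def] by (intro W0_add W0_scale u \<phi>)
      have "en v + p * form v (\<lambda>x. - t n * \<phi> x) \<le> en u"
        using en_subgradient[OF v u] by (simp add: v_def)
      then have 1: "en v / p - en u / p \<le> t n * form v \<phi>"
        unfolding form_scale_right using p by (simp add: field_simps)
      have av: "abs_l2 v = abs_l2 u + t n *\<^sub>R abs_l2 \<phi>"
        unfolding v_def[abs_def] using W0_sq[OF u] W0_sq[OF \<phi>]
        by (simp add: abs_l2_add[symmetric] abs_l2_scaleR sq_integrable_scale)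
      have 2: "norm (abs_l2 v - abs_l2 f) ^ 2 = norm (abs_l2 u - abs_l2 f) ^ 2
          + 2 * t n * ((abs_l2 u - abs_l2 f) \<bullet> abs_l2 \<phi>) + t n ^ 2 * norm (abs_l2 \<phi>) ^ 2"
        unfolding av by (simp add: power2_norm_eq_inner inner_diff_left inner_diff_right inner_add_left inner_add_right inner_commute)
          (simp add: power2_eq_square algebra_simps)
      have 3: "(abs_l2 u - abs_l2 f) \<bullet> abs_l2 \<phi> = - l * (abs_l2 w \<bullet> abs_l2 \<phi>)"
        using l by (simp add: aw inner_diff_left)
      have "0 \<le> penalized l f v - penalized l f u" using min[OF v] by simp
      also have "\<dots> = (en v / p - en u / p) + (2 * t n * (- l * (abs_l2 w \<bullet> abs_l2 \<phi>)) + t n ^ 2 * norm (abs_l2 \<phi>) ^ 2) / (2 * l)"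
        by (simp add: penalized_def 2 3 add_divide_distrib diff_divide_distrib)
      also have "\<dots> \<le> t n * form v \<phi> + (2 * t n * (- l * (abs_l2 w \<bullet> abs_l2 \<phi>)) + t n ^ 2 * norm (abs_l2 \<phi>) ^ 2) / (2 * l)"
        using 1 by simp
      also have "\<dots> = t n * (form v \<phi> - abs_l2 w \<bullet> abs_l2 \<phi> + t n * (norm (abs_l2 \<phi>) ^ 2 / (2 * l)))"
        using l by (simp add: field_simps power2_eq_square)
      finally show ?thesis using t(1)[of n] by (simp add: zero_le_mult_iff v_def[abs_def])
    qed
    have "(\<lambda>n. form (\<lambda>x. u x + t n * \<phi> x) \<phi> + t n * (norm (abs_l2 \<phi>) ^ 2 / (2 * l))) \<longlonglongrightarrow> form u \<phi> + 0 * (norm (abs_l2 \<phi>) ^ 2 / (2 * l))"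
      by (intro tendsto_intros form_continuous u \<phi> tl t)
    from LIMSEQ_le_const[OF this] ineq show ?thesis by auto
  qed
  have "form u \<phi> = abs_l2 w \<bullet> abs_l2 \<phi>" if \<phi>: "\<phi> \<in> W0 p s \<Omega>" for \<phi>
  proof (rule antisym)
    have "abs_l2 w \<bullet> abs_l2 (\<lambda>x. - 1 * \<phi> x) \<le> form u (\<lambda>x. - 1 * \<phi> x)" by (intro ge W0_scale \<phi>)
    then show "form u \<phi> \<le> abs_l2 w \<bullet> abs_l2 \<phi>"
      unfolding form_scale_right abs_l2_scaleR[OF W0_sq[OF \<phi>], symmetric] by simp
  qed (rule ge[OF \<phi>])
  then have "lap u w" using u w by (simp add: lap_iff)
  moreover have "abs_l2 u + l *\<^sub>R abs_l2 w = abs_l2 f" using l by (simp add: aw)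
  ultimately show ?thesis by blast
qed

end

section \<open>Existence of solutions\<close>

context frac_space
begin

definition lap_domain :: "'a l2 set" where "lap_domain = {x. \<exists>u w. lap u w \<and> abs_l2 u = x}"

text \<open>\<open>form\<close> and \<open>en\<close> act on functions, so the operator on classes
  works with a chosen representative; \<open>lap_W0_rep\<close> shows that the value of the operator
  is unaffected by the choice.\<close>

definition W0_rep :: "'a l2 \<Rightarrow> 'a \<Rightarrow> real" where "W0_rep x = (SOME u. u \<in> W0 p s \<Omega> \<and> abs_l2 u = x)"

definition frac_lap :: "'a l2 \<Rightarrow> 'a l2" where "frac_lap x = abs_l2 (SOME w. lap (W0_rep x) w)"

definition potential :: "'a l2 \<Rightarrow> real" where "potential x = en (W0_rep x) / p"

lemma W0_rep_W0: assumes "x \<in> lap_domain" shows "W0_rep x \<in> W0 p s \<Omega> \<and> abs_l2 (W0_rep x) = x"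
proof -
  have "\<exists>u. u \<in> W0 p s \<Omega> \<and> abs_l2 u = x" using assms by (auto simp: lap_domain_def lap_iff)
  from someI_ex[OF this] show ?thesis by (simp add: W0_rep_def)
qed

lemma lap_W0_rep: assumes "lap u w" shows "lap (W0_rep (abs_l2 u)) w"
proof -
  have x: "abs_l2 u \<in> lap_domain" using assms by (auto simp: lap_domain_def)
  have "u \<in> W0 p s \<Omega>" using assms by (simp add: lap_iff)
  then have "AE y in lebesgue. u y = W0_rep (abs_l2 u) y"
    using W0_rep_W0[OF x] by (subst abs_l2_eq_iff[symmetric]) (auto simp: W0_sq)
  then show ?thesis using lap_AE_cong[OF assms] W0_rep_W0[OF x] W0_supported by blast
qed

lemma frac_lap_eq: assumes "lap u w" shows "frac_lap (abs_l2 u) = abs_l2 w"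
proof -
  have "lap (W0_rep (abs_l2 u)) (SOME w. lap (W0_rep (abs_l2 u)) w)" by (rule someI[of "lap (W0_rep (abs_l2 u))" w, OF lap_W0_rep[OF assms]])
  then show ?thesis unfolding frac_lap_def using lap_W0_rep[OF assms] lap_unique by blast
qed

lemma lap_domain_lap:
  assumes "x \<in> lap_domain" obtains w where "lap (W0_rep x) w" "frac_lap x = abs_l2 w" "w \<in> L2 \<Omega>"
proof -
  obtain u w where u: "lap u w" "abs_l2 u = x" using assms by (auto simp: lap_domain_def)
  then show ?thesis using that[of w] lap_W0_rep[OF u(1)] frac_lap_eq[OF u(1)] lap_iff[THEN iffD1, OF u(1)] by simp
qed

lemma frac_lap_inner:
  assumes "x \<in> lap_domain" "\<phi> \<in> W0 p s \<Omega>" shows "frac_lap x \<bullet> abs_l2 \<phi> = form (W0_rep x) \<phi>"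
  using assms by (auto elim!: lap_domain_lap simp: lap_iff)

lemma lap_domain_L2_classes: "lap_domain \<subseteq> L2_classes"
  using W0_L2 by (auto simp: lap_domain_def L2_classes_def lap_iff)

lemma frac_lap_L2_classes: "x \<in> lap_domain \<Longrightarrow> frac_lap x \<in> L2_classes"
  by (erule lap_domain_lap) (auto simp: L2_classes_def)

lemma inner_diff_W0_rep:
  assumes "z \<in> lap_domain" "x \<in> lap_domain" "y \<in> lap_domain"
  shows "frac_lap z \<bullet> (x - y) = form (W0_rep z) (\<lambda>t. W0_rep x t - W0_rep y t)"
proof -
  have "x - y = abs_l2 (\<lambda>t. W0_rep x t - W0_rep y t)"
    using W0_rep_W0[OF assms(2)] W0_rep_W0[OF assms(3)] abs_l2_diff[OF W0_sq W0_sq] by metis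
  then show ?thesis using frac_lap_inner[OF assms(1) W0_diff] W0_rep_W0 assms by simp
qed

lemma potential_subgradient:
  assumes "x \<in> lap_domain" "y \<in> lap_domain" shows "potential x + frac_lap x \<bullet> (y - x) \<le> potential y"
proof -
  have "(en (W0_rep x) + p * form (W0_rep x) (\<lambda>t. W0_rep y t - W0_rep x t)) / p \<le> en (W0_rep y) / p"
    using en_subgradient[of "W0_rep x" "W0_rep y"] W0_rep_W0[OF assms(1)] W0_rep_W0[OF assms(2)] p
    by (intro divide_right_mono) auto
  then show ?thesis using p assms by (simp add: inner_diff_W0_rep potential_def add_divide_distrib)
qed

lemma lap_domain_range: assumes "f \<in> L2_classes" "0 < l" shows "\<exists>x\<in>lap_domain. x + l *\<^sub>R frac_lap x = f"
proof -
  obtain g where g: "g \<in> L2 \<Omega>" "f = abs_l2 g" using assms(1) by (auto simp: L2_classes_def)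
  obtain u w where u: "lap u w" "abs_l2 u + l *\<^sub>R abs_l2 w = f" using resolvent_exists[OF g(1) assms(2)] g(2) by auto
  show ?thesis using u frac_lap_eq[OF u(1)] by (intro bexI[of _ "abs_l2 u"]) (auto simp: lap_domain_def)
qed

sublocale monotone: monotone_operator L2_classes lap_domain frac_lap
proof
  fix x y assume xy: "x \<in> lap_domain" "y \<in> lap_domain"
  have "frac_lap x \<bullet> (y - x) + frac_lap y \<bullet> (x - y) \<le> 0"
    using potential_subgradient[OF xy] potential_subgradient[OF xy(2,1)] by simp
  then show "0 \<le> (frac_lap x - frac_lap y) \<bullet> (x - y)"
    by (simp add: inner_diff_left inner_diff_right)
qed (use L2_classes_subspace L2_classes_closed lap_domain_L2_classes frac_lap_L2_classes lap_domain_range in auto)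

lemma form_self: "form u u = en u"
proof -
  have "spow (p - 1) a * a = \<bar>a\<bar> powr p" for a :: real
  proof (cases "a = 0")
    case False
    have "spow (p - 1) a * a = \<bar>a\<bar> powr (p - 2) * a\<^sup>2" by (simp add: spow_def power2_eq_square)
    also have "a\<^sup>2 = \<bar>a\<bar> powr 2" using False by simp
    finally show ?thesis by (simp only: powr_add[symmetric]) simp
  qed (use p in simp)
  then show ?thesis by (simp add: form_def en_def)
qed

text \<open>Apply \<open>spow_mult_le\<close> to c a in place of a and divide by c^(p-1);
  homogeneity distributes the weights.\<close>

lemma form_young:
  assumes u: "u \<in> W0 p s \<Omega>" and \<phi>: "\<phi> \<in> W0 p s \<Omega>" and c: "0 < c"
  shows "\<bar>form u \<phi>\<bar> \<le> c * en u + c powr (1 - p) * en \<phi>"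
proof -
  have pt: "\<bar>spow (p - 1) a * b\<bar> \<le> c * \<bar>a\<bar> powr p + c powr (1 - p) * \<bar>b\<bar> powr p" for a b :: real
  proof -
    have "spow (p - 1) (c * a) = c powr (p - 1) * spow (p - 1) a"
    proof -
      have "c powr (p - 1) = c powr (p - 2) * c" using c powr_add[of c "p - 2" 1] by simp
      then show ?thesis using c by (simp add: spow_def abs_mult powr_mult)
    qed
    then have "c powr (1 - p) * \<bar>spow (p - 1) (c * a) * b\<bar> = c powr (1 - p) * c powr (p - 1) * \<bar>spow (p - 1) a * b\<bar>"
      by (simp add: abs_mult)
    also have "c powr (1 - p) * c powr (p - 1) = 1" using c by (simp add: powr_add[symmetric])
    finally have "\<bar>spow (p - 1) a * b\<bar> = c powr (1 - p) * \<bar>spow (p - 1) (c * a) * b\<bar>" by simp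
    also have "\<dots> \<le> c powr (1 - p) * (\<bar>c * a\<bar> powr p + \<bar>b\<bar> powr p)"
      by (intro mult_left_mono spow_mult_le p) simp
    also have "\<dots> = c powr (1 - p) * c powr p * \<bar>a\<bar> powr p + c powr (1 - p) * \<bar>b\<bar> powr p"
      using c by (simp add: abs_mult powr_mult distrib_left)
    also have "c powr (1 - p) * c powr p = c" using c by (simp add: powr_add[symmetric])
    finally show ?thesis .
  qed
  have "\<bar>form u \<phi>\<bar> \<le> (LINT z|M. \<bar>spow (p - 1) (jump u z) * jump \<phi> z\<bar>)"
    unfolding form_def by (rule integral_abs_bound)
  also have "\<dots> \<le> (LINT z|M. c * \<bar>jump u z\<bar> powr p + c powr (1 - p) * \<bar>jump \<phi> z\<bar> powr p)"
    by (intro integral_mono pt integrable_abs W0_form_integrable Bochner_Integration.integrable_add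
        Bochner_Integration.integrable_mult_right W0_en_integrable u \<phi>)
  also have "\<dots> = c * en u + c powr (1 - p) * en \<phi>"
    unfolding en_def using W0_en_integrable[OF u] W0_en_integrable[OF \<phi>] by simp
  finally show ?thesis .
qed

lemma zero_lap: "lap (\<lambda>x. 0) (\<lambda>x. 0)"
proof -
  have z: "(\<lambda>x. 0) \<in> Cc_infinity \<Omega>"
    by (rule Cc_infinityI[OF Cinfinity_const compact_empty]) auto
  have "form (\<lambda>x. 0) \<phi> = 0" for \<phi> by (simp add: form_def)
  then show ?thesis using Cc_W0[OF z] W0_L2[OF Cc_W0[OF z]] by (auto simp: lap_iff zero_l2_def[symmetric])
qed

lemma zero_lap_domain: "0 \<in> lap_domain" "frac_lap 0 = 0"
  using zero_lap frac_lap_eq[OF zero_lap] by (auto simp: lap_domain_def zero_l2_def)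

text \<open>The residuals f - u n of the resolvents at 1 / (n + 1) converge to some r, and testing
  the resolvent equation with u n bounds the energy of u n by (n + 1) |f|^2. Against a test function
  the residual is then small, so r is orthogonal to all test functions and vanishes: the resolvents
  tend to f.\<close>

lemma lap_domain_dense: "L2_classes \<subseteq> closure lap_domain"
proof
  fix f assume f: "f \<in> L2_classes"
  define u where "u n = monotone.resolvent (1 / Suc n) f" for n
  have uD: "u n \<in> lap_domain" for n unfolding u_def by (intro monotone.resolvent_D f) simp
  have res: "f - u n = (1 / Suc n) *\<^sub>R frac_lap (u n)" for n
    using monotone.resolvent_eq[OF f, of "1 / Suc n"] by (simp add: u_def algebra_simps)
  have un: "norm (u n) \<le> norm f" for n
    using monotone.nonexpansive_aux[OF uD zero_lap_domain(1), of "1 / Suc n" n] res[of n] zero_lap_domain(2)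
    by (simp add: algebra_simps)
  obtain r where r: "r \<in> L2_classes" "(\<lambda>n. f - u n) \<longlonglongrightarrow> r"
    using monotone.residual_convergent[OF f] by (auto simp: u_def)
  obtain g where g: "g \<in> L2 \<Omega>" "r = abs_l2 g" using r(1) by (auto simp: L2_classes_def)
  have small: "(\<lambda>n. 1 / real (Suc n)) \<longlonglongrightarrow> 0" using LIMSEQ_inverse_real_of_nat by (simp add: inverse_eq_divide)
  have "r \<bullet> abs_l2 \<phi> = 0" if \<phi>: "\<phi> \<in> Cc_infinity \<Omega>" for \<phi>
  proof -
    note \<phi>W = Cc_W0[OF \<phi>]
    have lim: "(\<lambda>n. \<bar>(f - u n) \<bullet> abs_l2 \<phi>\<bar>) \<longlonglongrightarrow> \<bar>r \<bullet> abs_l2 \<phi>\<bar>" by (intro tendsto_intros r)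
    \<comment> \<open>The scaled energies en / (n + 1) are only bounded. The weight c makes their
      contribution small, while the part containing \<phi> vanishes as n grows for each fixed
      c.\<close>
    have bound: "\<bar>r \<bullet> abs_l2 \<phi>\<bar> \<le> c * norm f ^ 2" if c: "0 < c" for c
    proof -
      have "\<bar>(f - u n) \<bullet> abs_l2 \<phi>\<bar> \<le> c * norm f ^ 2 + (1 / Suc n) * (c powr (1 - p) * en \<phi>)" for n
      proof -
        have rep_n: "W0_rep (u n) \<in> W0 p s \<Omega>" "abs_l2 (W0_rep (u n)) = u n" using W0_rep_W0[OF uD] by auto
        have "frac_lap (u n) \<bullet> u n = en (W0_rep (u n))"
          using frac_lap_inner[OF uD rep_n(1)] rep_n(2) form_self by metis
        then have "(1 / Suc n) * en (W0_rep (u n)) = (f - u n) \<bullet> u n" unfolding res by simp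
        also have "\<dots> \<le> f \<bullet> u n" by (simp add: inner_diff_left)
        also have "\<dots> \<le> norm f * norm (u n)" by (rule norm_cauchy_schwarz)
        also have "\<dots> \<le> norm f ^ 2" using un[of n] by (simp add: power2_eq_square mult_left_mono)
        finally have 1: "(1 / Suc n) * en (W0_rep (u n)) \<le> norm f ^ 2" .
        have "\<bar>(f - u n) \<bullet> abs_l2 \<phi>\<bar> = (1 / Suc n) * \<bar>form (W0_rep (u n)) \<phi>\<bar>"
          unfolding res using frac_lap_inner[OF uD \<phi>W] by (simp add: abs_mult)
        also have "\<dots> \<le> (1 / Suc n) * (c * en (W0_rep (u n)) + c powr (1 - p) * en \<phi>)"
          by (intro mult_left_mono form_young rep_n \<phi>W c) simp
        also have "\<dots> = c * ((1 / Suc n) * en (W0_rep (u n))) + (1 / Suc n) * (c powr (1 - p) * en \<phi>)"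
          by (simp add: distrib_left)
        also have "\<dots> \<le> c * norm f ^ 2 + (1 / Suc n) * (c powr (1 - p) * en \<phi>)"
          using 1 c by (intro add_right_mono mult_left_mono) auto
        finally show ?thesis .
      qed
      moreover have "(\<lambda>n. c * norm f ^ 2 + (1 / Suc n) * (c powr (1 - p) * en \<phi>)) \<longlonglongrightarrow> c * norm f ^ 2 + 0 * (c powr (1 - p) * en \<phi>)"
        by (intro tendsto_intros small)
      ultimately have "\<bar>r \<bullet> abs_l2 \<phi>\<bar> \<le> c * norm f ^ 2 + 0 * (c powr (1 - p) * en \<phi>)"
        by (intro LIMSEQ_le[OF lim]) auto
      then show ?thesis by simp
    qed
    have "(\<lambda>n. (1 / real (Suc n)) * norm f ^ 2) \<longlonglongrightarrow> 0 * norm f ^ 2" by (intro tendsto_intros small)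
    from LIMSEQ_le_const[OF this, of "\<bar>r \<bullet> abs_l2 \<phi>\<bar>"] have "\<bar>r \<bullet> abs_l2 \<phi>\<bar> \<le> 0"
      using bound[of "1 / real (Suc _)"] by auto
    then show ?thesis by simp
  qed
  then have "r = 0" using L2_classes_orthogonal[OF g(1)] g(2) by simp
  then have "(\<lambda>n. f - (f - u n)) \<longlonglongrightarrow> f - 0" using r(2) by (intro tendsto_intros) simp
  then have "u \<longlonglongrightarrow> f" by simp
  then show "f \<in> closure lap_domain" using uD by (auto simp: closure_sequential)
qed

sublocale gradient: gradient_operator L2_classes lap_domain frac_lap potential chain_const
proof
  fix x y assume "x \<in> lap_domain" "y \<in> lap_domain"
  then show "potential x + frac_lap x \<bullet> (y - x) \<le> potential y" by (rule potential_subgradient)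
next
  fix x assume "x \<in> lap_domain" then show "0 \<le> potential x" using p by (simp add: potential_def en_nonneg)
next
  show "0 \<in> lap_domain" by (rule zero_lap_domain)
  have "en (W0_rep 0) = form (W0_rep 0) (W0_rep 0)" by (simp add: form_self)
  also have "\<dots> = frac_lap 0 \<bullet> abs_l2 (W0_rep 0)"
    using frac_lap_inner[OF zero_lap_domain(1), of "W0_rep 0"] W0_rep_W0[OF zero_lap_domain(1)] by (simp only:)
  finally show "potential 0 = 0" by (simp add: potential_def zero_lap_domain(2))
  show "L2_classes \<subseteq> closure lap_domain" by (rule lap_domain_dense)
  show "0 \<le> chain_const" using p by (simp add: chain_const_def)
next
  fix x :: "nat \<Rightarrow> 'a l2" and n assume x: "\<And>k. x k \<in> lap_domain"
  have "form (W0_rep (x 0)) (\<lambda>t. W0_rep (x 0) t - W0_rep (x n) t) - form (W0_rep (x n)) (\<lambda>t. W0_rep (x 0) t - W0_rep (x n) t)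
    \<le> chain_const * n * (\<Sum>k<n. form (W0_rep (x k)) (\<lambda>t. W0_rep (x k) t - W0_rep (x (Suc k)) t) - form (W0_rep (x (Suc k))) (\<lambda>t. W0_rep (x k) t - W0_rep (x (Suc k)) t))"
    using W0_rep_W0[OF x] by (intro form_chain[of "\<lambda>k. W0_rep (x k)"]) auto
  then show "(frac_lap (x 0) - frac_lap (x n)) \<bullet> (x 0 - x n)
    \<le> chain_const * n * (\<Sum>k<n. (frac_lap (x k) - frac_lap (x (Suc k))) \<bullet> (x k - x (Suc k)))"
    using x by (simp add: inner_diff_left[of "frac_lap _" "frac_lap _"] inner_diff_W0_rep)
qed

section \<open>The flow as a solution\<close>

definition repr :: "'a l2 \<Rightarrow> 'a \<Rightarrow> real" where "repr x = (SOME f. f \<in> L2 \<Omega> \<and> abs_l2 f = x)"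

lemma repr: assumes "x \<in> L2_classes" shows "repr x \<in> L2 \<Omega> \<and> abs_l2 (repr x) = x"
proof -
  have "\<exists>f. f \<in> L2 \<Omega> \<and> abs_l2 f = x" using assms by (auto simp: L2_classes_def)
  from someI_ex[OF this] show ?thesis by (simp add: repr_def)
qed

lemma Lq_norm_2_tendsto:
  assumes "\<And>h. f h \<in> L2 \<Omega>" shows "((\<lambda>h. Lq_norm 2 \<Omega> (f h)) \<longlongrightarrow> 0) F \<longleftrightarrow> ((\<lambda>h. norm (abs_l2 (f h))) \<longlongrightarrow> 0) F"
proof -
  have "((\<lambda>h. ennreal (norm (abs_l2 (f h)))) \<longlongrightarrow> ennreal 0) F \<longleftrightarrow> ((\<lambda>h. norm (abs_l2 (f h))) \<longlongrightarrow> 0) F"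
    by (rule tendsto_ennreal_iff) auto
  then show ?thesis by (simp add: Lq_norm_2_abs_l2[OF sets_\<Omega> assms])
qed

text \<open>Run the flow from the class of \<open>u0\<close> and choose representatives that vanish
  off \<Omega>. Differentiability at every positive time supplies both the almost-everywhere and the
  everywhere form of the equation.\<close>

lemma regular_solution_exists:
  assumes u0: "u0 \<in> L2 \<Omega>"
  shows "\<exists>u. regular_strong_solution p s \<Omega> u0 u"
proof -
  define U where "U t = gradient.flow t (abs_l2 u0)" for t
  \<comment> \<open>The value at negative times is a default that keeps u (t + h) in L2 for every h,
    so that difference quotients are total in h; near h = 0 it plays no part in the limit.\<close>
  define u where "u t = repr (if 0 \<le> t then U t else 0)" for t
  have X: "abs_l2 u0 \<in> L2_classes" using u0 by (auto simp: L2_classes_def)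
  have UV: "(if 0 \<le> t then U t else 0) \<in> L2_classes" for t
    using gradient.flow_V[OF X] L2_classes_subspace by (auto simp: U_def subspace_0)
  have uL: "u t \<in> L2 \<Omega>" for t using repr[OF UV] by (simp add: u_def)
  have uU: "abs_l2 (u t) = U t" if "0 \<le> t" for t using repr[OF UV[of t]] that by (simp add: u_def)
  have der: "\<exists>w. lap (u t) w \<and> has_L2_derivative \<Omega> u (\<lambda>x. - w x) t" if t: "0 < t" for t
  proof -
    have Ud: "U t \<in> lap_domain" unfolding U_def by (rule gradient.flow_regular[OF X t])
    obtain w where w: "lap (W0_rep (U t)) w" "frac_lap (U t) = abs_l2 w" "w \<in> L2 \<Omega>" by (rule lap_domain_lap[OF Ud])
    have "AE x in lebesgue. W0_rep (U t) x = u t x"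
      using W0_rep_W0[OF Ud] uU[of t] t uL[of t] by (subst abs_l2_eq_iff[symmetric]) (auto simp: W0_sq L2_sq)
    then have lap: "lap (u t) w" using lap_AE_cong[OF w(1)] uL[of t] by (simp add: L2_eq)
    have mw: "(\<lambda>x. - w x) \<in> L2 \<Omega>" using L2_scale[OF w(3), of "- 1"] by simp
    have amw: "abs_l2 (\<lambda>x. - w x) = - abs_l2 w" using abs_l2_scaleR[OF L2_sq[OF w(3)], of "- 1"] by simp
    have "(U has_vector_derivative - abs_l2 w) (at t)"
      using gradient.flow_derivative[OF X t] w(2) by (simp add: U_def[abs_def])
    then have 0: "((\<lambda>h. norm (U (t + h) - U t - h *\<^sub>R - abs_l2 w) / norm h) \<longlongrightarrow> 0) (at 0)"
      by (simp add: has_vector_derivative_def has_derivative_at)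
    have 1: "((\<lambda>h. norm ((U (t + h) - U t) /\<^sub>R h - - abs_l2 w)) \<longlongrightarrow> 0) (at 0)"
    proof (rule Lim_transform_eventually[OF 0], unfold eventually_at_filter, intro always_eventually allI impI)
      fix h :: real assume h: "h \<noteq> 0"
      have "(U (t + h) - U t) /\<^sub>R h - - abs_l2 w = inverse h *\<^sub>R (U (t + h) - U t - h *\<^sub>R - abs_l2 w)"
        using h by (simp add: scaleR_diff_right scaleR_add_right)
      then show "norm (U (t + h) - U t - h *\<^sub>R - abs_l2 w) / norm h = norm ((U (t + h) - U t) /\<^sub>R h - - abs_l2 w)"
        by (simp add: divide_inverse mult.commute)
    qed
    define d where "d h x = (u (t + h) x - u t x) / h - - w x" for h x
    have dd: "d h = (\<lambda>x. (1 / h) * (u (t + h) x - u t x) - - w x)" for h by (simp add: d_def fun_eq_iff)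
    have dL: "d h \<in> L2 \<Omega>" for h unfolding dd by (intro L2_diff L2_scale uL mw)
    have ad: "abs_l2 (d h) = (1 / h) *\<^sub>R (abs_l2 (u (t + h)) - abs_l2 (u t)) - - abs_l2 w" for h
      unfolding dd abs_l2_diff[OF L2_sq[OF L2_scale[OF L2_diff[OF uL uL]]] L2_sq[OF mw], symmetric]
        abs_l2_scaleR[OF L2_sq[OF L2_diff[OF uL uL]], symmetric] abs_l2_diff[OF L2_sq[OF uL] L2_sq[OF uL], symmetric] amw ..
    have "eventually (\<lambda>h. norm ((U (t + h) - U t) /\<^sub>R h - - abs_l2 w) = norm (abs_l2 (d h))) (at 0)"
    proof -
      have "eventually (\<lambda>h. - t < h) (at 0)"
        using order_tendstoD(1)[OF tendsto_ident_at, of "- t" 0 UNIV] t by simp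
      then show ?thesis
      proof eventually_elim
        case (elim h)
        then show ?case using uU[of "t + h"] uU[of t] t by (simp add: ad inverse_eq_divide)
      qed
    qed
    then have "((\<lambda>h. norm (abs_l2 (d h))) \<longlongrightarrow> 0) (at 0)" by (rule Lim_transform_eventually[OF 1])
    then have "((\<lambda>h. Lq_norm 2 \<Omega> (d h)) \<longlongrightarrow> 0) (at 0)" by (simp add: Lq_norm_2_tendsto dL)
    then have "has_L2_derivative \<Omega> u (\<lambda>x. - w x) t"
      using mw unfolding has_L2_derivative_def d_def[abs_def] by blast
    then show ?thesis using lap by blast
  qed
  have cont: "L2_continuous \<Omega> u"
    unfolding L2_continuous_def
  proof (intro allI impI conjI uL)
    fix t :: real assume t: "0 \<le> t"
    have "continuous_on {0..} U" unfolding U_def[abs_def] by (rule gradient.flow_continuous[OF X])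
    then have "(U \<longlongrightarrow> U t) (at t within {0..})" using t by (simp add: continuous_on_def)
    then have 1: "((\<lambda>\<tau>. norm (U \<tau> - U t)) \<longlongrightarrow> 0) (at t within {0..})" by (intro tendsto_norm_zero LIM_zero)
    have "eventually (\<lambda>\<tau>. norm (U \<tau> - U t) = norm (abs_l2 (\<lambda>x. u \<tau> x - u t x))) (at t within {0..})"
      unfolding eventually_at_filter using uU t uL by (intro always_eventually) (auto simp: abs_l2_diff[symmetric] L2_sq)
    then have "((\<lambda>\<tau>. norm (abs_l2 (\<lambda>x. u \<tau> x - u t x))) \<longlongrightarrow> 0) (at t within {0..})" by (rule Lim_transform_eventually[OF 1])
    then show "((\<lambda>\<tau>. Lq_norm 2 \<Omega> (\<lambda>x. u \<tau> x - u t x)) \<longlongrightarrow> 0) (at t within {0..})"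
      by (simp add: Lq_norm_2_tendsto L2_diff uL)
  qed
  have init: "AE x in lebesgue_on \<Omega>. u 0 x = u0 x"
  proof -
    have "abs_l2 (u 0) = abs_l2 u0" using uU[of 0] gradient.flow_0[OF X] by (simp add: U_def)
    then have "AE x in lebesgue. u 0 x = u0 x" using L2_sq[OF uL] L2_sq[OF u0] by (simp add: abs_l2_eq_iff)
    then show ?thesis by (auto simp: AE_restrict_space_iff elim: eventually_mono)
  qed
  have "strong_solution p s \<Omega> u0 u"
    unfolding strong_solution_def using uL der init L2_zero[OF uL] by (auto simp: lap_def)
  moreover have "\<exists>w\<in>L2 \<Omega>. frac_p_Laplacian p s \<Omega> (u t) w" if "0 < t" for t
    using der[OF that] by (auto simp: lap_def lap_iff[unfolded lap_def])
  moreover have "\<exists>v w. has_L2_derivative \<Omega> u v t \<and> frac_p_Laplacian p s \<Omega> (u t) w \<and> (AE x in lebesgue_on \<Omega>. v x + w x = 0)"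
    if t: "0 < t" for t
  proof -
    obtain w where "lap (u t) w" "has_L2_derivative \<Omega> u (\<lambda>x. - w x) t" using der[OF t] by blast
    then show ?thesis by (intro exI[of _ "\<lambda>x. - w x"] exI[of _ w]) (simp add: lap_def)
  qed
  ultimately show ?thesis using cont unfolding regular_strong_solution_def by blast
qed

end

section \<open>Smooth truncations\<close>

text \<open>The derivative of \<open>smooth_step\<close> is \<open>flat_exp 2\<close>; the quadratic
  Taylor bound for exp (1/t) controls it and yields the Lipschitz constant 2.\<close>

lemma flat_exp_2_le: "\<bar>flat_exp 2 t\<bar> \<le> 2"
proof (cases "0 < t")
  case True
  have "(1 / t)\<^sup>2 / 2 \<le> 1 + 1 / t + (1 / t)\<^sup>2 / 2" using True by simp
  also have "\<dots> \<le> exp (1 / t)" using True by (intro exp_lower_Taylor_quadratic) simp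
  finally have "(1 / t)\<^sup>2 \<le> 2 * exp (1 / t)" by simp
  then have "exp (- (1 / t)) * (1 / t)\<^sup>2 \<le> exp (- (1 / t)) * (2 * exp (1 / t))" by (intro mult_left_mono) auto
  also have "\<dots> = 2" by (simp add: exp_minus)
  finally show ?thesis using True by (simp add: flat_exp_def power_divide)
qed (simp add: flat_exp_def)

lemma smooth_step_lipschitz: "\<bar>smooth_step s - smooth_step t\<bar> \<le> 2 * \<bar>s - t\<bar>"
proof -
  have d: "(smooth_step has_field_derivative flat_exp 2 x) (at x within UNIV)" for x
    using flat_exp_deriv[of 0 x] by (simp add: smooth_step_def numeral_2_eq_2)
  show ?thesis
    using field_differentiable_bound[of UNIV smooth_step "flat_exp 2" 2 s t] d flat_exp_2_le by simp
qed

lemma antiderivative_exists: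
  assumes H: "continuous_on UNIV (H :: real \<Rightarrow> real)"
  obtains G where "G 0 = 0" "\<And>x. (G has_real_derivative H x) (at x)"
proof -
  have "\<exists>F. \<forall>x::real. - \<infinity> < ereal x \<longrightarrow> ereal x < \<infinity> \<longrightarrow> (F has_vector_derivative H x) (at x)"
    using H by (intro einterval_antiderivative) (auto simp: continuous_on_eq_continuous_at)
  then obtain F where "\<And>x. (F has_real_derivative H x) (at x)"
    by (auto simp: has_real_derivative_iff_has_vector_derivative)
  then have "((\<lambda>x. F x - F 0) has_real_derivative H x) (at x)" for x
    by (auto intro!: derivative_eq_intros)
  then show ?thesis using that[of "\<lambda>x. F x - F 0"] by simp
qed

lemma mvt_real:
  fixes G H :: "real \<Rightarrow> real"
  assumes "\<And>x. (G has_real_derivative H x) (at x)"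
  obtains \<xi> where "min a b \<le> \<xi>" "\<xi> \<le> max a b" "G b - G a = H \<xi> * (b - a)"
proof -
  consider "a < b" | "b < a" | "a = b" by linarith
  then show ?thesis
  proof cases
    case 1
    then obtain z where "a < z" "z < b" "G b - G a = (b - a) * H z" using MVT2[of a b G H] assms by blast
    then show ?thesis using that[of z] by (simp add: mult.commute)
  next
    case 2
    then obtain z where "b < z" "z < a" "G a - G b = (a - b) * H z" using MVT2[of b a G H] assms by blast
    then show ?thesis using that[of z] by (simp add: algebra_simps)
  next
    case 3
    then show ?thesis using that[of a] by simp
  qed
qed

text \<open>Taylor's formula with integral remainder: r^q is q (q - 1) times the integral of k^(q-2)
  (r - k)_+ over k. The weight is nonnegative, and integrable at 0 because q > 1.\<close>

lemma powr_layer_cake: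
  assumes q: "1 < q"
  shows "(\<integral>\<^sup>+k. ennreal (k powr (q - 2) * max (r - k) 0) * indicator {0..} k \<partial>lborel) = ennreal (max r 0 powr q / (q * (q - 1)))"
proof (cases "0 \<le> r")
  case True
  have 1: "((\<lambda>k. k powr (q - 2)) has_integral (r powr (q - 1) / (q - 1))) {0..r}"
    using has_integral_powr_from_0[of "q - 2" r] q True by (simp add: algebra_simps)
  have 2: "((\<lambda>k. k powr (q - 1)) has_integral (r powr q / q)) {0..r}"
    using has_integral_powr_from_0[of "q - 1" r] q True by simp
  have "((\<lambda>k. r * k powr (q - 2) - k powr (q - 1)) has_integral (r * (r powr (q - 1) / (q - 1)) - r powr q / q)) {0..r}"
    by (intro has_integral_diff has_integral_mult_right 1 2)
  moreover have "r * (r powr (q - 1) / (q - 1)) - r powr q / q = r powr q / (q * (q - 1))"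
  proof -
    have "r * r powr (q - 1) = r powr q" using True q by (cases "r = 0") (simp_all add: powr_mult_base)
    then have "r * (r powr (q - 1) / (q - 1)) - r powr q / q = r powr q / (q - 1) - r powr q / q" by simp
    also have "\<dots> = r powr q / (q * (q - 1))" using q by (simp add: field_simps)
    finally show ?thesis .
  qed
  moreover have "r * k powr (q - 2) - k powr (q - 1) = k powr (q - 2) * (r - k)" if "k \<in> {0..r}" for k
  proof -
    have "k * k powr (q - 2) = k powr (q - 1)" using that q by (cases "k = 0") (simp_all add: powr_mult_base)
    then show ?thesis by (simp add: algebra_simps)
  qed
  ultimately have I: "((\<lambda>k. k powr (q - 2) * (r - k)) has_integral (r powr q / (q * (q - 1)))) {0..r}"
    by (metis (no_types, lifting) has_integral_cong)
  have "(\<integral>\<^sup>+k. ennreal (k powr (q - 2) * (r - k)) * indicator {0..r} k \<partial>lborel) = ennreal (r powr q / (q * (q - 1)))"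
    by (rule nn_integral_has_integral_lebesgue'[OF _ I]) auto
  moreover have "ennreal (k powr (q - 2) * max (r - k) 0) * indicator {0..} k = ennreal (k powr (q - 2) * (r - k)) * indicator {0..r} k" for k
    by (auto simp: indicator_def max_def)
  ultimately show ?thesis using True by simp
next
  case False
  have "(\<integral>\<^sup>+k. ennreal (k powr (q - 2) * max (r - k) 0) * indicator {0..} k \<partial>lborel) = (\<integral>\<^sup>+k. 0 \<partial>(lborel :: real measure))"
    using False by (intro nn_integral_cong) (auto simp: indicator_def max_def)
  then show ?thesis using False q by simp
qed

lemma abs_powr_split: "0 < q \<Longrightarrow> \<bar>r\<bar> powr q = max r 0 powr q + max (- r) 0 powr (q :: real)"
  by (cases "0 \<le> r") auto

text \<open>By the layer formula and Tonelli, the integral of the q-th power of a positive part is a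
  positive mixture of its truncated integrals, so comparison at every level suffices. For q = 1 the
  level k = 0 alone is used.\<close>

lemma truncation_domination_powr:
  fixes f g :: "'a::euclidean_space \<Rightarrow> real"
  assumes [measurable]: "f \<in> borel_measurable lebesgue" "g \<in> borel_measurable lebesgue"
    and pos: "\<And>k. 0 \<le> k \<Longrightarrow> (\<integral>\<^sup>+x. ennreal (max (f x - k) 0) \<partial>lebesgue) \<le> (\<integral>\<^sup>+x. ennreal (max (g x - k) 0) \<partial>lebesgue)"
    and neg: "\<And>k. 0 \<le> k \<Longrightarrow> (\<integral>\<^sup>+x. ennreal (max (- f x - k) 0) \<partial>lebesgue) \<le> (\<integral>\<^sup>+x. ennreal (max (- g x - k) 0) \<partial>lebesgue)"
    and q: "1 \<le> q"
  shows "(\<integral>\<^sup>+x. ennreal (\<bar>f x\<bar> powr q) \<partial>lebesgue) \<le> (\<integral>\<^sup>+x. ennreal (\<bar>g x\<bar> powr q) \<partial>lebesgue)"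
proof -
  have part: "(\<integral>\<^sup>+x. ennreal (max (f x) 0 powr q) \<partial>lebesgue) \<le> (\<integral>\<^sup>+x. ennreal (max (g x) 0 powr q) \<partial>lebesgue)"
    if [measurable]: "f \<in> borel_measurable lebesgue" "g \<in> borel_measurable lebesgue"
      and le: "\<And>k. 0 \<le> k \<Longrightarrow> (\<integral>\<^sup>+x. ennreal (max (f x - k) 0) \<partial>lebesgue) \<le> (\<integral>\<^sup>+x. ennreal (max (g x - k) 0) \<partial>lebesgue)"
    for f g :: "'a \<Rightarrow> real"
  proof (cases "q = 1")
    case True
    then show ?thesis using le[of 0] by simp
  next
    case False
    then have q1: "1 < q" using q by simp
    interpret P: pair_sigma_finite "lebesgue :: 'a measure" "lborel :: real measure" ..
    have rep: "(\<integral>\<^sup>+x. ennreal (max (h x) 0 powr q) \<partial>lebesgue) = ennreal (q * (q - 1)) *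
        (\<integral>\<^sup>+k. ennreal (k powr (q - 2)) * indicator {0..} k * (\<integral>\<^sup>+x. ennreal (max (h x - k) 0) \<partial>lebesgue) \<partial>lborel)"
      if [measurable]: "h \<in> borel_measurable lebesgue" for h :: "'a \<Rightarrow> real"
    proof -
      have "ennreal (max (h x) 0 powr q) = ennreal (q * (q - 1)) *
          (\<integral>\<^sup>+k. ennreal (k powr (q - 2) * max (h x - k) 0) * indicator {0..} k \<partial>lborel)" for x
        unfolding powr_layer_cake[OF q1] using q1 by (simp add: ennreal_mult'[symmetric])
      then have "(\<integral>\<^sup>+x. ennreal (max (h x) 0 powr q) \<partial>lebesgue) = (\<integral>\<^sup>+x. ennreal (q * (q - 1)) *
          (\<integral>\<^sup>+k. ennreal (k powr (q - 2) * max (h x - k) 0) * indicator {0..} k \<partial>lborel) \<partial>lebesgue)" by simp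
      also have "\<dots> = ennreal (q * (q - 1)) * (\<integral>\<^sup>+x. \<integral>\<^sup>+k. ennreal (k powr (q - 2) * max (h x - k) 0) * indicator {0..} k \<partial>lborel \<partial>lebesgue)"
        by (rule nn_integral_cmult) measurable
      also have "(\<integral>\<^sup>+x. \<integral>\<^sup>+k. ennreal (k powr (q - 2) * max (h x - k) 0) * indicator {0..} k \<partial>lborel \<partial>lebesgue)
          = (\<integral>\<^sup>+k. \<integral>\<^sup>+x. ennreal (k powr (q - 2) * max (h x - k) 0) * indicator {0..} k \<partial>lebesgue \<partial>lborel)"
        by (rule P.Fubini'[symmetric]) measurable
      also have "\<dots> = (\<integral>\<^sup>+k. ennreal (k powr (q - 2)) * indicator {0..} k * (\<integral>\<^sup>+x. ennreal (max (h x - k) 0) \<partial>lebesgue) \<partial>lborel)"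
      proof (rule nn_integral_cong)
        fix k :: real
        have "(\<integral>\<^sup>+x. ennreal (k powr (q - 2) * max (h x - k) 0) * indicator {0..} k \<partial>lebesgue)
            = (\<integral>\<^sup>+x. (ennreal (k powr (q - 2)) * indicator {0..} k) * ennreal (max (h x - k) 0) \<partial>lebesgue)"
          by (intro nn_integral_cong) (simp add: ennreal_mult mult_ac)
        also have "\<dots> = ennreal (k powr (q - 2)) * indicator {0..} k * (\<integral>\<^sup>+x. ennreal (max (h x - k) 0) \<partial>lebesgue)"
          by (rule nn_integral_cmult) measurable
        finally show "(\<integral>\<^sup>+x. ennreal (k powr (q - 2) * max (h x - k) 0) * indicator {0..} k \<partial>lebesgue)
          = ennreal (k powr (q - 2)) * indicator {0..} k * (\<integral>\<^sup>+x. ennreal (max (h x - k) 0) \<partial>lebesgue)" .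
      qed
      finally show ?thesis .
    qed
    show ?thesis unfolding rep[OF that(1)] rep[OF that(2)]
    proof (rule mult_left_mono, rule nn_integral_mono)
      fix k :: real
      show "ennreal (k powr (q - 2)) * indicator {0..} k * (\<integral>\<^sup>+x. ennreal (max (f x - k) 0) \<partial>lebesgue)
          \<le> ennreal (k powr (q - 2)) * indicator {0..} k * (\<integral>\<^sup>+x. ennreal (max (g x - k) 0) \<partial>lebesgue)"
        using le[of k] by (cases "0 \<le> k") (auto intro: mult_left_mono)
    qed simp
  qed
  have split: "(\<integral>\<^sup>+x. ennreal (\<bar>h x\<bar> powr q) \<partial>lebesgue)
      = (\<integral>\<^sup>+x. ennreal (max (h x) 0 powr q) \<partial>lebesgue) + (\<integral>\<^sup>+x. ennreal (max (- h x) 0 powr q) \<partial>lebesgue)"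
    if [measurable]: "h \<in> borel_measurable lebesgue" for h :: "'a \<Rightarrow> real"
    using q by (subst nn_integral_add[symmetric]) (auto simp: abs_powr_split)
  show ?thesis unfolding split[OF assms(1)] split[OF assms(2)]
    using part[of f g] part[of "\<lambda>x. - f x" "\<lambda>x. - g x"] pos neg by (intro add_mono) auto
qed

lemma truncation_zero_iff:
  fixes f :: "'a::euclidean_space \<Rightarrow> real"
  assumes [measurable]: "f \<in> borel_measurable lebesgue"
  shows "(\<integral>\<^sup>+x. ennreal (max (f x - k) 0) \<partial>lebesgue) = 0 \<longleftrightarrow> (AE x in lebesgue. f x \<le> k)"
  by (subst nn_integral_0_iff_AE) (auto simp: ennreal_eq_0_iff elim!: eventually_mono)

section \<open>Testing with nondecreasing functions of a difference\<close>

context frac_space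
begin

text \<open>The Lipschitz bound controls jumps of H(w), but not jumps of H(w) - H(\<phi> n) by jumps
  of w - \<phi> n. Instead these tend to 0 a.e. along a subsequence and are dominated, in p-th
  power, by a fixed integrable function plus a term \<open>a n\<close> tending to 0 in L1; dominated
  convergence is applied to the positive part of \<open>b n - a n\<close>.\<close>

lemma W0_compose:
  assumes w: "w \<in> W0 p s \<Omega>" and H: "Cinfinity H" "H 0 = 0" and lip: "\<And>a b. \<bar>H a - H b\<bar> \<le> L * \<bar>a - b\<bar>"
  shows "(\<lambda>x. H (w x)) \<in> W0 p s \<Omega>"
proof -
  have contH: "continuous_on UNIV H" using H(1) Ck.simps(1) unfolding Cinfinity_def by blast
  have [measurable]: "H \<in> borel_measurable borel" using contH by (rule borel_measurable_continuous_onI)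
  have [measurable]: "w \<in> borel_measurable lebesgue" by (rule W0_measurable[OF w])
  have L: "0 \<le> L" using lip[of 1 0] by simp
  have supp: "(\<lambda>x. H (w x)) \<in> supported" using W0_supported[OF w] H(2) by (auto simp: supported_def)
  obtain \<phi> where \<phi>: "\<And>n::nat. \<phi> n \<in> Cc_infinity \<Omega>" "(\<lambda>n. E (\<lambda>x. w x - \<phi> n x)) \<longlonglongrightarrow> 0" using w W0_iff by auto
  have \<phi>W: "\<phi> n \<in> W0 p s \<Omega>" for n by (rule Cc_W0[OF \<phi>(1)])
  have [measurable]: "\<phi> n \<in> borel_measurable lebesgue" for n by (rule W0_measurable[OF \<phi>W])
  obtain c where c: "0 < c" "\<And>u. u \<in> supported \<Longrightarrow> (\<integral>\<^sup>+x. ennreal (\<bar>u x\<bar> powr p) \<partial>lebesgue) \<le> ennreal c * E u"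
    using poincare by blast
  let ?d = "\<lambda>n x. w x - \<phi> n x"
  have dW: "?d n \<in> W0 p s \<Omega>" for n by (intro W0_diff w \<phi>W)
  have dfin: "(\<integral>\<^sup>+x. ennreal (\<bar>?d n x\<bar> powr p) \<partial>lebesgue) < \<infinity>" for n
    using le_less_trans[OF c(2)[OF W0_supported[OF dW]]] W0_energy[OF dW] by (simp add: ennreal_mult_less_top)
  have dint: "integrable lebesgue (\<lambda>x. \<bar>?d n x\<bar> powr p)" for n using dfin[of n] by (intro integrableI_nonneg) auto
  have "(\<lambda>n. \<integral>\<^sup>+x. ennreal (\<bar>?d n x\<bar> powr p) \<partial>lebesgue) \<longlonglongrightarrow> 0"
    by (rule ennreal_tendsto_0_le[OF ennreal_tendsto_0_cmult[OF \<phi>(2), of c]]) (intro c W0_supported dW)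
  then have "(\<lambda>n. ennreal (LINT x|lebesgue. \<bar>?d n x\<bar> powr p)) \<longlonglongrightarrow> ennreal 0"
    using dint by (simp add: nn_integral_eq_integral)
  then have "(\<lambda>n. LINT x|lebesgue. norm (\<bar>?d n x\<bar> powr p)) \<longlonglongrightarrow> 0"
    by (subst (asm) tendsto_ennreal_iff) auto
  from tendsto_L1_AE_subseq[OF dint this] obtain r :: "nat \<Rightarrow> nat" where r: "strict_mono r"
    "AE x in lebesgue. (\<lambda>n. \<bar>?d (r n) x\<bar> powr p) \<longlonglongrightarrow> 0" by blast
  have "AE x in lebesgue. (\<lambda>n. H (w x) - H (\<phi> (r n) x)) \<longlonglongrightarrow> 0"
    using r(2)
  proof eventually_elim
    case (elim x)
    have "(\<lambda>n. (\<bar>?d (r n) x\<bar> powr p) powr (1 / p)) \<longlonglongrightarrow> 0 powr (1 / p)"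
      using p_pos by (intro tendsto_powr' elim tendsto_const) auto
    then have "(\<lambda>n. L * \<bar>?d (r n) x\<bar>) \<longlonglongrightarrow> L * 0"
      using p_pos by (intro tendsto_mult tendsto_const) (simp add: powr_powr)
    then have "(\<lambda>n. L * \<bar>?d (r n) x\<bar>) \<longlonglongrightarrow> 0" by simp
    then show ?case by (rule Lim_null_comparison[OF eventuallyI, rotated]) (simp add: lip)
  qed
  then have Hjump: "AE z in M. (\<lambda>n. jump (\<lambda>x. H (w x) - H (\<phi> (r n) x)) z) \<longlonglongrightarrow> jump (\<lambda>x. 0) z"
    by (rule jump_AE_tendsto)
  define b where "b n z = \<bar>jump (\<lambda>x. H (w x) - H (\<phi> (r n) x)) z\<bar> powr p" for n z
  \<comment> \<open>Two uses of |x + y|^p <= 2^p (|x|^p + |y|^p): once to separate H(w) from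
    H(\<phi>), once to write the jump of \<phi> as that of w minus that of w - \<phi>.\<close>
  define K1 where "K1 = 2 powr p * (L powr p + L powr p * 2 powr p)"
  define K2 where "K2 = 2 powr p * (L powr p * 2 powr p)"
  define a where "a n z = K2 * \<bar>jump (?d (r n)) z\<bar> powr p" for n z
  have [measurable]: "b n \<in> borel_measurable M" "a n \<in> borel_measurable M" for n
    unfolding a_def[abs_def] b_def[abs_def] by measurable
  have jH: "\<bar>jump (\<lambda>x. H (v x)) z\<bar> powr p \<le> L powr p * \<bar>jump v z\<bar> powr p" for v z
  proof -
    have "\<bar>jump (\<lambda>x. H (v x)) z\<bar> \<le> L * \<bar>jump v z\<bar>" unfolding jump_def by (rule lip)
    then have "\<bar>jump (\<lambda>x. H (v x)) z\<bar> powr p \<le> (L * \<bar>jump v z\<bar>) powr p" using p_pos by (intro powr_mono2) auto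
    then show ?thesis using L by (simp add: powr_mult)
  qed
  have bound: "b n z \<le> K1 * \<bar>jump w z\<bar> powr p + a n z" for n z
  proof -
    let ?w = "\<bar>jump w z\<bar> powr p" and ?e = "\<bar>jump (?d (r n)) z\<bar> powr p"
    have 1: "\<bar>jump (\<phi> (r n)) z\<bar> powr p \<le> 2 powr p * (?w + ?e)"
      using abs_add_powr_le[OF p_pos, of "jump w z" "- jump (?d (r n)) z"] by (simp add: jump_diff abs_minus_commute)
    have "b n z \<le> 2 powr p * (\<bar>jump (\<lambda>x. H (w x)) z\<bar> powr p + \<bar>jump (\<lambda>x. H (\<phi> (r n) x)) z\<bar> powr p)"
      using abs_add_powr_le[OF p_pos, of "jump (\<lambda>x. H (w x)) z" "- jump (\<lambda>x. H (\<phi> (r n) x)) z"]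
      by (simp add: b_def jump_diff)
    also have "\<dots> \<le> 2 powr p * (L powr p * ?w + L powr p * (2 powr p * (?w + ?e)))"
      by (intro mult_left_mono add_mono jH order_trans[OF jH] 1) auto
    also have "\<dots> = K1 * ?w + a n z" by (simp add: K1_def K2_def a_def algebra_simps)
    finally show ?thesis .
  qed
  have K: "0 \<le> K1" "0 \<le> K2" by (auto simp: K1_def K2_def)
  have aint: "integrable M (a n)" for n unfolding a_def[abs_def]
    by (intro Bochner_Integration.integrable_mult_right W0_en_integrable dW)
  have mint: "integrable M (\<lambda>z. max (b n z - a n z) 0)" for n
    by (rule Bochner_Integration.integrable_bound[where f = "\<lambda>z. K1 * \<bar>jump w z\<bar> powr p"])
      (use bound K in \<open>auto intro!: Bochner_Integration.integrable_mult_right W0_en_integrable w AE_I2 simp: max_def algebra_simps\<close>)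
  have "(\<lambda>n. LINT z|M. max (b n z - a n z) 0) \<longlonglongrightarrow> (LINT z|M. 0)"
  proof (rule integral_dominated_convergence[where w = "\<lambda>z. K1 * \<bar>jump w z\<bar> powr p"])
    show "integrable M (\<lambda>z. K1 * \<bar>jump w z\<bar> powr p)" by (intro Bochner_Integration.integrable_mult_right W0_en_integrable w)
    show "AE z in M. norm (max (b n z - a n z) 0) \<le> K1 * \<bar>jump w z\<bar> powr p" for n
    proof (rule AE_I2)
      fix z
      have "0 \<le> K1 * \<bar>jump w z\<bar> powr p" using K by simp
      then show "norm (max (b n z - a n z) 0) \<le> K1 * \<bar>jump w z\<bar> powr p"
        using bound[of n z] by (simp add: max_def)
    qed
    show "AE z in M. (\<lambda>n. max (b n z - a n z) 0) \<longlonglongrightarrow> 0"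
      using Hjump
    proof eventually_elim
      case (elim z)
      then have "(\<lambda>n. b n z) \<longlonglongrightarrow> \<bar>0\<bar> powr p"
        unfolding b_def using p_pos by (intro tendsto_powr' tendsto_rabs tendsto_const) auto
      then have b0: "(\<lambda>n. b n z) \<longlonglongrightarrow> 0" using p_pos by simp
      have "0 \<le> a n z" "0 \<le> b n z" for n using K by (auto simp: a_def b_def)
      then have "norm (max (b n z - a n z) 0) \<le> b n z" for n by (simp add: max_def)
      then show ?case by (rule Lim_null_comparison[OF eventuallyI b0])
    qed
  qed measurable
  then have m0: "(\<lambda>n. LINT z|M. max (b n z - a n z) 0) \<longlonglongrightarrow> 0" by simp
  have "(\<lambda>n. ennreal (en (?d n))) \<longlonglongrightarrow> ennreal 0"
    using \<phi>(2) E_eq_en[OF W0_measurable[OF dW] W0_energy[OF dW]] by simp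
  then have "(\<lambda>n. en (?d n)) \<longlonglongrightarrow> 0" by (subst (asm) tendsto_ennreal_iff) (auto simp: en_nonneg)
  from LIMSEQ_subseq_LIMSEQ[OF this r(1)] have dr0: "(\<lambda>n. en (?d (r n))) \<longlonglongrightarrow> 0" by (simp add: o_def)
  have "(\<lambda>n. (LINT z|M. max (b n z - a n z) 0) + K2 * en (?d (r n))) \<longlonglongrightarrow> 0 + K2 * 0"
    by (intro tendsto_intros m0 dr0)
  then have "(\<lambda>n. ennreal ((LINT z|M. max (b n z - a n z) 0) + K2 * en (?d (r n)))) \<longlonglongrightarrow> 0"
    using tendsto_ennrealI by fastforce
  then have "(\<lambda>n. E (\<lambda>x. H (w x) - H (\<phi> (r n) x))) \<longlonglongrightarrow> 0"
  proof (rule ennreal_tendsto_0_le)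
    fix n
    have ai: "(LINT z|M. a n z) = K2 * en (?d (r n))" by (simp add: a_def en_def)
    have "E (\<lambda>x. H (w x) - H (\<phi> (r n) x)) = (\<integral>\<^sup>+z. ennreal (b n z) \<partial>M)" by (simp add: energy_def b_def)
    also have "\<dots> \<le> (\<integral>\<^sup>+z. ennreal (max (b n z - a n z) 0 + a n z) \<partial>M)"
      by (intro nn_integral_mono ennreal_leI) (simp add: max_def)
    also have "\<dots> = ennreal (LINT z|M. max (b n z - a n z) 0 + a n z)"
      using K by (intro nn_integral_eq_integral Bochner_Integration.integrable_add mint aint AE_I2) (auto simp: a_def)
    also have "(LINT z|M. max (b n z - a n z) 0 + a n z) = (LINT z|M. max (b n z - a n z) 0) + K2 * en (?d (r n))"
      unfolding ai[symmetric] by (rule Bochner_Integration.integral_add[OF mint aint])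
    finally show "E (\<lambda>x. H (w x) - H (\<phi> (r n) x)) \<le> ennreal ((LINT z|M. max (b n z - a n z) 0) + K2 * en (?d (r n)))" .
  qed
  then show ?thesis
    by (rule W0I_limit[OF supp Cc_W0[OF Cc_infinity_compose[OF \<phi>(1) H]]])
qed

text \<open>For nondecreasing H the jump of H(u - v) has the sign of the difference of the jumps of
  u and v, and so does the difference of their signed powers; the integrand of the difference is
  nonnegative.\<close>

lemma form_compose_mono:
  assumes u: "u \<in> W0 p s \<Omega>" and v: "v \<in> W0 p s \<Omega>" and HW: "(\<lambda>x. H (u x - v x)) \<in> W0 p s \<Omega>" and mono: "mono (H :: real \<Rightarrow> real)"
  shows "form v (\<lambda>x. H (u x - v x)) \<le> form u (\<lambda>x. H (u x - v x))"
  unfolding form_def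
proof (rule integral_mono[OF W0_form_integrable[OF v HW] W0_form_integrable[OF u HW]])
  fix z
  let ?a = "jump u z" and ?b = "jump v z" and ?h = "jump (\<lambda>x. H (u x - v x)) z"
  have gap: "0 \<le> (spow (p - 1) ?a - spow (p - 1) ?b) * (?a - ?b)" by (rule spow_mono_ineq[OF p])
  have h: "(?a - ?b > 0 \<longrightarrow> 0 \<le> ?h) \<and> (?a - ?b < 0 \<longrightarrow> ?h \<le> 0) \<and> (?a = ?b \<longrightarrow> spow (p - 1) ?a = spow (p - 1) ?b)"
    using monoD[OF mono, of "u (fst z) - v (fst z)" "u (snd z) - v (snd z)"]
      monoD[OF mono, of "u (snd z) - v (snd z)" "u (fst z) - v (fst z)"]
    by (auto simp: jump_def)
  consider "?a = ?b" | "?a - ?b > 0" | "?a - ?b < 0" by linarith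
  then have "0 \<le> (spow (p - 1) ?a - spow (p - 1) ?b) * ?h"
  proof cases
    case 1
    then show ?thesis using h by simp
  next
    case 2
    then have "0 \<le> spow (p - 1) ?a - spow (p - 1) ?b" using gap by (simp add: zero_le_mult_iff)
    then show ?thesis using h 2 by (intro mult_nonneg_nonneg) auto
  next
    case 3
    then have "spow (p - 1) ?a - spow (p - 1) ?b \<le> 0" using gap by (simp add: zero_le_mult_iff)
    then show ?thesis using h 3 by (intro mult_nonpos_nonpos) auto
  qed
  then show "spow (p - 1) ?b * ?h \<le> spow (p - 1) ?a * ?h" by (simp add: left_diff_distrib)
qed

end

section \<open>Contraction and uniqueness\<close>

text \<open>G is the convex integrand whose integral is to decrease, H = G' the function used for
  testing. The Lipschitz bound on H makes G at most quadratic, so its integral is finite and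
  differentiable on the Hilbert space.\<close>

locale convex_primitive =
  fixes G H :: "real \<Rightarrow> real" and L :: real
  assumes G_0: "G 0 = 0" and G_deriv: "\<And>x. (G has_real_derivative H x) (at x)"
    and H_0: "H 0 = 0" and H_mono: "mono H" and H_lip: "\<And>a b. \<bar>H a - H b\<bar> \<le> L * \<bar>a - b\<bar>"
begin

lemma L_nonneg: "0 \<le> L" using H_lip[of 1 0] by simp

text \<open>The mean value theorem replaces the increment of G by H at an intermediate point, and
  the Lipschitz bound on H compares that with H a.\<close>

lemma G_taylor: "\<bar>G b - G a - H a * (b - a)\<bar> \<le> L * (b - a)\<^sup>2"
proof -
  obtain \<xi> where \<xi>: "min a b \<le> \<xi>" "\<xi> \<le> max a b" "G b - G a = H \<xi> * (b - a)"
    using mvt_real[of G H, OF G_deriv] by blast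
  have "\<bar>\<xi> - a\<bar> \<le> \<bar>b - a\<bar>" using \<xi>(1,2) by (auto simp: min_def max_def split: if_splits)
  then have "\<bar>H \<xi> - H a\<bar> \<le> L * \<bar>b - a\<bar>"
    using H_lip[of \<xi> a] mult_left_mono[OF _ L_nonneg] order_trans by blast
  then have "\<bar>H \<xi> - H a\<bar> * \<bar>b - a\<bar> \<le> L * \<bar>b - a\<bar> * \<bar>b - a\<bar>" by (rule mult_right_mono) simp
  moreover have "G b - G a - H a * (b - a) = (H \<xi> - H a) * (b - a)" using \<xi>(3) by (simp add: left_diff_distrib)
  ultimately show ?thesis by (simp add: abs_mult power2_eq_square mult.assoc)
qed

lemma G_nonneg: "0 \<le> G r"
proof -
  obtain \<xi> where \<xi>: "min 0 r \<le> \<xi>" "\<xi> \<le> max 0 r" "G r - G 0 = H \<xi> * (r - 0)"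
    using mvt_real[of G H, OF G_deriv] by blast
  show ?thesis
  proof (cases "0 \<le> r")
    case True
    then have "0 \<le> H \<xi>" using monoD[OF H_mono, of 0 \<xi>] \<xi>(1) H_0 by simp
    then show ?thesis using True \<xi>(3) G_0 by simp
  next
    case False
    then have "H \<xi> \<le> 0" using monoD[OF H_mono, of \<xi> 0] \<xi>(2) H_0 by simp
    then show ?thesis using False \<xi>(3) G_0 by (simp add: mult_nonpos_nonpos)
  qed
qed

lemma G_le: "G r \<le> L * r\<^sup>2" using G_taylor[of r 0] G_0 H_0 by simp

lemma G_measurable [measurable]: "G \<in> borel_measurable borel"
  using G_deriv by (intro borel_measurable_continuous_onI) (auto simp: continuous_on_eq_continuous_at intro: DERIV_isCont)

lemma H_measurable [measurable]: "H \<in> borel_measurable borel"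
  using H_mono by (rule borel_measurable_mono)

lemma G_integrable: "sq_integrable f \<Longrightarrow> integrable lebesgue (\<lambda>x. G (f x))"
proof (rule Bochner_Integration.integrable_bound)
  assume f: "sq_integrable f"
  then show "integrable lebesgue (\<lambda>x. L * (f x)\<^sup>2)" by (simp add: sq_integrable_def)
  show "(\<lambda>x. G (f x)) \<in> borel_measurable lebesgue" using sq_integrable_measurable[OF f] by measurable
qed (auto simp: G_nonneg G_le intro!: AE_I2 order_trans[OF G_le abs_ge_self])

lemma H_sq_integrable: "sq_integrable f \<Longrightarrow> sq_integrable (\<lambda>x. H (f x))"
proof (rule sq_integrable_bound)
  assume f: "sq_integrable f"
  show "(\<lambda>x. H (f x)) \<in> borel_measurable lebesgue" using sq_integrable_measurable[OF f] by measurable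
  show "integrable lebesgue (\<lambda>x. L\<^sup>2 * (f x)\<^sup>2)" using f by (simp add: sq_integrable_def)
  show "(H (f x))\<^sup>2 \<le> L\<^sup>2 * (f x)\<^sup>2" for x
    using power_mono[of "\<bar>H (f x)\<bar>" "L * \<bar>f x\<bar>" 2] H_lip[of "f x" 0] H_0 by (simp add: power_mult_distrib)
qed

definition functional :: "'a::euclidean_space l2 \<Rightarrow> real" where "functional x = (LINT y|lebesgue. G (rep_l2 x y))"

lemma functional_abs:
  assumes "sq_integrable f" shows "functional (abs_l2 f) = (LINT y|lebesgue. G (f y))"
proof -
  have "AE y in lebesgue. rep_l2 (abs_l2 f) y = f y"
    using abs_l2_eq_iff[OF sq_integrable_rep assms] abs_rep_l2 by blast
  then have "AE y in lebesgue. G (rep_l2 (abs_l2 f) y) = G (f y)" by eventually_elim simp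
  moreover note [measurable] = sq_integrable_measurable[OF assms] sq_integrable_measurable[OF sq_integrable_rep]
  ultimately show ?thesis unfolding functional_def by (intro integral_cong_AE) measurable
qed

lemma functional_taylor:
  assumes f: "sq_integrable f" and g: "sq_integrable g"
  shows "\<bar>functional (abs_l2 g) - functional (abs_l2 f) - abs_l2 (\<lambda>x. H (f x)) \<bullet> (abs_l2 g - abs_l2 f)\<bar>
    \<le> L * norm (abs_l2 g - abs_l2 f) ^ 2"
proof -
  have d: "sq_integrable (\<lambda>x. g x - f x)" by (rule sq_integrable_diff[OF g f])
  note i = G_integrable[OF f] G_integrable[OF g] sq_integrable_mult[OF H_sq_integrable[OF f] d]
  have "functional (abs_l2 g) - functional (abs_l2 f) - abs_l2 (\<lambda>x. H (f x)) \<bullet> (abs_l2 g - abs_l2 f)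
      = (LINT x|lebesgue. G (g x) - G (f x) - H (f x) * (g x - f x))"
    unfolding functional_abs[OF f] functional_abs[OF g] abs_l2_diff[OF g f] abs_l2_inner[OF H_sq_integrable[OF f] d]
    using i by simp
  also have "\<bar>\<dots>\<bar> \<le> (LINT x|lebesgue. \<bar>G (g x) - G (f x) - H (f x) * (g x - f x)\<bar>)"
    by (rule integral_abs_bound)
  also have "\<dots> \<le> (LINT x|lebesgue. L * (g x - f x)\<^sup>2)"
    using i d G_taylor by (intro integral_mono) (auto simp: sq_integrable_def)
  also have "\<dots> = L * norm (abs_l2 g - abs_l2 f) ^ 2" by (simp add: abs_l2_diff[OF g f] abs_l2_norm[OF d])
  finally show ?thesis .
qed

lemma functional_has_derivative:
  assumes f: "sq_integrable f"
  shows "(functional has_derivative (\<lambda>h. abs_l2 (\<lambda>x. H (f x)) \<bullet> h)) (at (abs_l2 f))"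
  unfolding has_derivative_within_alt
proof (intro conjI allI impI bounded_linear_inner_right)
  fix e :: real assume e: "0 < e"
  show "\<exists>d>0. \<forall>y\<in>UNIV. norm (y - abs_l2 f) < d \<longrightarrow>
    norm (functional y - functional (abs_l2 f) - abs_l2 (\<lambda>x. H (f x)) \<bullet> (y - abs_l2 f)) \<le> e * norm (y - abs_l2 f)"
  proof (intro exI conjI ballI impI)
    show "0 < e / (L + 1)" using e L_nonneg by simp
    fix y :: "'a l2" assume y: "norm (y - abs_l2 f) < e / (L + 1)"
    have "norm (functional y - functional (abs_l2 f) - abs_l2 (\<lambda>x. H (f x)) \<bullet> (y - abs_l2 f)) \<le> L * norm (y - abs_l2 f) ^ 2"
      using functional_taylor[OF f sq_integrable_rep[of y]] by simp
    also have "\<dots> = (L * norm (y - abs_l2 f)) * norm (y - abs_l2 f)" by (simp add: power2_eq_square)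
    also have "\<dots> \<le> e * norm (y - abs_l2 f)"
    proof (rule mult_right_mono)
      have "L * norm (y - abs_l2 f) \<le> L * (e / (L + 1))" using y L_nonneg by (intro mult_left_mono) auto
      also have "\<dots> \<le> e" using e L_nonneg by (simp add: field_simps)
      finally show "L * norm (y - abs_l2 f) \<le> e" .
    qed simp
    finally show "norm (functional y - functional (abs_l2 f) - abs_l2 (\<lambda>x. H (f x)) \<bullet> (y - abs_l2 f)) \<le> e * norm (y - abs_l2 f)" .
  qed
qed

end

lemma ennroot_mono: "0 < q \<Longrightarrow> x \<le> y \<Longrightarrow> ennroot q x \<le> ennroot q y"
  unfolding ennroot_def by (auto simp: top_unique less_top intro!: ennreal_leI powr_mono2 enn2real_mono)

context frac_space
begin

section \<open>Solutions as curves in the Hilbert space\<close>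

lemma solution_L2: "regular_strong_solution p s \<Omega> u0 u \<Longrightarrow> 0 \<le> t \<Longrightarrow> u t \<in> L2 \<Omega>"
  by (simp add: regular_strong_solution_def strong_solution_def)

lemma AE_lebesgue_on_L2:
  assumes "f \<in> L2 \<Omega>" "g \<in> L2 \<Omega>"
  shows "(AE x in lebesgue_on \<Omega>. f x = g x) \<longleftrightarrow> abs_l2 f = abs_l2 g"
proof -
  have "(AE x in lebesgue_on \<Omega>. f x = g x) \<longleftrightarrow> (AE x in lebesgue. x \<in> \<Omega> \<longrightarrow> f x = g x)"
    by (simp add: AE_restrict_space_iff)
  also have "\<dots> \<longleftrightarrow> (AE x in lebesgue. f x = g x)"
  proof -
    have "(x \<in> \<Omega> \<longrightarrow> f x = g x) \<longleftrightarrow> f x = g x" for x using L2_zero[OF assms(1)] L2_zero[OF assms(2)] by metis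
    then show ?thesis by simp
  qed
  finally show ?thesis using assms by (simp add: abs_l2_eq_iff L2_sq)
qed

lemma solution_initial:
  assumes u: "regular_strong_solution p s \<Omega> u0 u" and u0: "u0 \<in> L2 \<Omega>" shows "abs_l2 (u 0) = abs_l2 u0"
  using u AE_lebesgue_on_L2[OF solution_L2[OF u order_refl] u0]
  by (simp add: regular_strong_solution_def strong_solution_def)

lemma solution_continuous:
  assumes u: "regular_strong_solution p s \<Omega> u0 u" shows "continuous_on {0..} (\<lambda>t. abs_l2 (u t))"
  unfolding continuous_on_def
proof
  fix t :: real assume t: "t \<in> {0..}"
  have uL: "u \<tau> \<in> L2 \<Omega>" if "0 \<le> \<tau>" for \<tau> by (rule solution_L2[OF u that])
  have 1: "((\<lambda>\<tau>. Lq_norm 2 \<Omega> (\<lambda>x. u \<tau> x - u t x)) \<longlongrightarrow> 0) (at t within {0..})"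
    using u t by (simp add: regular_strong_solution_def L2_continuous_def)
  have "eventually (\<lambda>\<tau>. Lq_norm 2 \<Omega> (\<lambda>x. u \<tau> x - u t x) = ennreal (norm (abs_l2 (u \<tau>) - abs_l2 (u t)))) (at t within {0..})"
    unfolding eventually_at_filter using t uL
    by (intro always_eventually allI impI) (simp add: Lq_norm_2_abs_l2 L2_diff abs_l2_diff L2_sq)
  from Lim_transform_eventually[OF 1 this]
  have "((\<lambda>\<tau>. ennreal (norm (abs_l2 (u \<tau>) - abs_l2 (u t)))) \<longlongrightarrow> ennreal 0) (at t within {0..})" by simp
  then have "((\<lambda>\<tau>. norm (abs_l2 (u \<tau>) - abs_l2 (u t))) \<longlongrightarrow> 0) (at t within {0..})"
    by (subst (asm) tendsto_ennreal_iff) auto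
  then show "((\<lambda>t. abs_l2 (u t)) \<longlongrightarrow> abs_l2 (u t)) (at t within {0..})"
    by (simp add: tendsto_norm_zero_iff LIM_zero_iff)
qed

text \<open>Difference quotients are compared only for h > - t, where u (t + h) is known to lie in
  L2; this holds near h = 0. The pointwise equation v + w = 0 identifies the derivative with minus
  the operator.\<close>

lemma solution_derivative:
  assumes u: "regular_strong_solution p s \<Omega> u0 u" and t: "0 < t"
  obtains w where "lap (u t) w" "((\<lambda>t. abs_l2 (u t)) has_vector_derivative - abs_l2 w) (at t)"
proof -
  obtain v w where v: "has_L2_derivative \<Omega> u v t" and w: "lap (u t) w" and vw: "AE x in lebesgue_on \<Omega>. v x + w x = 0"
    using u t unfolding regular_strong_solution_def lap_def by blast
  have vL: "v \<in> L2 \<Omega>" using v by (simp add: has_L2_derivative_def)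
  have wL: "w \<in> L2 \<Omega>" using w by (simp add: lap_iff)
  have mw: "(\<lambda>x. - 1 * w x) \<in> L2 \<Omega>" by (rule L2_scale[OF wL])
  have "AE x in lebesgue_on \<Omega>. v x = - 1 * w x" using vw by eventually_elim simp
  then have "abs_l2 v = abs_l2 (\<lambda>x. - 1 * w x)" using AE_lebesgue_on_L2[OF vL mw] by blast
  then have av: "abs_l2 v = - abs_l2 w" unfolding abs_l2_scaleR[OF L2_sq[OF wL], symmetric] by simp
  have uL: "u \<tau> \<in> L2 \<Omega>" if "0 \<le> \<tau>" for \<tau> by (rule solution_L2[OF u that])
  let ?U = "\<lambda>t. abs_l2 (u t)"
  have 1: "((\<lambda>h. Lq_norm 2 \<Omega> (\<lambda>x. (u (t + h) x - u t x) / h - v x)) \<longlongrightarrow> 0) (at 0)"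
    using v by (simp add: has_L2_derivative_def)
  have pos: "eventually (\<lambda>h. - t < h) (at 0)"
    using order_tendstoD(1)[OF tendsto_ident_at, of "- t" 0 UNIV] t by simp
  have "eventually (\<lambda>h. Lq_norm 2 \<Omega> (\<lambda>x. (u (t + h) x - u t x) / h - v x)
      = ennreal (norm (?U (t + h) - ?U t - h *\<^sub>R abs_l2 v) / norm h)) (at 0)"
    using pos eventually_neq_at_within[of 0 0 UNIV]
  proof eventually_elim
    case (elim h)
    have th: "u (t + h) \<in> L2 \<Omega>" "u t \<in> L2 \<Omega>" using elim t by (auto intro: uL)
    have d: "(\<lambda>x. (u (t + h) x - u t x) / h - v x) = (\<lambda>x. (1 / h) * (u (t + h) x - u t x) - v x)" by simp
    have dL: "(\<lambda>x. (1 / h) * (u (t + h) x - u t x) - v x) \<in> L2 \<Omega>" by (intro L2_diff L2_scale th vL)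
    have "abs_l2 (\<lambda>x. (1 / h) * (u (t + h) x - u t x) - v x) = (1 / h) *\<^sub>R (?U (t + h) - ?U t) - abs_l2 v"
      unfolding abs_l2_diff[OF L2_sq[OF L2_scale[OF L2_diff[OF th]]] L2_sq[OF vL], symmetric]
        abs_l2_scaleR[OF L2_sq[OF L2_diff[OF th]], symmetric] abs_l2_diff[OF L2_sq[OF th(1)] L2_sq[OF th(2)], symmetric] ..
    also have "\<dots> = (1 / h) *\<^sub>R (?U (t + h) - ?U t - h *\<^sub>R abs_l2 v)" using elim(2) by (simp add: scaleR_diff_right)
    finally have "norm (abs_l2 (\<lambda>x. (1 / h) * (u (t + h) x - u t x) - v x)) = norm (?U (t + h) - ?U t - h *\<^sub>R abs_l2 v) / norm h"
      by (simp add: divide_inverse mult.commute)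
    then show ?case unfolding d Lq_norm_2_abs_l2[OF sets_\<Omega> dL] by simp
  qed
  from Lim_transform_eventually[OF 1 this]
  have "((\<lambda>h. ennreal (norm (?U (t + h) - ?U t - h *\<^sub>R abs_l2 v) / norm h)) \<longlongrightarrow> ennreal 0) (at 0)" by simp
  then have "((\<lambda>h. norm (?U (t + h) - ?U t - h *\<^sub>R abs_l2 v) / norm h) \<longlongrightarrow> 0) (at 0)"
    by (subst (asm) tendsto_ennreal_iff) auto
  then have "(?U has_vector_derivative - abs_l2 w) (at t)"
    unfolding has_vector_derivative_def has_derivative_at av[symmetric] by (simp add: bounded_linear_scaleR_left)
  then show ?thesis using that w by blast
qed

text \<open>At every positive time the derivative of the integral of G(u - v) is minus the
  difference of the two forms tested with H(u - v), hence nonpositive by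
  \<open>form_compose_mono\<close>. Continuity includes the time 0, where the equation is not
  imposed.\<close>

lemma convex_functional_decreasing:
  assumes u: "regular_strong_solution p s \<Omega> u01 u" and v: "regular_strong_solution p s \<Omega> u02 v"
    and conv: "convex_primitive G H L" and smooth: "Cinfinity H" and t: "0 \<le> t"
  shows "(LINT x|lebesgue. G (u t x - v t x)) \<le> (LINT x|lebesgue. G (u 0 x - v 0 x))"
proof -
  interpret convex_primitive G H L by (rule conv)
  define W where "W t = abs_l2 (u t) - abs_l2 (v t)" for t
  have wL: "(\<lambda>x. u t x - v t x) \<in> L2 \<Omega>" "W t = abs_l2 (\<lambda>x. u t x - v t x)" if "0 \<le> t" for t
    using solution_L2[OF u that] solution_L2[OF v that] by (auto simp: W_def L2_diff abs_l2_diff L2_sq)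
  have fW: "functional (W t) = (LINT x|lebesgue. G (u t x - v t x))" if "0 \<le> t" for t
    using wL[OF that] by (simp add: functional_abs L2_sq)
  have "functional (W t) \<le> functional (W 0)"
  proof (rule DERIV_nonpos_imp_decreasing_open[OF t])
    fix r assume "0 < r" "r < t"
    then have r: "0 < r" "0 \<le> r" by auto
    obtain w1 where w1: "lap (u r) w1" "((\<lambda>t. abs_l2 (u t)) has_vector_derivative - abs_l2 w1) (at r)"
      by (rule solution_derivative[OF u r(1)])
    obtain w2 where w2: "lap (v r) w2" "((\<lambda>t. abs_l2 (v t)) has_vector_derivative - abs_l2 w2) (at r)"
      by (rule solution_derivative[OF v r(1)])
    have uW: "u r \<in> W0 p s \<Omega>" "v r \<in> W0 p s \<Omega>" using w1 w2 by (auto simp: lap_iff)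
    let ?\<phi> = "\<lambda>x. H (u r x - v r x)"
    have \<phi>: "?\<phi> \<in> W0 p s \<Omega>" using W0_compose[OF W0_diff[OF uW] smooth H_0 H_lip] .
    have "(W has_vector_derivative - abs_l2 w1 - - abs_l2 w2) (at r)"
      unfolding W_def[abs_def] by (intro has_vector_derivative_diff w1 w2)
    then have Wd: "(W has_derivative (\<lambda>h. h *\<^sub>R (abs_l2 w2 - abs_l2 w1))) (at r)"
      by (simp add: has_vector_derivative_def)
    have "(functional has_derivative (\<lambda>h. abs_l2 ?\<phi> \<bullet> h)) (at (W r))"
      unfolding wL(2)[OF r(2)] using functional_has_derivative[OF L2_sq[OF wL(1)[OF r(2)]]] .
    from diff_chain_at[OF Wd this]
    have "((\<lambda>t. functional (W t)) has_real_derivative (abs_l2 ?\<phi> \<bullet> (abs_l2 w2 - abs_l2 w1))) (at r)"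
      by (simp add: has_field_derivative_def o_def mult_commute_abs)
    moreover have "abs_l2 ?\<phi> \<bullet> (abs_l2 w2 - abs_l2 w1) = form (v r) ?\<phi> - form (u r) ?\<phi>"
      using w1(1) w2(1) \<phi> by (simp add: lap_iff inner_diff_right) (simp add: inner_commute)
    moreover have "form (v r) ?\<phi> \<le> form (u r) ?\<phi>" by (rule form_compose_mono[OF uW \<phi> H_mono])
    ultimately show "\<exists>y. ((\<lambda>t. functional (W t)) has_real_derivative y) (at r) \<and> y \<le> 0" by auto
  next
    have c: "continuous_on {0..} W" unfolding W_def[abs_def]
      by (intro continuous_on_diff solution_continuous[OF u] solution_continuous[OF v])
    have "continuous_on UNIV (functional :: 'a l2 \<Rightarrow> real)"
    proof (rule continuous_at_imp_continuous_on, rule ballI)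
      fix x :: "'a l2"
      show "isCont functional x" using functional_has_derivative[OF sq_integrable_rep[of x]] has_derivative_continuous by fastforce
    qed
    then show "continuous_on {0..t} (\<lambda>t. functional (W t))"
      by (rule continuous_on_compose2[OF _ continuous_on_subset[OF c]]) auto
  qed
  then show ?thesis using fW t by simp
qed

text \<open>With H(r) = smooth_step (c (r - k)), the primitive G lies between H(k + \<delta>) (r - k
  - \<delta>)_+ and (r - k)_+. As c grows the factor H(k + \<delta>) tends to 1; afterwards \<delta>
  tends to 0 by Fatou's lemma.\<close>

lemma truncation_decreasing:
  assumes u: "regular_strong_solution p s \<Omega> u01 u" and v: "regular_strong_solution p s \<Omega> u02 v"
    and t: "0 \<le> t" and k: "0 \<le> k"
  shows "(\<integral>\<^sup>+x. ennreal (max (u t x - v t x - k) 0) \<partial>lebesgue) \<le> (\<integral>\<^sup>+x. ennreal (max (u 0 x - v 0 x - k) 0) \<partial>lebesgue)"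
proof -
  define w where "w t x = u t x - v t x" for t x
  have wS: "sq_integrable (w t)" if "0 \<le> t" for t
    unfolding w_def using solution_L2[OF u that] solution_L2[OF v that] by (intro sq_integrable_diff L2_sq)
  have [measurable]: "w t \<in> borel_measurable lebesgue" "w 0 \<in> borel_measurable lebesgue"
    using wS t by (auto intro: sq_integrable_measurable)
  let ?B = "\<integral>\<^sup>+x. ennreal (max (w 0 x - k) 0) \<partial>lebesgue"
  have step: "(\<integral>\<^sup>+x. ennreal (max (w t x - k - \<delta>) 0) \<partial>lebesgue) \<le> ?B" if \<delta>: "0 < \<delta>" for \<delta>
  proof -
    let ?X = "\<integral>\<^sup>+x. ennreal (max (w t x - k - \<delta>) 0) \<partial>lebesgue"
    have le: "ennreal (smooth_step (real (Suc n) * \<delta>)) * ?X \<le> ?B" for n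
    proof -
      define c where "c = real (Suc n)"
      have c: "0 < c" by (simp add: c_def)
      define H where "H r = smooth_step (c * (r - k))" for r
      have smooth: "Cinfinity H"
      proof -
        have "Cinfinity (\<lambda>r::real. smooth_step (c * (r \<bullet> 1 + - k)))"
          by (intro Cinfinity_smooth_step_compose Cinfinity_mult Cinfinity_add Cinfinity_const Cinfinity_inner)
        then show ?thesis by (simp add: H_def[abs_def])
      qed
      then have "continuous_on UNIV H" using Ck.simps(1) unfolding Cinfinity_def by blast
      then obtain G where G: "G 0 = 0" "\<And>x. (G has_real_derivative H x) (at x)" by (rule antiderivative_exists) blast
      have Hz: "H r = 0" if "r \<le> k" for r
        using that c by (simp add: H_def smooth_step_eq zero_less_mult_iff)
      have H01: "0 \<le> H r" "H r \<le> 1" for r by (simp_all add: H_def smooth_step_bounds)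
      have Hm: "mono H" unfolding H_def using c by (intro monoI smooth_step_mono mult_left_mono) auto
      have conv: "convex_primitive G H (2 * c)"
      proof
        show "H 0 = 0" using Hz k by simp
        show "\<bar>H a - H b\<bar> \<le> 2 * c * \<bar>a - b\<bar>" for a b
        proof -
          have "\<bar>H a - H b\<bar> \<le> 2 * \<bar>c * (a - k) - c * (b - k)\<bar>" unfolding H_def by (rule smooth_step_lipschitz)
          also have "c * (a - k) - c * (b - k) = c * (a - b)" by (simp add: algebra_simps)
          finally show ?thesis using c by (simp add: abs_mult)
        qed
      qed (use G Hm in auto)
      interpret convex_primitive G H "2 * c" by (rule conv)
      have Gk: "G k = 0"
      proof -
        obtain \<xi> where "min 0 k \<le> \<xi>" "\<xi> \<le> max 0 k" "G k - G 0 = H \<xi> * (k - 0)" using mvt_real[of G H, OF G(2)] by blast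
        then show ?thesis using Hz[of \<xi>] k G(1) by simp
      qed
      have upper: "G r \<le> max (r - k) 0" for r
      proof -
        obtain \<xi> where \<xi>: "min k r \<le> \<xi>" "\<xi> \<le> max k r" "G r - G k = H \<xi> * (r - k)" using mvt_real[of G H, OF G(2)] by blast
        show ?thesis
        proof (cases "r \<le> k")
          case True
          then show ?thesis using \<xi> Hz[of \<xi>] Gk by simp
        next
          case False
          then have "H \<xi> * (r - k) \<le> 1 * (r - k)" using H01 by (intro mult_right_mono) auto
          then show ?thesis using \<xi> Gk by simp
        qed
      qed
      have lower: "H (k + \<delta>) * max (r - k - \<delta>) 0 \<le> G r" for r
      proof (cases "r \<le> k + \<delta>")
        case True
        then show ?thesis using G_nonneg[of r] by simp
      next
        case False
        obtain \<xi> where \<xi>: "min (k + \<delta>) r \<le> \<xi>" "\<xi> \<le> max (k + \<delta>) r" "G r - G (k + \<delta>) = H \<xi> * (r - (k + \<delta>))"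
          using mvt_real[of G H, OF G(2)] by blast
        have "H (k + \<delta>) * (r - (k + \<delta>)) \<le> H \<xi> * (r - (k + \<delta>))"
          using False \<xi> monoD[OF Hm] by (intro mult_right_mono) auto
        moreover have "max (r - k - \<delta>) 0 = r - (k + \<delta>)" using False by simp
        ultimately show ?thesis using \<xi>(3) G_nonneg[of "k + \<delta>"] by (simp only:)
      qed
      have nn: "(\<integral>\<^sup>+x. ennreal (G (w r x)) \<partial>lebesgue) = ennreal (LINT x|lebesgue. G (w r x))" if "0 \<le> r" for r
        by (intro nn_integral_eq_integral G_integrable wS that AE_I2 G_nonneg)
      have "ennreal (H (k + \<delta>)) * ?X = (\<integral>\<^sup>+x. ennreal (H (k + \<delta>)) * ennreal (max (w t x - k - \<delta>) 0) \<partial>lebesgue)"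
        by (rule nn_integral_cmult[symmetric]) measurable
      also have "\<dots> \<le> (\<integral>\<^sup>+x. ennreal (G (w t x)) \<partial>lebesgue)"
        using lower H01 by (intro nn_integral_mono) (simp add: ennreal_mult'[symmetric] ennreal_leI)
      also have "\<dots> \<le> (\<integral>\<^sup>+x. ennreal (G (w 0 x)) \<partial>lebesgue)"
        unfolding nn[OF t] nn[OF order_refl] unfolding w_def
        by (intro ennreal_leI convex_functional_decreasing[OF u v conv smooth t])
      also have "\<dots> \<le> ?B" by (intro nn_integral_mono ennreal_leI upper)
      finally show ?thesis by (simp add: H_def c_def)
    qed
    \<comment> \<open>Multiplication by a constant is continuous on extended nonnegative reals when
      the constant is finite; truncating at a level of at least \<delta> > 0 bounds the integrand by
      r^2 / \<delta>.\<close>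
    have fin: "?X < \<infinity>"
    proof -
      have "max (r - k - \<delta>) 0 \<le> r\<^sup>2 / \<delta>" for r
      proof (cases "r - k - \<delta> \<le> 0")
        case False
        then have "\<delta> \<le> r" "0 \<le> r" using k \<delta> by auto
        then have "r * \<delta> \<le> r\<^sup>2" by (simp add: power2_eq_square mult_left_mono)
        then have "r \<le> r\<^sup>2 / \<delta>" using \<delta> by (simp add: field_simps)
        then show ?thesis using False k \<delta> by simp
      qed (use \<delta> in simp)
      then have "?X \<le> (\<integral>\<^sup>+x. ennreal ((w t x)\<^sup>2 / \<delta>) \<partial>lebesgue)" by (intro nn_integral_mono ennreal_leI)
      also have "\<dots> < \<infinity>"
        using wS[OF t] \<delta> by (subst nn_integral_eq_integral) (auto simp: sq_integrable_def)
      finally show ?thesis .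
    qed
    have "(\<lambda>n. ennreal (smooth_step (real (Suc n) * \<delta>))) \<longlonglongrightarrow> ennreal 1"
      using smooth_step_scale_tendsto[of \<delta>] \<delta> by (intro tendsto_ennrealI) simp
    then have "(\<lambda>n. ?X * ennreal (smooth_step (real (Suc n) * \<delta>))) \<longlonglongrightarrow> ?X * ennreal 1"
      using fin by (intro ennreal_tendsto_cmult) auto
    then have "?X * ennreal 1 \<le> ?B"
      by (rule LIMSEQ_le_const2) (use le in \<open>auto simp: mult.commute\<close>)
    then show ?thesis by simp
  qed
  have "(\<integral>\<^sup>+x. ennreal (max (w t x - k) 0) \<partial>lebesgue)
      = (\<integral>\<^sup>+x. liminf (\<lambda>n. ennreal (max (w t x - k - 1 / real (Suc n)) 0)) \<partial>lebesgue)"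
  proof (rule nn_integral_cong)
    fix x
    have "(\<lambda>n. 1 / real (Suc n)) \<longlonglongrightarrow> 0" using LIMSEQ_inverse_real_of_nat by (simp add: inverse_eq_divide)
    then have "(\<lambda>n. ennreal (max (w t x - k - 1 / real (Suc n)) 0)) \<longlonglongrightarrow> ennreal (max (w t x - k - 0) 0)"
      by (intro tendsto_ennrealI tendsto_max tendsto_diff tendsto_const)
    from lim_imp_Liminf[OF trivial_limit_sequentially this]
    show "ennreal (max (w t x - k) 0) = liminf (\<lambda>n. ennreal (max (w t x - k - 1 / real (Suc n)) 0))" by simp
  qed
  also have "\<dots> \<le> liminf (\<lambda>n. \<integral>\<^sup>+x. ennreal (max (w t x - k - 1 / real (Suc n)) 0) \<partial>lebesgue)"
    by (rule nn_integral_liminf) measurable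
  also have "\<dots> \<le> ?B" by (intro liminf_le_eventually always_eventually allI step) simp
  finally show ?thesis by (simp add: w_def)
qed

lemma truncation_contraction:
  assumes u: "regular_strong_solution p s \<Omega> u01 u" and v: "regular_strong_solution p s \<Omega> u02 v"
    and u01: "u01 \<in> L2 \<Omega>" and u02: "u02 \<in> L2 \<Omega>" and t: "0 \<le> t" and k: "0 \<le> k"
  shows "(\<integral>\<^sup>+x. ennreal (max (u t x - v t x - k) 0) \<partial>lebesgue) \<le> (\<integral>\<^sup>+x. ennreal (max (u01 x - u02 x - k) 0) \<partial>lebesgue)"
proof -
  have "AE x in lebesgue. u 0 x = u01 x" "AE x in lebesgue. v 0 x = u02 x"
    using solution_initial[OF u u01] solution_initial[OF v u02] solution_L2[OF u order_refl] solution_L2[OF v order_refl] u01 u02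
    by (simp_all add: abs_l2_eq_iff L2_sq)
  then have "(\<integral>\<^sup>+x. ennreal (max (u 0 x - v 0 x - k) 0) \<partial>lebesgue) = (\<integral>\<^sup>+x. ennreal (max (u01 x - u02 x - k) 0) \<partial>lebesgue)"
    by (intro nn_integral_cong_AE) (auto elim: eventually_elim2)
  then show ?thesis using truncation_decreasing[OF u v t k] by simp
qed

section \<open>Contraction in every L^q and uniqueness\<close>

lemma Lq_norm_finite_eq:
  assumes q: "1 \<le> q" and f: "\<And>x. x \<notin> \<Omega> \<Longrightarrow> f x = 0"
  shows "Lq_norm (ennreal q) \<Omega> f = ennroot q (\<integral>\<^sup>+x. ennreal (\<bar>f x\<bar> powr q) \<partial>lebesgue)"
proof -
  have "(\<integral>\<^sup>+x. ennreal (\<bar>f x\<bar> powr q) \<partial>lebesgue_on \<Omega>) = (\<integral>\<^sup>+x. ennreal (\<bar>f x\<bar> powr q) \<partial>lebesgue)"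
    using f q by (intro lebesgue_on_nn_integral) auto
  then show ?thesis using q by (simp add: Lq_norm_def)
qed

text \<open>Exchanging the two solutions gives the truncation estimates for the negative part.
  Finite q follow by mixing levels; for q = \<infinity> a single level, the essential supremum of
  the initial difference, is decisive.\<close>

lemma solutions_contraction:
  assumes u: "regular_strong_solution p s \<Omega> u01 u" and v: "regular_strong_solution p s \<Omega> u02 v"
    and u01: "u01 \<in> L2 \<Omega>" and u02: "u02 \<in> L2 \<Omega>" and t: "0 \<le> t" and q: "1 \<le> q"
  shows "Lq_norm q \<Omega> (\<lambda>x. u t x - v t x) \<le> Lq_norm q \<Omega> (\<lambda>x. u01 x - u02 x)"
proof -
  let ?f = "\<lambda>x. u t x - v t x" and ?g = "\<lambda>x. u01 x - u02 x"
  have fg: "?f \<in> L2 \<Omega>" "?g \<in> L2 \<Omega>" using solution_L2[OF u t] solution_L2[OF v t] u01 u02 by (auto intro: L2_diff)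
  have [measurable]: "?f \<in> borel_measurable lebesgue" "?g \<in> borel_measurable lebesgue"
    using fg by (auto intro: sq_integrable_measurable L2_sq)
  have pos: "(\<integral>\<^sup>+x. ennreal (max (?f x - k) 0) \<partial>lebesgue) \<le> (\<integral>\<^sup>+x. ennreal (max (?g x - k) 0) \<partial>lebesgue)"
    and neg: "(\<integral>\<^sup>+x. ennreal (max (- ?f x - k) 0) \<partial>lebesgue) \<le> (\<integral>\<^sup>+x. ennreal (max (- ?g x - k) 0) \<partial>lebesgue)"
    if "0 \<le> k" for k
    using truncation_contraction[OF u v u01 u02 t that] truncation_contraction[OF v u u02 u01 t that] by simp_all
  show ?thesis
  proof (cases q)
    case (real r)
    then have r: "1 \<le> r" using q by simp
    have "(\<integral>\<^sup>+x. ennreal (\<bar>?f x\<bar> powr r) \<partial>lebesgue) \<le> (\<integral>\<^sup>+x. ennreal (\<bar>?g x\<bar> powr r) \<partial>lebesgue)"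
      by (rule truncation_domination_powr[OF _ _ pos neg r]) measurable
    then show ?thesis unfolding real
      using L2_zero[OF fg(1)] L2_zero[OF fg(2)] r by (simp add: Lq_norm_finite_eq ennroot_mono)
  next
    case top
    define S where "S = esssup (lebesgue_on \<Omega>) (\<lambda>x. ennreal \<bar>?g x\<bar>)"
    have "esssup (lebesgue_on \<Omega>) (\<lambda>x. ennreal \<bar>?f x\<bar>) \<le> S"
    proof (cases S)
      \<comment> \<open>At this level both truncated integrals of the initial difference vanish,
        hence so do those at time t, which bounds the difference by m almost everywhere.\<close>
      case (real m)
      have "AE x in lebesgue_on \<Omega>. ennreal \<bar>?g x\<bar> \<le> S" unfolding S_def by (rule esssup_AE)
      then have "AE x in lebesgue. x \<in> \<Omega> \<longrightarrow> \<bar>?g x\<bar> \<le> m" using real by (simp add: AE_restrict_space_iff)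
      then have "AE x in lebesgue. \<bar>?g x\<bar> \<le> m"
        by eventually_elim (use L2_zero[OF fg(2)] real in fastforce)
      then have "AE x in lebesgue. ?g x \<le> m" "AE x in lebesgue. - ?g x \<le> m" by (auto elim!: eventually_mono)
      then have "(\<integral>\<^sup>+x. ennreal (max (?g x - m) 0) \<partial>lebesgue) = 0" "(\<integral>\<^sup>+x. ennreal (max (- ?g x - m) 0) \<partial>lebesgue) = 0"
        by (subst truncation_zero_iff; (measurable | simp))+
      then have "(\<integral>\<^sup>+x. ennreal (max (?f x - m) 0) \<partial>lebesgue) = 0" "(\<integral>\<^sup>+x. ennreal (max (- ?f x - m) 0) \<partial>lebesgue) = 0"
        using pos[of m] neg[of m] real by simp_all
      moreover have "(\<lambda>x. - ?f x) \<in> borel_measurable lebesgue" by measurable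
      ultimately have "AE x in lebesgue. ?f x \<le> m" "AE x in lebesgue. - ?f x \<le> m"
        using truncation_zero_iff[of ?f m] truncation_zero_iff[of "\<lambda>x. - ?f x" m] by auto
      then have "AE x in lebesgue. ennreal \<bar>?f x\<bar> \<le> S"
        by eventually_elim (auto simp: real intro!: ennreal_leI)
      then have "AE x in lebesgue_on \<Omega>. ennreal \<bar>?f x\<bar> \<le> S"
        by (auto simp: AE_restrict_space_iff elim: eventually_mono)
      then show ?thesis by (intro esssup_I measurable_restrict_space1) measurable
    qed simp
    then show ?thesis using top by (simp add: Lq_norm_def S_def)
  qed
qed

lemma solutions_T_contraction:
  assumes u: "regular_strong_solution p s \<Omega> u01 u" and v: "regular_strong_solution p s \<Omega> u02 v"
    and u01: "u01 \<in> L2 \<Omega>" and u02: "u02 \<in> L2 \<Omega>" and t: "0 \<le> t"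
  shows "Lq_norm 1 \<Omega> (\<lambda>x. max (u t x - v t x) 0) \<le> Lq_norm 1 \<Omega> (\<lambda>x. max (u01 x - u02 x) 0)"
proof -
  have z: "max (u t x - v t x) 0 = 0" "max (u01 x - u02 x) 0 = 0" if "x \<notin> \<Omega>" for x
    using that L2_zero[OF solution_L2[OF u t]] L2_zero[OF solution_L2[OF v t]] L2_zero[OF u01] L2_zero[OF u02] by auto
  show ?thesis
    using Lq_norm_finite_eq[of 1 "\<lambda>x. max (u t x - v t x) 0"] Lq_norm_finite_eq[of 1 "\<lambda>x. max (u01 x - u02 x) 0"] z
      truncation_contraction[OF u v u01 u02 t order_refl] by (auto intro!: ennroot_mono)
qed

lemma solutions_unique:
  assumes u: "regular_strong_solution p s \<Omega> u0 u" and v: "regular_strong_solution p s \<Omega> u0 v"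
    and u0: "u0 \<in> L2 \<Omega>" and t: "0 \<le> t"
  shows "AE x in lebesgue_on \<Omega>. v t x = u t x"
proof -
  have uv: "u t \<in> L2 \<Omega>" "v t \<in> L2 \<Omega>" using solution_L2 u v t by auto
  have "Lq_norm 2 \<Omega> (\<lambda>x. v t x - u t x) \<le> Lq_norm 2 \<Omega> (\<lambda>x. u0 x - u0 x)"
    by (rule solutions_contraction[OF v u u0 u0 t]) simp
  also have "\<dots> = 0"
    using Lq_norm_2_abs_l2[OF sets_\<Omega> L2_diff[OF u0 u0]] by (simp add: zero_l2_def[symmetric])
  finally have "norm (abs_l2 (\<lambda>x. v t x - u t x)) = 0"
    using Lq_norm_2_abs_l2[OF sets_\<Omega> L2_diff[OF uv(2,1)]] by simp
  then have "abs_l2 (v t) = abs_l2 (u t)" using uv by (simp add: abs_l2_diff[symmetric] L2_sq)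
  then show ?thesis using AE_lebesgue_on_L2[OF uv(2,1)] by simp
qed

end

theorem theorem2p1:
  fixes \<Omega> :: "'a::euclidean_space set" and s p :: real
  assumes "0 < s" and "s < 1" and "2 < p" and "bounded_smooth_domain \<Omega>"
  shows "(\<forall>u0\<in>L2 \<Omega>. \<exists>u. regular_strong_solution p s \<Omega> u0 u \<and>
            (\<forall>v. regular_strong_solution p s \<Omega> u0 v \<longrightarrow>
               (\<forall>t\<ge>0. AE x in lebesgue_on \<Omega>. v t x = u t x))) \<and>
         (\<forall>u01\<in>L2 \<Omega>. \<forall>u02\<in>L2 \<Omega>. \<forall>u1 u2.
            regular_strong_solution p s \<Omega> u01 u1 \<longrightarrow>
            regular_strong_solution p s \<Omega> u02 u2 \<longrightarrow>
            (\<forall>t>0.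
               Lq_norm 1 \<Omega> (\<lambda>x. max (u1 t x - u2 t x) 0)
                 \<le> Lq_norm 1 \<Omega> (\<lambda>x. max (u01 x - u02 x) 0) \<and>
               (\<forall>q. 1 \<le> q \<longrightarrow>
                  Lq_norm q \<Omega> (\<lambda>x. u1 t x - u2 t x) \<le> Lq_norm q \<Omega> (\<lambda>x. u01 x - u02 x))))"
proof -
  interpret frac_space p s \<Omega>
    using assms by unfold_locales (auto simp: bounded_smooth_domain_def)
  show ?thesis
  proof (intro conjI ballI allI impI)
    fix u0 assume u0: "u0 \<in> L2 \<Omega>"
    obtain u where u: "regular_strong_solution p s \<Omega> u0 u" using regular_solution_exists[OF u0] by blast
    then show "\<exists>u. regular_strong_solution p s \<Omega> u0 u \<and>
        (\<forall>v. regular_strong_solution p s \<Omega> u0 v \<longrightarrow> (\<forall>t\<ge>0. AE x in lebesgue_on \<Omega>. v t x = u t x))"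
      using solutions_unique[OF u _ u0] by blast
  next
    fix u01 u02 u1 u2 and t :: real and q :: ennreal
    assume *: "u01 \<in> L2 \<Omega>" "u02 \<in> L2 \<Omega>" "regular_strong_solution p s \<Omega> u01 u1" "regular_strong_solution p s \<Omega> u02 u2" "0 < t"
    show "Lq_norm 1 \<Omega> (\<lambda>x. max (u1 t x - u2 t x) 0) \<le> Lq_norm 1 \<Omega> (\<lambda>x. max (u01 x - u02 x) 0)"
      using * by (intro solutions_T_contraction) auto
    assume "1 \<le> q"
    then show "Lq_norm q \<Omega> (\<lambda>x. u1 t x - u2 t x) \<le> Lq_norm q \<Omega> (\<lambda>x. u01 x - u02 x)"
      using * by (intro solutions_contraction) auto
  qed
qed

end
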